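(* Let $I=(\ell,r)\subset\mathbb R$ be a nonempty open interval (possibly with infinite endpoints), and let $b,\sigma:I\to\mathbb R$ be Borel functions satisfying $\sigma(x)\neq 0$ for all $x\in I$ and $\frac1{\sigma^2},\frac b{\sigma^2}\in L^1_{\mathrm{loc}}(I)$; set $a=\sigma^2/2$. Let $\mathcal V$ be an admissible form domain with associated operator $A$, let $q:I\to\mathbb R$ be bounded and Borel, and let $(T^q_t)_{t\ge0}$ be the strongly continuous semigroup $T^q_t=U^{-1}e^{tB}U$ on $L^2(I,\mu)$, where $B=A-Q$ (all notions as defined in the context). Let $f\in L^2(I,\mu)$. Then for every $t>0$, $T^q_tf$ admits a unique continuous representative, with which it is identified. Furthermore, with $u(t,x)=T^q_tf(x)$, $(t,x)\in(0,\infty)\times I$, the following hold. (i) For every $k\in\mathbb N_0$, $\partial_t^ku$ and $\partial_x\partial_t^ku$ exist on $(0,\infty)\times I$ and are jointly continuous there. (ii) For every $t>0$, $\partial_xu(t,\cdot)\in \mathrm{AC}_{\mathrm{loc}}(I)$, and for almost every $x\in I$, $$\partial_tu(t,x)=a(x)\,\partial_{xx}u(t,x)+b(x)\,\partial_xu(t,x)-q(x)\,u(t,x).$$ For every $k\in\mathbb N_0$, the same assertions hold with $u$ replaced by $\partial_t^ku$. (iii) If $a$, $b$, and $q$ are continuous on $I$, then $u\in C^{1,2}((0,\infty)\times I)$ and the equation in (ii) holds pointwise on $(0,\infty)\times I$. Moreover, $\partial_t^ku\in C^{1,2}((0,\infty)\times I)$ for every $k\in\mathbb N_0$. In addition, $u(t,\cdot)\to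 f$ in $L^2(I,\mu)$ as $t\downarrow0$.
   Context: All functions are real-valued; $\mathbb N=\{1,2,\dots\}$, $\mathbb N_0=\mathbb N\cup\{0\}$; $\mathrm{AC}_{\mathrm{loc}}$ denotes locally absolutely continuous functions; $C^{1,2}$ means once continuously differentiable in $t$ and twice continuously differentiable in $x$ (with jointly continuous derivatives $\partial_t u,\partial_x u,\partial_{xx}u$); "almost every" refers to Lebesgue measure. Scale and speed. Fix $x_0\in I$ and set $\rho(x)=\exp\left(-\int_{x_0}^x\frac{b(z)}{a(z)}\,dz\right)$, $s(x)=\int_{x_0}^x\rho(z)\,dz$, $\mu(dx)=\frac{dx}{a(x)\rho(x)}$, and $J=s(I)=(\alpha,\beta)$, where endpoints may be infinite. Define $w:J\to(0,\infty)$ by $w(s(x))=\frac1{a(x)\rho^2(x)}$; then $w\in L^1_{\mathrm{loc}}(J)$ and $w(y)\,dy$ is the push-forward of $\mu$ under $s$. Let $H=L^2(J,w(y)\,dy)$ and let $U:L^2(I,\mu)\to H$ be the unitary map $Uf=f\circ s^{-1}$. Form domains. $\mathcal V_{\max}$ is the set of $v\in H$ having an $\mathrm{AC}_{\mathrm{loc}}(J)$ representative with $v'\in L^2(J)$ (Lebesgue measure); $v$ is identified with this (unique) representative. A linear subspace $\mathcal V\subset\mathcal V_{\max}$ is admissible if $C_c^\infty(J)\subset\mathcal V$ and $\mathcal V$ is complete under the norm $\|v\|_{\mathcal V}^2=\|v\|_H^2+\|v'\|_{L^2(J)}^2$. For admissible $\mathcal V$, put $\mathcal E(v,z)=\int_Jv'(y)z'(y)\,dy$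 for $v,z\in\mathcal V$; this is a densely defined, closed, nonnegative symmetric form on $H$. The associated operator $A$ is the unique nonpositive self-adjoint operator on $H$ representing the closed form, i.e. $\mathrm{Dom}(A)\subset\mathcal V$ and $\mathcal E(v,z)=-\langle Av,z\rangle_H$ for $v\in\mathrm{Dom}(A)$, $z\in\mathcal V$. Semigroup. $Q$ is the bounded self-adjoint operator on $H$ of multiplication by $q\circ s^{-1}$, and $B=A-Q$ with $\mathrm{Dom}(B)=\mathrm{Dom}(A)$, which is self-adjoint and bounded above. *)

theory Defs
  imports "HOL-Analysis.Analysis"
begin

text \<open>
  An element of \<open>L\<^sup>2(M)\<close> is represented by any square integrable function in its class, so equality
  in \<open>L\<^sup>2(M)\<close> is equality almost everywhere, and subspaces and operators are required to be closed
  under almost everywhere modification.  Functions on an interval are total functions on the reals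
  whose values off the interval play no role.
\<close>

section \<open>Square integrable functions and operators\<close>

definition L2 :: "'a measure \<Rightarrow> ('a \<Rightarrow> real) set" where
  "L2 M = {f \<in> borel_measurable M. integrable M (\<lambda>x. (f x)\<^sup>2)}"

definition inner_L2 :: "'a measure \<Rightarrow> ('a \<Rightarrow> real) \<Rightarrow> ('a \<Rightarrow> real) \<Rightarrow> real" where
  "inner_L2 M f g = (LINT x|M. f x * g x)"

definition norm_L2 :: "'a measure \<Rightarrow> ('a \<Rightarrow> real) \<Rightarrow> real" where
  "norm_L2 M f = sqrt (inner_L2 M f f)"

definition eq_ae :: "'a measure \<Rightarrow> ('a \<Rightarrow> real) \<Rightarrow> ('a \<Rightarrow> real) \<Rightarrow> bool" where
  "eq_ae M f g \<longleftrightarrow> (AE x in M. f x = g x)"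

definition subspace_L2 :: "'a measure \<Rightarrow> ('a \<Rightarrow> real) set \<Rightarrow> bool" where
  "subspace_L2 M V \<longleftrightarrow> V \<subseteq> L2 M \<and> (\<lambda>_. 0) \<in> V \<and>
     (\<forall>v\<in>V. \<forall>z\<in>V. (\<lambda>x. v x + z x) \<in> V) \<and>
     (\<forall>v\<in>V. \<forall>c. (\<lambda>x. c * v x) \<in> V) \<and>
     (\<forall>v\<in>V. \<forall>z\<in>L2 M. eq_ae M v z \<longrightarrow> z \<in> V)"

text \<open>
  A possibly unbounded operator is given by its graph \<open>G\<close>, where \<open>(v, g) \<in> G\<close> means that \<open>v\<close> lies in
  the domain and is mapped to \<open>g\<close>; its domain is thus \<^term>\<open>Domain G\<close>.
\<close>

definition operator_L2 ::
  "'a measure \<Rightarrow> (('a \<Rightarrow> real) \<times> ('a \<Rightarrow> real)) set \<Rightarrow> bool" where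
  "operator_L2 M G \<longleftrightarrow> G \<subseteq> L2 M \<times> L2 M \<and>
     subspace_L2 M (Domain G) \<and>
     (\<forall>v g v' g'. (v, g) \<in> G \<and> v' \<in> L2 M \<and> g' \<in> L2 M \<and> eq_ae M v v' \<longrightarrow>
        ((v', g') \<in> G \<longleftrightarrow> eq_ae M g g')) \<and>
     (\<forall>v g v' g' c. (v, g) \<in> G \<and> (v', g') \<in> G \<longrightarrow>
        (\<lambda>x. c * v x + v' x, \<lambda>x. c * g x + g' x) \<in> G)"

definition densely_defined ::
  "'a measure \<Rightarrow> (('a \<Rightarrow> real) \<times> ('a \<Rightarrow> real)) set \<Rightarrow> bool" where
  "densely_defined M G \<longleftrightarrow>
     (\<forall>f\<in>L2 M. \<forall>\<epsilon>>0. \<exists>v\<in>Domain G. norm_L2 M (\<lambda>x. v x - f x) < \<epsilon>)"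

definition adjoint_L2 ::
  "'a measure \<Rightarrow> (('a \<Rightarrow> real) \<times> ('a \<Rightarrow> real)) set \<Rightarrow> (('a \<Rightarrow> real) \<times> ('a \<Rightarrow> real)) set" where
  "adjoint_L2 M G = {(h, k). h \<in> L2 M \<and> k \<in> L2 M \<and>
     (\<forall>(v, g)\<in>G. inner_L2 M g h = inner_L2 M v k)}"

definition self_adjoint ::
  "'a measure \<Rightarrow> (('a \<Rightarrow> real) \<times> ('a \<Rightarrow> real)) set \<Rightarrow> bool" where
  "self_adjoint M G \<longleftrightarrow> operator_L2 M G \<and> densely_defined M G \<and> adjoint_L2 M G = G"

definition nonpositive ::
  "'a measure \<Rightarrow> (('a \<Rightarrow> real) \<times> ('a \<Rightarrow> real)) set \<Rightarrow> bool" where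
  "nonpositive M G \<longleftrightarrow> (\<forall>(v, g)\<in>G. inner_L2 M g v \<le> 0)"

section \<open>Strongly continuous semigroups\<close>

definition c0_semigroup ::
  "'a measure \<Rightarrow> (real \<Rightarrow> ('a \<Rightarrow> real) \<Rightarrow> ('a \<Rightarrow> real)) \<Rightarrow> bool" where
  "c0_semigroup M S \<longleftrightarrow>
     (\<forall>t\<ge>0. (\<forall>f\<in>L2 M. S t f \<in> L2 M) \<and>
        (\<forall>f\<in>L2 M. \<forall>g\<in>L2 M. eq_ae M f g \<longrightarrow> eq_ae M (S t f) (S t g)) \<and>
        (\<forall>f\<in>L2 M. \<forall>g\<in>L2 M. \<forall>c.
           eq_ae M (S t (\<lambda>x. c * f x + g x)) (\<lambda>x. c * S t f x + S t g x)) \<and>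
        (\<exists>C. \<forall>f\<in>L2 M. norm_L2 M (S t f) \<le> C * norm_L2 M f)) \<and>
     (\<forall>f\<in>L2 M. eq_ae M (S 0 f) f) \<and>
     (\<forall>t\<ge>0. \<forall>r\<ge>0. \<forall>f\<in>L2 M. eq_ae M (S (t + r) f) (S t (S r f))) \<and>
     (\<forall>f\<in>L2 M. ((\<lambda>t. norm_L2 M (\<lambda>x. S t f x - f x)) \<longlongrightarrow> 0) (at_right 0))"

definition generator ::
  "'a measure \<Rightarrow> (real \<Rightarrow> ('a \<Rightarrow> real) \<Rightarrow> ('a \<Rightarrow> real)) \<Rightarrow> (('a \<Rightarrow> real) \<times> ('a \<Rightarrow> real)) set" where
  "generator M S = {(v, g). v \<in> L2 M \<and> g \<in> L2 M \<and>
     ((\<lambda>h. norm_L2 M (\<lambda>x. (S h v x - v x) / h - g x)) \<longlongrightarrow> 0) (at_right 0)}"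

text \<open>\<open>S\<close> is the family \<open>e\<^sup>t\<^sup>B\<close>, \<open>t \<ge> 0\<close>, i.e. the strongly continuous semigroup generated by \<open>B\<close>.\<close>

definition exp_semigroup ::
  "'a measure \<Rightarrow> (('a \<Rightarrow> real) \<times> ('a \<Rightarrow> real)) set \<Rightarrow>
    (real \<Rightarrow> ('a \<Rightarrow> real) \<Rightarrow> ('a \<Rightarrow> real)) \<Rightarrow> bool" where
  "exp_semigroup M B S \<longleftrightarrow> c0_semigroup M S \<and> generator M S = B"

section \<open>Local integrability and absolute continuity\<close>

definition loc_integrable :: "real set \<Rightarrow> (real \<Rightarrow> real) \<Rightarrow> bool" where
  "loc_integrable I g \<longleftrightarrow> (\<forall>c d. {c..d} \<subseteq> I \<longrightarrow> set_integrable lborel {c..d} g)"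

text \<open>Below, \<open>D\<close> is a finite family of nonoverlapping intervals, each given by its end points.\<close>

definition ac_on :: "real set \<Rightarrow> (real \<Rightarrow> real) \<Rightarrow> bool" where
  "ac_on S f \<longleftrightarrow> (\<forall>\<epsilon>>0. \<exists>\<delta>>0. \<forall>D. finite D \<and>
     (\<forall>(c, d)\<in>D. c \<le> d \<and> {c..d} \<subseteq> S) \<and>
     pairwise (\<lambda>(c, d) (c', d'). disjnt {c<..<d} {c'<..<d'}) D \<and>
     (\<Sum>(c, d)\<in>D. d - c) < \<delta> \<longrightarrow>
     (\<Sum>(c, d)\<in>D. \<bar>f d - f c\<bar>) < \<epsilon>)"

definition ac_loc :: "real set \<Rightarrow> (real \<Rightarrow> real) \<Rightarrow> bool" where
  "ac_loc I f \<longleftrightarrow> (\<forall>c d. {c..d} \<subseteq> I \<longrightarrow> ac_on {c..d} f)"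

section \<open>Scale and speed\<close>

definition rho :: "(real \<Rightarrow> real) \<Rightarrow> (real \<Rightarrow> real) \<Rightarrow> real \<Rightarrow> real \<Rightarrow> real" where
  "rho a b x\<^sub>0 x = exp (- (LBINT z=ereal x\<^sub>0..ereal x. b z / a z))"

definition scale_fun :: "(real \<Rightarrow> real) \<Rightarrow> (real \<Rightarrow> real) \<Rightarrow> real \<Rightarrow> real \<Rightarrow> real" where
  "scale_fun a b x\<^sub>0 x = (LBINT z=ereal x\<^sub>0..ereal x. rho a b x\<^sub>0 z)"

definition speed_measure ::
  "real set \<Rightarrow> (real \<Rightarrow> real) \<Rightarrow> (real \<Rightarrow> real) \<Rightarrow> real \<Rightarrow> real measure" where
  "speed_measure I a b x\<^sub>0 =
     density (restrict_space lborel I) (\<lambda>x. ennreal (1 / (a x * rho a b x\<^sub>0 x)))"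

definition weight ::
  "real set \<Rightarrow> (real \<Rightarrow> real) \<Rightarrow> (real \<Rightarrow> real) \<Rightarrow> real \<Rightarrow> real \<Rightarrow> real" where
  "weight I a b x\<^sub>0 y = (let x = the_inv_into I (scale_fun a b x\<^sub>0) y
     in 1 / (a x * (rho a b x\<^sub>0 x)\<^sup>2))"

definition weighted_measure :: "real set \<Rightarrow> (real \<Rightarrow> real) \<Rightarrow> real measure" where
  "weighted_measure J w = density (restrict_space lborel J) (\<lambda>y. ennreal (w y))"

section \<open>Form domains\<close>

text \<open>
  In this section \<open>H\<close> is the measure \<open>w(y) dy\<close> on \<open>J\<close>, standing for the Hilbert space \<open>L2 H\<close>.
\<close>

definition V_max :: "real measure \<Rightarrow> real set \<Rightarrow> (real \<Rightarrow> real) set" where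
  "V_max H J = {v \<in> L2 H. \<exists>c. ac_loc J c \<and> eq_ae H v c \<and>
     deriv c \<in> L2 (restrict_space lborel J)}"

definition ac_rep :: "real measure \<Rightarrow> real set \<Rightarrow> (real \<Rightarrow> real) \<Rightarrow> (real \<Rightarrow> real)" where
  "ac_rep H J v = (SOME c. ac_loc J c \<and> eq_ae H v c)"

text \<open>
  The representative is unique on \<open>J\<close>, hence so is its derivative there, which exists almost
  everywhere.
\<close>

definition form_deriv :: "real measure \<Rightarrow> real set \<Rightarrow> (real \<Rightarrow> real) \<Rightarrow> (real \<Rightarrow> real)" where
  "form_deriv H J v = deriv (ac_rep H J v)"

definition form_energy ::
  "real measure \<Rightarrow> real set \<Rightarrow> (real \<Rightarrow> real) \<Rightarrow> (real \<Rightarrow> real) \<Rightarrow> real" where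
  "form_energy H J v z =
     inner_L2 (restrict_space lborel J) (form_deriv H J v) (form_deriv H J z)"

definition norm_V :: "real measure \<Rightarrow> real set \<Rightarrow> (real \<Rightarrow> real) \<Rightarrow> real" where
  "norm_V H J v =
     sqrt ((norm_L2 H v)\<^sup>2 + (norm_L2 (restrict_space lborel J) (form_deriv H J v))\<^sup>2)"

definition test_functions :: "real set \<Rightarrow> (real \<Rightarrow> real) set" where
  "test_functions J = {\<phi>. (\<forall>k x. (deriv ^^ k) \<phi> field_differentiable at x) \<and>
     (\<exists>K. compact K \<and> K \<subseteq> J \<and> (\<forall>x. x \<notin> K \<longrightarrow> \<phi> x = 0))}"

definition admissible :: "real measure \<Rightarrow> real set \<Rightarrow> (real \<Rightarrow> real) set \<Rightarrow> bool" where
  "admissible H J V \<longleftrightarrow> subspace_L2 H V \<and> V \<subseteq> V_max H J \<and> test_functions J \<subseteq> V \<and>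
     (\<forall>v :: nat \<Rightarrow> real \<Rightarrow> real. (\<forall>n. v n \<in> V) \<and>
        (\<forall>\<epsilon>>0. \<exists>N. \<forall>m\<ge>N. \<forall>n\<ge>N. norm_V H J (\<lambda>y. v m y - v n y) < \<epsilon>) \<longrightarrow>
        (\<exists>z\<in>V. (\<lambda>n. norm_V H J (\<lambda>y. v n y - z y)) \<longlonglongrightarrow> 0))"

definition associated_operator ::
  "real measure \<Rightarrow> real set \<Rightarrow> (real \<Rightarrow> real) set \<Rightarrow> ((real \<Rightarrow> real) \<times> (real \<Rightarrow> real)) set \<Rightarrow> bool" where
  "associated_operator H J V A \<longleftrightarrow> self_adjoint H A \<and> nonpositive H A \<and> Domain A \<subseteq> V \<and>
     (\<forall>(v, g)\<in>A. \<forall>z\<in>V. form_energy H J v z = - inner_L2 H g z)"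

definition minus_mult ::
  "((real \<Rightarrow> real) \<times> (real \<Rightarrow> real)) set \<Rightarrow> (real \<Rightarrow> real) \<Rightarrow>
    ((real \<Rightarrow> real) \<times> (real \<Rightarrow> real)) set" where
  "minus_mult A p = {(v, \<lambda>y. g y - p y * v y) |v g. (v, g) \<in> A}"

text \<open>The conjugated family \<open>U\<^sup>-\<^sup>1 S\<^sub>t U\<close>, where \<open>U f = f \<circ> s\<^sup>-\<^sup>1\<close>.\<close>

definition conj_scale ::
  "real set \<Rightarrow> (real \<Rightarrow> real) \<Rightarrow> (real \<Rightarrow> (real \<Rightarrow> real) \<Rightarrow> (real \<Rightarrow> real)) \<Rightarrow>
    real \<Rightarrow> (real \<Rightarrow> real) \<Rightarrow> (real \<Rightarrow> real)" where
  "conj_scale I s S t f = S t (f \<circ> the_inv_into I s) \<circ> s"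

section \<open>Partial derivatives\<close>

definition pt :: "(real \<Rightarrow> real \<Rightarrow> real) \<Rightarrow> (real \<Rightarrow> real \<Rightarrow> real)" where
  "pt u t x = deriv (\<lambda>\<tau>. u \<tau> x) t"

definition px :: "(real \<Rightarrow> real \<Rightarrow> real) \<Rightarrow> (real \<Rightarrow> real \<Rightarrow> real)" where
  "px u t x = deriv (u t) x"

definition has_pt :: "(real \<times> real) set \<Rightarrow> (real \<Rightarrow> real \<Rightarrow> real) \<Rightarrow> bool" where
  "has_pt S u \<longleftrightarrow> (\<forall>(t, x)\<in>S. (\<lambda>\<tau>. u \<tau> x) field_differentiable at t)"

definition has_px :: "(real \<times> real) set \<Rightarrow> (real \<Rightarrow> real \<Rightarrow> real) \<Rightarrow> bool" where
  "has_px S u \<longleftrightarrow> (\<forall>(t, x)\<in>S. u t field_differentiable at x)"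

definition jointly_continuous :: "(real \<times> real) set \<Rightarrow> (real \<Rightarrow> real \<Rightarrow> real) \<Rightarrow> bool" where
  "jointly_continuous S u \<longleftrightarrow> continuous_on S (\<lambda>(t, x). u t x)"

definition C12_on :: "(real \<times> real) set \<Rightarrow> (real \<Rightarrow> real \<Rightarrow> real) \<Rightarrow> bool" where
  "C12_on S u \<longleftrightarrow> jointly_continuous S u \<and>
     has_pt S u \<and> jointly_continuous S (pt u) \<and>
     has_px S u \<and> jointly_continuous S (px u) \<and>
     has_px S (px u) \<and> jointly_continuous S (px (px u))"

end

theory Submission
  imports Defs
begin

text \<open>
  For a symmetric operator \<open>B\<close> bounded above, \<open>t \<mapsto> \<langle>e\<^sup>t\<^sup>Bv, v\<rangle>\<close> is, up to an exponential factor,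
  nonincreasing and convex, and this forces \<open>e\<^sup>t\<^sup>Bv\<close> into the domain of \<open>B\<close> for \<open>t > 0\<close>; hence orbits are
  infinitely differentiable in \<open>H\<close> with values in every \<open>Dom(B\<^sup>k)\<close>, without any spectral theorem.  By
  the lemma of du Bois-Reymond, each \<open>v \<in> Dom(A)\<close> has a \<open>C\<^sup>1\<close> representative \<open>c\<close> whose derivative is a
  primitive of \<open>w \<cdot> Av\<close>, and on compact subintervals \<open>|c| + |c'| \<le> C (\<parallel>v\<parallel> + \<parallel>Av\<parallel>)\<close>.  This estimate turns
  differentiability in \<open>H\<close> into joint regularity, and the change of variable \<open>y = s(x)\<close> turns
  \<open>c'' = w \<cdot> Av\<close> into the equation on \<open>I\<close>.
\<close>

section \<open>Semigroups of symmetric dissipative operators\<close>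

text \<open>The type of a Hilbert space cannot depend on the interval. The abstract arguments
  therefore run in one fixed space, the classes of square integrable functions on the line;
  \<open>L2 H\<close> is embedded by multiplication with the square root of the weight, and the
  transported family starts at time zero with a projection instead of the identity. What the
  semigroup argument takes from the self-adjointness of \<open>A\<close> is symmetry, a dense domain
  and a closed graph, the last because the graph equals its own adjoint.

  Absolute continuity is an \<epsilon>-\<delta> condition and \<open>deriv\<close> a total function,
  so the form can be used only once such functions are known to be indefinite integrals of their
  derivatives. This is why the Lebesgue differentiation theorem and a Radon-Nikodym argument occur.

  Since \<open>q\<close> is merely bounded and measurable, \<open>Q\<close> need not preserve the
  domain of \<open>A\<close>, and powers of \<open>B\<close> give no control on powers of
  \<open>A\<close>. Only one application of \<open>A\<close> is ever used, as
  \<open>A X = B X + Q X\<close>: convergence of two consecutive time derivatives in norm then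
  controls the representative and its first space derivative.\<close>

lemma uniform_boundedness:
  fixes T :: "nat \<Rightarrow> 'a::banach \<Rightarrow> 'b::real_normed_vector"
  assumes bl: "\<And>n. bounded_linear (T n)"
    and bdd: "\<And>x. bounded (range (\<lambda>n. T n x))"
  obtains M where "\<And>n x. norm (T n x) \<le> M * norm x"
proof -
  define F where "F = (\<lambda>k::nat. {x. \<forall>n. norm (T n x) \<le> real k})"
  have clo: "closed (F k)" for k
  proof -
    have "F k = (\<Inter>n. {x. norm (T n x) \<le> real k})" by (auto simp: F_def)
    moreover have "closed {x. norm (T n x) \<le> real k}" for n
      by (intro closed_Collect_le continuous_intros linear_continuous_on bl)
    ultimately show ?thesis by auto
  qed
  have "(\<Union>k. F k) = UNIV"
  proof -
    have "\<exists>k. x \<in> F k" for x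
    proof -
      obtain B where "\<And>n. norm (T n x) \<le> B" using bdd[of x] by (auto simp: bounded_iff)
      moreover obtain k :: nat where "B \<le> real k" using real_arch_simple by blast
      ultimately show ?thesis by (auto simp: F_def intro: order_trans)
    qed
    then show ?thesis by auto
  qed
  \<comment> \<open>Baire: countably many closed sets exhaust a complete space, so one of them has
    interior points.\<close>
  then have "\<exists>k. interior (F k) \<noteq> {}"
    using Baire_category_alt[of "euclidean :: 'a topology" "range F"] completely_metrizable_space_euclidean clo
    by fastforce
  then obtain k x0 r where r: "r > 0" "ball x0 r \<subseteq> F k"
    by (auto simp: mem_interior)
  have "norm (T n x) \<le> (4 * real k / r) * norm x" for n x
  proof (cases "x = 0")
    case True
    then show ?thesis using linear_simps(3)[OF bl[of n]] by simp
  next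
    case False
    \<comment> \<open>Rescaling \<open>x\<close> to length \<open>r / 2\<close> puts
      \<open>x0 + y\<close> and \<open>x0\<close> into the ball. Their images have norm at most
      \<open>k\<close>, and undoing the scaling yields the factor \<open>4 * k / r\<close>.\<close>
    define y where "y = (r / (2 * norm x)) *\<^sub>R x"
    have ny: "norm y = r / 2" using False r by (simp add: y_def)
    have "x0 + y \<in> F k" "x0 \<in> F k" using r ny by (auto simp: dist_norm intro!: subsetD[OF r(2)])
    then have "norm (T n (x0 + y)) \<le> k" "norm (T n x0) \<le> k" by (auto simp: F_def)
    moreover have "T n y = T n (x0 + y) - T n x0" using linear_simps(1)[OF bl[of n]] by simp
    ultimately have "norm (T n y) \<le> 2 * k" using norm_triangle_ineq4[of "T n (x0 + y)" "T n x0"] by simp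
    moreover have "norm (T n y) = r / (2 * norm x) * norm (T n x)"
      using linear_simps(5)[OF bl[of n]] r by (simp add: y_def)
    ultimately show ?thesis using False r by (simp add: field_simps)
  qed
  then show ?thesis using that by blast
qed

lemma at_left_shift: "filterlim f F (at_left t) \<longleftrightarrow> filterlim (\<lambda>h::real. f (t - h)) F (at_right (0::real))"
  by (simp add: filterlim_at_left_to_right filterlim_at_right_to_0[of _ _ "- t"])

lemma at_right_shift: "filterlim f F (at_right t) \<longleftrightarrow> filterlim (\<lambda>h::real. f (t + h)) F (at_right (0::real))"
  by (subst filterlim_at_right_to_0) (simp add: add.commute)

lemma has_vector_derivative_iff_tendsto:
  fixes f :: "real \<Rightarrow> 'a::real_normed_vector"
  shows "(f has_vector_derivative D) (at t) \<longleftrightarrow> ((\<lambda>y. (f y - f t) /\<^sub>R (y - t)) \<longlongrightarrow> D) (at t)"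
proof -
  have "((\<lambda>y. norm ((f y - f t) /\<^sub>R (y - t) - D)) \<longlongrightarrow> 0) (at t) \<longleftrightarrow>
        ((\<lambda>y. norm (f y - f t - (y - t) *\<^sub>R D) / norm (y - t)) \<longlongrightarrow> 0) (at t)"
  proof (rule filterlim_cong[OF refl refl])
    show "\<forall>\<^sub>F y in at t. norm ((f y - f t) /\<^sub>R (y - t) - D) = norm (f y - f t - (y - t) *\<^sub>R D) / norm (y - t)"
      unfolding eventually_at_filter
    proof (intro always_eventually allI impI)
      fix y assume "y \<noteq> t"
      then have "(f y - f t) /\<^sub>R (y - t) - D = (f y - f t - (y - t) *\<^sub>R D) /\<^sub>R (y - t)"
        by (simp add: scaleR_diff_right)
      then show "norm ((f y - f t) /\<^sub>R (y - t) - D) = norm (f y - f t - (y - t) *\<^sub>R D) / norm (y - t)"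
        by (simp add: divide_inverse mult.commute)
    qed
  qed
  then show ?thesis
    unfolding has_vector_derivative_def has_derivative_iff_norm
    by (simp add: bounded_linear_scaleR_left tendsto_norm_zero_iff LIM_zero_iff)
qed

text \<open>\<open>S 0\<close> is not assumed to be the identity. By \<open>S_add\<close> it is
  idempotent, and in the application it is the projection onto the copy of \<open>L2 H\<close>
  inside the fixed Hilbert space.\<close>

locale strongly_continuous_semigroup =
  fixes S :: "real \<Rightarrow> 'h::{real_inner,banach} \<Rightarrow> 'h"
  assumes lin: "t \<ge> 0 \<Longrightarrow> bounded_linear (S t)"
    and S_add: "\<lbrakk>t \<ge> 0; r \<ge> 0\<rbrakk> \<Longrightarrow> S (t + r) x = S t (S r x)"
    and cont0: "((\<lambda>t. S t x) \<longlongrightarrow> S 0 x) (at_right 0)"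
begin

definition gen :: "('h \<times> 'h) set" where
  "gen = {(v, g). S 0 v = v \<and> ((\<lambda>h. (S h v - v) /\<^sub>R h) \<longlongrightarrow> g) (at_right 0)}"

lemma linS: "t \<ge> 0 \<Longrightarrow> linear (S t)"
  using lin bounded_linear.linear by blast

lemmas S_simps = linear_add[OF linS] linear_diff[OF linS] linear_scale[OF linS] linear_0[OF linS]

lemma S_bound: "t \<ge> 0 \<Longrightarrow> \<exists>K\<ge>0. \<forall>x. norm (S t x) \<le> K * norm x"
  using bounded_linear.nonneg_bounded[OF lin, of t] by (auto simp: mult.commute)

text \<open>Otherwise there are times \<open>t n\<close> tending to 0 at which
  \<open>S (t n)\<close> exceeds every multiple of the norm, although \<open>S (t n) y\<close>
  converges for each \<open>y\<close>; uniform boundedness forbids this.\<close>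

lemma local_bound0: "\<exists>\<delta>>0. \<exists>M\<ge>0. \<forall>t\<in>{0..\<delta>}. \<forall>x. norm (S t x) \<le> M * norm x"
proof (rule ccontr)
  assume neg: "\<not> ?thesis"
  have "\<exists>t x. 0 \<le> t \<and> t \<le> inverse (real (Suc n)) \<and> norm (S t x) > real n * norm x" for n
  proof -
    have "inverse (real (Suc n)) > 0" "real n \<ge> 0" by auto
    then show ?thesis using neg by (meson atLeastAtMost_iff not_less)
  qed
  then obtain t x where t0: "\<And>n. 0 \<le> t n" and t1: "\<And>n. t n \<le> inverse (real (Suc n))"
    and big: "\<And>n. norm (S (t n) (x n)) > real n * norm (x n)" by metis
  have tl: "t \<longlonglongrightarrow> 0"
    by (rule tendsto_sandwich[OF _ _ tendsto_const LIMSEQ_inverse_real_of_nat]) (use t0 t1 in auto)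
  have "bounded (range (\<lambda>n. S (t n) y))" for y
  proof -
    have "\<forall>\<^sub>F t in at_right 0. dist (S t y) (S 0 y) < 1"
      using cont0[of y] by (auto simp: tendsto_iff)
    then obtain d where d: "d > 0" "\<And>t. 0 < t \<Longrightarrow> t < d \<Longrightarrow> dist (S t y) (S 0 y) < 1"
      by (auto simp: eventually_at_right_field)
    have "\<forall>\<^sub>F n in sequentially. t n < d" using tl d by (auto dest: order_tendstoD(2))
    then obtain N where N: "\<And>n. n \<ge> N \<Longrightarrow> t n < d" by (auto simp: eventually_sequentially)
    have "S (t n) y \<in> (\<lambda>n. S (t n) y) ` {..<N} \<union> cball (S 0 y) 1" for n
    proof (cases "n < N")
      case False
      then have "dist (S (t n) y) (S 0 y) \<le> 1"
        using d(2)[of "t n"] N[of n] t0[of n] by (cases "t n = 0") (auto intro: less_imp_le)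
      then show ?thesis by (simp add: dist_commute)
    qed auto
    then have "range (\<lambda>n. S (t n) y) \<subseteq> (\<lambda>n. S (t n) y) ` {..<N} \<union> cball (S 0 y) 1" by blast
    then show ?thesis by (rule bounded_subset[rotated]) (auto intro: finite_imp_bounded)
  qed
  then obtain M where M: "\<And>n y. norm (S (t n) y) \<le> M * norm y"
    using uniform_boundedness[of "\<lambda>n. S (t n)"] lin[OF t0] by blast
  obtain n :: nat where "M \<le> real n" using real_arch_simple by blast
  then have "norm (S (t n) (x n)) \<le> real n * norm (x n)"
    using M[of n "x n"] mult_right_mono[of M "real n" "norm (x n)"] by simp
  then show False using big[of n] by simp
qed

lemma local_bound:
  assumes "t \<ge> 0"
  obtains d M where "d > 0" "M \<ge> 0" "\<And>r x. \<lbrakk>t - d \<le> r; 0 \<le> r; r \<le> t\<rbrakk> \<Longrightarrow> norm (S r x) \<le> M * norm x"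
proof -
  obtain \<delta> M where d: "\<delta> > 0" "M \<ge> 0" and M: "\<And>t x. \<lbrakk>0 \<le> t; t \<le> \<delta>\<rbrakk> \<Longrightarrow> norm (S t x) \<le> M * norm x"
    using local_bound0 by auto
  show ?thesis
  proof (cases "t \<le> \<delta>")
    case True
    show ?thesis using True d M by (intro that[of \<delta> M]) auto
  next
    case False
    obtain K where K: "K \<ge> 0" "\<And>x. norm (S (t - \<delta>) x) \<le> K * norm x" using S_bound[of "t - \<delta>"] False by auto
    show ?thesis
    proof (rule that[of \<delta> "K * M"])
      fix r x assume r: "t - \<delta> \<le> r" "0 \<le> r" "r \<le> t"
      have "S r x = S (t - \<delta>) (S (r - (t - \<delta>)) x)" using S_add[of "t - \<delta>" "r - (t - \<delta>)" x] False r by simp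
      then have "norm (S r x) \<le> K * norm (S (r - (t - \<delta>)) x)" using K by simp
      also have "\<dots> \<le> K * (M * norm x)" using M[of "r - (t - \<delta>)" x] r K by (intro mult_left_mono) auto
      finally show "norm (S r x) \<le> K * M * norm x" by (simp add: mult.assoc)
    qed (use d K in auto)
  qed
qed

lemma S_right_tendsto:
  assumes "t \<ge> 0" shows "((\<lambda>h. S (t + h) x) \<longlongrightarrow> S t x) (at_right 0)"
proof -
  have "((\<lambda>h. S t (S h x)) \<longlongrightarrow> S t (S 0 x)) (at_right 0)"
    by (rule bounded_linear.tendsto[OF lin[OF assms] cont0])
  then have "((\<lambda>h. S t (S h x)) \<longlongrightarrow> S t x) (at_right 0)" using S_add[of t 0 x] assms by simp
  then show ?thesis
  proof (rule Lim_transform_eventually)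
    show "\<forall>\<^sub>F h in at_right 0. S t (S h x) = S (t + h) x"
      using assms S_add by (auto simp: eventually_at_right_field intro: exI[of _ 1])
  qed
qed

lemma S0_S: "t \<ge> 0 \<Longrightarrow> S 0 (S t x) = S t x" and S_S0: "t \<ge> 0 \<Longrightarrow> S t (S 0 x) = S t x"
  using S_add[of 0 t x] S_add[of t 0 x] by auto

text \<open>Since \<open>S t z = S (t - h) (S h z)\<close>, the difference is
  \<open>S (t - h)\<close> applied to \<open>y h - S h z\<close>, and these operators are bounded
  uniformly in small \<open>h\<close>. A constant \<open>y\<close> gives left continuity, a
  difference quotient gives the left derivative.\<close>

lemma S_left_tendsto_gen:
  assumes "t > 0" and y: "(y \<longlongrightarrow> S 0 z) (at_right 0)"
  shows "((\<lambda>h. S (t - h) (y h)) \<longlongrightarrow> S t z) (at_right 0)"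
proof -
  obtain d M where d: "d > 0" "M \<ge> 0" and M: "\<And>r x. \<lbrakk>t - d \<le> r; 0 \<le> r; r \<le> t\<rbrakk> \<Longrightarrow> norm (S r x) \<le> M * norm x"
    using local_bound[of t] assms by auto
  have lim: "((\<lambda>h. M * norm (y h - S h z)) \<longlongrightarrow> M * norm (S 0 z - S 0 z)) (at_right 0)"
    by (intro tendsto_intros y cont0)
  have "((\<lambda>h. S (t - h) (y h) - S t z) \<longlongrightarrow> 0) (at_right 0)"
  proof (rule Lim_null_comparison)
    show "((\<lambda>h. M * norm (y h - S h z)) \<longlongrightarrow> 0) (at_right 0)" using lim by simp
    show "\<forall>\<^sub>F h in at_right 0. norm (S (t - h) (y h) - S t z) \<le> M * norm (y h - S h z)"
      unfolding eventually_at_right_field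
    proof (intro exI[of _ "min d t"] conjI allI impI)
      fix h :: real assume h: "0 < h" "h < min d t"
      have "S t z = S (t - h) (S h z)" using S_add[of "t - h" h z] h by simp
      then have "S (t - h) (y h) - S t z = S (t - h) (y h - S h z)" using h by (simp add: S_simps)
      then show "norm (S (t - h) (y h) - S t z) \<le> M * norm (y h - S h z)" using M[of "t - h"] h by auto
    qed (use d assms in auto)
  qed
  then show ?thesis by (simp add: LIM_zero_iff)
qed

lemma S_isCont: assumes "t > 0" shows "isCont (\<lambda>t. S t x) t"
proof -
  have "((\<lambda>h. S (t - h) (S 0 x)) \<longlongrightarrow> S t x) (at_right 0)"
    by (rule S_left_tendsto_gen[OF assms tendsto_const])
  then have "((\<lambda>h. S (t - h) x) \<longlongrightarrow> S t x) (at_right 0)"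
  proof (rule Lim_transform_eventually)
    show "\<forall>\<^sub>F h in at_right 0. S (t - h) (S 0 x) = S (t - h) x"
      unfolding eventually_at_right_field using assms by (intro exI[of _ t]) (simp add: S_S0)
  qed
  moreover have "((\<lambda>h. S (t + h) x) \<longlongrightarrow> S t x) (at_right 0)"
    using assms by (intro S_right_tendsto) simp
  ultimately show ?thesis
    unfolding isCont_def filterlim_at_split at_left_shift[of _ _ t] at_right_shift[of _ _ t] by simp
qed

lemma S_continuous_on: "continuous_on {0..} (\<lambda>t. S t x)"
  unfolding continuous_on_eq_continuous_within
proof (rule ballI)
  fix t :: real assume t: "t \<in> {0..}"
  show "continuous (at t within {0..}) (\<lambda>t. S t x)"
  proof (cases "t = 0")
    case True
    show ?thesis unfolding True continuous_within at_within_Ici_at_right by (rule cont0)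
  next
    case False
    then have "t > 0" using t by simp
    then show ?thesis by (rule continuous_at_imp_continuous_at_within[OF S_isCont])
  qed
qed

lemma gen_S:
  assumes "(v, g) \<in> gen" "t \<ge> 0" shows "(S t v, S t g) \<in> gen"
proof -
  have "((\<lambda>h. S t ((S h v - v) /\<^sub>R h)) \<longlongrightarrow> S t g) (at_right 0)"
    using assms by (intro bounded_linear.tendsto[OF lin]) (auto simp: gen_def)
  then have "((\<lambda>h. (S h (S t v) - S t v) /\<^sub>R h) \<longlongrightarrow> S t g) (at_right 0)"
  proof (rule Lim_transform_eventually)
    show "\<forall>\<^sub>F h in at_right 0. S t ((S h v - v) /\<^sub>R h) = (S h (S t v) - S t v) /\<^sub>R h"
      unfolding eventually_at_right_field
      using assms by (auto intro!: exI[of _ 1] simp: S_simps S_add[symmetric] add.commute)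
  qed
  then show ?thesis using assms S0_S by (simp add: gen_def)
qed

lemma gen_unique: "(v, g) \<in> gen \<Longrightarrow> (v, g') \<in> gen \<Longrightarrow> g = g'"
  unfolding gen_def using tendsto_unique[of "at_right (0::real)"] by auto

lemma gen_S0: assumes "(v, g) \<in> gen" shows "S 0 v = v" "S 0 g = g"
  using gen_S[OF assms, of 0] gen_unique[OF assms, of "S 0 g"] assms by (auto simp: gen_def)

lemma gen_add: "(v, g) \<in> gen \<Longrightarrow> (v', g') \<in> gen \<Longrightarrow> (v - v', g - g') \<in> gen"
proof -
  assume a: "(v, g) \<in> gen" "(v', g') \<in> gen"
  then have "((\<lambda>h. (S h v - v) /\<^sub>R h - (S h v' - v') /\<^sub>R h) \<longlongrightarrow> g - g') (at_right 0)"
    by (intro tendsto_diff) (auto simp: gen_def)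
  then have "((\<lambda>h. (S h (v - v') - (v - v')) /\<^sub>R h) \<longlongrightarrow> g - g') (at_right 0)"
  proof (rule Lim_transform_eventually)
    show "\<forall>\<^sub>F h in at_right 0. (S h v - v) /\<^sub>R h - (S h v' - v') /\<^sub>R h = (S h (v - v') - (v - v')) /\<^sub>R h"
      unfolding eventually_at_right_field
      by (auto intro!: exI[of _ 1] simp: S_simps algebra_simps)
  qed
  then show ?thesis using a by (simp add: gen_def S_simps)
qed

text \<open>The right quotient is \<open>S t\<close> applied to the quotient at time 0. The left
  quotient is \<open>S (t - h)\<close> applied to it, where operator and argument move together;
  this needs the uniform bound and not only strong continuity.\<close>

lemma S_derivative:
  assumes v: "(v, g) \<in> gen" and t: "t > 0"
  shows "((\<lambda>t. S t v) has_vector_derivative S t g) (at t)"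
proof -
  have q: "((\<lambda>h. (S h v - v) /\<^sub>R h) \<longlongrightarrow> g) (at_right 0)" using v by (simp add: gen_def)
  have "((\<lambda>h. (S (t + h) v - S t v) /\<^sub>R h) \<longlongrightarrow> S t g) (at_right 0)"
  proof (rule Lim_transform_eventually)
    show "((\<lambda>h. S t ((S h v - v) /\<^sub>R h)) \<longlongrightarrow> S t g) (at_right 0)"
      using t by (intro bounded_linear.tendsto[OF lin q]) auto
    show "\<forall>\<^sub>F h in at_right 0. S t ((S h v - v) /\<^sub>R h) = (S (t + h) v - S t v) /\<^sub>R h"
      unfolding eventually_at_right_field
      using t by (auto intro!: exI[of _ 1] simp: S_simps S_add)
  qed
  moreover have "((\<lambda>h. (S (t - h) v - S t v) /\<^sub>R (- h)) \<longlongrightarrow> S t g) (at_right 0)"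
  proof (rule Lim_transform_eventually)
    show "((\<lambda>h. S (t - h) ((S h v - v) /\<^sub>R h)) \<longlongrightarrow> S t g) (at_right 0)"
      by (rule S_left_tendsto_gen[OF t]) (use q gen_S0[OF v] in simp)
    show "\<forall>\<^sub>F h in at_right 0. S (t - h) ((S h v - v) /\<^sub>R h) = (S (t - h) v - S t v) /\<^sub>R (- h)"
      unfolding eventually_at_right_field
    proof (intro exI[of _ t] conjI allI impI)
      fix h :: real assume h: "0 < h" "h < t"
      then have "S (t - h) (S h v) = S t v" using S_add[of "t - h" h v] by simp
      then show "S (t - h) ((S h v - v) /\<^sub>R h) = (S (t - h) v - S t v) /\<^sub>R (- h)"
        using h by (simp add: S_simps scaleR_diff_right)
    qed (use t in auto)
  qed
  ultimately have "((\<lambda>y. (S y v - S t v) /\<^sub>R (y - t)) \<longlongrightarrow> S t g) (at t)"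
    unfolding filterlim_at_split at_left_shift[of _ _ t] at_right_shift[of _ _ t] by simp
  then show ?thesis by (simp add: has_vector_derivative_iff_tendsto)
qed

end

text \<open>Symmetric, closed, bounded above by \<omega>, and densely defined in the range of the
  projection \<open>S 0\<close>. The rescaled family \<open>E\<close> below is generated by
  \<open>gen\<close> minus \<omega>, which is nonpositive, and is therefore a contraction
  there.\<close>

locale dissipative_semigroup = strongly_continuous_semigroup S
  for S :: "real \<Rightarrow> 'h::{real_inner,banach} \<Rightarrow> 'h" +
  fixes \<omega> :: real
  assumes gen_sym: "\<lbrakk>(v, g) \<in> gen; (v', g') \<in> gen\<rbrakk> \<Longrightarrow> g \<bullet> v' = v \<bullet> g'"
    and gen_closed: "closed gen"
    and gen_dense: "S 0 x = x \<Longrightarrow> x \<in> closure (Domain gen)"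
    and gen_diss: "(v, g) \<in> gen \<Longrightarrow> g \<bullet> v \<le> \<omega> * (v \<bullet> v)"
begin

definition E :: "real \<Rightarrow> 'h \<Rightarrow> 'h" where "E t x = exp (- \<omega> * t) *\<^sub>R S t x"

lemma E_derivative:
  assumes "(v, g) \<in> gen" "t > 0"
  shows "((\<lambda>t. E t v) has_vector_derivative E t (g - \<omega> *\<^sub>R v)) (at t)"
proof -
  have "((\<lambda>t. exp (- \<omega> * t)) has_field_derivative - \<omega> * exp (- \<omega> * t)) (at t)"
    by (auto intro!: derivative_eq_intros)
  from has_vector_derivative_scaleR[OF this S_derivative[OF assms]]
  have "((\<lambda>t. E t v) has_vector_derivative (exp (- \<omega> * t) *\<^sub>R S t g + (- \<omega> * exp (- \<omega> * t)) *\<^sub>R S t v)) (at t)"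
    unfolding E_def .
  moreover have "exp (- \<omega> * t) *\<^sub>R S t g + (- \<omega> * exp (- \<omega> * t)) *\<^sub>R S t v = E t (g - \<omega> *\<^sub>R v)"
    using assms by (simp add: E_def S_simps algebra_simps)
  ultimately show ?thesis by simp
qed

lemma E_continuous_on: "continuous_on {0..} (\<lambda>t. E t x)"
  unfolding E_def by (intro continuous_intros S_continuous_on)

text \<open>The squared norm along the orbit has derivative
  \<open>2 * (E r (g - \<omega> *\<^sub>R v) \<bullet> E r v)\<close>, which is at most 0 by
  dissipativity at the point \<open>S r v\<close>.\<close>

lemma E_contraction_dom:
  assumes v: "(v, g) \<in> gen" and t: "t \<ge> 0"
  shows "norm (E t v) \<le> norm v"
proof -
  define \<phi> where "\<phi> = (\<lambda>t. E t v \<bullet> E t v)"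
  have "\<phi> t \<le> \<phi> 0"
  proof (cases "t = 0")
    case False
    show ?thesis
    proof (rule DERIV_nonpos_imp_decreasing_open[of 0 t \<phi>])
      show "0 \<le> t" by (rule t)
      fix r assume r: "0 < r" "r < t"
      have "(\<phi> has_vector_derivative (E r v \<bullet> E r (g - \<omega> *\<^sub>R v) + E r (g - \<omega> *\<^sub>R v) \<bullet> E r v)) (at r)"
        unfolding \<phi>_def using has_derivative_inner[OF E_derivative[OF v r(1), unfolded has_vector_derivative_def]
            E_derivative[OF v r(1), unfolded has_vector_derivative_def]]
        by (simp add: has_vector_derivative_def algebra_simps)
      moreover have "E r (g - \<omega> *\<^sub>R v) \<bullet> E r v \<le> 0"
        using gen_diss[OF gen_S[OF v, of r]] r
        by (simp add: E_def S_simps inner_diff_left mult_nonneg_nonpos)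
      ultimately show "\<exists>y. (\<phi> has_real_derivative y) (at r) \<and> y \<le> 0"
        by (auto simp: has_real_derivative_iff_has_vector_derivative inner_commute intro!: exI)
    next
      show "continuous_on {0..t} \<phi>"
        unfolding \<phi>_def by (intro continuous_intros continuous_on_subset[OF E_continuous_on]) auto
    qed
  qed simp
  then show ?thesis using gen_S0[OF v] by (simp add: \<phi>_def norm_eq_sqrt_inner E_def)
qed

lemma dom_approx:
  assumes "S 0 x = x"
  obtains v g where "\<And>n::nat. (v n, g n) \<in> gen" "v \<longlonglongrightarrow> x"
proof -
  obtain v where v: "\<And>n. v n \<in> Domain gen" "v \<longlonglongrightarrow> x"
    using gen_dense[OF assms] unfolding closure_sequential by blast
  then have "\<forall>n. \<exists>g. (v n, g) \<in> gen" by blast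
  then obtain g where "\<And>n. (v n, g n) \<in> gen" by metis
  with v(2) show ?thesis using that by blast
qed

lemma E_tendsto: "t \<ge> 0 \<Longrightarrow> (f \<longlongrightarrow> x) F \<Longrightarrow> ((\<lambda>n. E t (f n)) \<longlongrightarrow> E t x) F"
  unfolding E_def by (intro tendsto_intros bounded_linear.tendsto[OF lin])

lemma E_contraction:
  assumes x: "S 0 x = x" and t: "t \<ge> 0"
  shows "norm (E t x) \<le> norm x"
proof -
  obtain v g where v: "\<And>n::nat. (v n, g n) \<in> gen" "v \<longlonglongrightarrow> x" using dom_approx[OF x] by blast
  show ?thesis
    by (rule tendsto_le[OF _ tendsto_norm[OF v(2)] tendsto_norm[OF E_tendsto[OF t v(2)]]])
      (use E_contraction_dom[OF v(1) t] in auto)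
qed

text \<open>The function \<open>r \<mapsto> S r v \<bullet> S (t - r) v'\<close> interpolates
  between the two sides, and its derivative vanishes because the generator is symmetric.\<close>

lemma S_sym_dom:
  assumes v: "(v, g) \<in> gen" "(v', g') \<in> gen" and t: "t \<ge> 0"
  shows "S t v \<bullet> v' = v \<bullet> S t v'"
proof (cases "t = 0")
  case True
  then show ?thesis using gen_S0[OF v(1)] gen_S0[OF v(2)] by simp
next
  case False
  define k where "k = (\<lambda>r. S r v \<bullet> S (t - r) v')"
  have "k t = k 0"
  proof (rule DERIV_isconst2[of 0 t k])
    show "0 < t" using t False by simp
    show "continuous_on {0..t} k"
      unfolding k_def
      by (intro continuous_intros continuous_on_subset[OF S_continuous_on]
          continuous_on_compose2[OF S_continuous_on]) auto
    fix r assume r: "0 < r" "r < t"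
    have 1: "((\<lambda>r. S (t - r) v') has_vector_derivative - S (t - r) g') (at r)"
    proof -
      have "((\<lambda>r. t - r) has_vector_derivative (0 - 1)) (at r)" by (intro derivative_intros)
      from vector_diff_chain_at[OF this, of "\<lambda>r. S r v'" "S (t - r) g'"] show ?thesis
        using S_derivative[OF v(2), of "t - r"] r by (simp add: o_def)
    qed
    have "(k has_vector_derivative (S r v \<bullet> (- S (t - r) g') + S r g \<bullet> S (t - r) v')) (at r)"
      unfolding k_def
      using has_derivative_inner[OF S_derivative[OF v(1) r(1), unfolded has_vector_derivative_def]
            1[unfolded has_vector_derivative_def]]
        by (simp add: has_vector_derivative_def algebra_simps)
    moreover have "S r g \<bullet> S (t - r) v' = S r v \<bullet> S (t - r) g'"
      using gen_sym[OF gen_S[OF v(1)] gen_S[OF v(2)], of r "t - r"] r by simp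
    ultimately show "DERIV k r :> 0"
      by (simp add: has_real_derivative_iff_has_vector_derivative)
  qed (use t in auto)
  then show ?thesis using gen_S0[OF v(1)] gen_S0[OF v(2)] by (simp add: k_def)
qed

lemma S_sym:
  assumes x: "S 0 x = x" and y: "S 0 y = y" and t: "t \<ge> 0"
  shows "S t x \<bullet> y = x \<bullet> S t y"
proof -
  obtain v g where v: "\<And>n::nat. (v n, g n) \<in> gen" "v \<longlonglongrightarrow> x" using dom_approx[OF x] by blast
  obtain v' g' where v': "\<And>n::nat. (v' n, g' n) \<in> gen" "v' \<longlonglongrightarrow> y" using dom_approx[OF y] by blast
  have "(\<lambda>n. S t (v n) \<bullet> v' n) \<longlonglongrightarrow> S t x \<bullet> y"
    by (intro tendsto_intros bounded_linear.tendsto[OF lin[OF t]] v v')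
  moreover have "(\<lambda>n. v n \<bullet> S t (v' n)) \<longlonglongrightarrow> x \<bullet> S t y"
    by (intro tendsto_intros bounded_linear.tendsto[OF lin[OF t]] v v')
  ultimately show ?thesis using S_sym_dom[OF v(1) v'(1) t] LIMSEQ_unique by auto
qed

lemma E_sym: "S 0 x = x \<Longrightarrow> S 0 y = y \<Longrightarrow> t \<ge> 0 \<Longrightarrow> E t x \<bullet> y = x \<bullet> E t y"
  by (simp add: E_def S_sym)

lemma E_add: assumes "t \<ge> 0" "r \<ge> 0" shows "E (t + r) x = E t (E r x)"
proof -
  have "exp (- \<omega> * (t + r)) = exp (- \<omega> * t) * exp (- \<omega> * r)"
    by (simp only: distrib_left exp_add)
  then show ?thesis using assms by (simp only: E_def S_add[OF assms] S_simps scaleR_scaleR)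
qed

lemma S0_E: "t \<ge> 0 \<Longrightarrow> S 0 (E t x) = E t x"
  by (simp add: E_def S_simps S0_S)

text \<open>The function \<open>t \<mapsto> E t v \<bullet> v\<close> is nonnegative, nonincreasing and convex with a nonincreasing
  second derivative, which the mean value theorem, applied twice, bounds by the function itself.\<close>

lemma E_smoothing_dom:
  assumes v: "(v, g) \<in> gen" and t: "t > 0"
  shows "t * norm (E (3 * t / 2) (g - \<omega> *\<^sub>R v)) \<le> norm v"
proof -
  define h where "h = g - \<omega> *\<^sub>R v"
  have S0: "S 0 v = v" "S 0 h = h" using gen_S0[OF v] by (auto simp: h_def S_simps)
  \<comment> \<open>Splitting the time in two turns \<open>E r x \<bullet> x\<close> into a square,
    hence nonnegative, and \<open>E r v \<bullet> h\<close> into a value of the nonpositive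
    form.\<close>
  have half: "E r x \<bullet> y = E (r / 2) x \<bullet> E (r / 2) y" if "S 0 x = x" "S 0 y = y" "r \<ge> 0" for r x y
    using E_add[of "r / 2" "r / 2" x] E_sym[of "E (r / 2) x" y "r / 2"] that by (simp add: S0_E)
  have d1: "DERIV (\<lambda>r. E r v \<bullet> v) r :> E r v \<bullet> h" if "r > 0" for r
  proof -
    have "((\<lambda>r. E r v \<bullet> v) has_vector_derivative E r h \<bullet> v) (at r)"
      using bounded_linear.has_vector_derivative[OF bounded_linear_inner_left E_derivative[OF v that], of v]
      by (simp add: h_def)
    moreover have "E r h \<bullet> v = E r v \<bullet> h" using E_sym[OF S0(2,1), of r] that by (simp add: inner_commute)
    ultimately show ?thesis by (simp add: has_real_derivative_iff_has_vector_derivative)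
  qed
  have d2: "DERIV (\<lambda>r. E r v \<bullet> h) r :> E r h \<bullet> h" if "r > 0" for r
    using bounded_linear.has_vector_derivative[OF bounded_linear_inner_left E_derivative[OF v that], of h]
    by (simp add: has_real_derivative_iff_has_vector_derivative h_def)
  have neg: "E r v \<bullet> h \<le> 0" if "r > 0" for r
  proof -
    have "(S (r / 2) g - \<omega> *\<^sub>R S (r / 2) v) \<bullet> S (r / 2) v \<le> 0"
      using gen_diss[OF gen_S[OF v, of "r / 2"]] that by (simp add: inner_diff_left)
    moreover have "E r v \<bullet> h = (exp (- \<omega> * (r / 2)))\<^sup>2 * ((S (r / 2) g - \<omega> *\<^sub>R S (r / 2) v) \<bullet> S (r / 2) v)"
      using half[of v h r] S0 that by (simp add: E_def h_def S_simps inner_commute power2_eq_square)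
    ultimately show ?thesis by (simp add: mult_nonneg_nonpos)
  qed
  \<comment> \<open>The intermediate times satisfy \<open>\<eta> < 2 * t\<close> and
    \<open>\<xi> < 3 * t\<close>, so the second interval, from \<eta> to \<open>3 * t\<close>, still
    has length at least \<open>t\<close>. Each application of the mean value theorem thus
    contributes one factor \<open>t\<close>.\<close>
  obtain \<eta> where \<eta>: "t < \<eta>" "\<eta> < 2 * t" "E (2 * t) v \<bullet> v - E t v \<bullet> v = (2 * t - t) * (E \<eta> v \<bullet> h)"
    using MVT2[of t "2 * t" "\<lambda>r. E r v \<bullet> v" "\<lambda>r. E r v \<bullet> h"] d1 t by auto
  obtain \<xi> where \<xi>: "\<eta> < \<xi>" "\<xi> < 3 * t" "E (3 * t) v \<bullet> h - E \<eta> v \<bullet> h = (3 * t - \<eta>) * (E \<xi> h \<bullet> h)"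
    using MVT2[of \<eta> "3 * t" "\<lambda>r. E r v \<bullet> h" "\<lambda>r. E r h \<bullet> h"] d2 t \<eta> by auto
  define N where "N = norm (E (3 * t / 2) h)"
  \<comment> \<open>The time \<open>3 * t / 2\<close> is half of \<open>3 * t\<close>: it lies
    beyond \<open>\<xi> / 2\<close> whatever \<xi> is, so contraction removes the dependence on the
    unknown \<xi>.\<close>
  have "E (3 * t / 2) h = E (3 * t / 2 - \<xi> / 2) (E (\<xi> / 2) h)"
    using E_add[of "3 * t / 2 - \<xi> / 2" "\<xi> / 2" h] \<xi> \<eta> t by simp
  then have "N \<le> norm (E (\<xi> / 2) h)"
    unfolding N_def using E_contraction[of "E (\<xi> / 2) h" "3 * t / 2 - \<xi> / 2"] \<xi> \<eta> t by (simp add: S0_E)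
  then have "N\<^sup>2 \<le> (norm (E (\<xi> / 2) h))\<^sup>2" by (intro power_mono) (auto simp: N_def)
  also have "\<dots> = E \<xi> h \<bullet> h" using half[of h h \<xi>] S0 \<xi> \<eta> t by (simp add: power2_norm_eq_inner)
  finally have N: "N\<^sup>2 \<le> E \<xi> h \<bullet> h" .
  have "t * N\<^sup>2 \<le> (3 * t - \<eta>) * (E \<xi> h \<bullet> h)" using N \<eta> t by (intro mult_mono) auto
  then have "t * (t * N\<^sup>2) \<le> t * (- (E \<eta> v \<bullet> h))" using \<xi>(3) neg[of "3 * t"] t by (intro mult_left_mono) auto
  also have "\<dots> \<le> E t v \<bullet> v" 
  proof -
    have "E (2 * t) v \<bullet> v \<ge> 0" using half[of v v "2 * t"] S0 t by simp
    then show ?thesis using \<eta>(3) by simp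
  qed
  also have "\<dots> \<le> norm (E t v) * norm v" by (rule norm_cauchy_schwarz)
  also have "\<dots> \<le> norm v * norm v" using E_contraction[OF S0(1), of t] t by (intro mult_right_mono) auto
  finally have "(t * N)\<^sup>2 \<le> (norm v)\<^sup>2" by (simp add: power2_eq_square mult_ac)
  then show ?thesis unfolding N_def h_def by (rule power2_le_imp_le) simp
qed

lemma S_smoothing:
  assumes t: "t > 0" shows "S t f \<in> Domain gen"
proof -
  \<comment> \<open>Chosen so that the smoothing estimate with parameter \<open>r\<close> speaks
    about time \<open>t\<close>.\<close>
  define r where "r = 2 * t / 3"
  have r: "r > 0" "3 * r / 2 = t" using t by (auto simp: r_def)
  have "S 0 (S 0 f) = S 0 f" by (rule S0_S) simp
  then obtain v g where v: "\<And>n::nat. (v n, g n) \<in> gen" "v \<longlonglongrightarrow> S 0 f" using dom_approx by blast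
  define h where "h = (\<lambda>n. g n - \<omega> *\<^sub>R v n)"
  have Eh: "E t (h n) - E t (h m) = E t ((g n - g m) - \<omega> *\<^sub>R (v n - v m))" for n m
    using t by (simp add: E_def h_def S_simps algebra_simps)
  have bnd: "norm (E t (h n) - E t (h m)) \<le> norm (v n - v m) / r" for n m
    using E_smoothing_dom[OF gen_add[OF v(1)[of n] v(1)[of m]] r(1)] r
    by (simp add: Eh field_simps)
  \<comment> \<open>The images of the approximants under the generator may diverge, but after time
    \<open>t\<close> the smoothing estimate bounds their differences by those of \<open>v\<close>.
    Closedness of \<open>gen\<close> then identifies the limit.\<close>
  have "Cauchy (\<lambda>n. E t (h n))"
  proof (rule metric_CauchyI)
    fix e :: real assume e: "e > 0"
    have "Cauchy v" using v(2) LIMSEQ_imp_Cauchy by blast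
    then obtain M where M: "\<And>m n. m \<ge> M \<Longrightarrow> n \<ge> M \<Longrightarrow> dist (v m) (v n) < e * r"
      using e r(1) metric_CauchyD[of v "e * r"] by (metis mult_pos_pos)
    show "\<exists>M. \<forall>m\<ge>M. \<forall>n\<ge>M. dist (E t (h m)) (E t (h n)) < e"
    proof (intro exI[of _ M] allI impI)
      fix m n assume "m \<ge> M" "n \<ge> M"
      from M[OF this] have "norm (v m - v n) / r < e" using r(1) by (simp add: dist_norm field_simps)
      then show "dist (E t (h m)) (E t (h n)) < e" using bnd[of m n] by (simp add: dist_norm)
    qed
  qed
  then obtain y where y: "(\<lambda>n. E t (h n)) \<longlonglongrightarrow> y" using Cauchy_convergent convergent_def by blast
  have St: "(\<lambda>n. S t (v n)) \<longlonglongrightarrow> S t (S 0 f)" using t by (intro bounded_linear.tendsto[OF lin v(2)]) simp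
  have "S t (g n) = exp (\<omega> * t) *\<^sub>R E t (h n) + \<omega> *\<^sub>R S t (v n)" for n
  proof -
    have "exp (\<omega> * t) * exp (- \<omega> * t) = 1" by (simp add: exp_add[symmetric])
    then show ?thesis using t by (simp add: E_def h_def S_simps)
  qed
  then have "(\<lambda>n. S t (g n)) \<longlonglongrightarrow> exp (\<omega> * t) *\<^sub>R y + \<omega> *\<^sub>R S t (S 0 f)"
    by (auto intro!: tendsto_intros y St)
  then have "(\<lambda>n. (S t (v n), S t (g n))) \<longlonglongrightarrow> (S t (S 0 f), exp (\<omega> * t) *\<^sub>R y + \<omega> *\<^sub>R S t (S 0 f))"
    by (intro tendsto_Pair St)
  moreover have "(S t (v n), S t (g n)) \<in> gen" for n using gen_S[OF v(1)] t by simp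
  ultimately have "(S t (S 0 f), exp (\<omega> * t) *\<^sub>R y + \<omega> *\<^sub>R S t (S 0 f)) \<in> gen"
    using closed_sequentially[OF gen_closed, of "\<lambda>n. (S t (v n), S t (g n))"] by blast
  then show ?thesis using S_S0[of t f] t by auto
qed

theorem smooth_orbit:
  obtains x where "x 0 = (\<lambda>t. S t f)"
    "\<And>k t. t > 0 \<Longrightarrow> (x k t, x (Suc k) t) \<in> gen"
    "\<And>k t. t > 0 \<Longrightarrow> (x k has_vector_derivative x (Suc k) t) (at t)"
proof -
  define L where "L = (\<lambda>v. THE g. (v, g) \<in> gen)"
  have L: "(v, g) \<in> gen \<Longrightarrow> L v = g" for v g unfolding L_def using gen_unique by blast
  define x where "x = (\<lambda>k t. (L ^^ k) (S t f))"
  \<comment> \<open>The orbit relation is carried along in the induction because it supplies the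
    domain statement: \<open>x (Suc k) t\<close> is \<open>S (t / 2)\<close> of its value at
    \<open>t / 2\<close>, hence smoothed again.\<close>
  have dom: "\<forall>t>0. x k t \<in> Domain gen \<and> (\<forall>h\<ge>0. x k (t + h) = S h (x k t))" for k
  proof (induction k)
    case 0
    have "S (t + h) f = S h (S t f)" if "t > 0" "h \<ge> 0" for t h
      using S_add[of h t f] that by (simp add: add.commute)
    then show ?case using S_smoothing by (auto simp: x_def)
  next
    case (Suc k)
    have step: "x (Suc k) (t + h) = S h (x (Suc k) t)" if "t > 0" "h \<ge> 0" for t h
    proof -
      have "x k t \<in> Domain gen" using Suc that by blast
      then obtain g where g: "(x k t, g) \<in> gen" by blast
      have "x (Suc k) (t + h) = L (S h (x k t))" using Suc that by (simp add: x_def)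
      also have "\<dots> = S h g" using L gen_S[OF g that(2)] by blast
      also have "\<dots> = S h (x (Suc k) t)" using L[OF g] by (simp add: x_def)
      finally show ?thesis .
    qed
    have "x (Suc k) t \<in> Domain gen" if "t > 0" for t
      using step[of "t / 2" "t / 2"] S_smoothing[of "t / 2"] that by simp
    then show ?case using step by blast
  qed
  have gen: "(x k t, x (Suc k) t) \<in> gen" if "t > 0" for k t
  proof -
    have "x k t \<in> Domain gen" using dom that by blast
    then obtain g where "(x k t, g) \<in> gen" by blast
    with L show ?thesis by (simp add: x_def)
  qed
  show ?thesis
  proof (rule that[of x])
    fix k t assume t: "(t::real) > 0"
    \<comment> \<open>Restarting at time \<open>t / 2\<close> makes \<open>x k\<close> near
      \<open>t\<close> the orbit of a point of the domain, at a strictly positive time, where the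
      two-sided derivative is available.\<close>
    have "((\<lambda>r. S r (x k (t / 2))) has_vector_derivative S (t / 2) (x (Suc k) (t / 2))) (at (t / 2))"
      using S_derivative[OF gen, of "t / 2"] t by simp
    moreover have "((\<lambda>r. r - t / 2) has_vector_derivative (1 - 0)) (at t)" by (intro derivative_intros)
    ultimately have "((\<lambda>r. S (r - t / 2) (x k (t / 2))) has_vector_derivative S (t / 2) (x (Suc k) (t / 2))) (at t)"
      using vector_diff_chain_at[of "\<lambda>r. r - t / 2" "1 - 0" t "\<lambda>r. S r (x k (t / 2))" "S (t / 2) (x (Suc k) (t / 2))"]
      by (simp add: o_def)
    moreover have "S (t / 2) (x (Suc k) (t / 2)) = x (Suc k) t"
      using dom[of "Suc k"] t by (metis field_sum_of_halves half_gt_zero less_imp_le)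
    ultimately have "((\<lambda>r. S (r - t / 2) (x k (t / 2))) has_vector_derivative x (Suc k) t) (at t)" by simp
    then show "(x k has_vector_derivative x (Suc k) t) (at t)"
    proof (rule has_vector_derivative_transform_within_open[of _ _ _ "{t / 2 <..}"])
      fix r assume "r \<in> {t / 2 <..}"
      then show "S (r - t / 2) (x k (t / 2)) = x k r"
        using dom[of k, rule_format, of "t / 2"] t by (metis add.commute diff_add_cancel diff_ge_0_iff_ge greaterThan_iff half_gt_zero less_imp_le)
    qed (use t in auto)
  next
    show "\<And>k t. t > 0 \<Longrightarrow> (x k t, x (Suc k) t) \<in> gen" by (rule gen)
  qed (simp add: x_def)
qed

end

section \<open>The Lebesgue differentiation theorem on the line\<close>

lemma negligible_AE_lborel: assumes "negligible N" shows "AE x in lborel. x \<notin> N"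
proof -
  have "AE x in lebesgue. x \<notin> N" using assms by (intro AE_not_in) (simp add: negligible_iff_null_sets)
  then show ?thesis by (simp add: AE_completion_iff)
qed

text \<open>A Vitali covering argument. At a bad point \<open>g\<close> is below \<open>p\<close>
  although arbitrarily short intervals around it have mean above \<open>q\<close>. Disjoint such
  intervals cover the bad set up to a null set; their union \<open>W\<close> lies in an open set
  where the positive part of \<open>g - q\<close> has small integral. On each interval the negative
  part integrates to no more than the positive part, and it is at least \<open>q - p\<close> on the
  points with \<open>g < p\<close>.\<close>

lemma density_bad_negligible:
  fixes g :: "real \<Rightarrow> real"
  assumes g: "integrable lborel g" and q: "p < q"
  shows "negligible {x. - n < x \<and> x < n \<and> g x < p \<and>
     (\<forall>\<delta>>0. \<exists>u v. u \<le> x \<and> x \<le> v \<and> u < v \<and> v - u < \<delta> \<and> q * (v - u) < (LBINT y:{u..v}. g y))}"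
    (is "negligible ?E")
  unfolding negligible_outer_le
proof (intro allI impI)
  fix e :: real assume e: "e > 0"
  have [measurable]: "g \<in> borel_measurable borel" using g by auto
  \<comment> \<open>As \<open>ennreal\<close> truncates at 0, these densities are positive parts: of
    \<open>g - q\<close> for \<nu> and \<open>\<nu>1\<close>, of \<open>q - g\<close> for
    \<open>\<nu>2\<close>. Cutting off at \<open>n\<close> keeps \<nu> finite, so that outer
    regularity applies to \<nu> and \<open>E'\<close>, a \<nu>-null set.\<close>
  define \<nu> where "\<nu> = density lborel (\<lambda>x. ennreal ((g x - q) * indicator {- n<..<n} x))"
  define \<nu>1 where "\<nu>1 = density lborel (\<lambda>x. ennreal (g x - q))"
  define \<nu>2 where "\<nu>2 = density lborel (\<lambda>x. ennreal (q - g x))"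
  define E' where "E' = {x. g x < p}"
  have [measurable]: "E' \<in> sets borel" unfolding E'_def by measurable
  have "emeasure lborel {- n<..<n} < \<infinity>" by (cases "- n \<le> n") auto
  then have "integrable lborel (indicat_real {- n<..<n})" by (intro integrable_real_indicator) auto
  then have "integrable lborel (\<lambda>x. indicator {- n<..<n} x *\<^sub>R g x - q * indicator {- n<..<n} x)"
    using g by (intro Bochner_Integration.integrable_diff integrable_mult_indicator integrable_mult_right) auto
  then have "integrable lborel (\<lambda>x. (g x - q) * indicator {- n<..<n} x)"
    by (simp add: algebra_simps)
  then have "(\<integral>\<^sup>+x. ennreal ((g x - q) * indicator {- n<..<n} x) \<partial>lborel) < \<infinity>"
    using real_integrable_def by (metis infinity_ennreal_def less_top)
  then have fin: "emeasure \<nu> (space \<nu>) \<noteq> \<infinity>"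
    by (simp add: \<nu>_def emeasure_density)
  have "emeasure \<nu> E' = 0"
    unfolding \<nu>_def using q by (subst emeasure_density)
      (auto simp: E'_def nn_integral_0_iff_AE ennreal_neg mult_le_0_iff split: split_indicator intro!: AE_I2)
  moreover have "emeasure \<nu> E' = (INF U\<in>{U. E' \<subseteq> U \<and> open U}. emeasure \<nu> U)"
    by (rule outer_regular) (use fin in \<open>auto simp: \<nu>_def\<close>)
  ultimately have "(INF U\<in>{U. E' \<subseteq> U \<and> open U}. emeasure \<nu> U) < ennreal ((q - p) * e)"
    using e q by simp
  then obtain U where U: "E' \<subseteq> U" "open U" "emeasure \<nu> U < ennreal ((q - p) * e)"
    by (auto simp: INF_less_iff)
  define K where "K = {(u, v). u < v \<and> {u..v} \<subseteq> U \<inter> {- n<..<n} \<and> q * (v - u) < (LBINT y:{u..v}. g y)}"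
  define a where "a = (\<lambda>(u::real, v). (u + v) / 2)"
  define r where "r = (\<lambda>(u::real, v). (v - u) / 2)"
  have cb: "cball (a i) (r i) = {fst i..snd i}" for i
    by (cases i) (auto simp: a_def r_def cball_eq_atLeastAtMost field_simps)
  obtain C where C: "countable C" "C \<subseteq> K"
     "pairwise (\<lambda>i j. disjnt (cball (a i) (r i)) (cball (a j) (r j))) C"
     "negligible (?E - (\<Union>i \<in> C. cball (a i) (r i)))"
  proof (rule Vitali_covering_theorem_cballs[of K r ?E a])
    fix i assume "i \<in> K" then show "0 < r i" by (auto simp: K_def r_def)
  next
    fix x d assume x: "x \<in> ?E" and d: "(d::real) > 0"
    then have "x \<in> U \<inter> {- n<..<n}" using U by (auto simp: E'_def)
    then obtain d' where d': "d' > 0" "ball x d' \<subseteq> U \<inter> {- n<..<n}"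
      using \<open>open U\<close> by (meson open_Int open_contains_ball open_greaterThanLessThan)
    have "min d d' > 0" using d d' by simp
    then obtain u v where uv: "u \<le> x" "x \<le> v" "u < v" "v - u < min d d'" "q * (v - u) < (LBINT y:{u..v}. g y)"
      using x by blast
    have "{u..v} \<subseteq> ball x d'" using uv by (auto simp: dist_real_def)
    then have "(u, v) \<in> K" using uv d' by (auto simp: K_def)
    moreover have "x \<in> cball (a (u, v)) (r (u, v))" using uv cb[of "(u, v)"] by simp
    moreover have "r (u, v) < d" using uv by (simp add: r_def)
    ultimately show "\<exists>i. i \<in> K \<and> x \<in> cball (a i) (r i) \<and> r i < d" by blast
  qed blast
  define W where "W = (\<Union>i\<in>C. {fst i..snd i})"
  have [measurable]: "W \<in> sets borel" unfolding W_def using C(1) by auto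
  have WU: "W \<subseteq> U \<inter> {- n<..<n}" using C(2) unfolding W_def K_def by fastforce
  have disj: "disjoint_family_on (\<lambda>i. {fst i..snd i}) C"
    using C(3) unfolding cb by (auto simp: disjoint_family_on_def pairwise_def disjnt_def)
  have le: "emeasure \<nu>2 {fst i..snd i} \<le> emeasure \<nu>1 {fst i..snd i}" if "i \<in> C" for i
  proof -
    obtain u v where i: "i = (u, v)" by (cases i)
    have uv: "u < v" "q * (v - u) < (LBINT y:{u..v}. g y)" using that C(2) i by (auto simp: K_def)
    define h where "h = (\<lambda>x. (g x - q) * indicator {u..v} x)"
    have gi: "integrable lborel (\<lambda>x. indicator {u..v} x *\<^sub>R g x)" using g by (intro integrable_mult_indicator) auto
    have ii: "integrable lborel (\<lambda>x. q * indicator {u..v} x)"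
      using uv by (intro integrable_mult_right integrable_real_indicator) auto
    have heq: "h = (\<lambda>x. indicator {u..v} x *\<^sub>R g x - q * indicator {u..v} x)"
      by (auto simp: h_def algebra_simps)
    have h: "integrable lborel h" unfolding heq by (intro Bochner_Integration.integrable_diff gi ii)
    have "(\<integral>x. h x \<partial>lborel) = (LBINT y:{u..v}. g y) - q * (v - u)"
      unfolding heq using uv by (subst Bochner_Integration.integral_diff[OF gi ii]) (simp add: set_lebesgue_integral_def)
    then have pos: "(\<integral>x. h x \<partial>lborel) > 0" using uv by simp
    have e1: "emeasure \<nu>1 {u..v} = (\<integral>\<^sup>+x. ennreal (h x) \<partial>lborel)"
      unfolding \<nu>1_def by (subst emeasure_density) (auto simp: h_def intro!: nn_integral_cong split: split_indicator)
    have e2: "emeasure \<nu>2 {u..v} = (\<integral>\<^sup>+x. ennreal (- h x) \<partial>lborel)"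
      unfolding \<nu>2_def by (subst emeasure_density) (auto simp: h_def intro!: nn_integral_cong split: split_indicator)
    have f1: "(\<integral>\<^sup>+x. ennreal (h x) \<partial>lborel) < top" "(\<integral>\<^sup>+x. ennreal (- h x) \<partial>lborel) < top"
      using h unfolding real_integrable_def by (auto simp: less_top)
    have "enn2real (\<integral>\<^sup>+x. ennreal (- h x) \<partial>lborel) < enn2real (\<integral>\<^sup>+x. ennreal (h x) \<partial>lborel)"
      using pos real_lebesgue_integral_def[OF h] by simp
    then show ?thesis using i e1 e2 f1 by (simp add: enn2real_less_iff less_imp_le)
  qed
  have WE: "emeasure lborel (W \<inter> E') \<le> ennreal e"
  proof -
    have "ennreal (q - p) * emeasure lborel (W \<inter> E') = (\<integral>\<^sup>+x. ennreal (q - p) * indicator (W \<inter> E') x \<partial>lborel)"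
      by (simp add: nn_integral_cmult_indicator)
    also have "\<dots> \<le> (\<integral>\<^sup>+x. ennreal (q - g x) * indicator W x \<partial>lborel)"
      using q by (intro nn_integral_mono) (auto split: split_indicator simp: E'_def intro!: ennreal_leI)
    also have "\<dots> = emeasure \<nu>2 W" by (simp add: \<nu>2_def emeasure_density)
    also have "\<dots> = (\<integral>\<^sup>+i. emeasure \<nu>2 {fst i..snd i} \<partial>count_space C)"
      unfolding W_def using C(1) disj by (intro emeasure_UN_countable) (auto simp: \<nu>2_def)
    also have "\<dots> \<le> (\<integral>\<^sup>+i. emeasure \<nu>1 {fst i..snd i} \<partial>count_space C)"
      using le by (intro nn_integral_mono) auto
    also have "\<dots> = emeasure \<nu>1 W"
      unfolding W_def using C(1) disj by (intro emeasure_UN_countable[symmetric]) (auto simp: \<nu>1_def)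
    also have "\<dots> = (\<integral>\<^sup>+x. ennreal (g x - q) * indicator W x \<partial>lborel)" by (simp add: \<nu>1_def emeasure_density)
    also have "\<dots> \<le> (\<integral>\<^sup>+x. ennreal ((g x - q) * indicator {- n<..<n} x) * indicator U x \<partial>lborel)"
      using WU by (intro nn_integral_mono) (auto split: split_indicator)
    also have "\<dots> = emeasure \<nu> U" using \<open>open U\<close> by (simp add: \<nu>_def emeasure_density)
    also have "\<dots> \<le> ennreal (q - p) * ennreal e" using U q e by (simp add: ennreal_mult less_imp_le)
    finally show ?thesis using q by (subst (asm) ennreal_mult_le_mult_iff) (auto simp: )
  qed
  have "emeasure lborel (W \<inter> E') < \<infinity>" using WE by (simp add: le_less_trans)
  then have lm: "W \<inter> E' \<in> lmeasurable" by (auto simp: fmeasurable_def)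
  have "measure lebesgue (W \<inter> E') \<le> e"
    using WE e by (simp add: measure_def enn2real_leI)
  moreover have neg: "negligible (?E - W)" using C(4) unfolding cb W_def .
  moreover have "measure lebesgue ((W \<inter> E') \<union> (?E - W)) \<le> measure lebesgue (W \<inter> E') + measure lebesgue (?E - W)"
    using lm neg by (intro measure_Un_le) (auto simp: negligible_imp_sets)
  ultimately have "measure lebesgue ((W \<inter> E') \<union> (?E - W)) \<le> e" by (simp add: negligible_imp_measure0)
  moreover have "(W \<inter> E') \<union> (?E - W) \<in> lmeasurable" using lm neg by (rule fmeasurable.Un[OF _ negligible_imp_measurable])
  moreover have "?E \<subseteq> (W \<inter> E') \<union> (?E - W)" by (auto simp: E'_def)
  ultimately show "\<exists>T. ?E \<subseteq> T \<and> T \<in> lmeasurable \<and> measure lebesgue T \<le> e"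
    by (intro exI[of _ "(W \<inter> E') \<union> (?E - W)"] conjI)
qed

text \<open>Every violation at \<open>x\<close> fits rationals with
  \<open>g x < p < q < g x + e\<close> and a bound \<open>n\<close> on the modulus of
  \<open>x\<close>, so countably many bad sets cover all of them.\<close>

lemma lebesgue_density_upper:
  fixes g :: "real \<Rightarrow> real"
  assumes g: "integrable lborel g"
  shows "AE x in lborel. \<forall>e>0. \<exists>\<delta>>0. \<forall>u v. u \<le> x \<and> x \<le> v \<and> u < v \<and> v - u < \<delta> \<longrightarrow>
           (LBINT y:{u..v}. g y) \<le> (g x + e) * (v - u)"
proof -
  define E where "E = (\<lambda>n p q. {x. - n < x \<and> x < n \<and> g x < p \<and>
     (\<forall>\<delta>>0. \<exists>u v. u \<le> x \<and> x \<le> v \<and> u < v \<and> v - u < \<delta> \<and> q * (v - u) < (LBINT y:{u..v}. g y))})"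
  have "AE x in lborel. \<forall>n::nat. \<forall>p\<in>\<rat>. \<forall>q\<in>\<rat>. p < q \<longrightarrow> x \<notin> E n p q"
    unfolding AE_all_countable
    using negligible_AE_lborel[OF density_bad_negligible[OF g]] unfolding E_def
    by (intro allI AE_ball_countable' AE_impI) (auto simp: countable_rat)
  then show ?thesis
  proof eventually_elim
    case (elim x)
    show ?case
    proof (intro allI impI)
      fix e :: real assume e: "e > 0"
      obtain p where p: "p \<in> \<rat>" "g x < p" "p < g x + e" using Rats_dense_in_real[of "g x" "g x + e"] e by auto
      obtain q where q: "q \<in> \<rat>" "p < q" "q < g x + e" using Rats_dense_in_real[of p "g x + e"] p by auto
      obtain n :: nat where n: "\<bar>x\<bar> < real n" using reals_Archimedean2 by blast
      have "x \<notin> E n p q" using elim p q by blast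
      then obtain \<delta> where \<delta>: "\<delta> > 0" "\<And>u v. u \<le> x \<Longrightarrow> x \<le> v \<Longrightarrow> u < v \<Longrightarrow> v - u < \<delta> \<Longrightarrow> (LBINT y:{u..v}. g y) \<le> q * (v - u)"
        using p n unfolding E_def abs_less_iff mem_Collect_eq by (metis minus_less_iff not_less)
      show "\<exists>\<delta>>0. \<forall>u v. u \<le> x \<and> x \<le> v \<and> u < v \<and> v - u < \<delta> \<longrightarrow> (LBINT y:{u..v}. g y) \<le> (g x + e) * (v - u)"
      proof (intro exI[of _ \<delta>] conjI allI impI)
        fix u v assume uv: "u \<le> x \<and> x \<le> v \<and> u < v \<and> v - u < \<delta>"
        then have "(LBINT y:{u..v}. g y) \<le> q * (v - u)" using \<delta>(2) by blast
        also have "\<dots> \<le> (g x + e) * (v - u)" using q uv by (intro mult_right_mono) auto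
        finally show "(LBINT y:{u..v}. g y) \<le> (g x + e) * (v - u)" .
      qed (rule \<delta>)
    qed
  qed
qed

text \<open>The upper bound for \<open>g\<close> and for \<open>- g\<close>. The intervals have to
  contain \<open>x\<close> but need not be centred at it, so difference quotients from either side
  are covered.\<close>

theorem lebesgue_density:
  fixes g :: "real \<Rightarrow> real"
  assumes g: "integrable lborel g"
  shows "AE x in lborel. \<forall>e>0. \<exists>\<delta>>0. \<forall>u v. u \<le> x \<and> x \<le> v \<and> u < v \<and> v - u < \<delta> \<longrightarrow>
           \<bar>(LBINT y:{u..v}. g y) - g x * (v - u)\<bar> \<le> e * (v - u)"
proof -
  have "integrable lborel (\<lambda>x. - g x)" using g by simp
  from lebesgue_density_upper[OF this] lebesgue_density_upper[OF g] show ?thesis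
  proof eventually_elim
    case (elim x)
    have neg: "(LBINT y:{u..v}. - g y) = - (LBINT y:{u..v}. g y)" for u v
      by (simp add: set_lebesgue_integral_def)
    show ?case
    proof (intro allI impI)
      fix e :: real assume e: "e > 0"
      obtain d1 where d1: "d1 > 0" "\<forall>u v. u \<le> x \<and> x \<le> v \<and> u < v \<and> v - u < d1 \<longrightarrow>
          - (LBINT y:{u..v}. g y) \<le> (- g x + e) * (v - u)"
        using elim(1)[rule_format, OF e] unfolding neg by blast
      obtain d2 where d2: "d2 > 0" "\<forall>u v. u \<le> x \<and> x \<le> v \<and> u < v \<and> v - u < d2 \<longrightarrow>
          (LBINT y:{u..v}. g y) \<le> (g x + e) * (v - u)"
        using elim(2)[rule_format, OF e] by blast
      show "\<exists>\<delta>>0. \<forall>u v. u \<le> x \<and> x \<le> v \<and> u < v \<and> v - u < \<delta> \<longrightarrow>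
           \<bar>(LBINT y:{u..v}. g y) - g x * (v - u)\<bar> \<le> e * (v - u)"
      proof (intro exI[of _ "min d1 d2"] conjI allI impI)
        fix u v assume uv: "u \<le> x \<and> x \<le> v \<and> u < v \<and> v - u < min d1 d2"
        have "- (LBINT y:{u..v}. g y) \<le> (- g x + e) * (v - u)" "(LBINT y:{u..v}. g y) \<le> (g x + e) * (v - u)"
          using d1(2) d2(2) uv by auto
        then show "\<bar>(LBINT y:{u..v}. g y) - g x * (v - u)\<bar> \<le> e * (v - u)"
          unfolding abs_le_iff by (simp add: algebra_simps)
      qed (use d1 d2 in auto)
    qed
  qed
qed

section \<open>Absolutely continuous functions\<close>

text \<open>Unlike the families in \<open>ac_on\<close>, these contain no degenerate intervals.
  Strictness makes left end points pairwise distinct, and right end points too, so that cutting a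
  family at a point is injective.\<close>

definition nonoverlapping :: "real \<Rightarrow> real \<Rightarrow> (real \<times> real) set \<Rightarrow> bool" where
  "nonoverlapping c d D \<longleftrightarrow> finite D \<and> (\<forall>i\<in>D. c \<le> fst i \<and> fst i < snd i \<and> snd i \<le> d) \<and>
     disjoint_family_on (\<lambda>i. {fst i<..<snd i}) D"

text \<open>The increments are signed, so the supremum over all families is a positive variation;
  for \<open>id\<close> the sum is the total length.\<close>

definition incr :: "(real \<Rightarrow> real) \<Rightarrow> (real \<times> real) set \<Rightarrow> real" where
  "incr f D = (\<Sum>i\<in>D. f (snd i) - f (fst i))"

lemma nonoverlapping_overlap:
  assumes "nonoverlapping c d D" "i \<in> D" "j \<in> D" "max (fst i) (fst j) < min (snd i) (snd j)"
  shows "i = j"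
proof (rule ccontr)
  assume "i \<noteq> j"
  then have "{fst i<..<snd i} \<inter> {fst j<..<snd j} = {}"
    using assms by (auto simp: nonoverlapping_def disjoint_family_on_def)
  moreover obtain x where "max (fst i) (fst j) < x" "x < min (snd i) (snd j)" using dense[OF assms(4)] by blast
  ultimately show False by auto
qed

lemma nonoverlapping_inj_fst: "nonoverlapping c d D \<Longrightarrow> inj_on fst D"
  by (rule inj_onI) (rule nonoverlapping_overlap, auto simp: nonoverlapping_def)

lemma nonoverlapping_inj_snd: "nonoverlapping c d D \<Longrightarrow> inj_on snd D"
  by (rule inj_onI) (rule nonoverlapping_overlap, auto simp: nonoverlapping_def)

lemma nonoverlappingI:
  assumes "finite D" "\<And>i. i \<in> D \<Longrightarrow> c \<le> fst i \<and> fst i < snd i \<and> snd i \<le> d"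
    "\<And>i j. i \<in> D \<Longrightarrow> j \<in> D \<Longrightarrow> max (fst i) (fst j) < min (snd i) (snd j) \<Longrightarrow> i = j"
  shows "nonoverlapping c d D"
  unfolding nonoverlapping_def disjoint_family_on_def
proof (intro conjI ballI impI)
  fix i j assume ij: "i \<in> D" "j \<in> D" "i \<noteq> j"
  show "{fst i<..<snd i} \<inter> {fst j<..<snd j} = {}"
  proof (rule ccontr)
    assume "\<not> ?thesis"
    then have "max (fst i) (fst j) < min (snd i) (snd j)" by (simp add: not_le)
    then show False using assms(3)[of i j] ij by blast
  qed
qed (use assms in auto)

lemma nonoverlapping_mono: "nonoverlapping u v D \<Longrightarrow> c \<le> u \<Longrightarrow> v \<le> d \<Longrightarrow> nonoverlapping c d D"
  by (fastforce simp: nonoverlapping_def)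

lemma incr_id_le_emeasure:
  assumes D: "nonoverlapping c d D" and U: "U \<in> sets borel" "(\<Union>i\<in>D. {fst i<..<snd i}) \<subseteq> U"
  shows "ennreal (incr id D) \<le> emeasure lborel U"
proof -
  have "ennreal (incr id D) = (\<Sum>i\<in>D. emeasure lborel {fst i<..<snd i})"
    unfolding incr_def using D by (subst sum_ennreal[symmetric]) (auto simp: nonoverlapping_def less_imp_le)
  also have "\<dots> = emeasure lborel (\<Union>i\<in>D. {fst i<..<snd i})"
    using D by (intro sum_emeasure) (auto simp: nonoverlapping_def)
  also have "\<dots> \<le> emeasure lborel U" using U by (intro emeasure_mono) auto
  finally show ?thesis .
qed

lemma incr_id_le: assumes D: "nonoverlapping c d D" and "c \<le> d" shows "incr id D \<le> d - c"
proof -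
  have "ennreal (incr id D) \<le> emeasure lborel {c..d}"
    using D by (intro incr_id_le_emeasure[OF D]) (fastforce simp: nonoverlapping_def)+
  then show ?thesis using assms by (simp add: ennreal_le_iff)
qed

lemma ac_on_iff:
  "ac_on {c..d} f \<longleftrightarrow> (\<forall>\<epsilon>>0. \<exists>\<delta>>0. \<forall>D. nonoverlapping c d D \<and> incr id D < \<delta> \<longrightarrow>
      (\<Sum>i\<in>D. \<bar>f (snd i) - f (fst i)\<bar>) < \<epsilon>)" (is "?L \<longleftrightarrow> ?R")
proof
  assume L: ?L
  show ?R
  proof (intro allI impI)
    fix \<epsilon> :: real assume "\<epsilon> > 0"
    with L obtain \<delta> where \<delta>: "\<delta> > 0" "\<And>D. finite D \<Longrightarrow>
      (\<forall>(c', d')\<in>D. c' \<le> d' \<and> {c'..d'} \<subseteq> {c..d}) \<Longrightarrow>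
      pairwise (\<lambda>(c, d) (c', d'). disjnt {c<..<d} {c'<..<d'}) D \<Longrightarrow>
      (\<Sum>(c, d)\<in>D. d - c) < \<delta> \<Longrightarrow> (\<Sum>(c, d)\<in>D. \<bar>f d - f c\<bar>) < \<epsilon>"
      unfolding ac_on_def by meson
    show "\<exists>\<delta>>0. \<forall>D. nonoverlapping c d D \<and> incr id D < \<delta> \<longrightarrow> (\<Sum>i\<in>D. \<bar>f (snd i) - f (fst i)\<bar>) < \<epsilon>"
    proof (intro exI[of _ \<delta>] conjI allI impI)
      fix D assume D: "nonoverlapping c d D \<and> incr id D < \<delta>"
      have "(\<Sum>(c, d)\<in>D. \<bar>f d - f c\<bar>) < \<epsilon>"
      proof (rule \<delta>(2))
        show "\<forall>(c', d')\<in>D. c' \<le> d' \<and> {c'..d'} \<subseteq> {c..d}"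
          using D by (fastforce simp: nonoverlapping_def)
        show "pairwise (\<lambda>(c, d) (c', d'). disjnt {c<..<d} {c'<..<d'}) D"
          using D unfolding nonoverlapping_def pairwise_def disjoint_family_on_def disjnt_def case_prod_beta by blast
      qed (use D in \<open>auto simp: nonoverlapping_def incr_def case_prod_beta'\<close>)
      then show "(\<Sum>i\<in>D. \<bar>f (snd i) - f (fst i)\<bar>) < \<epsilon>" by (simp add: case_prod_beta')
    qed (rule \<delta>)
  qed
next
  assume R: ?R
  show ?L unfolding ac_on_def
  proof (intro allI impI)
    fix \<epsilon> :: real assume \<epsilon>: "\<epsilon> > 0"
    obtain \<delta> where \<delta>: "\<delta> > 0" "\<And>D. nonoverlapping c d D \<Longrightarrow> incr id D < \<delta> \<Longrightarrow>
      (\<Sum>i\<in>D. \<bar>f (snd i) - f (fst i)\<bar>) < \<epsilon>"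
      using R[rule_format, OF \<epsilon>] by blast
    show "\<exists>\<delta>>0. \<forall>D. finite D \<and> (\<forall>(c', d')\<in>D. c' \<le> d' \<and> {c'..d'} \<subseteq> {c..d}) \<and>
      pairwise (\<lambda>(c, d) (c', d'). disjnt {c<..<d} {c'<..<d'}) D \<and>
      (\<Sum>(c, d)\<in>D. d - c) < \<delta> \<longrightarrow> (\<Sum>(c, d)\<in>D. \<bar>f d - f c\<bar>) < \<epsilon>"
    proof (intro exI[of _ \<delta>] conjI allI impI)
      fix D assume D: "finite D \<and> (\<forall>(c', d')\<in>D. c' \<le> d' \<and> {c'..d'} \<subseteq> {c..d}) \<and>
        pairwise (\<lambda>(c, d) (c', d'). disjnt {c<..<d} {c'<..<d'}) D \<and> (\<Sum>(c, d)\<in>D. d - c) < \<delta>"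
      \<comment> \<open>Degenerate intervals contribute 0 to either sum, so discarding them changes
        neither.\<close>
      define D' where "D' = {i\<in>D. fst i < snd i}"
      have fin: "finite D" and Dle: "\<And>i. i \<in> D \<Longrightarrow> fst i \<le> snd i \<and> {fst i..snd i} \<subseteq> {c..d}"
        and Ddisj: "\<And>i j. i \<in> D \<Longrightarrow> j \<in> D \<Longrightarrow> i \<noteq> j \<Longrightarrow> {fst i<..<snd i} \<inter> {fst j<..<snd j} = {}"
        using D unfolding pairwise_def disjnt_def case_prod_beta by blast+
      have *: "(\<Sum>i\<in>D'. \<bar>h (snd i) - h (fst i)\<bar>) = (\<Sum>i\<in>D. \<bar>h (snd i) - h (fst i)\<bar>)" for h :: "real \<Rightarrow> real"
      proof (rule sum.mono_neutral_left[OF fin])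
        show "\<forall>i\<in>D - D'. \<bar>h (snd i) - h (fst i)\<bar> = 0"
        proof
          fix i assume "i \<in> D - D'"
          then have "fst i = snd i" using Dle[of i] by (auto simp: D'_def)
          then show "\<bar>h (snd i) - h (fst i)\<bar> = 0" by simp
        qed
      qed (simp add: D'_def)
      have "incr id D' = (\<Sum>i\<in>D'. \<bar>id (snd i) - id (fst i)\<bar>)"
        unfolding incr_def by (intro sum.cong) (auto simp: D'_def)
      also have "\<dots> = (\<Sum>(c, d)\<in>D. d - c)" unfolding * using Dle by (intro sum.cong) (auto simp: case_prod_beta')
      finally have "incr id D' < \<delta>" using D by simp
      moreover have "nonoverlapping c d D'"
        unfolding nonoverlapping_def disjoint_family_on_def
      proof (intro conjI ballI impI)
        fix i assume "i \<in> D'"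
        then have "i \<in> D" "fst i < snd i" by (auto simp: D'_def)
        with Dle[of i] show "c \<le> fst i" "fst i < snd i" "snd i \<le> d" by auto
      next
        fix i j assume "i \<in> D'" "j \<in> D'" "i \<noteq> j"
        then show "{fst i<..<snd i} \<inter> {fst j<..<snd j} = {}" by (intro Ddisj) (auto simp: D'_def)
      qed (use fin in \<open>simp add: D'_def\<close>)
      ultimately show "(\<Sum>(c, d)\<in>D. \<bar>f d - f c\<bar>) < \<epsilon>" using \<delta>(2)[of D'] *[of f] by (simp add: case_prod_beta')
    qed (rule \<delta>)
  qed
qed

text \<open>An interval straddling \<open>e\<close> is cut into two pieces whose increments add up;
  every other interval goes to one side unchanged.\<close>

lemma nonoverlapping_split:
  assumes D: "nonoverlapping c d D" and e: "c \<le> e" "e \<le> d"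
  obtains D1 D2 where "nonoverlapping c e D1" "nonoverlapping e d D2" "\<And>f. incr f D = incr f D1 + incr f D2"
proof -
  have fin: "finite D" and D': "\<And>i. i \<in> D \<Longrightarrow> c \<le> fst i \<and> fst i < snd i \<and> snd i \<le> d"
    using D by (auto simp: nonoverlapping_def)
  define A where "A = {i\<in>D. fst i < e}"
  define B where "B = {i\<in>D. e < snd i}"
  define D1 where "D1 = (\<lambda>i. (fst i, min (snd i) e)) ` A"
  define D2 where "D2 = (\<lambda>i. (max (fst i) e, snd i)) ` B"
  have i1: "inj_on (\<lambda>i. (fst i, min (snd i) e)) A"
    using nonoverlapping_inj_fst[OF D] by (auto simp: A_def inj_on_def)
  have i2: "inj_on (\<lambda>i. (max (fst i) e, snd i)) B"
    using nonoverlapping_inj_snd[OF D] by (auto simp: B_def inj_on_def)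
  show ?thesis
  proof (rule that[of D1 D2])
    show "nonoverlapping c e D1"
    proof (rule nonoverlappingI)
      fix i j assume "i \<in> D1" "j \<in> D1" and ov: "max (fst i) (fst j) < min (snd i) (snd j)"
      then obtain i' j' where ij: "i' \<in> A" "j' \<in> A" "i = (fst i', min (snd i') e)" "j = (fst j', min (snd j') e)"
        by (auto simp: D1_def)
      then have "i' = j'" using ov by (intro nonoverlapping_overlap[OF D]) (auto simp: A_def)
      then show "i = j" using ij by simp
    qed (use fin D' in \<open>auto simp: D1_def A_def\<close>)
    show "nonoverlapping e d D2"
    proof (rule nonoverlappingI)
      fix i j assume "i \<in> D2" "j \<in> D2" and ov: "max (fst i) (fst j) < min (snd i) (snd j)"
      then obtain i' j' where ij: "i' \<in> B" "j' \<in> B" "i = (max (fst i') e, snd i')" "j = (max (fst j') e, snd j')"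
        by (auto simp: D2_def)
      then have "i' = j'" using ov by (intro nonoverlapping_overlap[OF D]) (auto simp: B_def)
      then show "i = j" using ij by simp
    qed (use fin D' in \<open>auto simp: D2_def B_def\<close>)
    fix f :: "real \<Rightarrow> real"
    have "incr f D1 = (\<Sum>i\<in>D. if fst i < e then f (min (snd i) e) - f (fst i) else 0)"
      unfolding incr_def D1_def sum.reindex[OF i1] using fin by (simp add: A_def sum.inter_filter o_def)
    moreover have "incr f D2 = (\<Sum>i\<in>D. if e < snd i then f (snd i) - f (max (fst i) e) else 0)"
      unfolding incr_def D2_def sum.reindex[OF i2] using fin by (simp add: B_def sum.inter_filter o_def)
    moreover have "incr f D = (\<Sum>i\<in>D. (if fst i < e then f (min (snd i) e) - f (fst i) else 0) +
        (if e < snd i then f (snd i) - f (max (fst i) e) else 0))"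
      unfolding incr_def using D' by (intro sum.cong) (auto simp: min_def max_def dest: D')
    ultimately show "incr f D = incr f D1 + incr f D2" by (simp add: sum.distrib)
  qed
qed

text \<open>Intervals from the refinements of two different members cannot overlap, since the
  members themselves would. This allows an optimal family to be chosen separately inside each
  interval.\<close>

lemma nonoverlapping_UN:
  assumes D: "nonoverlapping c d D" and E: "\<And>i. i \<in> D \<Longrightarrow> nonoverlapping (fst i) (snd i) (E i)"
  shows "nonoverlapping c d (\<Union>i\<in>D. E i)" "incr f (\<Union>i\<in>D. E i) = (\<Sum>i\<in>D. incr f (E i))"
proof -
  have fin: "finite D" and D': "\<And>i. i \<in> D \<Longrightarrow> c \<le> fst i \<and> fst i < snd i \<and> snd i \<le> d"
    using D by (auto simp: nonoverlapping_def)
  have fE: "finite (E i)" if "i \<in> D" for i using E[OF that] by (simp add: nonoverlapping_def)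
  have E': "fst i \<le> fst x \<and> fst x < snd x \<and> snd x \<le> snd i" if "i \<in> D" "x \<in> E i" for i x
    using E[OF that(1)] that(2) by (auto simp: nonoverlapping_def)
  have same: "i = j" if "i \<in> D" "j \<in> D" "x \<in> E i" "y \<in> E j" "max (fst x) (fst y) < min (snd x) (snd y)" for i j x y
    using E'[OF that(1,3)] E'[OF that(2,4)] that by (intro nonoverlapping_overlap[OF D]) auto
  show "nonoverlapping c d (\<Union>i\<in>D. E i)"
  proof (rule nonoverlappingI)
    fix x y assume "x \<in> (\<Union>i\<in>D. E i)" "y \<in> (\<Union>i\<in>D. E i)" and ov: "max (fst x) (fst y) < min (snd x) (snd y)"
    then obtain i j where ij: "i \<in> D" "j \<in> D" "x \<in> E i" "y \<in> E j" by blast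
    with same[OF this ov] show "x = y" using nonoverlapping_overlap[OF E[OF ij(1)], of x y] ov by simp
  next
    fix x assume "x \<in> (\<Union>i\<in>D. E i)"
    then obtain i where i: "i \<in> D" "x \<in> E i" by blast
    show "c \<le> fst x \<and> fst x < snd x \<and> snd x \<le> d" using D'[OF i(1)] E'[OF i] by auto
  qed (use fin fE in auto)
  show "incr f (\<Union>i\<in>D. E i) = (\<Sum>i\<in>D. incr f (E i))"
    unfolding incr_def
  proof (rule sum.UNION_disjoint)
    show "\<forall>i\<in>D. \<forall>j\<in>D. i \<noteq> j \<longrightarrow> E i \<inter> E j = {}"
    proof (intro ballI impI, rule ccontr)
      fix i j assume ij: "i \<in> D" "j \<in> D" "i \<noteq> j" "E i \<inter> E j \<noteq> {}"
      then obtain x where "x \<in> E i" "x \<in> E j" by blast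
      then show False using same[of i j x x] E'[of i x] ij by auto
    qed
  qed (use fin fE in auto)
qed

text \<open>The positive variation of \<open>f\<close>; a real supremum, hence meaningful only together with a bound.\<close>

definition pos_var :: "(real \<Rightarrow> real) \<Rightarrow> real \<Rightarrow> real \<Rightarrow> real" where
  "pos_var f c d = (SUP D\<in>Collect (nonoverlapping c d). incr f D)"

definition finite_var :: "(real \<Rightarrow> real) \<Rightarrow> real \<Rightarrow> real \<Rightarrow> bool" where
  "finite_var f c d \<longleftrightarrow> bdd_above (incr f ` Collect (nonoverlapping c d))"

lemma finite_var_mono: "finite_var f c d \<Longrightarrow> c \<le> u \<Longrightarrow> v \<le> d \<Longrightarrow> finite_var f u v"
  unfolding finite_var_def by (erule bdd_above_mono) (auto intro: nonoverlapping_mono)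

lemma nonoverlapping_empty [simp]: "nonoverlapping c d {}"
  by (simp add: nonoverlapping_def disjoint_family_on_def)

lemma incr_empty [simp]: "incr f {} = 0"
  by (simp add: incr_def)

lemma incr_le_pos_var: "finite_var f c d \<Longrightarrow> nonoverlapping c d D \<Longrightarrow> incr f D \<le> pos_var f c d"
  unfolding pos_var_def finite_var_def by (intro cSUP_upper) auto

lemma pos_var_nonneg: "finite_var f c d \<Longrightarrow> 0 \<le> pos_var f c d"
  using incr_le_pos_var[of f c d "{}"] by simp

lemma pos_var_ge: assumes "finite_var f c d" "c \<le> d" shows "f d - f c \<le> pos_var f c d"
proof (cases "c = d")
  case False
  then have "nonoverlapping c d {(c, d)}" using assms by (auto intro!: nonoverlappingI)
  from incr_le_pos_var[OF assms(1) this] show ?thesis by (simp add: incr_def)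
qed (use pos_var_nonneg assms in auto)

lemma finite_var_join: assumes "finite_var f c e" "finite_var f e d" "c \<le> e" "e \<le> d" shows "finite_var f c d"
proof -
  have "incr f D \<le> pos_var f c e + pos_var f e d" if "nonoverlapping c d D" for D
  proof -
    obtain D1 D2 where "nonoverlapping c e D1" "nonoverlapping e d D2" "\<And>f. incr f D = incr f D1 + incr f D2"
      using nonoverlapping_split[OF \<open>nonoverlapping c d D\<close> assms(3,4)] by blast
    then show ?thesis using incr_le_pos_var[OF assms(1)] incr_le_pos_var[OF assms(2)] by (auto intro: add_mono)
  qed
  then show ?thesis by (auto simp: finite_var_def intro!: bdd_aboveI)
qed

lemma pos_var_add:
  assumes fv: "finite_var f c d" and e: "c \<le> e" "e \<le> d"
  shows "pos_var f c d = pos_var f c e + pos_var f e d"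
proof (rule antisym)
  note fv1 = finite_var_mono[OF fv order_refl e(2)] and fv2 = finite_var_mono[OF fv e(1) order_refl]
  show "pos_var f c d \<le> pos_var f c e + pos_var f e d"
    unfolding pos_var_def[of f c d]
  proof (rule cSUP_least)
    fix D assume "D \<in> Collect (nonoverlapping c d)"
    then obtain D1 D2 where "nonoverlapping c e D1" "nonoverlapping e d D2" "\<And>f. incr f D = incr f D1 + incr f D2"
      using nonoverlapping_split[of c d D, OF _ e] by blast
    then show "incr f D \<le> pos_var f c e + pos_var f e d"
      using incr_le_pos_var[OF fv1] incr_le_pos_var[OF fv2] by (auto intro: add_mono)
  qed (auto intro: exI[of _ "{}"])
  have *: "incr f D1 + incr f D2 \<le> pos_var f c d" if D: "nonoverlapping c e D1" "nonoverlapping e d D2" for D1 D2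
  proof -
    have D': "c \<le> fst i \<and> fst i < snd i \<and> snd i \<le> e" if "i \<in> D1" for i
      using D that by (auto simp: nonoverlapping_def)
    have D'': "e \<le> fst i \<and> fst i < snd i \<and> snd i \<le> d" if "i \<in> D2" for i
      using D that by (auto simp: nonoverlapping_def)
    have disj: "D1 \<inter> D2 = {}" using D' D'' by fastforce
    have "nonoverlapping c d (D1 \<union> D2)"
    proof (rule nonoverlappingI)
      fix i j assume ij: "i \<in> D1 \<union> D2" "j \<in> D1 \<union> D2" "max (fst i) (fst j) < min (snd i) (snd j)"
      then have "(i \<in> D1 \<and> j \<in> D1) \<or> (i \<in> D2 \<and> j \<in> D2)" using D'[of i] D'[of j] D''[of i] D''[of j] by auto
      then show "i = j" using nonoverlapping_overlap[OF D(1) _ _ ij(3)] nonoverlapping_overlap[OF D(2) _ _ ij(3)] by blast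
    next
      fix i assume "i \<in> D1 \<union> D2"
      then show "c \<le> fst i \<and> fst i < snd i \<and> snd i \<le> d" using D'[of i] D''[of i] e by auto
    qed (use D in \<open>auto simp: nonoverlapping_def\<close>)
    from incr_le_pos_var[OF fv this] show ?thesis
      unfolding incr_def using D disj by (subst (asm) sum.union_disjoint) (auto simp: nonoverlapping_def)
  qed
  \<comment> \<open>The two suprema are taken one after the other, with the other family held
    fixed.\<close>
  have "pos_var f c e \<le> pos_var f c d - incr f D2" if "nonoverlapping e d D2" for D2
    unfolding pos_var_def[of f c e] using *[OF _ that] by (intro cSUP_least) (auto intro: exI[of _ "{}"] simp: le_diff_eq)
  then have "pos_var f e d \<le> pos_var f c d - pos_var f c e"
    unfolding pos_var_def[of f e d] by (intro cSUP_least) (auto intro: exI[of _ "{}"] simp: le_diff_eq add.commute)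
  then show "pos_var f c e + pos_var f e d \<le> pos_var f c d" by simp
qed

text \<open>On an interval shorter than the \<delta> belonging to \<epsilon> = 1 every family has
  increment at most 1. Finitely many steps of length \<open>\<delta> / 2\<close>, strictly below
  \<delta>, reach \<open>d\<close>.\<close>

lemma ac_on_finite_var:
  assumes ac: "ac_on {c..d} f" and "c \<le> d" shows "finite_var f c d"
proof -
  obtain \<delta> where \<delta>: "\<delta> > 0" "\<And>D. nonoverlapping c d D \<Longrightarrow> incr id D < \<delta> \<Longrightarrow>
      (\<Sum>i\<in>D. \<bar>f (snd i) - f (fst i)\<bar>) < 1"
    using ac[unfolded ac_on_iff, rule_format, OF zero_less_one] by blast
  have short: "finite_var f u v" if "c \<le> u" "u \<le> v" "v \<le> d" "v - u < \<delta>" for u v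
  proof -
    have "incr f D \<le> 1" if D: "nonoverlapping u v D" for D
    proof -
      have "incr id D < \<delta>" using incr_id_le[OF D] \<open>u \<le> v\<close> \<open>v - u < \<delta>\<close> by simp
      then have "(\<Sum>i\<in>D. \<bar>f (snd i) - f (fst i)\<bar>) < 1"
        using \<delta>(2)[OF nonoverlapping_mono[OF D]] \<open>c \<le> u\<close> \<open>v \<le> d\<close> by simp
      moreover have "incr f D \<le> (\<Sum>i\<in>D. \<bar>f (snd i) - f (fst i)\<bar>)" unfolding incr_def by (intro sum_mono) simp
      ultimately show ?thesis by simp
    qed
    then show ?thesis by (auto simp: finite_var_def intro!: bdd_aboveI)
  qed
  have "finite_var f c (min d (c + real n * (\<delta> / 2)))" for n
  proof (induction n)
    case 0
    then show ?case using short[of c c] \<delta>(1) assms by simp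
  next
    case (Suc n)
    define s where "s = c + real n * (\<delta> / 2)"
    have s: "c \<le> s" "c + real (Suc n) * (\<delta> / 2) = s + \<delta> / 2" using \<delta>(1) by (auto simp: s_def field_simps)
    have "finite_var f c (min d (s + \<delta> / 2))"
      by (rule finite_var_join[OF Suc[folded s_def] short]) (use \<delta>(1) assms s(1) in \<open>auto simp: min_def\<close>)
    then show ?case unfolding s .
  qed
  moreover obtain n :: nat where "d - c < real n * (\<delta> / 2)" using ex_less_of_nat_mult[of "\<delta> / 2" "d - c"] \<delta>(1) by auto
  ultimately show ?thesis by (metis add.commute less_diff_eq less_eq_real_def min.absorb1 diff_less_eq)
qed

text \<open>Inside each interval of a short family a nearly optimal family is chosen. Together they
  form a family of no greater total length, to which the absolute continuity of \<open>f\<close>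
  applies.\<close>

lemma ac_on_pos_var:
  assumes ac: "ac_on {c..d} f" and "c \<le> d" shows "ac_on {c..d} (pos_var f c)"
  unfolding ac_on_iff
proof (intro allI impI)
  note fv = ac_on_finite_var[OF assms]
  fix \<epsilon> :: real assume "\<epsilon> > 0"
  obtain \<delta> where \<delta>: "\<delta> > 0" "\<And>D. nonoverlapping c d D \<Longrightarrow> incr id D < \<delta> \<Longrightarrow>
      (\<Sum>i\<in>D. \<bar>f (snd i) - f (fst i)\<bar>) < \<epsilon> / 2"
    using ac[unfolded ac_on_iff, rule_format, OF half_gt_zero[OF \<open>\<epsilon> > 0\<close>]] by blast
  show "\<exists>\<delta>>0. \<forall>D. nonoverlapping c d D \<and> incr id D < \<delta> \<longrightarrow>
      (\<Sum>i\<in>D. \<bar>pos_var f c (snd i) - pos_var f c (fst i)\<bar>) < \<epsilon>"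
  proof (intro exI[of _ \<delta>] conjI allI impI)
    fix D assume D: "nonoverlapping c d D \<and> incr id D < \<delta>"
    have fin: "finite D" and D': "\<And>i. i \<in> D \<Longrightarrow> c \<le> fst i \<and> fst i < snd i \<and> snd i \<le> d"
      using D by (auto simp: nonoverlapping_def)
    have pv: "\<bar>pos_var f c (snd i) - pos_var f c (fst i)\<bar> = pos_var f (fst i) (snd i)" if "i \<in> D" for i
      using pos_var_add[OF finite_var_mono[OF fv order_refl], of "snd i" "fst i"] D'[OF that]
        pos_var_nonneg[OF finite_var_mono[OF fv], of "fst i" "snd i"] by simp
    \<comment> \<open>The slack per interval, at most \<open>\<epsilon> / 2\<close> in total; the
      added 1 covers the empty family.\<close>
    define \<eta> where "\<eta> = \<epsilon> / (2 * (card D + 1))"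
    have \<eta>: "\<eta> > 0" using \<open>\<epsilon> > 0\<close> by (simp add: \<eta>_def)
    have "\<exists>E. nonoverlapping (fst i) (snd i) E \<and> pos_var f (fst i) (snd i) - \<eta> < incr f E" if "i \<in> D" for i
    proof -
      have "pos_var f (fst i) (snd i) - \<eta> < (SUP D\<in>Collect (nonoverlapping (fst i) (snd i)). incr f D)"
        using \<eta> by (simp add: pos_var_def)
      then show ?thesis
        using finite_var_mono[OF fv, of "fst i" "snd i"] D'[OF that]
        by (subst (asm) less_cSUP_iff) (auto simp: finite_var_def intro: exI[of _ "{}"])
    qed
    then obtain E where E: "\<And>i. i \<in> D \<Longrightarrow> nonoverlapping (fst i) (snd i) (E i)"
      "\<And>i. i \<in> D \<Longrightarrow> pos_var f (fst i) (snd i) - \<eta> < incr f (E i)" by metis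
    have UN: "nonoverlapping c d (\<Union>i\<in>D. E i)" "\<And>f. incr f (\<Union>i\<in>D. E i) = (\<Sum>i\<in>D. incr f (E i))"
      using nonoverlapping_UN[of c d D E] D E(1) by auto
    have "incr id (\<Union>i\<in>D. E i) \<le> incr id D"
      unfolding UN(2) incr_def[of id D] using incr_id_le[OF E(1)] D' by (intro sum_mono) (simp add: less_imp_le)
    then have "(\<Sum>i\<in>(\<Union>i\<in>D. E i). \<bar>f (snd i) - f (fst i)\<bar>) < \<epsilon> / 2" using \<delta>(2)[OF UN(1)] D by simp
    moreover have "incr f (\<Union>i\<in>D. E i) \<le> (\<Sum>i\<in>(\<Union>i\<in>D. E i). \<bar>f (snd i) - f (fst i)\<bar>)"
      unfolding incr_def by (intro sum_mono) simp
    ultimately have "(\<Sum>i\<in>D. incr f (E i)) < \<epsilon> / 2" unfolding UN(2) by simp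
    moreover have "(\<Sum>i\<in>D. pos_var f (fst i) (snd i)) \<le> (\<Sum>i\<in>D. incr f (E i) + \<eta>)"
      using E(2) by (intro sum_mono) (simp add: less_imp_le diff_less_eq)
    moreover have "real (card D) * \<eta> \<le> \<epsilon> / 2" using \<open>\<epsilon> > 0\<close> by (simp add: \<eta>_def field_simps)
    ultimately show "(\<Sum>i\<in>D. \<bar>pos_var f c (snd i) - pos_var f c (fst i)\<bar>) < \<epsilon>"
      using pv by (simp add: sum.distrib)
  qed (rule \<delta>)
qed

text \<open>The device for all closure properties of absolute continuity: differences, products,
  exponentials and Lipschitz functions all have increments dominated by those of two known
  functions.\<close>

lemma ac_on_bound:
  assumes f: "ac_on {c..d} f" and g: "ac_on {c..d} g" and K: "K \<ge> 0"
    and h: "\<And>u v. \<lbrakk>c \<le> u; u \<le> v; v \<le> d\<rbrakk> \<Longrightarrow> \<bar>h v - h u\<bar> \<le> K * (\<bar>f v - f u\<bar> + \<bar>g v - g u\<bar>)"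
  shows "ac_on {c..d} h"
  unfolding ac_on_iff
proof (intro allI impI)
  fix \<epsilon> :: real assume \<epsilon>: "\<epsilon> > 0"
  define e where "e = \<epsilon> / (2 * (K + 1))"
  have e: "e > 0" using \<epsilon> K by (simp add: e_def)
  obtain \<delta>1 where 1: "\<delta>1 > 0" "\<And>D. nonoverlapping c d D \<Longrightarrow> incr id D < \<delta>1 \<Longrightarrow> (\<Sum>i\<in>D. \<bar>f (snd i) - f (fst i)\<bar>) < e"
    using f[unfolded ac_on_iff, rule_format, OF e] by blast
  obtain \<delta>2 where 2: "\<delta>2 > 0" "\<And>D. nonoverlapping c d D \<Longrightarrow> incr id D < \<delta>2 \<Longrightarrow> (\<Sum>i\<in>D. \<bar>g (snd i) - g (fst i)\<bar>) < e"
    using g[unfolded ac_on_iff, rule_format, OF e] by blast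
  show "\<exists>\<delta>>0. \<forall>D. nonoverlapping c d D \<and> incr id D < \<delta> \<longrightarrow> (\<Sum>i\<in>D. \<bar>h (snd i) - h (fst i)\<bar>) < \<epsilon>"
  proof (intro exI[of _ "min \<delta>1 \<delta>2"] conjI allI impI)
    fix D assume D: "nonoverlapping c d D \<and> incr id D < min \<delta>1 \<delta>2"
    have "(\<Sum>i\<in>D. \<bar>h (snd i) - h (fst i)\<bar>) \<le> (\<Sum>i\<in>D. K * (\<bar>f (snd i) - f (fst i)\<bar> + \<bar>g (snd i) - g (fst i)\<bar>))"
      using D by (intro sum_mono h) (auto simp: nonoverlapping_def less_imp_le)
    also have "\<dots> = K * ((\<Sum>i\<in>D. \<bar>f (snd i) - f (fst i)\<bar>) + (\<Sum>i\<in>D. \<bar>g (snd i) - g (fst i)\<bar>))"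
      by (simp add: sum.distrib sum_distrib_left[symmetric])
    also have "\<dots> \<le> K * (e + e)" using 1(2)[of D] 2(2)[of D] D K by (intro mult_left_mono add_mono) auto
    also have "\<dots> = \<epsilon> * (K / (K + 1))" using K by (simp add: e_def divide_simps)
    also have "\<dots> < \<epsilon> * 1" using K \<epsilon> by (intro mult_strict_left_mono) auto
    finally show "(\<Sum>i\<in>D. \<bar>h (snd i) - h (fst i)\<bar>) < \<epsilon>" by simp
  qed (use 1 2 in auto)
qed

lemma ac_on_small:
  assumes f: "ac_on {c..d} f" and \<epsilon>: "\<epsilon> > 0"
  obtains \<delta> where "\<delta> > 0" "\<And>u v. \<lbrakk>c \<le> u; u \<le> v; v \<le> d; v - u < \<delta>\<rbrakk> \<Longrightarrow> \<bar>f v - f u\<bar> < \<epsilon>"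
proof -
  obtain \<delta> where \<delta>: "\<delta> > 0" "\<And>D. nonoverlapping c d D \<Longrightarrow> incr id D < \<delta> \<Longrightarrow> (\<Sum>i\<in>D. \<bar>f (snd i) - f (fst i)\<bar>) < \<epsilon>"
    using f[unfolded ac_on_iff, rule_format, OF \<epsilon>] by blast
  show ?thesis
  proof (rule that[OF \<delta>(1)])
    fix u v assume uv: "c \<le> u" "u \<le> v" "v \<le> d" "v - u < \<delta>"
    show "\<bar>f v - f u\<bar> < \<epsilon>"
    proof (cases "u = v")
      case False
      then have "nonoverlapping c d {(u, v)}" using uv by (auto intro!: nonoverlappingI)
      from \<delta>(2)[OF this] uv show ?thesis by (simp add: incr_def)
    qed (use \<epsilon> in simp)
  qed
qed

lemma ac_on_continuous_on:
  assumes f: "ac_on {c..d} f" shows "continuous_on {c..d} f"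
  unfolding continuous_on_iff
proof (intro ballI allI impI)
  fix x \<epsilon> :: real assume x: "x \<in> {c..d}" and \<epsilon>: "\<epsilon> > 0"
  obtain \<delta> where \<delta>: "\<delta> > 0" "\<And>u v. \<lbrakk>c \<le> u; u \<le> v; v \<le> d; v - u < \<delta>\<rbrakk> \<Longrightarrow> \<bar>f v - f u\<bar> < \<epsilon>"
    using ac_on_small[OF f \<epsilon>] by blast
  show "\<exists>\<delta>>0. \<forall>x'\<in>{c..d}. dist x' x < \<delta> \<longrightarrow> dist (f x') (f x) < \<epsilon>"
  proof (intro exI[of _ \<delta>] conjI ballI impI)
    fix x' assume "x' \<in> {c..d}" "dist x' x < \<delta>"
    then show "dist (f x') (f x) < \<epsilon>"
      using \<delta>(2)[of x x'] \<delta>(2)[of x' x] x by (cases "x \<le> x'") (auto simp: dist_real_def abs_minus_commute)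
  qed (rule \<delta>)
qed

section \<open>Absolutely continuous functions as indefinite integrals\<close>

text \<open>Local integrability is part of the notion because the integral of a function that is not
  integrable has the default value 0.\<close>

definition primitive_on :: "real set \<Rightarrow> (real \<Rightarrow> real) \<Rightarrow> (real \<Rightarrow> real) \<Rightarrow> bool" where
  "primitive_on I g F \<longleftrightarrow> loc_integrable I g \<and>
     (\<forall>u v. u \<le> v \<longrightarrow> {u..v} \<subseteq> I \<longrightarrow> F v - F u = (LBINT y:{u..v}. g y))"

lemma primitive_onD: "primitive_on I g F \<Longrightarrow> u \<le> v \<Longrightarrow> {u..v} \<subseteq> I \<Longrightarrow> F v - F u = (LBINT y:{u..v}. g y)"
  and primitive_on_integrable: "primitive_on I g F \<Longrightarrow> {u..v} \<subseteq> I \<Longrightarrow> set_integrable lborel {u..v} g"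
  by (auto simp: primitive_on_def loc_integrable_def)

lemma primitive_on_diff:
  assumes "primitive_on I g F" "primitive_on I g' F'"
  shows "primitive_on I (\<lambda>x. g x - g' x) (\<lambda>x. F x - F' x)"
  using assms unfolding primitive_on_def loc_integrable_def
  by (simp add: set_integral_diff) (smt (verit, best))

text \<open>Boxes exhausting an open set may overlap, whereas absolute continuity speaks of
  nonoverlapping intervals. A division with the same union repairs this, its degenerate members
  being dropped from the family.\<close>

lemma finite_division_family:
  assumes fin: "finite \<F>" and cb: "\<And>K. K \<in> \<F> \<Longrightarrow> \<exists>a b. K = cbox a b" and sub: "\<Union>\<F> \<subseteq> {c<..<(d::real)}"
  obtains P where "finite P" "\<And>K. K \<in> P \<Longrightarrow> \<exists>a b. a \<le> b \<and> K = {a..b} \<and> c \<le> a \<and> b \<le> d" "\<Union>P = \<Union>\<F>"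
    "nonoverlapping c d ((\<lambda>K. (Inf K, Sup K)) ` {K\<in>P. Inf K < Sup K})" "inj_on (\<lambda>K. (Inf K, Sup K)) P"
proof -
  obtain P where P: "P division_of (\<Union>\<F>)" using elementary_unions_intervals[OF fin] cb by blast
  note PD = division_ofD[OF P]
  have K: "\<exists>a b. a \<le> b \<and> K = {a..b} \<and> c \<le> a \<and> b \<le> d" if KP: "K \<in> P" for K
  proof -
    obtain a b where ab: "K = cbox a b" using PD(4)[OF KP] by blast
    have ne: "a \<le> b" using PD(3)[OF KP] ab by simp
    have "K \<subseteq> {c<..<d}" using PD(2)[OF KP] sub by blast
    then have "c < a" "b < d" using ne ab by auto
    then show ?thesis using ab ne by (intro exI[of _ a] exI[of _ b]) auto
  qed
  have K': "K = {Inf K..Sup K} \<and> c \<le> Inf K \<and> Sup K \<le> d" if "K \<in> P" for K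
    using K[OF that] by auto
  have inj: "inj_on (\<lambda>K. (Inf K, Sup K)) P"
  proof (rule inj_onI)
    fix K L assume "K \<in> P" "L \<in> P" "(Inf K, Sup K) = (Inf L, Sup L)"
    then show "K = L" using K'[of K] K'[of L] by (metis prod.inject)
  qed
  have "nonoverlapping c d ((\<lambda>K. (Inf K, Sup K)) ` {K\<in>P. Inf K < Sup K})"
  proof (rule nonoverlappingI)
    show "finite ((\<lambda>K. (Inf K, Sup K)) ` {K \<in> P. Inf K < Sup K})" using PD(1) by simp
    fix i j assume "i \<in> (\<lambda>K. (Inf K, Sup K)) ` {K \<in> P. Inf K < Sup K}"
      "j \<in> (\<lambda>K. (Inf K, Sup K)) ` {K \<in> P. Inf K < Sup K}"
      and ov: "max (fst i) (fst j) < min (snd i) (snd j)"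
    then obtain K L where KL: "K \<in> P" "L \<in> P" "i = (Inf K, Sup K)" "j = (Inf L, Sup L)" by blast
    obtain x where x: "max (fst i) (fst j) < x" "x < min (snd i) (snd j)" using dense[OF ov] by blast
    have "K = L"
    proof (rule ccontr)
      assume "K \<noteq> L"
      then have "interior K \<inter> interior L = {}" using PD(5)[OF KL(1,2)] by simp
      moreover have "x \<in> interior {Inf K..Sup K}" "x \<in> interior {Inf L..Sup L}"
        using x KL by (auto simp: interior_atLeastAtMost_real)
      ultimately show False using K'[OF KL(1)] K'[OF KL(2)] by (metis IntI empty_iff)
    qed
    then show "i = j" using KL by simp
  qed (use K' in auto)
  then show ?thesis using that[of P] PD(1,6) K inj by blast
qed

text \<open>The Lebesgue-Stieltjes measure of \<open>r\<close> is absolutely continuous with respect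
  to Lebesgue measure, and its Radon-Nikodym density is the required integrand.\<close>

lemma mono_ac_on_primitive:
  assumes mono: "\<And>x y. \<lbrakk>c \<le> x; x \<le> y; y \<le> d\<rbrakk> \<Longrightarrow> r x \<le> r y"
    and ac: "ac_on {c..d} r" and cd: "c \<le> d"
  shows "\<exists>g. primitive_on {c..d} g r"
proof -
  \<comment> \<open>The constant extension of \<open>r\<close> beyond both ends makes
    \<open>F\<close> monotone and continuous on the whole line, with no mass outside the open
    interval from \<open>c\<close> to \<open>d\<close>.\<close>
  define F where "F = (\<lambda>x. r (max c (min d x)))"
  have F: "F x = r x" if "c \<le> x" "x \<le> d" for x using that by (simp add: F_def)
  have Fmono: "F x \<le> F y" if "x \<le> y" for x y
    unfolding F_def using that cd by (intro mono) (auto simp: max_def min_def)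
  have Fcont: "continuous_on UNIV F"
    unfolding F_def by (rule continuous_on_compose2[OF ac_on_continuous_on[OF ac]])
      (use cd in \<open>auto intro!: continuous_intros\<close>)
  define \<nu> where "\<nu> = interval_measure F"
  have Ioc: "emeasure \<nu> {a<..b} = ennreal (F b - F a)" if "a \<le> b" for a b
    unfolding \<nu>_def using that Fmono Fcont
    by (intro emeasure_interval_measure_Ioc) (auto intro: continuous_on_imp_continuous_within)
  have Icc: "emeasure \<nu> {a..b} = ennreal (F b - F a)" if "a \<le> b" for a b
    unfolding \<nu>_def using that Fmono Fcont
    by (intro emeasure_interval_measure_Icc) auto
  have [simp]: "sets \<nu> = sets borel" "space \<nu> = UNIV" by (auto simp: \<nu>_def)
  have lower: "emeasure \<nu> {..c} = 0"
  proof -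
    have "emeasure \<nu> (\<Union>n::nat. {c - real n<..c}) = 0"
      using cd by (intro emeasure_UN_eq_0) (auto simp: Ioc F_def max_def min_def)
    moreover have "(\<Union>n::nat. {c - real n<..c}) = {..c}"
      by (auto simp: diff_less_eq) (metis add.commute less_diff_eq reals_Archimedean2 diff_less_eq)
    ultimately show ?thesis by simp
  qed
  have upper: "emeasure \<nu> {d..} = 0"
  proof -
    have "emeasure \<nu> (\<Union>n::nat. {d..d + real n}) = 0"
      using cd by (intro emeasure_UN_eq_0) (auto simp: Icc F_def max_def min_def)
    moreover have "(\<Union>n::nat. {d..d + real n}) = {d..}"
      by auto (metis add.commute diff_le_eq real_arch_simple)
    ultimately show ?thesis by simp
  qed
  have "absolutely_continuous lborel \<nu>"
    unfolding absolutely_continuous_def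
  proof
    fix A assume A: "A \<in> null_sets (lborel :: real measure)"
    then have [measurable]: "A \<in> sets borel" by auto
    have "emeasure \<nu> (A \<inter> {c<..<d}) \<le> 0 + ennreal \<epsilon>" if \<epsilon>: "\<epsilon> > 0" for \<epsilon>
    proof -
      obtain \<delta> where \<delta>: "\<delta> > 0" "\<And>D. nonoverlapping c d D \<Longrightarrow> incr id D < \<delta> \<Longrightarrow> (\<Sum>i\<in>D. \<bar>r (snd i) - r (fst i)\<bar>) < \<epsilon>"
        using ac[unfolded ac_on_iff, rule_format, OF \<epsilon>] by blast
      obtain U0 where U0: "open U0" "A \<subseteq> U0" "emeasure lborel (U0 - A) < ennreal \<delta>"
        using outer_regular_lborel[of A \<delta>] \<delta>(1) by auto
      define U where "U = U0 \<inter> {c<..<d}"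
      have "open U" unfolding U_def using U0(1) by (intro open_Int open_greaterThanLessThan)
      then have [measurable]: "U \<in> sets borel" by simp
      have "emeasure lborel U \<le> emeasure lborel ((U0 - A) \<union> A)"
        using U0 by (intro emeasure_mono) (auto simp: U_def)
      also have "\<dots> \<le> emeasure lborel (U0 - A) + emeasure lborel A"
        using U0 by (intro emeasure_subadditive) auto
      also have "\<dots> < ennreal \<delta>" using A U0(3) by (simp add: null_setsD1)
      finally have U\<delta>: "emeasure lborel U < ennreal \<delta>" .
      obtain \<D> where \<D>: "countable \<D>" "\<D> \<subseteq> Pow U" "\<And>X. X \<in> \<D> \<Longrightarrow> \<exists>a b. X = cbox a b" "\<Union>\<D> = U"
        using open_countable_Union_open_cbox[OF \<open>open U\<close>] by blast
      \<comment> \<open>Absolute continuity controls finite families only; the bound is first proved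
        for finite unions of boxes and then passes to \<open>U\<close> by monotone limits.\<close>
      have fin: "emeasure \<nu> (\<Union>\<F>) \<le> ennreal \<epsilon>" if \<F>: "finite \<F>" "\<F> \<subseteq> \<D>" for \<F>
      proof -
        have sub: "\<Union>\<F> \<subseteq> {c<..<d}" using \<F> \<D>(2) by (auto simp: U_def)
        have cb: "\<And>K. K \<in> \<F> \<Longrightarrow> \<exists>a b. K = cbox a b" using \<D>(3) \<F>(2) by blast
        obtain P where P: "finite P" "\<And>K. K \<in> P \<Longrightarrow> \<exists>a b. a \<le> b \<and> K = {a..b} \<and> c \<le> a \<and> b \<le> d" "\<Union>P = \<Union>\<F>"
            "nonoverlapping c d ((\<lambda>K. (Inf K, Sup K)) ` {K\<in>P. Inf K < Sup K})" "inj_on (\<lambda>K. (Inf K, Sup K)) P"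
          using finite_division_family[OF \<F>(1) cb sub] by blast
        define D where "D = (\<lambda>K. (Inf K, Sup K)) ` {K\<in>P. Inf K < Sup K}"
        have PK: "emeasure \<nu> K = ennreal (r (Sup K) - r (Inf K)) \<and> r (Inf K) \<le> r (Sup K) \<and> K \<in> sets borel \<and> Inf K \<le> Sup K"
          and PK': "{Inf K..Sup K} = K" if KP: "K \<in> P" for K
        proof -
          obtain a b where "a \<le> b" "K = {a..b}" "c \<le> a" "b \<le> d" using P(2)[OF KP] by blast
          then show "emeasure \<nu> K = ennreal (r (Sup K) - r (Inf K)) \<and> r (Inf K) \<le> r (Sup K) \<and> K \<in> sets borel \<and> Inf K \<le> Sup K"
            "{Inf K..Sup K} = K" using Icc[of a b] F[of a] F[of b] mono[of a b] by auto
        qed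
        have inj: "inj_on (\<lambda>K. (Inf K, Sup K)) {K\<in>P. Inf K < Sup K}" using P(5) by (rule inj_on_subset) auto
        have "(\<Union>i\<in>D. {fst i<..<snd i}) \<subseteq> U"
        proof
          fix x assume "x \<in> (\<Union>i\<in>D. {fst i<..<snd i})"
          then obtain K where K: "K \<in> P" "Inf K < x" "x < Sup K" by (auto simp: D_def)
          then have "x \<in> {Inf K..Sup K}" by simp
          then have "x \<in> \<Union>P" unfolding PK'[OF K(1)] using K(1) by blast
          then show "x \<in> U" using P(3) \<F> \<D>(2) by auto
        qed
        then have "ennreal (incr id D) \<le> emeasure lborel U"
          using P(4) by (intro incr_id_le_emeasure[of c d]) (auto simp: D_def)
        then have "ennreal (incr id D) < ennreal \<delta>" using U\<delta> by simp
        then have "incr id D < \<delta>" by (meson ennreal_leI not_le)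
        then have s: "(\<Sum>i\<in>D. \<bar>r (snd i) - r (fst i)\<bar>) < \<epsilon>" using \<delta>(2) P(4) by (simp add: D_def)
        have "emeasure \<nu> (\<Union>P) \<le> (\<Sum>K\<in>P. emeasure \<nu> K)"
          using emeasure_subadditive_finite[of P "\<lambda>K. K" \<nu>] P(1) PK by auto
        also have "\<dots> = (\<Sum>K\<in>P. ennreal (r (Sup K) - r (Inf K)))" using PK by (intro sum.cong) auto
        also have "\<dots> = ennreal (\<Sum>K\<in>P. r (Sup K) - r (Inf K))" using PK by (intro sum_ennreal) auto
        also have "(\<Sum>K\<in>P. r (Sup K) - r (Inf K)) = (\<Sum>K\<in>{K\<in>P. Inf K < Sup K}. r (Sup K) - r (Inf K))"
        proof (rule sum.mono_neutral_right[OF P(1)])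
          show "\<forall>i\<in>P - {K \<in> P. Inf K < Sup K}. r (Sup i) - r (Inf i) = 0"
          proof
            fix K assume "K \<in> P - {K \<in> P. Inf K < Sup K}"
            then have "Sup K = Inf K" using PK[of K] by (auto intro: antisym)
            then show "r (Sup K) - r (Inf K) = 0" by simp
          qed
        qed auto
        also have "\<dots> \<le> (\<Sum>i\<in>D. \<bar>r (snd i) - r (fst i)\<bar>)"
          unfolding D_def sum.reindex[OF inj] by (intro sum_mono) simp
        finally show ?thesis using s P(3) by (metis ennreal_leI less_imp_le order_trans)
      qed
      have "emeasure \<nu> U \<le> ennreal \<epsilon>"
      proof (cases "\<D> = {}")
        case True
        then show ?thesis using \<D>(4) by simp
      next
        case False
        have "(SUP n. emeasure \<nu> (\<Union>k\<le>n. from_nat_into \<D> k)) = emeasure \<nu> (\<Union>n. \<Union>k\<le>n. from_nat_into \<D> k)"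
        proof (rule SUP_emeasure_incseq)
          show "range (\<lambda>n. \<Union>k\<le>n. from_nat_into \<D> k) \<subseteq> sets \<nu>"
          proof -
            have "from_nat_into \<D> k \<in> sets borel" for k
              using \<D>(3)[OF from_nat_into[OF False, of k]] by auto
            then show ?thesis by auto
          qed
          show "incseq (\<lambda>n. \<Union>k\<le>n. from_nat_into \<D> k)" by (force simp: incseq_def)
        qed
        moreover have "(\<Union>n. \<Union>k\<le>n. from_nat_into \<D> k) = U"
        proof -
          have "(\<Union>n. \<Union>k\<le>n. from_nat_into \<D> k) = \<Union>(range (from_nat_into \<D>))" by blast
          then show ?thesis using \<D>(1,4) range_from_nat_into[OF False \<D>(1)] by simp
        qed
        ultimately have "emeasure \<nu> U = (SUP n. emeasure \<nu> (\<Union>k\<le>n. from_nat_into \<D> k))" by simp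
        also have "\<dots> \<le> ennreal \<epsilon>"
          by (intro SUP_least fin) (use from_nat_into[OF False] in auto)
        finally show ?thesis .
      qed
      moreover have "emeasure \<nu> (A \<inter> {c<..<d}) \<le> emeasure \<nu> U"
        using U0 by (intro emeasure_mono) (auto simp: U_def)
      ultimately show ?thesis by simp
    qed
    then have mid: "emeasure \<nu> (A \<inter> {c<..<d}) = 0"
      by (metis ennreal_le_epsilon le_zero_eq)
    have "emeasure \<nu> A \<le> emeasure \<nu> (A \<inter> {c<..<d} \<union> ({..c} \<union> {d..}))" by (intro emeasure_mono) auto
    also have "\<dots> \<le> emeasure \<nu> (A \<inter> {c<..<d}) + emeasure \<nu> ({..c} \<union> {d..})" by (intro emeasure_subadditive) auto
    also have "emeasure \<nu> ({..c} \<union> {d..}) \<le> emeasure \<nu> {..c} + emeasure \<nu> {d..}" by (intro emeasure_subadditive) auto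
    finally have "emeasure \<nu> A \<le> 0" using mid lower upper by (simp add: add_mono)
    then show "A \<in> null_sets \<nu>" by (auto intro!: null_setsI)
  qed
  then obtain h where h[measurable]: "h \<in> borel_measurable lborel" and \<nu>h: "density lborel h = \<nu>"
    using sigma_finite_measure.Radon_Nikodym[OF lborel.sigma_finite_measure_axioms, of \<nu>] by auto
  \<comment> \<open>The density may be infinite on a null set, where \<open>enn2real\<close>
    replaces it by 0; \<open>eq\<close> below shows that nothing is lost almost everywhere.\<close>
  define g where "g = (\<lambda>x. enn2real (h x))"
  have [measurable]: "g \<in> borel_measurable borel" using h by (simp add: g_def)
  have tot: "(\<integral>\<^sup>+x. h x * indicator {c..d} x \<partial>lborel) = ennreal (r d - r c)"
    using Icc[of c d] cd F[of c] F[of d] by (simp add: \<nu>h[symmetric] emeasure_density)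
  have "AE x in lborel. h x * indicator {c..d} x \<noteq> \<infinity>"
    by (rule nn_integral_noteq_infinite) (auto simp: tot)
  then have eq: "AE x in lborel. x \<in> {c..d} \<longrightarrow> ennreal (g x) = h x"
    by eventually_elim (auto simp: g_def less_top[symmetric])
  have g: "set_integrable lborel {u..v} g \<and> r v - r u = (LBINT y:{u..v}. g y)"
    if uv: "{u..v} \<subseteq> {c..d}" "u \<le> v" for u v
  proof -
    have "(\<integral>\<^sup>+x. ennreal (indicator {u..v} x * g x) \<partial>lborel) = (\<integral>\<^sup>+x. h x * indicator {u..v} x \<partial>lborel)"
      using eq by (intro nn_integral_cong_AE, eventually_elim) (use uv in \<open>auto split: split_indicator\<close>)
    also have "\<dots> = ennreal (r v - r u)"
      using Icc[of u v] uv F[of u] F[of v] by (simp add: \<nu>h[symmetric] emeasure_density)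
    finally have *: "(\<integral>\<^sup>+x. ennreal (indicator {u..v} x * g x) \<partial>lborel) = ennreal (r v - r u)" .
    have "has_bochner_integral lborel (\<lambda>x. indicator {u..v} x * g x) (r v - r u)"
      by (rule has_bochner_integral_nn_integral) (use * uv mono[of u v] in \<open>auto simp: g_def\<close>)
    then show ?thesis
      by (auto simp: set_integrable_def set_lebesgue_integral_def has_bochner_integral_iff)
  qed
  have "primitive_on {c..d} g r"
    unfolding primitive_on_def loc_integrable_def
  proof (intro conjI allI impI)
    fix u v assume "{u..v} \<subseteq> {c..d}"
    then show "set_integrable lborel {u..v} g" using g[of u v] by (cases "u \<le> v") auto
  qed (use g in blast)
  then show ?thesis by blast
qed

text \<open>Jordan decomposition: \<open>f\<close> is its positive variation minus the excess of
  that variation over \<open>f\<close>. Both terms are nondecreasing and absolutely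
  continuous.\<close>

theorem ac_on_primitive:
  assumes ac: "ac_on {c..d} f" and cd: "c \<le> d"
  shows "\<exists>g. primitive_on {c..d} g f"
proof -
  note fv = ac_on_finite_var[OF assms]
  note acp = ac_on_pos_var[OF assms]
  have add: "pos_var f c y = pos_var f c x + pos_var f x y" if "c \<le> x" "x \<le> y" "y \<le> d" for x y
    using that by (intro pos_var_add finite_var_mono[OF fv]) auto
  have "pos_var f c x \<le> pos_var f c y" if "c \<le> x" "x \<le> y" "y \<le> d" for x y
    using add[OF that] pos_var_nonneg[OF finite_var_mono[OF fv], of x y] that by simp
  then obtain g1 where g1: "primitive_on {c..d} g1 (pos_var f c)"
    using mono_ac_on_primitive[of c d "pos_var f c", OF _ acp cd] by blast
  have "ac_on {c..d} (\<lambda>x. pos_var f c x - f x)"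
    by (rule ac_on_bound[OF acp ac, of 1]) auto
  moreover have "pos_var f c x - f x \<le> pos_var f c y - f y" if "c \<le> x" "x \<le> y" "y \<le> d" for x y
    using add[OF that] pos_var_ge[OF finite_var_mono[OF fv], of x y] that by simp
  ultimately obtain g2 where g2: "primitive_on {c..d} g2 (\<lambda>x. pos_var f c x - f x)"
    using mono_ac_on_primitive[of c d "\<lambda>x. pos_var f c x - f x", OF _ _ cd] by blast
  from primitive_on_diff[OF g1 g2] show ?thesis by (intro exI[of _ "\<lambda>x. g1 x - g2 x"]) simp
qed

lemma continuous_on_Icc_bounded:
  fixes f :: "real \<Rightarrow> real"
  assumes "continuous_on {c..d} f"
  obtains K where "K \<ge> 0" "\<And>x. x \<in> {c..d} \<Longrightarrow> \<bar>f x\<bar> \<le> K"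
proof -
  have "bounded (f ` {c..d})" using assms by (auto intro!: compact_imp_bounded compact_continuous_image)
  then obtain K where "\<forall>x\<in>{c..d}. \<bar>f x\<bar> \<le> K" unfolding bounded_iff by auto
  then show ?thesis using that[of "\<bar>K\<bar>"] by fastforce
qed

lemma integral_Icc_Ioo: "a \<le> b \<Longrightarrow> (LBINT x:{a..b}. f x) = (LBINT x:{a<..<b}. f x)" for f :: "real \<Rightarrow> real"
  using interval_integral_Icc[of a b f] interval_integral_Ioo[of a b f] by simp

text \<open>The modulus of the integrand is at most a constant \<open>M\<close> plus a tail of
  integral below \<open>\<epsilon> / 2\<close>. The constant contributes \<open>M\<close> times the
  total length, the tail is summed over disjoint intervals.\<close>

lemma primitive_on_ac:
  assumes "primitive_on {c..d} g F" shows "ac_on {c..d} F"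
  unfolding ac_on_iff
proof (intro allI impI)
  fix \<epsilon> :: real assume \<epsilon>: "\<epsilon> > 0"
  define h where "h = (\<lambda>x. \<bar>indicator {c..d} x * g x\<bar>)"
  have "integrable lborel (\<lambda>x. indicator {c..d} x * g x)"
    using primitive_on_integrable[OF assms order_refl] by (simp add: set_integrable_def)
  then have hi: "integrable lborel h" unfolding h_def by (rule integrable_abs)
  then have [measurable]: "h \<in> borel_measurable borel" by auto
  have h0: "h x \<ge> 0" for x by (simp add: h_def)
  have "(\<lambda>n. \<integral>x. max 0 (h x - real n) \<partial>lborel) \<longlonglongrightarrow> (\<integral>x. 0 \<partial>(lborel::real measure))"
  proof (rule integral_dominated_convergence[OF _ _ hi])
    show "AE x in lborel. (\<lambda>n. max 0 (h x - real n)) \<longlonglongrightarrow> 0"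
    proof (intro AE_I2 tendsto_eventually)
      fix x
      obtain N :: nat where "h x \<le> real N" using real_arch_simple by blast
      then show "\<forall>\<^sub>F n in sequentially. max 0 (h x - real n) = 0"
        by (intro eventually_sequentiallyI[of N]) auto
    qed
  qed (use h0 in auto)
  then have "\<forall>\<^sub>F n in sequentially. (\<integral>x. max 0 (h x - real n) \<partial>lborel) < \<epsilon> / 2"
    using \<epsilon> by (intro order_tendstoD(2)) auto
  then obtain M :: nat where M: "(\<integral>x. max 0 (h x - real M) \<partial>lborel) < \<epsilon> / 2"
    by (auto simp: eventually_sequentially)
  have mi: "integrable lborel (\<lambda>x. max 0 (h x - real M))"
    by (rule Bochner_Integration.integrable_bound[OF hi]) (use h0 in auto)
  define \<delta> where "\<delta> = \<epsilon> / (2 * (real M + 1))"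
  show "\<exists>\<delta>>0. \<forall>D. nonoverlapping c d D \<and> incr id D < \<delta> \<longrightarrow> (\<Sum>i\<in>D. \<bar>F (snd i) - F (fst i)\<bar>) < \<epsilon>"
  proof (intro exI[of _ \<delta>] conjI allI impI)
    show "\<delta> > 0" using \<epsilon> by (simp add: \<delta>_def)
    fix D assume D: "nonoverlapping c d D \<and> incr id D < \<delta>"
    have fin: "finite D" and D': "\<And>i. i \<in> D \<Longrightarrow> c \<le> fst i \<and> fst i < snd i \<and> snd i \<le> d"
      and disj: "disjoint_family_on (\<lambda>i. {fst i<..<snd i}) D"
      using D by (auto simp: nonoverlapping_def)
    have ii: "integrable lborel (\<lambda>x. indicator {fst i<..<snd i} x * h x)" for i :: "real \<times> real"
      using integrable_mult_indicator[OF _ hi, of "{fst i<..<snd i}"] by simp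
    have one: "integrable lborel (\<lambda>x. real M * indicator {fst i<..<snd i} x)" if "i \<in> D" for i
      using D'[OF that] by (intro integrable_mult_right integrable_real_indicator) auto
    have mi': "integrable lborel (\<lambda>x. indicator {fst i<..<snd i} x * max 0 (h x - real M))" for i :: "real \<times> real"
      using integrable_mult_indicator[OF _ mi, of "{fst i<..<snd i}"] by simp
    have step: "\<bar>F (snd i) - F (fst i)\<bar> \<le> real M * (snd i - fst i) +
        (\<integral>x. indicator {fst i<..<snd i} x * max 0 (h x - real M) \<partial>lborel)" if i: "i \<in> D" for i
    proof -
      have "F (snd i) - F (fst i) = (LBINT x:{fst i<..<snd i}. g x)"
        using primitive_onD[OF assms, of "fst i" "snd i"] D'[OF i] by (simp add: integral_Icc_Ioo)
      also have "\<dots> = (\<integral>x. indicator {fst i<..<snd i} x * (indicator {c..d} x * g x) \<partial>lborel)"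
        unfolding set_lebesgue_integral_def using D'[OF i]
        by (intro Bochner_Integration.integral_cong) (auto split: split_indicator)
      finally have "\<bar>F (snd i) - F (fst i)\<bar> \<le> (\<integral>x. \<bar>indicator {fst i<..<snd i} x * (indicator {c..d} x * g x)\<bar> \<partial>lborel)"
        by (simp add: integral_abs_bound)
      also have "\<dots> = (\<integral>x. indicator {fst i<..<snd i} x * h x \<partial>lborel)"
        by (intro Bochner_Integration.integral_cong) (auto simp: h_def abs_mult)
      also have "\<dots> \<le> (\<integral>x. real M * indicator {fst i<..<snd i} x +
          indicator {fst i<..<snd i} x * max 0 (h x - real M) \<partial>lborel)"
        by (intro integral_mono ii Bochner_Integration.integrable_add one mi' i) (auto split: split_indicator)
      also have "\<dots> = real M * (snd i - fst i) + (\<integral>x. indicator {fst i<..<snd i} x * max 0 (h x - real M) \<partial>lborel)"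
        using D'[OF i] by (subst Bochner_Integration.integral_add[OF one[OF i] mi']) simp
      finally show ?thesis .
    qed
    have "(\<Sum>i\<in>D. \<bar>F (snd i) - F (fst i)\<bar>) \<le> real M * incr id D +
        (\<Sum>i\<in>D. \<integral>x. indicator {fst i<..<snd i} x * max 0 (h x - real M) \<partial>lborel)"
      using sum_mono[of D, OF step] by (simp add: sum.distrib sum_distrib_left incr_def)
    also have "(\<Sum>i\<in>D. \<integral>x. indicator {fst i<..<snd i} x * max 0 (h x - real M) \<partial>lborel) =
        (\<integral>x. (\<Sum>i\<in>D. indicator {fst i<..<snd i} x * max 0 (h x - real M)) \<partial>lborel)"
      using mi' by (intro Bochner_Integration.integral_sum[symmetric]) auto
    also have "\<dots> \<le> (\<integral>x. max 0 (h x - real M) \<partial>lborel)"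
    proof (rule integral_mono[OF Bochner_Integration.integrable_sum[OF mi'] mi])
      fix x
      have "(\<Sum>i\<in>D. indicator {fst i<..<snd i} x * max 0 (h x - real M)) =
          indicator (\<Union>i\<in>D. {fst i<..<snd i}) x * max 0 (h x - real M)"
        unfolding indicator_UN_disjoint[OF fin disj] by (simp add: sum_distrib_right)
      then show "(\<Sum>i\<in>D. indicator {fst i<..<snd i} x * max 0 (h x - real M)) \<le> max 0 (h x - real M)"
        by (auto split: split_indicator)
    qed
    also have "real M * incr id D \<le> real M * \<delta>" using D by (intro mult_left_mono) auto
    also have "real M * \<delta> \<le> \<epsilon> / 2" using \<epsilon> by (simp add: \<delta>_def field_simps)
    finally show "(\<Sum>i\<in>D. \<bar>F (snd i) - F (fst i)\<bar>) < \<epsilon>" using M by simp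
  qed
qed

lemma primitive_on_subset: "primitive_on I g F \<Longrightarrow> K \<subseteq> I \<Longrightarrow> primitive_on K g F"
  unfolding primitive_on_def loc_integrable_def by blast

lemma primitive_on_ac_loc: "primitive_on I g F \<Longrightarrow> ac_loc I F"
  unfolding ac_loc_def by (auto intro: primitive_on_ac primitive_on_subset)

lemma ac_on_id: "ac_on {c..d} (\<lambda>x. x)"
  unfolding ac_on_iff
proof (intro allI impI)
  fix \<epsilon> :: real assume "\<epsilon> > 0"
  moreover have "(\<Sum>i\<in>D. \<bar>snd i - fst i\<bar>) = incr id D" if "nonoverlapping c d D" for D
    using that unfolding incr_def by (intro sum.cong) (auto simp: nonoverlapping_def)
  ultimately show "\<exists>\<delta>>0. \<forall>D. nonoverlapping c d D \<and> incr id D < \<delta> \<longrightarrow> (\<Sum>i\<in>D. \<bar>snd i - fst i\<bar>) < \<epsilon>"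
    by auto
qed

lemma ac_on_lipschitz:
  assumes "K \<ge> 0" "\<And>u v. \<lbrakk>c \<le> u; u \<le> v; v \<le> d\<rbrakk> \<Longrightarrow> \<bar>h v - h u\<bar> \<le> K * (v - u)"
  shows "ac_on {c..d} h"
  by (rule ac_on_bound[OF ac_on_id ac_on_id assms(1)]) (use assms in \<open>fastforce intro: order_trans mult_left_mono\<close>)

lemma ac_on_mult:
  assumes f: "ac_on {c..d} f" and g: "ac_on {c..d} g" shows "ac_on {c..d} (\<lambda>x. f x * g x)"
proof -
  obtain K1 where K1: "K1 \<ge> 0" "\<And>x. x \<in> {c..d} \<Longrightarrow> \<bar>f x\<bar> \<le> K1"
    using continuous_on_Icc_bounded[OF ac_on_continuous_on[OF f]] by blast
  obtain K2 where K2: "K2 \<ge> 0" "\<And>x. x \<in> {c..d} \<Longrightarrow> \<bar>g x\<bar> \<le> K2"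
    using continuous_on_Icc_bounded[OF ac_on_continuous_on[OF g]] by blast
  show ?thesis
  proof (rule ac_on_bound[OF f g, of "K1 + K2"])
    fix u v assume uv: "c \<le> u" "u \<le> v" "v \<le> d"
    have "f v * g v - f u * g u = (f v - f u) * g v + f u * (g v - g u)" by (simp add: algebra_simps)
    then have "\<bar>f v * g v - f u * g u\<bar> \<le> \<bar>f v - f u\<bar> * \<bar>g v\<bar> + \<bar>f u\<bar> * \<bar>g v - g u\<bar>"
      by (metis abs_mult abs_triangle_ineq)
    also have "\<dots> \<le> \<bar>f v - f u\<bar> * (K1 + K2) + (K1 + K2) * \<bar>g v - g u\<bar>"
      using K1(2)[of u] K2(2)[of v] K1(1) K2(1) uv by (intro add_mono mult_left_mono mult_right_mono) auto
    finally show "\<bar>f v * g v - f u * g u\<bar> \<le> (K1 + K2) * (\<bar>f v - f u\<bar> + \<bar>g v - g u\<bar>)"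
      by (simp add: algebra_simps)
  qed (use K1 K2 in auto)
qed

lemma ac_loc_mult: "ac_loc I f \<Longrightarrow> ac_loc I g \<Longrightarrow> ac_loc I (\<lambda>x. f x * g x)"
  unfolding ac_loc_def by (auto intro: ac_on_mult)

lemma ac_on_C1:
  assumes "\<And>x. x \<in> {c..d} \<Longrightarrow> DERIV h x :> h' x" "continuous_on {c..d} h'"
  shows "ac_on {c..d} h"
proof -
  obtain K where K: "K \<ge> 0" "\<And>x. x \<in> {c..d} \<Longrightarrow> \<bar>h' x\<bar> \<le> K"
    using continuous_on_Icc_bounded[OF assms(2)] by blast
  show ?thesis
  proof (rule ac_on_lipschitz[OF K(1)])
    fix u v assume uv: "c \<le> u" "u \<le> v" "v \<le> d"
    show "\<bar>h v - h u\<bar> \<le> K * (v - u)"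
    proof (cases "u = v")
      case False
      then obtain z where z: "u < z" "z < v" "h v - h u = (v - u) * h' z"
        using MVT2[of u v h h'] assms(1) uv by auto
      have "\<bar>h' z\<bar> \<le> K" using K(2)[of z] z uv by auto
      then show ?thesis using z uv by (simp add: abs_mult mult.commute mult_right_mono)
    qed simp
  qed
qed

text \<open>\<open>f\<close> is bounded by some \<open>K\<close> on the compact interval, and
  \<open>exp\<close> is Lipschitz with constant \<open>exp K\<close> on the values
  concerned.\<close>

lemma ac_on_exp: assumes f: "ac_on {c..d} f" shows "ac_on {c..d} (\<lambda>x. exp (f x :: real))"
proof -
  obtain K where K: "\<And>x. x \<in> {c..d} \<Longrightarrow> \<bar>f x\<bar> \<le> K"
    using continuous_on_Icc_bounded[OF ac_on_continuous_on[OF f]] by blast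
  have le: "\<bar>exp y - exp x\<bar> \<le> exp K * \<bar>y - x\<bar>" if xy: "x < y" "\<bar>x\<bar> \<le> K" "\<bar>y\<bar> \<le> K" for x y :: real
  proof -
    obtain z where z: "x < z" "z < y" "exp y - exp x = (y - x) * exp z"
      using MVT2[of x y exp exp] xy by (auto intro: DERIV_exp)
    have "exp z \<le> exp K" using z that by auto
    then show ?thesis using z that by (simp add: abs_mult mult.commute mult_right_mono)
  qed
  show ?thesis
  proof (rule ac_on_bound[OF f f, of "exp K"])
    fix u v assume uv: "c \<le> u" "u \<le> v" "v \<le> d"
    have "\<bar>exp (f v) - exp (f u)\<bar> \<le> exp K * \<bar>f v - f u\<bar>"
      using le[of "f u" "f v"] le[of "f v" "f u"] K[of u] K[of v] uv
      by (cases "f u" "f v" rule: linorder_cases) (auto simp: abs_minus_commute)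
    also have "\<dots> \<le> exp K * (\<bar>f v - f u\<bar> + \<bar>f v - f u\<bar>)" by (intro mult_left_mono) auto
    finally show "\<bar>exp (f v) - exp (f u)\<bar> \<le> exp K * (\<bar>f v - f u\<bar> + \<bar>f v - f u\<bar>)" .
  qed simp
qed

section \<open>Differentiation of indefinite integrals\<close>

lemma DERIV_if_density:
  fixes F :: "real \<Rightarrow> real"
  assumes "\<And>e. e > 0 \<Longrightarrow> \<exists>\<delta>>0. \<forall>u v. u \<le> x \<and> x \<le> v \<and> u < v \<and> v - u < \<delta> \<longrightarrow> \<bar>F v - F u - D * (v - u)\<bar> \<le> e * (v - u)"
  shows "DERIV F x :> D"
  unfolding has_field_derivative_iff LIM_def
proof (intro allI impI)
  fix r :: real assume r: "r > 0"
  obtain \<delta> where \<delta>: "\<delta> > 0" "\<And>u v. u \<le> x \<Longrightarrow> x \<le> v \<Longrightarrow> u < v \<Longrightarrow> v - u < \<delta> \<Longrightarrow> \<bar>F v - F u - D * (v - u)\<bar> \<le> r / 2 * (v - u)"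
    using assms[OF half_gt_zero[OF r]] by blast
  have gt: "\<bar>(F v - F u) / (v - u) - D\<bar> < r" if "u \<le> x" "x \<le> v" "u < v" "v - u < \<delta>" for u v
  proof -
    have "\<bar>(F v - F u) / (v - u) - D\<bar> = \<bar>F v - F u - D * (v - u)\<bar> / (v - u)"
      using that by (simp add: divide_simps)
    also have "\<dots> \<le> r / 2" using \<delta>(2)[OF that] that by (simp add: divide_simps)
    finally show ?thesis using r by simp
  qed
  show "\<exists>s>0. \<forall>y. y \<noteq> x \<and> dist y x < s \<longrightarrow> dist ((F y - F x) / (y - x)) D < r"
  proof (intro exI[of _ \<delta>] conjI allI impI)
    fix y assume y: "y \<noteq> x \<and> dist y x < \<delta>"
    show "dist ((F y - F x) / (y - x)) D < r"
    proof (cases "x < y")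
      case True
      then show ?thesis using gt[of x y] y by (simp add: dist_real_def)
    next
      case False
      have "(F y - F x) / (y - x) = (F x - F y) / (x - y)" by (metis minus_diff_eq minus_divide_divide)
      then show ?thesis using gt[of y x] y False by (simp add: dist_real_def)
    qed
  qed (rule \<delta>)
qed

text \<open>Countably many compact intervals with rational end points have interiors covering
  \<open>I\<close>, so the exceptional null sets can be united.\<close>

lemma AE_open_from_intervals:
  fixes I :: "real set"
  assumes I: "open I" and P: "\<And>c d. \<lbrakk>c < d; {c..d} \<subseteq> I\<rbrakk> \<Longrightarrow> AE x in lborel. c < x \<and> x < d \<longrightarrow> P x"
  shows "AE x in lborel. x \<in> I \<longrightarrow> P x"
proof -
  have "AE x in lborel. \<forall>c\<in>\<rat>. \<forall>d\<in>\<rat>. c < d \<and> {c..d} \<subseteq> I \<longrightarrow> c < x \<and> x < d \<longrightarrow> P x"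
  proof (intro AE_ball_countable' countable_rat)
    fix c d :: real
    show "AE x in lborel. c < d \<and> {c..d} \<subseteq> I \<longrightarrow> c < x \<and> x < d \<longrightarrow> P x"
      using P[of c d] by (cases "c < d \<and> {c..d} \<subseteq> I") auto
  qed
  then show ?thesis
  proof eventually_elim
    case (elim x)
    show ?case
    proof
      assume "x \<in> I"
      then obtain e where e: "e > 0" "ball x e \<subseteq> I" using I open_contains_ball by blast
      obtain c where c: "c \<in> \<rat>" "x - e < c" "c < x" using Rats_dense_in_real[of "x - e" x] e by auto
      obtain d where d: "d \<in> \<rat>" "x < d" "d < x + e" using Rats_dense_in_real[of x "x + e"] e by auto
      have "{c..d} \<subseteq> ball x e" using c d by (auto simp: dist_real_def)
      then have "{c..d} \<subseteq> I" using e(2) by blast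
      then show "P x" using elim c d by (meson less_trans)
    qed
  qed
qed

text \<open>On a compact subinterval the integrand is cut off to an integrable function on the line,
  and its density points are points of differentiability of \<open>F\<close>.\<close>

lemma primitive_on_DERIV_AE:
  assumes I: "open I" and F: "primitive_on I g F"
  shows "AE x in lborel. x \<in> I \<longrightarrow> DERIV F x :> g x"
proof (rule AE_open_from_intervals[OF I])
  fix c d assume cd: "c < d" "{c..d} \<subseteq> I"
  define h where "h = (\<lambda>x. indicator {c..d} x * g x)"
  have hi: "integrable lborel h"
    using primitive_on_integrable[OF F cd(2)] by (simp add: set_integrable_def h_def)
  have hF: "(LBINT y:{u..v}. h y) = F v - F u" if "c \<le> u" "u \<le> v" "v \<le> d" for u v
  proof -
    have "F v - F u = (LBINT y:{u..v}. g y)" using cd that by (intro primitive_onD[OF F]) auto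
    also have "\<dots> = (LBINT y:{u..v}. h y)"
      using that by (intro set_lebesgue_integral_cong) (auto simp: h_def)
    finally show ?thesis by simp
  qed
  show "AE x in lborel. c < x \<and> x < d \<longrightarrow> DERIV F x :> g x"
    using lebesgue_density[OF hi]
  proof eventually_elim
    case (elim x)
    show ?case
    proof (intro impI DERIV_if_density)
      fix e :: real assume x: "c < x \<and> x < d" and e: "e > 0"
      obtain \<delta> where \<delta>: "\<delta> > 0" "\<And>u v. u \<le> x \<Longrightarrow> x \<le> v \<Longrightarrow> u < v \<Longrightarrow> v - u < \<delta> \<Longrightarrow>
           \<bar>(LBINT y:{u..v}. h y) - h x * (v - u)\<bar> \<le> e * (v - u)"
        using elim[rule_format, OF e] by blast
      show "\<exists>\<delta>>0. \<forall>u v. u \<le> x \<and> x \<le> v \<and> u < v \<and> v - u < \<delta> \<longrightarrow> \<bar>F v - F u - g x * (v - u)\<bar> \<le> e * (v - u)"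
      proof (intro exI[of _ "Min {\<delta>, x - c, d - x}"] conjI allI impI)
        fix u v assume uv: "u \<le> x \<and> x \<le> v \<and> u < v \<and> v - u < Min {\<delta>, x - c, d - x}"
        then have "c \<le> u" "v \<le> d" "v - u < \<delta>" by auto
        then show "\<bar>F v - F u - g x * (v - u)\<bar> \<le> e * (v - u)"
          using \<delta>(2)[of u v] hF[of u v] uv x by (simp add: h_def)
      qed (use \<delta> x in auto)
    qed
  qed
qed

text \<open>Continuity of \<open>g\<close> at the single point \<open>x\<close> suffices. This
  yields classical derivatives where the coefficients are continuous, and the derivative of the
  scale function everywhere.\<close>

lemma primitive_on_DERIV_cont:
  assumes I: "open I" and F: "primitive_on I g F" and x: "x \<in> I" and cont: "isCont g x"
  shows "DERIV F x :> g x"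
proof (rule DERIV_if_density)
  fix e :: real assume e: "e > 0"
  obtain d1 where d1: "d1 > 0" "ball x d1 \<subseteq> I" using I x open_contains_ball by blast
  obtain d2 where d2: "d2 > 0" "\<And>y. \<bar>y - x\<bar> < d2 \<Longrightarrow> \<bar>g y - g x\<bar> < e"
    using cont e unfolding continuous_at_eps_delta by (auto simp: dist_real_def)
  show "\<exists>\<delta>>0. \<forall>u v. u \<le> x \<and> x \<le> v \<and> u < v \<and> v - u < \<delta> \<longrightarrow> \<bar>F v - F u - g x * (v - u)\<bar> \<le> e * (v - u)"
  proof (intro exI[of _ "min d1 d2"] conjI allI impI)
    fix u v assume uv: "u \<le> x \<and> x \<le> v \<and> u < v \<and> v - u < min d1 d2"
    have "{u..v} \<subseteq> ball x d1" using uv by (auto simp: dist_real_def)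
    then have sub: "{u..v} \<subseteq> I" using d1 by blast
    note gi = primitive_on_integrable[OF F sub]
    have ci: "set_integrable lborel {u..v} (\<lambda>_. k :: real)" for k
      unfolding set_integrable_def using uv by (simp add: integrable_real_indicator)
    have "F v - F u - g x * (v - u) = (LBINT y:{u..v}. g y) - (LBINT y:{u..v}. g x)"
      using primitive_onD[OF F _ sub] uv by (simp add: set_lebesgue_integral_def)
    also have "\<dots> = (LBINT y:{u..v}. g y - g x)" using gi ci by (simp add: set_integral_diff)
    finally have eq: "F v - F u - g x * (v - u) = (LBINT y:{u..v}. g y - g x)" .
    have le: "(LBINT y:{u..v}. g y - g x) \<le> (LBINT y:{u..v}. e)"
      using d2(2) uv by (intro set_integral_mono set_integral_diff gi ci) (smt (verit) atLeastAtMost_iff)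
    have ge: "(LBINT y:{u..v}. - e) \<le> (LBINT y:{u..v}. g y - g x)"
      using d2(2) uv by (intro set_integral_mono set_integral_diff gi ci) (smt (verit) atLeastAtMost_iff)
    have "(LBINT y:{u..v}. k) = k * (v - u)" for k :: real using uv by (simp add: set_lebesgue_integral_def)
    then show "\<bar>F v - F u - g x * (v - u)\<bar> \<le> e * (v - u)" unfolding eq using le ge by (simp add: abs_le_iff)
  qed (use d1 d2 in auto)
qed

text \<open>The density \<open>g\<close> given by Radon-Nikodym is almost everywhere the derivative
  of \<open>f\<close>, hence equal to \<open>h\<close> by uniqueness of derivatives. Integrability
  of \<open>h\<close> is thus a conclusion; only its measurability is supplied.\<close>

lemma ac_on_FTC:
  assumes ac: "ac_on {c..d} f" and cd: "c \<le> d" and h: "set_borel_measurable lborel {c..d} h"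
    and D: "AE x in lborel. c < x \<and> x < d \<longrightarrow> DERIV f x :> h x"
  shows "set_integrable lborel {c..d} h \<and> f d - f c = (LBINT y:{c..d}. h y)"
proof -
  obtain g where g: "primitive_on {c..d} g f" using ac_on_primitive[OF ac cd] by blast
  have "primitive_on {c<..<d} g f" by (rule primitive_on_subset[OF g]) auto
  from primitive_on_DERIV_AE[OF _ this] have "AE x in lborel. x \<in> {c<..<d} \<longrightarrow> DERIV f x :> g x" by simp
  then have eq: "AE x in lborel. indicator {c..d} x *\<^sub>R g x = indicator {c..d} x *\<^sub>R h x"
    using D AE_lborel_singleton[of c] AE_lborel_singleton[of d]
  proof eventually_elim
    case (elim x)
    then show ?case by (cases "c < x \<and> x < d") (auto dest: DERIV_unique split: split_indicator)
  qed
  have gi: "integrable lborel (\<lambda>x. indicator {c..d} x *\<^sub>R g x)"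
    using primitive_on_integrable[OF g order_refl] by (simp add: set_integrable_def)
  then have gm: "(\<lambda>x. indicator {c..d} x *\<^sub>R g x) \<in> borel_measurable lborel" by (rule borel_measurable_integrable)
  have hm: "(\<lambda>x. indicator {c..d} x *\<^sub>R h x) \<in> borel_measurable lborel" using h by (simp add: set_borel_measurable_def)
  have "set_integrable lborel {c..d} h"
    using gi integrable_cong_AE[OF gm hm eq] by (simp add: set_integrable_def)
  moreover have "(LBINT y:{c..d}. h y) = (LBINT y:{c..d}. g y)"
    using integral_cong_AE[OF gm hm eq] by (simp add: set_lebesgue_integral_def)
  ultimately show ?thesis using primitive_onD[OF g cd order_refl] by simp
qed

lemma ac_loc_FTC:
  assumes ac: "ac_loc I f" and h: "\<And>c d. {c..d} \<subseteq> I \<Longrightarrow> set_borel_measurable lborel {c..d} h"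
    and D: "AE x in lborel. x \<in> I \<longrightarrow> DERIV f x :> h x"
  shows "primitive_on I h f"
proof -
  have *: "set_integrable lborel {c..d} h \<and> f d - f c = (LBINT y:{c..d}. h y)" if "c \<le> d" "{c..d} \<subseteq> I" for c d
  proof (rule ac_on_FTC)
    show "AE x in lborel. c < x \<and> x < d \<longrightarrow> DERIV f x :> h x"
      using D
    proof eventually_elim
      case (elim x)
      then show ?case using that(2) by (auto simp: subset_eq)
    qed
  qed (use ac h that in \<open>auto simp: ac_loc_def\<close>)
  show ?thesis unfolding primitive_on_def loc_integrable_def
  proof (intro conjI allI impI)
    fix c d assume "{c..d} \<subseteq> I"
    then show "set_integrable lborel {c..d} h" using *[of c d] by (cases "c \<le> d") auto
  qed (use * in blast)
qed

lemma ac_loc_DERIV_AE: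
  assumes I: "open I" and ac: "ac_loc I f"
  shows "AE x in lborel. x \<in> I \<longrightarrow> DERIV f x :> deriv f x"
proof (rule AE_open_from_intervals[OF I])
  fix c d assume cd: "c < d" "{c..d} \<subseteq> I"
  obtain g where g: "primitive_on {c..d} g f"
    using ac_on_primitive[of c d f] ac cd by (auto simp: ac_loc_def)
  have "primitive_on {c<..<d} g f" by (rule primitive_on_subset[OF g]) auto
  from primitive_on_DERIV_AE[OF open_greaterThanLessThan this]
  show "AE x in lborel. c < x \<and> x < d \<longrightarrow> DERIV f x :> deriv f x"
    by eventually_elim (auto simp: DERIV_imp_deriv)
qed

lemma measurable_restrict_set_borel:
  assumes "h \<in> borel_measurable (restrict_space borel I)" "{c..d} \<subseteq> I"
  shows "set_borel_measurable lborel {c..d} (h :: real \<Rightarrow> real)"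
proof -
  have "h \<in> borel_measurable (restrict_space borel {c..d})"
    by (rule measurable_restrict_mono[OF assms])
  then show ?thesis
    by (simp add: borel_measurable_restrict_space_iff set_borel_measurable_def)
qed

lemma ac_loc_primitive_deriv:
  assumes I: "open I" and ac: "ac_loc I f" and m: "deriv f \<in> borel_measurable (restrict_space borel I)"
  shows "primitive_on I (deriv f) f"
  by (rule ac_loc_FTC[OF ac measurable_restrict_set_borel[OF m] ac_loc_DERIV_AE[OF I ac]])

text \<open>Serves to replace an integrand known up to null sets by a continuous one, after which
  \<open>primitive_on_DERIV_cont\<close> gives pointwise statements.\<close>

lemma primitive_on_cong_AE:
  assumes I: "open I" and F: "primitive_on I g F" and h: "h \<in> borel_measurable (restrict_space borel I)"
    and eq: "AE x in lborel. x \<in> I \<longrightarrow> g x = h x"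
  shows "primitive_on I h F"
proof (rule ac_loc_FTC[OF primitive_on_ac_loc[OF F] measurable_restrict_set_borel[OF h]])
  show "AE x in lborel. x \<in> I \<longrightarrow> DERIV F x :> h x"
    using primitive_on_DERIV_AE[OF I F] eq by eventually_elim auto
qed

text \<open>The interval integral is oriented, so one formula covers points on both sides of
  \<open>x0\<close>; additivity over three arbitrary points gives the increments.\<close>

lemma primitive_on_interval_integral:
  assumes g: "loc_integrable I g" and x0: "x0 \<in> I" and I: "is_interval I"
  shows "primitive_on I g (\<lambda>x. LBINT z=ereal x0..ereal x. g z)"
  unfolding primitive_on_def
proof (intro conjI allI impI g)
  fix u v assume uv: "u \<le> v" "{u..v} \<subseteq> I"
  define c d where "c = min x0 u" and "d = max x0 v"
  have "c \<in> I" "d \<in> I" using uv x0 by (auto simp: c_def d_def min_def max_def)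
  then have "{c..d} \<subseteq> I" using I unfolding is_interval_1 by (meson atLeastAtMost_iff subsetI)
  then have gi: "set_integrable lborel {c..d} g" using g by (simp add: loc_integrable_def)
  have "set_integrable lborel (einterval c d) g"
    by (rule set_integrable_subset[OF gi]) auto
  moreover have "c \<le> d" using uv by (auto simp: c_def d_def)
  ultimately have "interval_lebesgue_integrable lborel (ereal c) (ereal d) g"
    by (simp add: interval_lebesgue_integrable_def)
  moreover have "min (ereal x0) (min (ereal u) (ereal v)) = ereal c" "max (ereal x0) (max (ereal u) (ereal v)) = ereal d"
    using uv by (auto simp: c_def d_def min_def max_def)
  ultimately have "(LBINT z=ereal x0..ereal u. g z) + (LBINT z=ereal u..ereal v. g z) = (LBINT z=ereal x0..ereal v. g z)"
    by (intro interval_integral_sum) simp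
  then show "(LBINT z=ereal x0..ereal v. g z) - (LBINT z=ereal x0..ereal u. g z) = (LBINT y:{u..v}. g y)"
    using interval_integral_Icc[of u v g] uv by simp
qed

lemma set_integrable_mult_continuous:
  fixes g k :: "real \<Rightarrow> real"
  assumes g: "set_integrable lborel {u..v} g" and k: "continuous_on {u..v} k"
  shows "set_integrable lborel {u..v} (\<lambda>x. g x * k x)"
proof -
  obtain B where B: "B \<ge> 0" "\<And>x. x \<in> {u..v} \<Longrightarrow> \<bar>k x\<bar> \<le> B" using continuous_on_Icc_bounded[OF k] by blast
  have "(\<lambda>x. indicator {u..v} x *\<^sub>R k x) \<in> borel_measurable borel"
    using borel_measurable_continuous_on_restrict[OF k] by (simp add: borel_measurable_restrict_space_iff)
  moreover have "(\<lambda>x. indicator {u..v} x *\<^sub>R g x) \<in> borel_measurable lborel" using g by (auto simp: set_integrable_def)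
  ultimately have "(\<lambda>x. (indicator {u..v} x *\<^sub>R g x) * (indicator {u..v} x *\<^sub>R k x)) \<in> borel_measurable lborel" by simp
  moreover have "(\<lambda>x. (indicator {u..v} x *\<^sub>R g x) * (indicator {u..v} x *\<^sub>R k x)) = (\<lambda>x. indicator {u..v} x *\<^sub>R (g x * k x))"
    by (auto split: split_indicator)
  ultimately have m: "(\<lambda>x. indicator {u..v} x *\<^sub>R (g x * k x)) \<in> borel_measurable lborel" by (simp only:)
  show ?thesis
    unfolding set_integrable_def
  proof (rule Bochner_Integration.integrable_bound[OF _ m])
    show "integrable lborel (\<lambda>x. B * (indicator {u..v} x *\<^sub>R g x))"
      using g by (intro integrable_mult_right) (simp add: set_integrable_def)
    show "AE x in lborel. norm (indicator {u..v} x *\<^sub>R (g x * k x)) \<le> norm (B * (indicator {u..v} x *\<^sub>R g x))"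
    proof (rule AE_I2)
      fix x
      have "\<bar>g x\<bar> * \<bar>k x\<bar> \<le> \<bar>g x\<bar> * B" if "x \<in> {u..v}" by (rule mult_left_mono[OF B(2)[OF that]]) simp
      then show "norm (indicator {u..v} x *\<^sub>R (g x * k x)) \<le> norm (B * (indicator {u..v} x *\<^sub>R g x))"
        using B(1) by (auto simp: abs_mult mult.commute split: split_indicator)
    qed
  qed
qed

section \<open>Test functions and the lemma of du Bois-Reymond\<close>

text \<open>The polynomial factor in \<open>1 / x\<close> makes the family closed under
  differentiation, so that smoothness at 0 needs one argument for all orders. The parameter
  \<epsilon> is later sent to 0, which turns the exponential into 1 on the positive axis.\<close>

definition flat :: "real \<Rightarrow> real poly \<Rightarrow> real \<Rightarrow> real" where
  "flat \<epsilon> p x = (if x > 0 then poly p (1 / x) * exp (- \<epsilon> / x) else 0)"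

lemma poly_exp_tendsto_0:
  fixes \<epsilon> :: real
  assumes \<epsilon>: "\<epsilon> > 0" shows "((\<lambda>y. poly p y * exp (- \<epsilon> * y)) \<longlongrightarrow> 0) at_top"
proof -
  have 1: "((\<lambda>y. coeff p i * (y ^ i * exp (- \<epsilon> * y))) \<longlongrightarrow> 0) at_top" for i
  proof -
    have "filterlim (\<lambda>y. \<epsilon> * y) at_top at_top"
      using filterlim_tendsto_pos_mult_at_top[of "\<lambda>_. \<epsilon>" \<epsilon> at_top "\<lambda>y. y"] \<epsilon>
      by (simp add: filterlim_ident)
    from filterlim_compose[OF tendsto_power_div_exp_0 this]
    have "((\<lambda>y. (\<epsilon> * y) ^ i / exp (\<epsilon> * y)) \<longlongrightarrow> 0) at_top" .
    from tendsto_mult_left[OF this, of "coeff p i / \<epsilon> ^ i"]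
    show ?thesis using \<epsilon> by (simp add: power_mult_distrib exp_minus field_simps)
  qed
  have "((\<lambda>y. \<Sum>i\<le>degree p. coeff p i * (y ^ i * exp (- \<epsilon> * y))) \<longlongrightarrow> (\<Sum>i\<le>degree p. 0)) at_top"
    by (intro tendsto_sum 1)
  then show ?thesis by (simp add: poly_altdef sum_distrib_right mult.assoc)
qed

lemma flat_tendsto_0: assumes "\<epsilon> > 0" shows "(flat \<epsilon> p \<longlongrightarrow> 0) (at_right 0)"
  unfolding filterlim_at_right_to_top
proof (rule Lim_transform_eventually[OF poly_exp_tendsto_0[OF assms]])
  show "\<forall>\<^sub>F y in at_top. poly p y * exp (- \<epsilon> * y) = flat \<epsilon> p (inverse y)"
    using eventually_gt_at_top[of "0::real"] by eventually_elim (simp add: flat_def divide_inverse)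
qed

text \<open>Differentiating \<open>p\<close> at \<open>1 / x\<close> brings the factor
  \<open>- 1 / x\<^sup>2\<close>, the exponential brings \<open>\<epsilon> / x\<^sup>2\<close>; the
  common factor is the monomial of degree 2. At 0 the quotient
  \<open>flat \<epsilon> p h / h\<close> is again of the form \<open>flat\<close> and tends to
  0.\<close>

lemma flat_DERIV:
  assumes \<epsilon>: "\<epsilon> > 0"
  shows "DERIV (flat \<epsilon> p) x :> flat \<epsilon> (monom 1 2 * (smult \<epsilon> p - pderiv p)) x"
proof (cases x "0::real" rule: linorder_cases)
  case less
  have "((\<lambda>_. 0) has_real_derivative 0) (at x)" by simp
  then have "(flat \<epsilon> p has_real_derivative 0) (at x)"
    by (rule has_field_derivative_transform_within_open[where S="{..<0}"]) (use less in \<open>auto simp: flat_def\<close>)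
  then show ?thesis using less by (simp add: flat_def)
next
  case equal
  have "((\<lambda>h. flat \<epsilon> p h / h) \<longlongrightarrow> 0) (at 0)"
    unfolding filterlim_at_split
  proof
    show "((\<lambda>h. flat \<epsilon> p h / h) \<longlongrightarrow> 0) (at_left 0)"
      by (intro tendsto_eventually) (auto simp: eventually_at_left_field flat_def intro: exI[of _ "-1"])
    show "((\<lambda>h. flat \<epsilon> p h / h) \<longlongrightarrow> 0) (at_right 0)"
    proof (rule Lim_transform_eventually[OF flat_tendsto_0[OF \<epsilon>, of "monom 1 1 * p"]])
      show "\<forall>\<^sub>F h in at_right 0. flat \<epsilon> (monom 1 1 * p) h = flat \<epsilon> p h / h"
        by (auto simp: eventually_at_right_field flat_def poly_monom intro: exI[of _ 1])
    qed
  qed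
  then show ?thesis using equal by (simp add: has_field_derivative_iff flat_def)
next
  case greater
  have "((\<lambda>x. poly p (1 / x) * exp (- \<epsilon> / x)) has_real_derivative
      poly (pderiv p) (1 / x) * (- 1 / x\<^sup>2) * exp (- \<epsilon> / x) + exp (- \<epsilon> / x) * (\<epsilon> / x\<^sup>2) * poly p (1 / x)) (at x)"
  proof (rule DERIV_mult)
    have "((\<lambda>x. 1 / x) has_real_derivative - 1 / x\<^sup>2) (at x)"
      using greater by (auto intro!: derivative_eq_intros simp: power2_eq_square)
    from DERIV_chain2[OF poly_DERIV this]
    show "((\<lambda>x. poly p (1 / x)) has_real_derivative poly (pderiv p) (1 / x) * (- 1 / x\<^sup>2)) (at x)" .
    have "((\<lambda>x. - \<epsilon> / x) has_real_derivative \<epsilon> / x\<^sup>2) (at x)"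
      using greater by (auto intro!: derivative_eq_intros simp: power2_eq_square)
    from DERIV_chain2[OF DERIV_exp this]
    show "((\<lambda>x. exp (- \<epsilon> / x)) has_real_derivative exp (- \<epsilon> / x) * (\<epsilon> / x\<^sup>2)) (at x)" .
  qed
  then have "((\<lambda>x. poly p (1 / x) * exp (- \<epsilon> / x)) has_real_derivative flat \<epsilon> (monom 1 2 * (smult \<epsilon> p - pderiv p)) x) (at x)"
    using greater by (simp add: flat_def poly_monom field_simps power2_eq_square)
  then show ?thesis
    by (rule has_field_derivative_transform_within_open[where S="{0<..}"]) (use greater in \<open>auto simp: flat_def\<close>)
qed

text \<open>Products of a \<open>flat\<close> function starting at \<open>a\<close> and a reflected
  one ending at \<open>a + \<tau>\<close>. Sums are included because the product rule produces them,
  which makes the set closed under differentiation.\<close>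

inductive_set bumps :: "real \<Rightarrow> real \<Rightarrow> (real \<Rightarrow> real) set" for \<epsilon> \<tau> where
  flat: "(\<lambda>x. flat \<epsilon> p (x - a) * flat \<epsilon> r (a + \<tau> - x)) \<in> bumps \<epsilon> \<tau>"
| add: "\<lbrakk>f \<in> bumps \<epsilon> \<tau>; g \<in> bumps \<epsilon> \<tau>\<rbrakk> \<Longrightarrow> (\<lambda>x. f x + g x) \<in> bumps \<epsilon> \<tau>"

lemma bumps_DERIV:
  assumes "\<epsilon> > 0" "f \<in> bumps \<epsilon> \<tau>" shows "\<exists>f'\<in>bumps \<epsilon> \<tau>. \<forall>x. DERIV f x :> f' x"
  using assms(2)
proof induction
  case (flat p a r)
  define q where "q = (\<lambda>p. monom 1 2 * (smult \<epsilon> p - pderiv p))"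
  have neg: "flat \<epsilon> (- s) y = - flat \<epsilon> s y" for s y by (simp add: flat_def)
  have "DERIV (\<lambda>x. flat \<epsilon> p (x - a) * flat \<epsilon> r (a + \<tau> - x)) x :>
      flat \<epsilon> (q p) (x - a) * flat \<epsilon> r (a + \<tau> - x) + flat \<epsilon> p (x - a) * flat \<epsilon> (- q r) (a + \<tau> - x)" for x
  proof -
    have d: "DERIV (\<lambda>x. x - a) x :> 1" "DERIV (\<lambda>x. a + \<tau> - x) x :> - 1" by (auto intro!: derivative_eq_intros)
    from DERIV_mult[OF DERIV_chain2[OF flat_DERIV[OF assms(1), of p] d(1)] DERIV_chain2[OF flat_DERIV[OF assms(1), of r] d(2)]]
    show ?thesis by (simp add: q_def neg mult.commute)
  qed
  then show ?case using bumps.add[OF bumps.flat bumps.flat] by fastforce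
next
  case (add f g)
  then obtain f' g' where "f' \<in> bumps \<epsilon> \<tau>" "\<forall>x. DERIV f x :> f' x" "g' \<in> bumps \<epsilon> \<tau>" "\<forall>x. DERIV g x :> g' x"
    by blast
  then show ?case by (intro bexI[of _ "\<lambda>x. f' x + g' x"]) (auto intro: bumps.add DERIV_add)
qed

text \<open>A set in which every member has a derivative that is again a member consists of smooth
  functions; no formula for higher derivatives is required.\<close>

lemma smooth_coinduct:
  fixes X :: "(real \<Rightarrow> real) set"
  assumes f: "f \<in> X" and X: "\<And>f. f \<in> X \<Longrightarrow> \<exists>f'\<in>X. \<forall>x. DERIV f x :> f' x"
  shows "(deriv ^^ k) f field_differentiable at x"
proof -
  have "(deriv ^^ k) f \<in> X"
  proof (induction k)
    case (Suc k)
    then obtain f' where f': "f' \<in> X" "\<forall>x. DERIV ((deriv ^^ k) f) x :> f' x" using X by blast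
    then have "deriv ((deriv ^^ k) f) = f'" by (auto intro: DERIV_imp_deriv)
    then show ?case using f' by simp
  qed (simp add: f)
  then show ?thesis using X by (metis field_differentiable_def)
qed

text \<open>A smooth approximation from below of the indicator of the open interval from 0 to
  \<tau>, attained in the limit as \<epsilon> tends to 0.\<close>

definition plateau :: "real \<Rightarrow> real \<Rightarrow> real \<Rightarrow> real" where
  "plateau \<epsilon> \<tau> x = flat \<epsilon> 1 x * flat \<epsilon> 1 (\<tau> - x)"

lemma plateau_bounds: "\<epsilon> > 0 \<Longrightarrow> 0 \<le> plateau \<epsilon> \<tau> x \<and> plateau \<epsilon> \<tau> x \<le> indicator {0<..<\<tau>} x"
  by (auto simp: plateau_def flat_def mult_le_one split: split_indicator)

lemma plateau_isCont: assumes \<epsilon>: "\<epsilon> > 0" shows "isCont (plateau \<epsilon> \<tau>) x"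
proof -
  have "isCont (flat \<epsilon> 1) y" for y using flat_DERIV[OF \<epsilon>] DERIV_isCont by blast
  then show ?thesis unfolding plateau_def by (intro continuous_intros isCont_o2[of _ "\<lambda>x. \<tau> - x" "flat \<epsilon> 1"]) auto
qed

lemma plateau_tendsto: "(\<lambda>n. plateau (1 / real (Suc n)) \<tau> x) \<longlonglongrightarrow> indicator {0<..<\<tau>} x"
proof (cases "x \<in> {0<..<\<tau>}")
  case True
  have "(\<lambda>n. exp (- (1 / real (Suc n)) / x) * exp (- (1 / real (Suc n)) / (\<tau> - x))) \<longlonglongrightarrow> exp (- 0 / x) * exp (- 0 / (\<tau> - x))"
    by (intro tendsto_intros LIMSEQ_Suc lim_1_over_n) (use True in auto)
  then show ?thesis using True by (simp add: plateau_def flat_def)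
qed (auto simp: plateau_def flat_def)

text \<open>A bump and its translate have equal integrals, so the primitive of their difference
  vanishes on both sides of \<open>{a..b + \<tau>}\<close> and is a test function.\<close>

lemma test_function_exists:
  assumes \<epsilon>: "\<epsilon> > 0" and \<tau>: "\<tau> > 0" and ab: "a \<le> b" and J: "{a..b + \<tau>} \<subseteq> J"
  shows "\<exists>\<phi>\<in>test_functions J. \<forall>x. deriv \<phi> x = plateau \<epsilon> \<tau> (x - a) - plateau \<epsilon> \<tau> (x - b)"
proof -
  note cont = plateau_isCont[OF \<epsilon>]
  have int: "loc_integrable UNIV (plateau \<epsilon> \<tau>)"
    unfolding loc_integrable_def
    using cont by (auto intro!: borel_integrable_atLeastAtMost' continuous_at_imp_continuous_on)
  define F where "F = (\<lambda>x. LBINT z=ereal 0..ereal x. plateau \<epsilon> \<tau> z)"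
  have "primitive_on UNIV (plateau \<epsilon> \<tau>) F"
    unfolding F_def by (rule primitive_on_interval_integral[OF int]) auto
  then have F: "DERIV F x :> plateau \<epsilon> \<tau> x" for x
    by (intro primitive_on_DERIV_cont[OF open_UNIV _ UNIV_I cont])
  have F0: "F x = F 0" if "x \<le> 0" for x
  proof (cases "x = 0")
    case False
    show ?thesis
      by (rule DERIV_isconst_end[symmetric]) (use that False F plateau_bounds[OF \<epsilon>, of \<tau>] in
          \<open>auto intro!: DERIV_continuous_on[of _ F] has_field_derivative_at_within[OF F] intro: DERIV_cong[OF F] simp: plateau_def flat_def\<close>)
  qed simp
  have F1: "F x = F \<tau>" if "x \<ge> \<tau>" for x
  proof (cases "x = \<tau>")
    case False
    show ?thesis
      by (rule DERIV_isconst_end) (use that False F plateau_bounds[OF \<epsilon>, of \<tau>] in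
          \<open>auto intro!: DERIV_continuous_on[of _ F] has_field_derivative_at_within[OF F] intro: DERIV_cong[OF F] simp: plateau_def flat_def\<close>)
  qed simp
  define \<phi> where "\<phi> = (\<lambda>x. F (x - a) - F (x - b))"
  \<comment> \<open>The minus sign is absorbed into the polynomial \<open>- 1\<close>, since
    \<open>bumps\<close> is built with sums only.\<close>
  define \<phi>' where "\<phi>' = (\<lambda>x. flat \<epsilon> 1 (x - a) * flat \<epsilon> 1 (a + \<tau> - x) + flat \<epsilon> 1 (x - b) * flat \<epsilon> (- 1) (b + \<tau> - x))"
  have \<phi>'eq: "\<phi>' x = plateau \<epsilon> \<tau> (x - a) - plateau \<epsilon> \<tau> (x - b)" for x
    by (simp add: \<phi>'_def plateau_def flat_def algebra_simps)
  have D: "DERIV \<phi> x :> \<phi>' x" for x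
  proof -
    have "DERIV (\<lambda>x. x - c) x :> 1" for c :: real by (auto intro!: derivative_eq_intros)
    from DERIV_diff[OF DERIV_chain2[OF F this[of a]] DERIV_chain2[OF F this[of b]]]
    show ?thesis by (simp add: \<phi>_def \<phi>'eq)
  qed
  have "\<phi>' \<in> bumps \<epsilon> \<tau>" unfolding \<phi>'_def by (intro bumps.intros)
  then have "(deriv ^^ k) \<phi> field_differentiable at x" for k x
    using D bumps_DERIV[OF \<epsilon>, of _ \<tau>] by (intro smooth_coinduct[of _ "insert \<phi> (bumps \<epsilon> \<tau>)"]) blast+
  moreover have "\<phi> x = 0" if "x \<notin> {a..b + \<tau>}" for x
    using that ab \<tau> F0[of "x - a"] F0[of "x - b"] F1[of "x - a"] F1[of "x - b"] by (auto simp: \<phi>_def not_le)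
  ultimately have "\<phi> \<in> test_functions J"
    unfolding test_functions_def using J by (auto intro!: exI[of _ "{a..b + \<tau>}"])
  moreover have "deriv \<phi> x = \<phi>' x" for x using D by (rule DERIV_imp_deriv)
  ultimately show ?thesis using \<phi>'eq by auto
qed

text \<open>Testing with \<epsilon> = \<open>1 / Suc n\<close> and letting \<open>n\<close> grow
  turns the smooth weights into the difference of two indicators, by dominated convergence with
  majorant \<open>\<bar>g x\<bar>\<close>.\<close>

lemma du_bois_reymond_shift:
  assumes h: "loc_integrable J h" and \<tau>: "\<tau> > 0" and ab: "a \<le> b" and J: "{a..b + \<tau>} \<subseteq> J"
    and orth: "\<And>\<phi>. \<phi> \<in> test_functions J \<Longrightarrow> (LBINT x:J. h x * deriv \<phi> x) = 0"
  shows "(LBINT x:{a..a + \<tau>}. h x) = (LBINT x:{b..b + \<tau>}. h x)"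
proof -
  define g where "g = (\<lambda>x. indicator {a..b + \<tau>} x * h x)"
  have gi: "integrable lborel g"
    using h J unfolding loc_integrable_def g_def set_integrable_def by auto
  define P where "P = (\<lambda>n x. g x * (plateau (1 / real (Suc n)) \<tau> (x - a) - plateau (1 / real (Suc n)) \<tau> (x - b)))"
  have "(LINT x|lborel. P n x) = 0" for n
  proof -
    obtain \<phi> where \<phi>: "\<phi> \<in> test_functions J" "\<And>x. deriv \<phi> x = plateau (1 / real (Suc n)) \<tau> (x - a) - plateau (1 / real (Suc n)) \<tau> (x - b)"
      using test_function_exists[OF _ \<tau> ab J, of "1 / real (Suc n)"] by auto
    have "P n x = indicator J x *\<^sub>R (h x * deriv \<phi> x)" for x
    proof (cases "x \<in> {a..b + \<tau>}")
      case False
      then have "plateau (1 / real (Suc n)) \<tau> (x - a) = 0" "plateau (1 / real (Suc n)) \<tau> (x - b) = 0"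
        using plateau_bounds[of "1 / real (Suc n)" \<tau>] ab \<tau> by (auto simp: plateau_def flat_def)
      then show ?thesis by (simp add: P_def \<phi>(2))
    qed (use J in \<open>auto simp: P_def g_def \<phi>(2)\<close>)
    then show ?thesis using orth[OF \<phi>(1)] by (simp add: set_lebesgue_integral_def)
  qed
  moreover have "(\<lambda>n. LINT x|lborel. P n x) \<longlonglongrightarrow> (LINT x|lborel. g x * (indicator {a<..<a + \<tau>} x - indicator {b<..<b + \<tau>} x))"
  proof (rule integral_dominated_convergence[where w="\<lambda>x. \<bar>g x\<bar>"])
    have [measurable]: "g \<in> borel_measurable borel" using gi by auto
    have [measurable]: "plateau (1 / real (Suc n)) \<tau> \<in> borel_measurable borel" for n
      by (intro borel_measurable_continuous_onI continuous_at_imp_continuous_on ballI plateau_isCont) simp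
    show "(\<lambda>x. g x * (indicator {a<..<a + \<tau>} x - indicator {b<..<b + \<tau>} x)) \<in> borel_measurable lborel" by measurable
    show "P n \<in> borel_measurable lborel" for n unfolding P_def by measurable
    show "integrable lborel (\<lambda>x. \<bar>g x\<bar>)" using gi by simp
    have ind: "indicator {0<..<\<tau>} (x - c) = (indicator {c<..<c + \<tau>} x :: real)" for x c
      by (auto split: split_indicator)
    show "AE x in lborel. (\<lambda>n. P n x) \<longlonglongrightarrow> g x * (indicator {a<..<a + \<tau>} x - indicator {b<..<b + \<tau>} x)"
      unfolding P_def ind[symmetric] by (intro AE_I2 tendsto_intros plateau_tendsto)
    show "AE x in lborel. norm (P n x) \<le> \<bar>g x\<bar>" for n
    proof (rule AE_I2)
      fix x
      have "0 \<le> plateau (1 / real (Suc n)) \<tau> y \<and> plateau (1 / real (Suc n)) \<tau> y \<le> 1" for y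
        using plateau_bounds[of "1 / real (Suc n)" \<tau> y] by (auto split: split_indicator_asm)
      from this[of "x - a"] this[of "x - b"]
      have "\<bar>plateau (1 / real (Suc n)) \<tau> (x - a) - plateau (1 / real (Suc n)) \<tau> (x - b)\<bar> \<le> 1" by linarith
      then show "norm (P n x) \<le> \<bar>g x\<bar>" by (simp add: P_def abs_mult mult_left_le)
    qed
  qed
  ultimately have "(LINT x|lborel. g x * (indicator {a<..<a + \<tau>} x - indicator {b<..<b + \<tau>} x)) = 0"
    using LIMSEQ_unique[of "\<lambda>_. 0::real"] by auto
  moreover have "integrable lborel (\<lambda>x. g x * indicator {c<..<c + \<tau>} x)" for c
    using integrable_mult_indicator[OF _ gi, of "{c<..<c + \<tau>}"] by (simp add: mult.commute)
  ultimately have "(LINT x|lborel. g x * indicator {a<..<a + \<tau>} x) = (LINT x|lborel. g x * indicator {b<..<b + \<tau>} x)"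
    by (simp add: right_diff_distrib)
  moreover have "(LINT x|lborel. g x * indicator {c<..<c + \<tau>} x) = (LBINT x:{c..c + \<tau>}. h x)" if "a \<le> c" "c \<le> b" for c
  proof -
    have "(LINT x|lborel. g x * indicator {c<..<c + \<tau>} x) = (LBINT x:{c<..<c + \<tau>}. h x)"
      unfolding set_lebesgue_integral_def
      by (intro Bochner_Integration.integral_cong) (use that in \<open>auto simp: g_def split: split_indicator\<close>)
    then show ?thesis using \<tau> by (simp add: integral_Icc_Ioo)
  qed
  ultimately show ?thesis using ab by simp
qed

text \<open>A primitive \<open>F\<close> of \<open>h\<close> has equal increments over translated
  intervals. Dividing by their length, which tends to 0, gives the same derivative at all points
  where \<open>F\<close> has derivative \<open>h\<close>, that is, almost everywhere.\<close>

lemma du_bois_reymond: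
  assumes J: "open J" "is_interval J" "J \<noteq> {}" and h: "loc_integrable J h"
    and orth: "\<And>\<phi>. \<phi> \<in> test_functions J \<Longrightarrow> (LBINT x:J. h x * deriv \<phi> x) = 0"
  shows "\<exists>k. AE x in lborel. x \<in> J \<longrightarrow> h x = k"
proof -
  obtain y0 where "y0 \<in> J" using J by blast
  define F where "F = (\<lambda>x. LBINT z=ereal y0..ereal x. h z)"
  have F: "primitive_on J h F"
    unfolding F_def by (rule primitive_on_interval_integral[OF h \<open>y0 \<in> J\<close> J(2)])
  note ae = primitive_on_DERIV_AE[OF J(1) F]
  \<comment> \<open>One reference point is needed to name the constant; it exists since a nonempty
    open set is not negligible.\<close>
  have "\<exists>x0\<in>J. DERIV F x0 :> h x0"
  proof (rule ccontr)
    assume "\<not> ?thesis"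
    with ae have "AE x in lborel. x \<notin> J" by (auto elim!: eventually_mono)
    then have "J \<in> null_sets lborel" using J(1) by (auto simp: AE_iff_null_sets)
    then have "negligible J" using J(1) by (simp add: negligible_iff_null_sets null_sets_completionI)
    then show False using J open_not_negligible by blast
  qed
  then obtain x0 where x0: "x0 \<in> J" "DERIV F x0 :> h x0" by blast
  have shift: "F (x + \<tau>) - F x = F (y + \<tau>) - F y" if "\<tau> > 0" "x \<in> J" "y + \<tau> \<in> J" "x \<le> y" for x y \<tau>
  proof -
    have sub: "{x..y + \<tau>} \<subseteq> J" using that J(2) unfolding is_interval_1 by (meson atLeastAtMost_iff subsetI)
    have "F (x + \<tau>) - F x = (LBINT z:{x..x + \<tau>}. h z)" "F (y + \<tau>) - F y = (LBINT z:{y..y + \<tau>}. h z)"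
      using that sub by (auto intro!: primitive_onD[OF F])
    then show ?thesis using du_bois_reymond_shift[OF h that(1,4) sub orth] by simp
  qed
  have "h x = h x0" if x: "x \<in> J" "DERIV F x :> h x" for x
  proof -
    obtain e where e: "e > 0" "ball x e \<subseteq> J" using J x open_contains_ball by blast
    obtain e0 where e0: "e0 > 0" "ball x0 e0 \<subseteq> J" using J x0 open_contains_ball by blast
    have lim: "((\<lambda>\<tau>. (F (z + \<tau>) - F z) / \<tau>) \<longlongrightarrow> h z) (at_right 0)" if "DERIV F z :> h z" for z
      using that unfolding DERIV_def by (auto intro: filterlim_mono at_le)
    have ev: "\<forall>\<^sub>F \<tau> in at_right 0. (F (x + \<tau>) - F x) / \<tau> = (F (x0 + \<tau>) - F x0) / \<tau>"
      unfolding eventually_at_right_field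
    proof (intro exI[of _ "min e e0"] conjI allI impI)
      fix \<tau> :: real assume \<tau>: "0 < \<tau>" "\<tau> < min e e0"
      then have "x + \<tau> \<in> ball x e" "x0 + \<tau> \<in> ball x0 e0" by (auto simp: dist_real_def)
      then have mem: "x + \<tau> \<in> J" "x0 + \<tau> \<in> J" using e e0 by auto
      have "F (x + \<tau>) - F x = F (x0 + \<tau>) - F x0"
      proof (cases "x \<le> x0")
        case True
        show ?thesis by (rule shift[OF \<tau>(1) x(1) mem(2) True])
      next
        case False
        then show ?thesis by (intro shift[OF \<tau>(1) x0(1) mem(1), symmetric]) simp
      qed
      then show "(F (x + \<tau>) - F x) / \<tau> = (F (x0 + \<tau>) - F x0) / \<tau>" by simp
    qed (use e e0 in auto)
    show ?thesis
      by (rule tendsto_unique[OF _ Lim_transform_eventually[OF lim[OF x(2)] ev] lim[OF x0(2)]]) simp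
  qed
  then have "AE x in lborel. x \<in> J \<longrightarrow> h x = h x0" using ae by (auto elim!: eventually_mono)
  then show ?thesis by blast
qed

lemma compact_in_interval:
  fixes J :: "real set"
  assumes "compact K" "K \<subseteq> J" "is_interval J" "J \<noteq> {}"
  obtains c d where "c \<le> d" "K \<subseteq> {c..d}" "{c..d} \<subseteq> J"
proof (cases "K = {}")
  case True
  then show ?thesis using that assms(4) by (metis atLeastAtMost_singleton_iff empty_subsetI ex_in_conv order_refl singletonD subsetI)
next
  case False
  obtain c where c: "c \<in> K" "\<forall>x\<in>K. c \<le> x" using compact_attains_inf[OF assms(1) False] by blast
  obtain d where d: "d \<in> K" "\<forall>x\<in>K. x \<le> d" using compact_attains_sup[OF assms(1) False] by blast
  have "{c..d} \<subseteq> J" using assms(2,3) c(1) d(1) unfolding is_interval_1 by (meson atLeastAtMost_iff subset_iff)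
  then show ?thesis using c d by (intro that[of c d]) auto
qed

text \<open>Integration by parts shows that \<open>c\<close> minus a primitive of \<open>G\<close>
  is orthogonal to all derivatives of test functions, hence almost everywhere constant.\<close>

lemma weak_derivative_primitive:
  assumes J: "open J" "is_interval J" "J \<noteq> {}" and c: "loc_integrable J c" and G: "loc_integrable J G"
    and weak: "\<And>\<phi>. \<phi> \<in> test_functions J \<Longrightarrow> (LBINT x:J. c x * deriv \<phi> x) = - (LBINT x:J. G x * \<phi> x)"
  shows "\<exists>D. primitive_on J G D \<and> (AE x in lborel. x \<in> J \<longrightarrow> c x = D x)"
proof -
  obtain y0 where "y0 \<in> J" using J by blast
  define F where "F = (\<lambda>x. LBINT z=ereal y0..ereal x. G z)"
  have F: "primitive_on J G F"
    unfolding F_def by (rule primitive_on_interval_integral[OF G \<open>y0 \<in> J\<close> J(2)])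
  have acF: "ac_loc J F" by (rule primitive_on_ac_loc[OF F])
  have Fint: "set_integrable lborel {u..v} F" if "{u..v} \<subseteq> J" for u v
    using ac_on_continuous_on acF that by (intro borel_integrable_atLeastAtMost') (auto simp: ac_loc_def)
  have h: "loc_integrable J (\<lambda>x. c x - F x)"
    using c Fint by (auto simp: loc_integrable_def intro!: set_integral_diff)
  have "\<exists>k. AE x in lborel. x \<in> J \<longrightarrow> c x - F x = k"
  proof (rule du_bois_reymond[OF J h])
    fix \<phi> assume \<phi>: "\<phi> \<in> test_functions J"
    then obtain K where K: "compact K" "K \<subseteq> J" "\<And>x. x \<notin> K \<Longrightarrow> \<phi> x = 0" by (auto simp: test_functions_def)
    have sm: "\<And>k x. (deriv ^^ k) \<phi> field_differentiable at x" using \<phi> by (auto simp: test_functions_def)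
    have D\<phi>: "DERIV \<phi> x :> deriv \<phi> x" for x using sm[of 0 x] by (simp add: DERIV_deriv_iff_field_differentiable)
    have D\<phi>': "isCont (deriv \<phi>) x" for x
      using sm[of 1 x] by (simp add: field_differentiable_imp_continuous_at)
    have \<phi>'0: "deriv \<phi> x = 0" if "x \<notin> K" for x
    proof -
      have "((\<lambda>_. 0) has_real_derivative 0) (at x)" by simp
      then have "(\<phi> has_real_derivative 0) (at x)"
        by (rule has_field_derivative_transform_within_open[where S="- K"])
          (use that K(3) compact_imp_closed[OF K(1)] in \<open>auto simp: open_closed\<close>)
      then show ?thesis by (rule DERIV_imp_deriv)
    qed
    obtain u v where uv: "u \<le> v" "K \<subseteq> {u..v}" "{u..v} \<subseteq> J" using compact_in_interval[OF K(1,2) J(2,3)] by blast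
    obtain e where e: "e > 0" "ball u e \<subseteq> J" using J(1) uv open_contains_ball by (metis atLeastAtMost_iff order_refl subsetD)
    \<comment> \<open>The end points \<open>u'\<close> and \<open>v'\<close> are moved off the
      support of \<phi> but kept in \<open>J\<close>, so that the boundary terms of the integration
      by parts vanish.\<close>
    define u' where "u' = u - e / 2"
    have "u' < u" using e by (simp add: u'_def)
    moreover from this have "u' \<notin> K" using uv(2) by force
    ultimately have u': "u' < u" "u' \<notin> K" "\<phi> u' = 0" using K(3) by auto
    have sub': "{u'..v} \<subseteq> J"
    proof -
      have "u' \<in> J" using e by (auto simp: u'_def dist_real_def)
      moreover have "v \<in> J" using uv by auto
      ultimately show ?thesis using J(2) unfolding is_interval_1 by (meson atLeastAtMost_iff subsetI)
    qed
    obtain e2 where e2: "e2 > 0" "ball v e2 \<subseteq> J" using J(1) uv open_contains_ball by (metis atLeastAtMost_iff order_refl subsetD)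
    define v' where "v' = v + e2 / 2"
    have "v < v'" using e2 by (simp add: v'_def)
    moreover from this have "v' \<notin> K" using uv(2) by force
    ultimately have v': "v < v'" "v' \<notin> K" "\<phi> v' = 0" using K(3) by auto
    have sub: "{u'..v'} \<subseteq> J"
    proof -
      have "v' \<in> J" using e2 by (auto simp: v'_def dist_real_def)
      moreover have "u' \<in> J" using sub' u'(1) uv(1) by auto
      ultimately show ?thesis using J(2) unfolding is_interval_1 by (meson atLeastAtMost_iff subsetI)
    qed
    have K': "K \<subseteq> {u'..v'}" using uv(2) u' v' by auto
    have red: "(LBINT x:J. f x) = (LBINT x:{u'..v'}. f x)" if f0: "\<And>x. x \<notin> K \<Longrightarrow> f x = 0" for f :: "real \<Rightarrow> real"
      unfolding set_lebesgue_integral_def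
    proof (intro Bochner_Integration.integral_cong refl)
      fix x
      show "indicator J x *\<^sub>R f x = indicator {u'..v'} x *\<^sub>R f x"
        using sub K' f0[of x] by (cases "x \<in> K") (auto simp: subset_eq split: split_indicator)
    qed
    have "continuous_on {u'..v'} \<phi>" "continuous_on {u'..v'} (deriv \<phi>)"
      using D\<phi> D\<phi>' by (auto intro!: continuous_at_imp_continuous_on intro: DERIV_isCont)
    note cts = set_integrable_mult_continuous[OF _ this(1)] set_integrable_mult_continuous[OF _ this(2)]
    note G\<phi> = cts(1)[OF G[unfolded loc_integrable_def, rule_format, OF sub]]
    note F\<phi>' = cts(2)[OF Fint[OF sub]] and c\<phi>' = cts(2)[OF c[unfolded loc_integrable_def, rule_format, OF sub]]
    have ac: "ac_on {u'..v'} (\<lambda>x. F x * \<phi> x)"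
    proof (rule ac_on_mult)
      show "ac_on {u'..v'} F" using acF sub by (simp add: ac_loc_def)
      show "ac_on {u'..v'} \<phi>"
        by (rule ac_on_C1[OF D\<phi>]) (simp add: D\<phi>' continuous_at_imp_continuous_on)
    qed
    have sumint: "set_integrable lborel {u'..v'} (\<lambda>x. G x * \<phi> x + F x * deriv \<phi> x)"
      using G\<phi> F\<phi>' by (rule set_integral_add)
    have "F v' * \<phi> v' - F u' * \<phi> u' = (LBINT x:{u'..v'}. G x * \<phi> x + F x * deriv \<phi> x)"
    proof (rule conjunct2[OF ac_on_FTC[OF ac]])
      show "set_borel_measurable lborel {u'..v'} (\<lambda>x. G x * \<phi> x + F x * deriv \<phi> x)"
        using sumint by (auto simp: set_integrable_def set_borel_measurable_def)
      show "AE x in lborel. u' < x \<and> x < v' \<longrightarrow> DERIV (\<lambda>x. F x * \<phi> x) x :> G x * \<phi> x + F x * deriv \<phi> x"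
        using primitive_on_DERIV_AE[OF J(1) F]
      proof eventually_elim
        case (elim x)
        then show ?case using sub DERIV_mult[OF _ D\<phi>, of F "G x" x] by (auto simp: mult.commute subset_eq)
      qed
    qed (use u' v' uv in auto)
    then have "(LBINT x:{u'..v'}. F x * deriv \<phi> x) = - (LBINT x:{u'..v'}. G x * \<phi> x)"
      using u' v' G\<phi> F\<phi>' by (simp add: set_integral_add)
    moreover have "(LBINT x:{u'..v'}. c x * deriv \<phi> x) = - (LBINT x:{u'..v'}. G x * \<phi> x)"
      using weak[OF \<phi>] red[of "\<lambda>x. c x * deriv \<phi> x"] red[of "\<lambda>x. G x * \<phi> x"] K(3) \<phi>'0 by simp
    ultimately have "(LBINT x:{u'..v'}. c x * deriv \<phi> x - F x * deriv \<phi> x) = 0"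
      using c\<phi>' F\<phi>' by (simp add: set_integral_diff)
    then show "(LBINT x:J. (c x - F x) * deriv \<phi> x) = 0"
      using red[of "\<lambda>x. (c x - F x) * deriv \<phi> x"] \<phi>'0 by (simp add: left_diff_distrib)
  qed
  then obtain k where k: "AE x in lborel. x \<in> J \<longrightarrow> c x - F x = k" by blast
  have "primitive_on J G (\<lambda>x. F x + k)" using F by (simp add: primitive_on_def)
  moreover have "AE x in lborel. x \<in> J \<longrightarrow> c x = F x + k" using k by (auto elim!: eventually_mono simp: algebra_simps)
  ultimately show ?thesis by blast
qed

section \<open>The Hilbert space of square integrable functions on the line\<close>

lemma L2_measurable: "f \<in> L2 M \<Longrightarrow> f \<in> borel_measurable M"
  and L2_square: "f \<in> L2 M \<Longrightarrow> integrable M (\<lambda>x. (f x)\<^sup>2)"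
  by (auto simp: L2_def)

lemma L2_mult_integrable:
  assumes "f \<in> L2 M" "g \<in> L2 M" shows "integrable M (\<lambda>x. f x * g x)"
proof (rule Bochner_Integration.integrable_bound)
  show "integrable M (\<lambda>x. (f x)\<^sup>2 + (g x)\<^sup>2)" using assms by (intro Bochner_Integration.integrable_add) (auto simp: L2_def)
  show "(\<lambda>x. f x * g x) \<in> borel_measurable M" using assms by (auto simp: L2_def)
  show "AE x in M. norm (f x * g x) \<le> norm ((f x)\<^sup>2 + (g x)\<^sup>2)"
  proof (rule AE_I2)
    fix x
    have "2 * (\<bar>f x\<bar> * \<bar>g x\<bar>) \<le> (f x)\<^sup>2 + (g x)\<^sup>2"
      using sum_squares_bound[of "\<bar>f x\<bar>" "\<bar>g x\<bar>"] by (simp add: mult.assoc)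
    moreover have "0 \<le> \<bar>f x\<bar> * \<bar>g x\<bar>" by simp
    ultimately have "\<bar>f x\<bar> * \<bar>g x\<bar> \<le> (f x)\<^sup>2 + (g x)\<^sup>2" by linarith
    then show "norm (f x * g x) \<le> norm ((f x)\<^sup>2 + (g x)\<^sup>2)" by (simp add: abs_mult)
  qed
qed

lemma L2_lincomb: assumes "f \<in> L2 M" "g \<in> L2 M" shows "(\<lambda>x. c * f x + g x) \<in> L2 M"
proof -
  have "integrable M (\<lambda>x. c\<^sup>2 * (f x)\<^sup>2 + 2 * c * (f x * g x) + (g x)\<^sup>2)"
    using assms by (intro Bochner_Integration.integrable_add integrable_mult_right L2_mult_integrable L2_square)
  moreover have "c\<^sup>2 * (f x)\<^sup>2 + 2 * c * (f x * g x) + (g x)\<^sup>2 = (c * f x + g x)\<^sup>2" for x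
    by (simp add: power2_eq_square algebra_simps)
  ultimately show ?thesis
    using L2_measurable[OF assms(1)] L2_measurable[OF assms(2)] by (simp add: L2_def)
qed

lemma L2_zero [simp]: "(\<lambda>x. 0) \<in> L2 M" by (simp add: L2_def)

lemma L2_add: "f \<in> L2 M \<Longrightarrow> g \<in> L2 M \<Longrightarrow> (\<lambda>x. f x + g x) \<in> L2 M"
  using L2_lincomb[of f M g 1] by simp

lemma L2_scale: "f \<in> L2 M \<Longrightarrow> (\<lambda>x. c * f x) \<in> L2 M"
  using L2_lincomb[of f M "\<lambda>_. 0" c] by simp

lemma L2_diff: "f \<in> L2 M \<Longrightarrow> g \<in> L2 M \<Longrightarrow> (\<lambda>x. f x - g x) \<in> L2 M"
  using L2_lincomb[of g M f "-1"] by (simp add: algebra_simps)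

lemma inner_L2_cong:
  assumes "f \<in> L2 M" "f' \<in> L2 M" "g \<in> L2 M" "g' \<in> L2 M" "eq_ae M f f'" "eq_ae M g g'"
  shows "inner_L2 M f g = inner_L2 M f' g'"
  unfolding inner_L2_def
proof (rule integral_cong_AE)
  show "AE x in M. f x * g x = f' x * g' x"
    using assms(5,6) unfolding eq_ae_def by eventually_elim simp
qed (use assms in \<open>auto simp: L2_def\<close>)

lemma inner_L2_commute: "inner_L2 M f g = inner_L2 M g f"
  by (simp add: inner_L2_def mult.commute)

lemma inner_L2_lincomb:
  "f \<in> L2 M \<Longrightarrow> g \<in> L2 M \<Longrightarrow> h \<in> L2 M \<Longrightarrow> inner_L2 M (\<lambda>x. c * f x + g x) h = c * inner_L2 M f h + inner_L2 M g h"
  unfolding inner_L2_def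
  by (simp add: distrib_right mult.assoc L2_mult_integrable Bochner_Integration.integral_add)

text \<open>A partial equivalence: functions that are not square integrable are related to nothing,
  so the quotient consists of the classes of square integrable functions only.\<close>

definition l2_rel :: "(real \<Rightarrow> real) \<Rightarrow> (real \<Rightarrow> real) \<Rightarrow> bool" where
  "l2_rel f g \<longleftrightarrow> f \<in> L2 lborel \<and> g \<in> L2 lborel \<and> eq_ae lborel f g"

lemma l2_rel_part_equivp: "part_equivp l2_rel"
proof (rule part_equivpI)
  show "\<exists>f. l2_rel f f" by (auto simp: l2_rel_def eq_ae_def intro: exI[of _ "\<lambda>_. 0"])
  show "symp l2_rel" by (auto simp: symp_def l2_rel_def eq_ae_def eq_commute)
  show "transp l2_rel"
  proof (rule transpI)
    fix f g h assume "l2_rel f g" "l2_rel g h"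
    then show "l2_rel f h" unfolding l2_rel_def eq_ae_def by (auto elim: AE_mp)
  qed
qed

quotient_type l2 = "real \<Rightarrow> real" / partial: l2_rel
  by (rule l2_rel_part_equivp)

instantiation l2 :: real_inner
begin

lift_definition zero_l2 :: l2 is "\<lambda>_. 0" by (simp add: l2_rel_def eq_ae_def)

lift_definition plus_l2 :: "l2 \<Rightarrow> l2 \<Rightarrow> l2" is "\<lambda>f g x. f x + g x"
  unfolding l2_rel_def eq_ae_def by (auto intro: L2_add elim: AE_mp)

lift_definition minus_l2 :: "l2 \<Rightarrow> l2 \<Rightarrow> l2" is "\<lambda>f g x. f x - g x"
  unfolding l2_rel_def eq_ae_def by (auto intro: L2_diff elim: AE_mp)

lift_definition uminus_l2 :: "l2 \<Rightarrow> l2" is "\<lambda>f x. - f x"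
  using L2_scale[of _ lborel "-1"] unfolding l2_rel_def eq_ae_def by auto

lift_definition scaleR_l2 :: "real \<Rightarrow> l2 \<Rightarrow> l2" is "\<lambda>c f x. c * f x"
  unfolding l2_rel_def eq_ae_def by (auto intro: L2_scale elim: AE_mp)

lift_definition inner_l2 :: "l2 \<Rightarrow> l2 \<Rightarrow> real" is "inner_L2 lborel"
  unfolding l2_rel_def by (auto intro: inner_L2_cong)

definition norm_l2 :: "l2 \<Rightarrow> real" where "norm_l2 x = sqrt (inner x x)"

definition dist_l2 :: "l2 \<Rightarrow> l2 \<Rightarrow> real" where "dist_l2 x y = norm (x - y)"

definition sgn_l2 :: "l2 \<Rightarrow> l2" where "sgn_l2 x = scaleR (inverse (norm x)) x"

definition uniformity_l2 :: "(l2 \<times> l2) filter" where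
  "uniformity_l2 = (INF e\<in>{0<..}. principal {(x, y). dist x y < e})"

definition open_l2 :: "l2 set \<Rightarrow> bool" where
  "open_l2 U \<longleftrightarrow> (\<forall>x\<in>U. \<forall>\<^sub>F (x', y) in uniformity. x' = x \<longrightarrow> y \<in> U)"

instance
proof
  fix x y z :: l2 and a b :: real
  show "x + y + z = x + (y + z)"
    by transfer (auto simp: l2_rel_def eq_ae_def add.assoc intro: L2_add)
  show "x + y = y + x"
    by transfer (auto simp: l2_rel_def eq_ae_def add.commute intro: L2_add)
  show "0 + x = x" by transfer (auto simp: l2_rel_def eq_ae_def)
  show "- x + x = 0" by transfer (auto simp: l2_rel_def eq_ae_def)
  show "x - y = x + - y"
    by transfer (auto simp: l2_rel_def eq_ae_def intro: L2_diff)
  show "a *\<^sub>R (x + y) = a *\<^sub>R x + a *\<^sub>R y"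
    by transfer (auto simp: l2_rel_def eq_ae_def distrib_left intro: L2_add L2_scale)
  show "(a + b) *\<^sub>R x = a *\<^sub>R x + b *\<^sub>R x"
    by transfer (auto simp: l2_rel_def eq_ae_def distrib_right intro: L2_add L2_scale)
  show "a *\<^sub>R b *\<^sub>R x = (a * b) *\<^sub>R x"
    by transfer (auto simp: l2_rel_def eq_ae_def mult.assoc intro: L2_scale)
  show "1 *\<^sub>R x = x" by transfer (auto simp: l2_rel_def eq_ae_def)
  show "inner x y = inner y x" by transfer (rule inner_L2_commute)
  show "inner (x + y) z = inner x z + inner y z"
    by transfer (use inner_L2_lincomb[where c=1] in \<open>auto simp: l2_rel_def\<close>)
  show "inner (a *\<^sub>R x) y = a * inner x y" by transfer (simp add: inner_L2_def mult.assoc)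
  show "0 \<le> inner x x" by transfer (simp add: inner_L2_def)
  show "inner x x = 0 \<longleftrightarrow> x = 0"
    by transfer (auto simp: l2_rel_def eq_ae_def inner_L2_def integral_nonneg_eq_0_iff_AE L2_mult_integrable)
  show "norm x = sqrt (inner x x)" by (rule norm_l2_def)
  show "dist x y = norm (x - y)" by (rule dist_l2_def)
  show "sgn x = scaleR (inverse (norm x)) x" by (rule sgn_l2_def)
  show "uniformity = (INF e\<in>{0<..}. principal {(x::l2, y). dist x y < e})" by (rule uniformity_l2_def)
  show "open U \<longleftrightarrow> (\<forall>x\<in>U. \<forall>\<^sub>F (x', y) in uniformity. x' = x \<longrightarrow> y \<in> U)" for U :: "l2 set"
    by (rule open_l2_def)
qed

end

lemma rep_l2: "rep_l2 x \<in> L2 lborel"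
  using Quotient_rep_reflp[OF Quotient_l2, of x] by (simp add: l2_rel_def)

lemma abs_rep_l2 [simp]: "abs_l2 (rep_l2 x) = x"
  using Quotient_abs_rep[OF Quotient_l2] .

lemma abs_l2_eq_iff: "f \<in> L2 lborel \<Longrightarrow> g \<in> L2 lborel \<Longrightarrow> abs_l2 f = abs_l2 g \<longleftrightarrow> eq_ae lborel f g"
  using Quotient_rel[OF Quotient_l2, of f g] by (auto simp: l2_rel_def eq_ae_def)

lemma rep_abs_l2: "f \<in> L2 lborel \<Longrightarrow> eq_ae lborel (rep_l2 (abs_l2 f)) f"
  using abs_l2_eq_iff[OF rep_l2, of f "abs_l2 f"] by simp

lemma abs_l2_lincomb:
  "f \<in> L2 lborel \<Longrightarrow> g \<in> L2 lborel \<Longrightarrow> abs_l2 (\<lambda>x. c * f x + g x) = c *\<^sub>R abs_l2 f + abs_l2 g"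
  by (subst scaleR_l2.abs_eq, simp add: l2_rel_def eq_ae_def, subst plus_l2.abs_eq)
    (auto simp: l2_rel_def eq_ae_def L2_scale)

lemma abs_l2_diff:
  "f \<in> L2 lborel \<Longrightarrow> g \<in> L2 lborel \<Longrightarrow> abs_l2 (\<lambda>x. f x - g x) = abs_l2 f - abs_l2 g"
  by (subst minus_l2.abs_eq) (auto simp: l2_rel_def eq_ae_def)

lemma inner_abs_l2: "f \<in> L2 lborel \<Longrightarrow> g \<in> L2 lborel \<Longrightarrow> inner (abs_l2 f) (abs_l2 g) = inner_L2 lborel f g"
  by (subst inner_l2.abs_eq) (auto simp: l2_rel_def eq_ae_def)

lemma nn_integral_square_L2:
  assumes "f \<in> L2 lborel" shows "(\<integral>\<^sup>+x. ennreal ((f x)\<^sup>2) \<partial>lborel) = ennreal ((norm (abs_l2 f))\<^sup>2)"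
  using assms inner_abs_l2[OF assms assms] L2_square[OF assms]
  by (simp add: power2_norm_eq_inner inner_L2_def nn_integral_eq_integral power2_eq_square[symmetric])

section \<open>Completeness of the space of square integrable classes\<close>

text \<open>The inequality between geometric and arithmetic mean with weights \<open>2 ^ n\<close>
  and \<open>(1 / 2) ^ n\<close> bounds each term by
  \<open>2 ^ n * (d n)\<^sup>2 + (1 / 2) ^ n\<close>.\<close>

lemma summable_if_weighted_squares:
  fixes d :: "nat \<Rightarrow> real"
  assumes "summable (\<lambda>n. 2 ^ n * (d n)\<^sup>2)" shows "summable d"
proof (rule summable_comparison_test')
  show "summable (\<lambda>n. 2 ^ n * (d n)\<^sup>2 + (1 / 2) ^ n)" by (intro summable_add assms summable_geometric) simp
  fix n :: nat
  have "0 \<le> (sqrt (2 ^ n) * \<bar>d n\<bar> - sqrt ((1 / 2) ^ n))\<^sup>2 + (2 ^ n * (d n)\<^sup>2 + (1 / 2) ^ n)" by simp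
  also have "\<dots> = 2 * (2 ^ n * (d n)\<^sup>2 + (1 / 2) ^ n) - 2 * (sqrt (2 ^ n) * sqrt ((1 / 2) ^ n)) * \<bar>d n\<bar>"
    by (simp add: power2_diff power_mult_distrib algebra_simps)
  also have "sqrt (2 ^ n) * sqrt ((1 / 2) ^ n) = (1 :: real)"
    by (simp add: real_sqrt_mult[symmetric] power_mult_distrib[symmetric])
  finally show "norm (d n) \<le> 2 ^ n * (d n)\<^sup>2 + (1 / 2) ^ n" by simp
qed

text \<open>Riesz-Fischer: a rapidly converging subsequence converges almost everywhere, because the
  weighted squares of its increments have finite integral, and Fatou's lemma shows that the
  pointwise limit is also the limit in norm.\<close>

instance l2 :: complete_space
proof
  fix X :: "nat \<Rightarrow> l2" assume X: "Cauchy X"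
  have "\<exists>N. \<forall>m\<ge>N. \<forall>n\<ge>N. dist (X m) (X n) < (1 / 2) ^ k" for k
    using metric_CauchyD[OF X, of "(1 / 2) ^ k"] by simp
  then obtain N where N: "\<And>k m n. m \<ge> N k \<Longrightarrow> n \<ge> N k \<Longrightarrow> dist (X m) (X n) < (1 / 2) ^ k" by metis
  \<comment> \<open>The sum makes \<open>r\<close> monotone and at least \<open>N (2 * k)\<close>,
    so that increments are below \<open>(1 / 2) ^ (2 * k)\<close>; half of that decay pays for the
    weight \<open>2 ^ k\<close>. The summand \<open>k\<close> ensures that \<open>r\<close> is
    unbounded.\<close>
  define r where "r = (\<lambda>k. k + (\<Sum>i\<le>2 * k. N i))"
  have rN: "N (2 * k) \<le> r k" for k unfolding r_def by (intro trans_le_add2 member_le_sum) auto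
  have rmono: "r k \<le> r (Suc k)" for k
    unfolding r_def by (intro add_mono sum_mono2) auto
  define f where "f = (\<lambda>n. rep_l2 (X (r n)))"
  have fL2: "f n \<in> L2 lborel" and Xf: "abs_l2 (f n) = X (r n)" for n by (auto simp: f_def rep_l2)
  have [measurable]: "f n \<in> borel_measurable borel" for n using L2_measurable[OF fL2[of n]] by simp
  define d where "d = (\<lambda>n x. f (Suc n) x - f n x)"
  have dint: "(\<integral>\<^sup>+x. ennreal (2 ^ n * (d n x)\<^sup>2) \<partial>lborel) \<le> ennreal ((1 / 2) ^ n)" for n
  proof -
    have dL: "d n \<in> L2 lborel" unfolding d_def by (intro L2_diff fL2)
    have "norm (abs_l2 (d n)) \<le> (1 / 2) ^ (2 * n)"
      using N[of "2 * n" "r (Suc n)" "r n"] rN[of n] rmono[of n] abs_l2_diff[OF fL2 fL2, of "Suc n" n]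
      by (simp add: d_def Xf dist_norm less_imp_le)
    then have "(norm (abs_l2 (d n)))\<^sup>2 \<le> ((1 / 2) ^ (2 * n))\<^sup>2" by (intro power_mono) auto
    also have "\<dots> \<le> (1 / 2) ^ (2 * n)" by (simp add: power2_eq_square mult_left_le power_le_one)
    also have "\<dots> = (1 / 2) ^ n * (1 / 2) ^ n" by (simp add: power_add[symmetric] mult_2)
    finally have le: "2 ^ n * (norm (abs_l2 (d n)))\<^sup>2 \<le> (1 / 2) ^ n" by (simp add: power_one_over field_simps)
    have "(\<integral>\<^sup>+x. ennreal (2 ^ n * (d n x)\<^sup>2) \<partial>lborel) = (\<integral>\<^sup>+x. ennreal (2 ^ n) * ennreal ((d n x)\<^sup>2) \<partial>lborel)"
      by (simp add: ennreal_mult)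
    also have "\<dots> = ennreal (2 ^ n) * ennreal ((norm (abs_l2 (d n)))\<^sup>2)"
      using L2_measurable[OF dL] by (subst nn_integral_cmult) (auto simp: nn_integral_square_L2[OF dL])
    also have "\<dots> \<le> ennreal ((1 / 2) ^ n)" using le by (simp add: ennreal_mult[symmetric] ennreal_leI)
    finally show ?thesis .
  qed
  have "(\<integral>\<^sup>+x. (\<Sum>n. ennreal (2 ^ n * (d n x)\<^sup>2)) \<partial>lborel) = (\<Sum>n. \<integral>\<^sup>+x. ennreal (2 ^ n * (d n x)\<^sup>2) \<partial>lborel)"
    unfolding d_def by (intro nn_integral_suminf) simp
  also have "\<dots> \<le> (\<Sum>n. ennreal ((1 / 2) ^ n))" by (intro suminf_le dint) auto
  also have "\<dots> = ennreal (\<Sum>n. (1 / 2) ^ n)" by (intro suminf_ennreal2 summable_geometric) auto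
  also have "\<dots> < \<infinity>" by simp
  finally have "AE x in lborel. (\<Sum>n. ennreal (2 ^ n * (d n x)\<^sup>2)) \<noteq> \<infinity>"
    by (intro nn_integral_noteq_infinite) (auto simp: d_def)
  then have conv: "AE x in lborel. convergent (\<lambda>n. f n x)"
  proof eventually_elim
    case (elim x)
    then have "summable (\<lambda>n. 2 ^ n * (d n x)\<^sup>2)" by (intro summable_suminf_not_top) auto
    then have "summable (\<lambda>n. d n x)" by (rule summable_if_weighted_squares)
    then have "(\<lambda>n. (\<Sum>i<n. f (Suc i) x - f i x)) \<longlonglongrightarrow> (\<Sum>i. d i x)"
      unfolding d_def by (rule summable_LIMSEQ)
    then have "(\<lambda>n. f n x - f 0 x) \<longlonglongrightarrow> (\<Sum>i. d i x)" by (simp only: sum_lessThan_telescope[of "\<lambda>n. f n x"])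
    from tendsto_add[OF this tendsto_const[of "f 0 x"]] show ?case by (simp add: convergentI)
  qed
  define g where "g = (\<lambda>x. lim (\<lambda>n. f n x))"
  have [measurable]: "g \<in> borel_measurable borel" unfolding g_def by measurable
  \<comment> \<open>Fatou in the second index: the Cauchy estimate between \<open>f n\<close> and
    \<open>f m\<close> survives the limit in \<open>m\<close>.\<close>
  have fg: "(\<integral>\<^sup>+x. ennreal ((f n x - g x)\<^sup>2) \<partial>lborel) \<le> ennreal (((1 / 2) ^ k)\<^sup>2)" if rn: "r n \<ge> N k" for n k
  proof -
    have "(\<integral>\<^sup>+x. ennreal ((f n x - g x)\<^sup>2) \<partial>lborel) = (\<integral>\<^sup>+x. liminf (\<lambda>m. ennreal ((f n x - f m x)\<^sup>2)) \<partial>lborel)"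
    proof (rule nn_integral_cong_AE)
      show "AE x in lborel. ennreal ((f n x - g x)\<^sup>2) = liminf (\<lambda>m. ennreal ((f n x - f m x)\<^sup>2))"
        using conv
      proof eventually_elim
        case (elim x)
        then have "(\<lambda>m. f m x) \<longlonglongrightarrow> g x" unfolding g_def by (simp add: convergent_LIMSEQ_iff)
        then have "(\<lambda>m. ennreal ((f n x - f m x)\<^sup>2)) \<longlonglongrightarrow> ennreal ((f n x - g x)\<^sup>2)"
          by (intro tendsto_intros tendsto_ennrealI)
        then show ?case by (intro lim_imp_Liminf[symmetric]) auto
      qed
    qed
    also have "\<dots> \<le> liminf (\<lambda>m. \<integral>\<^sup>+x. ennreal ((f n x - f m x)\<^sup>2) \<partial>lborel)"
      by (rule nn_integral_liminf) simp
    also have "\<dots> \<le> limsup (\<lambda>m. \<integral>\<^sup>+x. ennreal ((f n x - f m x)\<^sup>2) \<partial>lborel)"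
      by (intro Liminf_le_Limsup) simp
    also have "\<dots> \<le> ennreal (((1 / 2) ^ k)\<^sup>2)"
    proof (rule Limsup_bounded)
      show "\<forall>\<^sub>F m in sequentially. (\<integral>\<^sup>+x. ennreal ((f n x - f m x)\<^sup>2) \<partial>lborel) \<le> ennreal (((1 / 2) ^ k)\<^sup>2)"
      proof (rule eventually_sequentiallyI)
        fix m assume "n \<le> m"
        then have "r n \<le> r m" by (rule lift_Suc_mono_le[of r, OF rmono])
        then have "norm (X (r n) - X (r m)) \<le> (1 / 2) ^ k"
          using N[of k "r n" "r m"] rn by (simp add: dist_norm less_imp_le)
        then show "(\<integral>\<^sup>+x. ennreal ((f n x - f m x)\<^sup>2) \<partial>lborel) \<le> ennreal (((1 / 2) ^ k)\<^sup>2)"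
          unfolding nn_integral_square_L2[OF L2_diff[OF fL2 fL2]] abs_l2_diff[OF fL2 fL2] Xf
          by (intro ennreal_leI power_mono) auto
      qed
    qed
    finally show ?thesis .
  qed
  have rbig: "r (N k) \<ge> N k" for k by (simp add: r_def)
  have fgL: "(\<lambda>x. f (N k) x - g x) \<in> L2 lborel" for k
  proof -
    have "integrable lborel (\<lambda>x. (f (N k) x - g x)\<^sup>2)"
      by (rule integrableI_bounded) (use fg[OF rbig[of k]] in \<open>auto simp: le_less_trans\<close>)
    then show ?thesis by (simp add: L2_def)
  qed
  have gL: "g \<in> L2 lborel" using L2_diff[OF fL2[of "N 0"] fgL[of 0]] by simp
  have near: "dist (X m) (abs_l2 g) < 2 * (1 / 2) ^ k" if "m \<ge> N k" for m k
  proof -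
    have "(norm (X (r (N k)) - abs_l2 g))\<^sup>2 \<le> ((1 / 2) ^ k)\<^sup>2"
      using fg[OF rbig[of k]] unfolding nn_integral_square_L2[OF fgL] abs_l2_diff[OF fL2 gL] Xf
      by (simp add: ennreal_le_iff)
    then have "dist (X (r (N k))) (abs_l2 g) \<le> (1 / 2) ^ k"
      unfolding dist_norm by (rule power2_le_imp_le) simp
    moreover have "dist (X m) (X (r (N k))) < (1 / 2) ^ k" using N that rbig by blast
    ultimately show ?thesis using dist_triangle[of "X m" "abs_l2 g" "X (r (N k))"] by simp
  qed
  have "X \<longlonglongrightarrow> abs_l2 g"
  proof (rule metric_LIMSEQ_I)
    fix e :: real assume e: "e > 0"
    obtain k where k: "(1 / 2 :: real) ^ k < e / 2" using real_arch_pow_inv[of "e / 2" "1 / 2"] e by auto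
    show "\<exists>no. \<forall>n\<ge>no. dist (X n) (abs_l2 g) < e"
    proof (intro exI[of _ "N k"] allI impI)
      fix n assume "n \<ge> N k"
      from near[OF this] show "dist (X n) (abs_l2 g) < e" using k by simp
    qed
  qed
  then show "convergent X" by (rule convergentI)
qed

instance l2 :: banach ..

section \<open>Transfer to a weighted space\<close>

lemma measurable_restrict_lborel:
  "borel_measurable (restrict_space lborel J) = borel_measurable (restrict_space borel J)"
  by (rule measurable_cong_sets) (auto simp: sets_restrict_space)

lemma eq_ae_sym: "eq_ae M f g \<Longrightarrow> eq_ae M g f"
  unfolding eq_ae_def by (rule eventually_mono) auto

locale weighted_space =
  fixes J :: "real set" and w :: "real \<Rightarrow> real" and H :: "real measure"
  assumes J: "J \<in> sets borel" and w: "w \<in> borel_measurable (restrict_space borel J)"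
    and w_pos: "y \<in> J \<Longrightarrow> w y > 0" and H: "H = weighted_measure J w"
begin

lemma measurable_H: "borel_measurable H = borel_measurable (restrict_space borel J)"
  unfolding H weighted_measure_def by (rule measurable_cong_sets) (auto simp: sets_restrict_space)

lemma measurable_J_iff:
  "f \<in> borel_measurable (restrict_space borel J) \<longleftrightarrow> (\<lambda>y. indicator J y * f y) \<in> borel_measurable borel" for f :: "real \<Rightarrow> real"
  using J by (subst borel_measurable_restrict_space_iff) auto

lemma measurable_wJ [measurable]: "(\<lambda>y. indicator J y * w y) \<in> borel_measurable borel"
  using w by (simp add: measurable_J_iff)

text \<open>Strict positivity of \<open>w\<close> on \<open>J\<close> makes the null sets of the
  weighted measure exactly the Lebesgue null subsets of \<open>J\<close>.\<close>

lemma AE_H_iff: "(AE y in H. P y) \<longleftrightarrow> (AE y in lborel. y \<in> J \<longrightarrow> P y)"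
proof -
  have "w \<in> borel_measurable (restrict_space lborel J)"
    using w by (simp add: measurable_restrict_lborel)
  then have "(AE y in H. P y) \<longleftrightarrow> (AE y in restrict_space lborel J. 0 < ennreal (w y) \<longrightarrow> P y)"
    unfolding H weighted_measure_def by (intro AE_density measurable_compose[OF _ measurable_ennreal])
  also have "\<dots> \<longleftrightarrow> (AE y in lborel. y \<in> J \<longrightarrow> 0 < ennreal (w y) \<longrightarrow> P y)"
    using J by (intro AE_restrict_space_iff) auto
  also have "\<dots> \<longleftrightarrow> (AE y in lborel. y \<in> J \<longrightarrow> P y)"
    by (rule AE_cong) (use w_pos in auto)
  finally show ?thesis .
qed

lemma integral_H:
  assumes F: "F \<in> borel_measurable H"
  shows "integrable H F \<longleftrightarrow> integrable lborel (\<lambda>y. indicator J y * (w y * F y))"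
    and "(LINT y|H. F y) = (LINT y|lborel. indicator J y * (w y * F y) :: real)"
proof -
  have wm: "w \<in> borel_measurable (restrict_space lborel J)"
    using w by (simp add: measurable_restrict_lborel)
  have Fm: "F \<in> borel_measurable (restrict_space lborel J)"
    using F unfolding measurable_H by (simp add: measurable_restrict_lborel)
  have pos: "AE y in restrict_space lborel J. 0 \<le> w y"
    by (rule AE_I2) (use w_pos in \<open>auto simp: space_restrict_space less_imp_le\<close>)
  have "integrable H F \<longleftrightarrow> integrable (restrict_space lborel J) (\<lambda>y. w y * F y)"
    unfolding H weighted_measure_def using integrable_density[OF Fm wm pos] by simp
  also have "\<dots> \<longleftrightarrow> integrable lborel (\<lambda>y. indicator J y * (w y * F y))"
    using J by (subst integrable_restrict_space) auto
  finally show "integrable H F \<longleftrightarrow> integrable lborel (\<lambda>y. indicator J y * (w y * F y))" .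
  have "(LINT y|H. F y) = (LINT y|restrict_space lborel J. w y * F y)"
    unfolding H weighted_measure_def using integral_density[OF Fm wm pos] by simp
  also have "\<dots> = (LINT y|lborel. indicator J y * (w y * F y))"
    using J by (subst integral_restrict_space) auto
  finally show "(LINT y|H. F y) = (LINT y|lborel. indicator J y * (w y * F y))" .
qed

text \<open>The square root of the weight makes this an isometry into the unweighted space on the
  line; the indicator fixes the value off \<open>J\<close>.\<close>

definition lift :: "(real \<Rightarrow> real) \<Rightarrow> real \<Rightarrow> real" where
  "lift f y = indicator J y * (sqrt (w y) * f y)"

definition emb :: "(real \<Rightarrow> real) \<Rightarrow> l2" where "emb f = abs_l2 (lift f)"

definition ext :: "l2 \<Rightarrow> real \<Rightarrow> real" where "ext x y = rep_l2 x y / sqrt (w y)"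

lemma sqrt_w [measurable]: "(\<lambda>y. indicator J y * sqrt (w y)) \<in> borel_measurable borel"
proof -
  have "(\<lambda>y. indicator J y * sqrt (w y)) = (\<lambda>y. sqrt (indicator J y * w y))"
    by (auto split: split_indicator)
  then show ?thesis by simp
qed

lemma lift_L2: assumes "f \<in> L2 H" shows "lift f \<in> L2 lborel"
proof -
  have fm: "f \<in> borel_measurable H" and fi: "integrable H (\<lambda>y. (f y)\<^sup>2)"
    using assms by (auto simp: L2_def)
  then have [measurable]: "(\<lambda>y. indicator J y * f y) \<in> borel_measurable borel"
    by (simp add: measurable_H measurable_J_iff)
  have "lift f = (\<lambda>y. (indicator J y * sqrt (w y)) * (indicator J y * f y))"
    by (auto simp: lift_def split: split_indicator)
  then have "lift f \<in> borel_measurable lborel" by simp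
  moreover have "(lift f y)\<^sup>2 = indicator J y * (w y * (f y)\<^sup>2)" for y
    using w_pos[of y] by (auto simp: lift_def power_mult_distrib split: split_indicator)
  then have "integrable lborel (\<lambda>y. (lift f y)\<^sup>2)"
    using fi fm by (simp add: integral_H(1))
  ultimately show ?thesis by (simp add: L2_def)
qed

lemma inner_emb: assumes "f \<in> L2 H" "g \<in> L2 H" shows "inner (emb f) (emb g) = inner_L2 H f g"
proof -
  have "inner (emb f) (emb g) = (LINT y|lborel. lift f y * lift g y)"
    unfolding emb_def using assms by (simp add: inner_abs_l2 lift_L2 inner_L2_def)
  also have "\<dots> = (LINT y|lborel. indicator J y * (w y * (f y * g y)))"
  proof (intro Bochner_Integration.integral_cong refl)
    fix y
    have "y \<in> J \<Longrightarrow> sqrt (w y) * sqrt (w y) = w y" using w_pos[of y] by simp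
    then show "lift f y * lift g y = indicator J y * (w y * (f y * g y))"
      unfolding lift_def by (cases "y \<in> J") (simp_all add: algebra_simps)
  qed
  also have "\<dots> = inner_L2 H f g"
    unfolding inner_L2_def using assms L2_measurable by (intro integral_H(2)[symmetric]) measurable
  finally show ?thesis .
qed

lemma norm_emb: "f \<in> L2 H \<Longrightarrow> norm (emb f) = norm_L2 H f"
  by (simp add: norm_eq_sqrt_inner inner_emb norm_L2_def)

lemma emb_lincomb: assumes "f \<in> L2 H" "g \<in> L2 H" shows "emb (\<lambda>y. c * f y + g y) = c *\<^sub>R emb f + emb g"
proof -
  have "lift (\<lambda>y. c * f y + g y) = (\<lambda>y. c * lift f y + lift g y)" by (auto simp: lift_def algebra_simps)
  then show ?thesis unfolding emb_def using assms by (simp add: abs_l2_lincomb lift_L2)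
qed

lemma emb_diff: assumes "f \<in> L2 H" "g \<in> L2 H" shows "emb (\<lambda>y. f y - g y) = emb f - emb g"
  using emb_lincomb[OF assms(2,1), of "-1"] by (simp add: algebra_simps)

lemma emb_scale: assumes "f \<in> L2 H" shows "emb (\<lambda>y. c * f y) = c *\<^sub>R emb f"
proof -
  have "emb (\<lambda>_. 0) = 0" unfolding emb_def lift_def by (simp add: zero_l2.abs_eq)
  then show ?thesis using emb_lincomb[OF assms L2_zero, of c] by simp
qed

lemma emb_eq_iff: assumes "f \<in> L2 H" "g \<in> L2 H" shows "emb f = emb g \<longleftrightarrow> eq_ae H f g"
proof -
  have "emb f = emb g \<longleftrightarrow> eq_ae lborel (lift f) (lift g)"
    unfolding emb_def using assms by (simp add: abs_l2_eq_iff lift_L2)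
  also have "\<dots> \<longleftrightarrow> (AE y in lborel. y \<in> J \<longrightarrow> f y = g y)"
    unfolding eq_ae_def
  proof (rule AE_cong)
    fix y
    show "(lift f y = lift g y) \<longleftrightarrow> (y \<in> J \<longrightarrow> f y = g y)" using w_pos[of y] by (auto simp: lift_def)
  qed
  finally show ?thesis by (simp add: eq_ae_def AE_H_iff)
qed

lemma ext_L2: "ext x \<in> L2 H"
proof -
  have [measurable]: "rep_l2 x \<in> borel_measurable borel" using L2_measurable[OF rep_l2[of x]] by simp
  have "(\<lambda>y. indicator J y * ext x y) = (\<lambda>y. indicator J y * (rep_l2 x y / (indicator J y * sqrt (w y))))"
    by (auto simp: ext_def split: split_indicator)
  moreover have "(\<lambda>y. indicator J y * (rep_l2 x y / (indicator J y * sqrt (w y)))) \<in> borel_measurable borel"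
    using J by measurable
  ultimately have m: "ext x \<in> borel_measurable H" by (simp add: measurable_H measurable_J_iff)
  have "(\<lambda>y. indicator J y * (w y * (ext x y)\<^sup>2)) = (\<lambda>y. indicator J y * (rep_l2 x y)\<^sup>2)"
  proof
    fix y
    show "indicator J y * (w y * (ext x y)\<^sup>2) = indicator J y * (rep_l2 x y)\<^sup>2"
      using w_pos[of y] by (auto simp: ext_def power_divide split: split_indicator)
  qed
  moreover have "integrable lborel (\<lambda>y. indicator J y * (rep_l2 x y)\<^sup>2)"
    using J L2_square[OF rep_l2[of x]] integrable_mult_indicator[of J lborel "\<lambda>y. (rep_l2 x y)\<^sup>2"] by simp
  moreover have "(\<lambda>y. (ext x y)\<^sup>2) \<in> borel_measurable H" using m by simp
  ultimately have "integrable H (\<lambda>y. (ext x y)\<^sup>2)" by (simp only: integral_H(1))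
  then show ?thesis using m by (simp add: L2_def)
qed

text \<open>Multiplication by the indicator of \<open>J\<close>, so the orthogonal projection onto
  the image of \<open>L2 H\<close>. The equation \<open>proj x = x\<close> expresses that
  \<open>x\<close> comes from \<open>L2 H\<close>.\<close>

definition proj :: "l2 \<Rightarrow> l2" where "proj x = emb (ext x)"

lemma proj_eq: "proj x = abs_l2 (\<lambda>y. indicator J y * rep_l2 x y)"
proof -
  have "lift (ext x) = (\<lambda>y. indicator J y * rep_l2 x y)"
    using w_pos by (fastforce simp: lift_def ext_def split: split_indicator)
  then show ?thesis by (simp add: proj_def emb_def)
qed

lemma ext_emb: assumes "f \<in> L2 H" shows "eq_ae H (ext (emb f)) f"
proof -
  have "AE y in lborel. rep_l2 (emb f) y = lift f y"
    using rep_abs_l2[OF lift_L2[OF assms]] unfolding emb_def eq_ae_def .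
  then show ?thesis unfolding eq_ae_def AE_H_iff
  proof eventually_elim
    case (elim y)
    then show ?case using w_pos[of y] by (auto simp: ext_def lift_def)
  qed
qed

lemma proj_emb: "f \<in> L2 H \<Longrightarrow> proj (emb f) = emb f"
  unfolding proj_def using ext_emb by (subst emb_eq_iff) (auto intro: ext_L2)

lemma proj_L2: "(\<lambda>y. indicator J y * rep_l2 x y) \<in> L2 lborel"
proof -
  have "indicator J y * (rep_l2 x y)\<^sup>2 = (indicator J y * rep_l2 x y)\<^sup>2" for y by (auto split: split_indicator)
  moreover have "integrable lborel (\<lambda>y. indicator J y * (rep_l2 x y)\<^sup>2)"
    using J L2_square[OF rep_l2[of x]] integrable_mult_indicator[of J lborel "\<lambda>y. (rep_l2 x y)\<^sup>2"] by simp
  moreover have "rep_l2 x \<in> borel_measurable borel" using L2_measurable[OF rep_l2[of x]] by simp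
  ultimately show ?thesis using J by (simp add: L2_def)
qed

lemma norm_proj_le: "norm (proj x) \<le> norm x"
proof -
  have "inner (proj x) (proj x) = (LINT y|lborel. (indicator J y * rep_l2 x y) * (indicator J y * rep_l2 x y))"
    unfolding proj_eq by (simp add: inner_abs_l2 proj_L2 inner_L2_def)
  also have "\<dots> \<le> (LINT y|lborel. rep_l2 x y * rep_l2 x y)"
    by (intro integral_mono L2_mult_integrable proj_L2 rep_l2) (auto split: split_indicator)
  also have "\<dots> = inner x x" using inner_abs_l2[OF rep_l2 rep_l2, of x x] by (simp add: inner_L2_def)
  finally show ?thesis by (simp add: norm_eq_sqrt_inner)
qed

lemma proj_bounded_linear: "bounded_linear proj"
proof (rule bounded_linear_intro)
  have lin: "proj (c *\<^sub>R x + y) = c *\<^sub>R proj x + proj y" for c x y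
  proof -
    have "eq_ae lborel (rep_l2 (c *\<^sub>R x + y)) (\<lambda>z. c * rep_l2 x z + rep_l2 y z)"
      using rep_abs_l2[OF L2_lincomb[OF rep_l2 rep_l2], of c x y] by (simp add: abs_l2_lincomb rep_l2)
    then have "eq_ae lborel (\<lambda>z. indicator J z * rep_l2 (c *\<^sub>R x + y) z)
        (\<lambda>z. c * (indicator J z * rep_l2 x z) + indicator J z * rep_l2 y z)"
      unfolding eq_ae_def by eventually_elim (simp add: algebra_simps)
    then have "proj (c *\<^sub>R x + y) = abs_l2 (\<lambda>z. c * (indicator J z * rep_l2 x z) + indicator J z * rep_l2 y z)"
      unfolding proj_eq by (subst abs_l2_eq_iff) (auto intro!: proj_L2 L2_lincomb)
    then show ?thesis by (simp add: proj_eq abs_l2_lincomb proj_L2)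
  qed
  show "proj (x + y) = proj x + proj y" for x y using lin[of 1 x y] by simp
  show "proj (c *\<^sub>R x) = c *\<^sub>R proj x" for c x
  proof -
    have "proj 0 = 0" using lin[of 1 0 0] by simp
    then show ?thesis using lin[of c x 0] by simp
  qed
  show "norm (proj x) \<le> norm x * 1" for x using norm_proj_le by simp
qed

lemma ext_lincomb: "eq_ae H (ext (c *\<^sub>R x + y)) (\<lambda>z. c * ext x z + ext y z)"
proof -
  have "eq_ae lborel (rep_l2 (c *\<^sub>R x + y)) (\<lambda>z. c * rep_l2 x z + rep_l2 y z)"
    using rep_abs_l2[OF L2_lincomb[OF rep_l2 rep_l2], of c x y] by (simp add: abs_l2_lincomb rep_l2)
  then show ?thesis unfolding eq_ae_def AE_H_iff
    by eventually_elim (simp add: ext_def add_divide_distrib)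
qed

lemma norm_ext_le: "norm_L2 H (ext x) \<le> norm x"
  using norm_emb[OF ext_L2, of x] norm_proj_le[of x] by (simp add: proj_def)

lemma lim_emb_iff:
  assumes "\<And>n. f n \<in> L2 H" "g \<in> L2 H"
  shows "((\<lambda>n. emb (f n)) \<longlongrightarrow> emb g) F \<longleftrightarrow> ((\<lambda>n. norm_L2 H (\<lambda>y. f n y - g y)) \<longlongrightarrow> 0) F"
proof -
  have "norm_L2 H (\<lambda>y. f n y - g y) = dist (emb (f n)) (emb g)" for n
    using assms by (simp add: norm_emb[symmetric] L2_diff emb_diff dist_norm)
  then show ?thesis by (simp add: tendsto_dist_iff[of _ "emb g"])
qed

text \<open>Transport to the fixed Hilbert space and back. Closedness is stated with sequences and
  norms, since \<open>L2 H\<close> carries no topology of its own.\<close>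

theorem smooth_orbit_H:
  assumes c0: "c0_semigroup H S" and gen: "generator H S = B"
    and sym: "\<And>v g v' g'. \<lbrakk>(v, g) \<in> B; (v', g') \<in> B\<rbrakk> \<Longrightarrow> inner_L2 H g v' = inner_L2 H v g'"
    and clo: "\<And>vs gs v g. \<lbrakk>\<And>n::nat. (vs n, gs n) \<in> B; v \<in> L2 H; g \<in> L2 H;
        (\<lambda>n. norm_L2 H (\<lambda>y. vs n y - v y)) \<longlonglongrightarrow> 0; (\<lambda>n. norm_L2 H (\<lambda>y. gs n y - g y)) \<longlonglongrightarrow> 0\<rbrakk> \<Longrightarrow> (v, g) \<in> B"
    and dense: "densely_defined H B"
    and diss: "\<And>v g. (v, g) \<in> B \<Longrightarrow> inner_L2 H g v \<le> \<omega> * inner_L2 H v v"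
    and f: "f \<in> L2 H"
  obtains X where "\<And>t. t > 0 \<Longrightarrow> eq_ae H (X 0 t) (S t f)"
    "\<And>k t. t > 0 \<Longrightarrow> (X k t, X (Suc k) t) \<in> B"
    "\<And>k t. t > 0 \<Longrightarrow> ((\<lambda>h. norm_L2 H (\<lambda>y. (X k (t + h) y - X k t y) / h - X (Suc k) t y)) \<longlongrightarrow> 0) (at 0)"
proof -
  have SL: "S t g \<in> L2 H" if "t \<ge> 0" "g \<in> L2 H" for t g
    using c0 that unfolding c0_semigroup_def by blast
  have Scong: "eq_ae H (S t g) (S t g')" if "t \<ge> 0" "g \<in> L2 H" "g' \<in> L2 H" "eq_ae H g g'" for t g g'
    using c0 that unfolding c0_semigroup_def by blast
  have Slin: "eq_ae H (S t (\<lambda>x. c * g x + g' x)) (\<lambda>x. c * S t g x + S t g' x)"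
    if "t \<ge> 0" "g \<in> L2 H" "g' \<in> L2 H" for t g g' c
    using c0 that unfolding c0_semigroup_def by blast
  have Sbound: "\<exists>C. \<forall>g\<in>L2 H. norm_L2 H (S t g) \<le> C * norm_L2 H g" if "t \<ge> 0" for t
    using c0 that unfolding c0_semigroup_def by blast
  have S0: "eq_ae H (S 0 g) g" if "g \<in> L2 H" for g
    using c0 that unfolding c0_semigroup_def by blast
  have Sadd: "eq_ae H (S (t + r) g) (S t (S r g))" if "t \<ge> 0" "r \<ge> 0" "g \<in> L2 H" for t r g
    using c0 that unfolding c0_semigroup_def by blast
  have Scont: "((\<lambda>t. norm_L2 H (\<lambda>x. S t g x - g x)) \<longlongrightarrow> 0) (at_right 0)" if "g \<in> L2 H" for g
    using c0 that unfolding c0_semigroup_def by blast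
  have BL: "v \<in> L2 H" "g \<in> L2 H" if "(v, g) \<in> B" for v g
    using that gen by (auto simp: generator_def)
  \<comment> \<open>\<open>ext\<close> depends on a chosen representative, but \<open>S\<close>
    respects equality almost everywhere, so the composition is a well-defined bounded operator,
    equal to \<open>proj\<close> at time 0.\<close>
  define S' where "S' = (\<lambda>t x. emb (S t (ext x)))"
  have S'emb: "S' t (emb g) = emb (S t g)" if "t \<ge> 0" "g \<in> L2 H" for t g
    unfolding S'_def using that by (subst emb_eq_iff) (auto intro: SL ext_L2 Scong ext_emb)
  have S'0: "S' 0 x = proj x" for x
    unfolding S'_def proj_def by (subst emb_eq_iff) (auto intro: SL ext_L2 S0)
  have S'_add: "S' (t + r) x = S' t (S' r x)" if "0 \<le> t" "0 \<le> r" for t r x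
    proof -
      have "S' t (S' r x) = emb (S t (S r (ext x)))"
        unfolding S'_def[of] using S'emb[OF that(1) SL[OF that(2) ext_L2]] by (simp add: S'_def)
      also have "\<dots> = S' (t + r) x"
        unfolding S'_def using that eq_ae_sym[OF Sadd[OF that ext_L2, of x]]
        by (subst emb_eq_iff) (auto intro!: SL ext_L2)
      finally show ?thesis by simp
    qed
  have S'_bl: "bounded_linear (S' t)" if "0 \<le> t" for t
    proof -
      have lin: "S' t (c *\<^sub>R x + y) = c *\<^sub>R S' t x + S' t y" for c x y
      proof -
        have "S' t (c *\<^sub>R x + y) = emb (S t (\<lambda>z. c * ext x z + ext y z))"
          unfolding S'_def using that by (subst emb_eq_iff) (auto intro!: SL ext_L2 L2_lincomb Scong ext_lincomb)
        also have "\<dots> = emb (\<lambda>z. c * S t (ext x) z + S t (ext y) z)"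
          using that by (subst emb_eq_iff) (auto intro!: SL ext_L2 L2_lincomb Slin)
        also have "\<dots> = c *\<^sub>R S' t x + S' t y"
          unfolding S'_def using that by (intro emb_lincomb SL ext_L2)
        finally show ?thesis .
      qed
      obtain C where C: "\<And>g. g \<in> L2 H \<Longrightarrow> norm_L2 H (S t g) \<le> C * norm_L2 H g" using Sbound[OF \<open>0 \<le> t\<close>] by blast
      have n0: "0 \<le> norm_L2 H (ext x)" for x using norm_emb[OF ext_L2, of x] by (metis norm_ge_zero)
      show ?thesis
      proof (rule bounded_linear_intro)
        show "S' t (x + y) = S' t x + S' t y" for x y using lin[of 1 x y] by simp
        show "S' t (c *\<^sub>R x) = c *\<^sub>R S' t x" for c x
        proof -
          have "S' t 0 = 0" using lin[of 1 0 0] by simp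
          then show ?thesis using lin[of c x 0] by simp
        qed
        show "norm (S' t x) \<le> norm x * \<bar>C\<bar>" for x
        proof -
          have "norm (S' t x) = norm_L2 H (S t (ext x))"
            unfolding S'_def using that by (intro norm_emb SL ext_L2)
          also have "\<dots> \<le> C * norm_L2 H (ext x)" by (rule C[OF ext_L2])
          also have "\<dots> \<le> \<bar>C\<bar> * norm_L2 H (ext x)" using n0 by (intro mult_right_mono) auto
          also have "\<dots> \<le> \<bar>C\<bar> * norm x" by (intro mult_left_mono norm_ext_le) simp
          finally show ?thesis by (simp add: mult.commute)
        qed
      qed
    qed
  have S'_cont: "((\<lambda>t. S' t x) \<longlongrightarrow> S' 0 x) (at_right 0)" for x
    proof -
      \<comment> \<open>\<open>lim_emb_iff\<close> asks for square integrability at all times, while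
        \<open>S t\<close> is known to preserve it for nonnegative \<open>t\<close> only;
        \<open>max 0 t\<close> bridges this.\<close>
      have "((\<lambda>t. emb (S (max 0 t) (ext x))) \<longlongrightarrow> emb (ext x)) (at_right 0)"
      proof (subst lim_emb_iff)
        show "((\<lambda>t. norm_L2 H (\<lambda>y. S (max 0 t) (ext x) y - ext x y)) \<longlongrightarrow> 0) (at_right 0)"
        proof (rule Lim_transform_eventually[OF Scont[OF ext_L2]])
          show "\<forall>\<^sub>F t in at_right 0. norm_L2 H (\<lambda>y. S t (ext x) y - ext x y) = norm_L2 H (\<lambda>y. S (max 0 t) (ext x) y - ext x y)"
            unfolding eventually_at_right_field by (intro exI[of _ 1]) (auto simp: max_def)
        qed
      qed (auto intro: SL ext_L2)
      then have "((\<lambda>t. S' t x) \<longlongrightarrow> emb (ext x)) (at_right 0)"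
      proof (rule Lim_transform_eventually)
        show "\<forall>\<^sub>F t in at_right 0. emb (S (max 0 t) (ext x)) = S' t x"
          unfolding eventually_at_right_field S'_def by (intro exI[of _ 1]) (auto simp: max_def)
      qed
      then show ?thesis by (simp add: S'0 proj_def)
    qed
  interpret P: strongly_continuous_semigroup S'
    by (rule strongly_continuous_semigroup.intro[OF S'_bl S'_add S'_cont])
  \<comment> \<open>On the range of \<open>proj\<close> the norm of \<open>x\<close> is the norm of
    \<open>ext x\<close>, so the difference quotients converge in one space exactly when they do in
    the other.\<close>
  have gen_iff: "(x, y) \<in> P.gen \<longleftrightarrow> (proj x = x \<and> proj y = y \<and> (ext x, ext y) \<in> B)" for x y
  proof -
    have quot: "((\<lambda>h. (S' h x - x) /\<^sub>R h) \<longlongrightarrow> y) (at_right 0) \<longleftrightarrow>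
       ((\<lambda>h. norm_L2 H (\<lambda>z. (S h (ext x) z - ext x z) / h - ext y z)) \<longlongrightarrow> 0) (at_right 0)"
      if px: "proj x = x" and py: "proj y = y"
    proof -
      have e: "\<forall>\<^sub>F h in at_right 0. norm_L2 H (\<lambda>z. (S h (ext x) z - ext x z) / h - ext y z) = dist ((S' h x - x) /\<^sub>R h) y"
        unfolding eventually_at_right_field
      proof (intro exI[of _ 1] conjI allI impI)
        fix h :: real assume h: "0 < h" "h < 1"
        have L: "(\<lambda>z. inverse h * (S h (ext x) z - ext x z)) \<in> L2 H"
          using h by (intro L2_scale L2_diff SL ext_L2) auto
        have "norm_L2 H (\<lambda>z. inverse h * (S h (ext x) z - ext x z) - ext y z) = norm (emb (\<lambda>z. inverse h * (S h (ext x) z - ext x z) - ext y z))"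
          using L by (simp add: norm_emb L2_diff ext_L2)
        also have "emb (\<lambda>z. inverse h * (S h (ext x) z - ext x z) - ext y z) = inverse h *\<^sub>R (emb (S h (ext x)) - emb (ext x)) - emb (ext y)"
          using h L by (simp add: emb_diff emb_scale ext_L2 SL L2_diff)
        also have "\<dots> = (S' h x - x) /\<^sub>R h - y" using px py by (simp add: S'_def proj_def)
        finally show "norm_L2 H (\<lambda>z. (S h (ext x) z - ext x z) / h - ext y z) = dist ((S' h x - x) /\<^sub>R h) y"
          by (simp add: dist_norm divide_inverse mult.commute)
      qed simp
      show ?thesis unfolding tendsto_dist_iff[of _ y] using filterlim_cong[OF refl refl e, of "nhds 0"] by simp
    qed
    show ?thesis
    proof
      assume a: "(x, y) \<in> P.gen"
      then have px: "proj x = x" and py: "proj y = y" using P.gen_S0[OF a] by (auto simp: S'0)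
      then show "proj x = x \<and> proj y = y \<and> (ext x, ext y) \<in> B"
        using a quot[OF px py] ext_L2 gen by (auto simp: P.gen_def generator_def)
    next
      assume a: "proj x = x \<and> proj y = y \<and> (ext x, ext y) \<in> B"
      then show "(x, y) \<in> P.gen"
        using quot gen by (auto simp: P.gen_def generator_def S'0)
    qed
  qed
  have inn: "inner x y = inner_L2 H (ext x) (ext y)" if "proj x = x" "proj y = y" for x y
    using inner_emb[OF ext_L2 ext_L2, of x y] that by (simp add: proj_def)
  \<comment> \<open>\<open>ext (emb v)\<close> agrees with \<open>v\<close> only almost everywhere.
    Membership of the modified pair in \<open>B\<close> follows from closedness applied to a
    constant sequence.\<close>
  have emb_gen: "(emb v, emb g) \<in> P.gen" if "(v, g) \<in> B" for v g
  proof -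
    have "eq_ae H (ext (emb v)) v" "eq_ae H (ext (emb g)) g" using BL[OF that] by (auto intro: ext_emb)
    then have e: "norm_L2 H (\<lambda>y. ext (emb v) y - v y) = 0" "norm_L2 H (\<lambda>y. ext (emb g) y - g y) = 0"
      using BL[OF that] by (auto simp: norm_emb[symmetric] emb_diff ext_L2 L2_diff emb_eq_iff[symmetric])
    have e2: "norm_L2 H (\<lambda>y. v y - ext (emb v) y) = 0" "norm_L2 H (\<lambda>y. g y - ext (emb g) y) = 0"
      using BL[OF that] e by (auto simp: norm_emb[symmetric] emb_diff ext_L2 L2_diff)
    have "(ext (emb v), ext (emb g)) \<in> B"
    proof (rule clo)
      show "(v, g) \<in> B" for n :: nat by (rule that)
      show "(\<lambda>n::nat. norm_L2 H (\<lambda>y. v y - ext (emb v) y)) \<longlonglongrightarrow> 0"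
        "(\<lambda>n::nat. norm_L2 H (\<lambda>y. g y - ext (emb g) y)) \<longlonglongrightarrow> 0" unfolding e2 by simp_all
    qed (rule ext_L2)+
    then show ?thesis using BL[OF that] by (simp add: gen_iff proj_emb)
  qed
  interpret D: dissipative_semigroup S' \<omega>
  proof
    show "g \<bullet> v' = v \<bullet> g'" if "(v, g) \<in> P.gen" "(v', g') \<in> P.gen" for v g v' g'
      using that sym by (auto simp: gen_iff inn)
    show "g \<bullet> v \<le> \<omega> * (v \<bullet> v)" if "(v, g) \<in> P.gen" for v g
      using that diss by (auto simp: gen_iff inn)
    show "closed P.gen"
      unfolding closed_sequential_limits
    proof (intro allI impI)
      fix z l assume z: "(\<forall>n. z n \<in> P.gen) \<and> z \<longlonglongrightarrow> l"
      define x y where "x = fst \<circ> z" and "y = snd \<circ> z"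
      have gz: "(x n, y n) \<in> P.gen" for n using z by (simp add: x_def y_def)
      have lim: "x \<longlonglongrightarrow> fst l" "y \<longlonglongrightarrow> snd l"
        using z by (auto simp: x_def y_def o_def intro: tendsto_fst tendsto_snd)
      have pl: "proj (fst l) = fst l" "proj (snd l) = snd l"
        using bounded_linear.tendsto[OF proj_bounded_linear lim(1)] bounded_linear.tendsto[OF proj_bounded_linear lim(2)]
          gz lim by (auto simp: gen_iff intro: LIMSEQ_unique)
      have "(ext (fst l), ext (snd l)) \<in> B"
      proof (rule clo)
        show "(ext (x n), ext (y n)) \<in> B" for n using gz[of n] by (simp add: gen_iff)
        have "emb (ext (x n)) = x n" "emb (ext (y n)) = y n" for n using gz[of n] by (auto simp: gen_iff proj_def)
        moreover have "emb (ext (fst l)) = fst l" "emb (ext (snd l)) = snd l" using pl by (auto simp: proj_def)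
        ultimately show "(\<lambda>n. norm_L2 H (\<lambda>z. ext (x n) z - ext (fst l) z)) \<longlonglongrightarrow> 0"
          "(\<lambda>n. norm_L2 H (\<lambda>z. ext (y n) z - ext (snd l) z)) \<longlonglongrightarrow> 0"
          using lim by (auto simp: lim_emb_iff[symmetric] ext_L2)
      qed (auto intro: ext_L2)
      with pl have "(fst l, snd l) \<in> P.gen" using gen_iff by blast
      then show "l \<in> P.gen" unfolding prod.collapse .
    qed
    show "x \<in> closure (Domain P.gen)" if "S' 0 x = x" for x
      unfolding closure_approachable
    proof (intro allI impI)
      fix e :: real assume "e > 0"
      then obtain v where v: "v \<in> Domain B" "norm_L2 H (\<lambda>y. v y - ext x y) < e"
        using dense ext_L2 unfolding densely_defined_def by blast
      then obtain g where g: "(v, g) \<in> B" by blast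
      have "dist (emb v) (emb (ext x)) < e" using v BL[OF g] by (simp add: dist_norm emb_diff[symmetric] norm_emb L2_diff ext_L2)
      then have "dist (emb v) x < e" using that by (simp add: S'0 proj_def)
      then show "\<exists>y\<in>Domain P.gen. dist y x < e" using emb_gen[OF g] by blast
    qed
  qed
  obtain x where x: "x 0 = (\<lambda>t. S' t (emb f))" "\<And>k t. t > 0 \<Longrightarrow> (x k t, x (Suc k) t) \<in> P.gen"
    "\<And>k t. t > 0 \<Longrightarrow> (x k has_vector_derivative x (Suc k) t) (at t)"
    using D.smooth_orbit[of "emb f"] by blast
  show ?thesis
  proof (rule that[of "\<lambda>k t. ext (x k t)"])
    fix t :: real assume t: "t > 0"
    show "eq_ae H (ext (x 0 t)) (S t f)"
      using ext_emb[OF SL[OF _ f], of t] t S'emb[OF _ f, of t] by (simp add: x(1))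
    fix k
    show "(ext (x k t), ext (x (Suc k) t)) \<in> B" using x(2)[OF t] by (simp add: gen_iff)
    have px: "proj (x k r) = x k r" if "r > 0" for k r using x(2)[OF that, of k] by (simp add: gen_iff)
    have "((\<lambda>y. (x k y - x k t) /\<^sub>R (y - t)) \<longlongrightarrow> x (Suc k) t) (at t)"
      using x(3)[OF t, of k] by (simp add: has_vector_derivative_iff_tendsto)
    then have "((\<lambda>h. (x k (t + h) - x k t) /\<^sub>R h) \<longlongrightarrow> x (Suc k) t) (at 0)"
      by (subst (asm) LIM_offset_zero_iff) auto
    then have "((\<lambda>h. dist ((x k (t + h) - x k t) /\<^sub>R h) (x (Suc k) t)) \<longlongrightarrow> 0) (at 0)"
      by (rule tendsto_dist_iff[THEN iffD1])
    then show "((\<lambda>h. norm_L2 H (\<lambda>y. (ext (x k (t + h)) y - ext (x k t) y) / h - ext (x (Suc k) t) y)) \<longlongrightarrow> 0) (at 0)"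
    proof (rule Lim_transform_eventually)
      have "\<forall>\<^sub>F h in at (0::real). dist h 0 < t" using t by (auto simp: eventually_at intro: exI[of _ t])
      then show "\<forall>\<^sub>F h in at 0. dist ((x k (t + h) - x k t) /\<^sub>R h) (x (Suc k) t) =
          norm_L2 H (\<lambda>y. (ext (x k (t + h)) y - ext (x k t) y) / h - ext (x (Suc k) t) y)"
      proof eventually_elim
        case (elim h)
        then have th: "t + h > 0" by (auto simp: dist_real_def)
        define F where "F = (\<lambda>y. inverse h * (ext (x k (t + h)) y - ext (x k t) y) - ext (x (Suc k) t) y)"
        have FL: "F \<in> L2 H" unfolding F_def by (intro L2_diff L2_scale ext_L2)
        have "emb F = (x k (t + h) - x k t) /\<^sub>R h - x (Suc k) t"
          using px[OF th, of k] px[OF t] by (simp add: F_def emb_diff emb_scale ext_L2 L2_scale L2_diff proj_def)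
        then have "dist ((x k (t + h) - x k t) /\<^sub>R h) (x (Suc k) t) = norm_L2 H F"
          using norm_emb[OF FL] by (simp add: dist_norm)
        also have "F = (\<lambda>y. (ext (x k (t + h)) y - ext (x k t) y) / h - ext (x (Suc k) t) y)"
          by (simp add: F_def divide_inverse mult.commute)
        finally show ?case .
      qed
    qed
  qed
qed

end

section \<open>Regularity of the operator domain\<close>

lemma continuous_AE_eq:
  fixes f g :: "real \<Rightarrow> real"
  assumes J: "open J" and f: "continuous_on J f" and g: "continuous_on J g"
    and ae: "AE x in lborel. x \<in> J \<longrightarrow> f x = g x" and y: "y \<in> J"
  shows "f y = g y"
proof (rule ccontr)
  assume ne: "f y \<noteq> g y"
  define U where "U = {x \<in> J. f x - g x \<in> - {0}}"
  have "open U" unfolding U_def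
    using continuous_open_preimage[OF continuous_on_diff[OF f g] J, of "- {0}"] by (auto simp: vimage_def Int_def)
  moreover have "AE x in lborel. x \<notin> U" using ae by eventually_elim (auto simp: U_def)
  ultimately have "U \<in> null_sets lborel" by (simp add: AE_iff_null_sets)
  then have "negligible U" by (simp add: negligible_iff_null_sets null_sets_completionI)
  then show False using open_not_negligible[OF \<open>open U\<close>] ne y by (auto simp: U_def)
qed

lemma open_Icc_nbhd:
  fixes J :: "real set"
  assumes "open J" "y \<in> J" obtains u v where "u < y" "y < v" "{u..v} \<subseteq> J"
proof -
  obtain e where e: "e > 0" "cball y e \<subseteq> J" using assms open_contains_cball by blast
  then show ?thesis using that[of "y - e" "y + e"] by (auto simp: cball_eq_atLeastAtMost)
qed

lemma continuous_on_from_Icc: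
  fixes f :: "real \<Rightarrow> real"
  assumes J: "open J" and "\<And>u v. {u..v} \<subseteq> J \<Longrightarrow> continuous_on {u..v} f"
  shows "continuous_on J f"
  unfolding continuous_on_eq_continuous_at[OF J]
proof
  fix y assume "y \<in> J"
  then obtain u v where uv: "u < y" "y < v" "{u..v} \<subseteq> J" using open_Icc_nbhd[OF J] by blast
  then show "isCont f y" using assms(2)[OF uv(3)] by (intro continuous_on_interior[of "{u..v}"]) auto
qed

lemma ac_loc_continuous_on: "open J \<Longrightarrow> ac_loc J f \<Longrightarrow> continuous_on J f"
  by (rule continuous_on_from_Icc) (auto simp: ac_loc_def intro: ac_on_continuous_on)

lemma deriv_cong_open:
  assumes "open J" "\<And>x. x \<in> J \<Longrightarrow> f x = g x" "y \<in> J" shows "deriv f y = deriv g y"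
  using assms by (intro deriv_cong_ev) (auto simp: eventually_nhds)

text \<open>Pointwise \<open>\<bar>w f\<bar> \<le> w + w f\<^sup>2\<close>: a locally integrable
  weight makes weighted square integrable functions locally integrable with the weight as
  factor.\<close>

lemma set_integrable_square_bound:
  assumes f: "set_borel_measurable lborel {u..v} f" and w: "set_integrable lborel {u..v} w"
    and w0: "\<And>x. x \<in> {u..v} \<Longrightarrow> 0 \<le> w x" and m: "set_integrable lborel {u..v} (\<lambda>x. w x * (f x)\<^sup>2)"
  shows "set_integrable lborel {u..v} (\<lambda>x. w x * f x :: real)"
  unfolding set_integrable_def
proof (rule Bochner_Integration.integrable_bound)
  show "integrable lborel (\<lambda>x. indicator {u..v} x *\<^sub>R w x + indicator {u..v} x *\<^sub>R (w x * (f x)\<^sup>2))"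
    using w m unfolding set_integrable_def by (rule Bochner_Integration.integrable_add)
  have "(\<lambda>x. indicator {u..v} x *\<^sub>R (w x * f x)) = (\<lambda>x. (indicator {u..v} x *\<^sub>R w x) * (indicator {u..v} x *\<^sub>R f x))"
    by (auto split: split_indicator)
  moreover have "(\<lambda>x. indicator {u..v} x *\<^sub>R w x) \<in> borel_measurable lborel"
    using w unfolding set_integrable_def by (rule borel_measurable_integrable)
  moreover have "(\<lambda>x. indicator {u..v} x *\<^sub>R f x) \<in> borel_measurable lborel"
    using f by (simp add: set_borel_measurable_def)
  ultimately show "(\<lambda>x. indicator {u..v} x *\<^sub>R (w x * f x)) \<in> borel_measurable lborel"
    by (simp only: borel_measurable_times)
  show "AE x in lborel. norm (indicator {u..v} x *\<^sub>R (w x * f x))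
      \<le> norm (indicator {u..v} x *\<^sub>R w x + indicator {u..v} x *\<^sub>R (w x * (f x)\<^sup>2))"
  proof (rule AE_I2)
    fix x
    have "\<bar>f x\<bar> \<le> 1 + (f x)\<^sup>2"
      using sum_squares_bound[of 1 "\<bar>f x\<bar>"] by simp
    then have "w x * \<bar>f x\<bar> \<le> w x * (1 + (f x)\<^sup>2)" if "x \<in> {u..v}" by (rule mult_left_mono[OF _ w0[OF that]])
    then show "norm (indicator {u..v} x *\<^sub>R (w x * f x))
      \<le> norm (indicator {u..v} x *\<^sub>R w x + indicator {u..v} x *\<^sub>R (w x * (f x)\<^sup>2))"
      using w0[of x] by (auto simp: abs_mult algebra_simps split: split_indicator)
  qed
qed

locale weighted_interval = weighted_space J w H for J w H +
  assumes J_open: "open J" and J_int: "is_interval J" and J_ne: "J \<noteq> {}"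
    and w_int: "loc_integrable J w"
begin

lemma set_borel_measurable_H: "f \<in> borel_measurable H \<Longrightarrow> {u..v} \<subseteq> J \<Longrightarrow> set_borel_measurable lborel {u..v} f"
  for f :: "real \<Rightarrow> real"
  by (simp add: measurable_H measurable_restrict_set_borel)

lemma w_times_L2_integrable: assumes g: "g \<in> L2 H" shows "loc_integrable J (\<lambda>y. w y * g y)"
  unfolding loc_integrable_def
proof (intro allI impI)
  fix u v assume uv: "{u..v} \<subseteq> J"
  have "integrable lborel (\<lambda>y. indicator J y * (w y * (g y)\<^sup>2))"
    using g L2_measurable[OF g] by (subst integral_H(1)[symmetric]) (auto simp: L2_def)
  from integrable_mult_indicator[OF _ this, of "{u..v}"]
  have "integrable lborel (\<lambda>y. indicator {u..v} y *\<^sub>R (indicator J y * (w y * (g y)\<^sup>2)))" by simp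
  moreover have "indicator {u..v} y *\<^sub>R (indicator J y * (w y * (g y)\<^sup>2)) = indicator {u..v} y *\<^sub>R (w y * (g y)\<^sup>2)" for y
    using uv by (auto split: split_indicator)
  ultimately have "set_integrable lborel {u..v} (\<lambda>y. w y * (g y)\<^sup>2)" by (simp only: set_integrable_def)
  then show "set_integrable lborel {u..v} (\<lambda>y. w y * g y)"
  proof (rule set_integrable_square_bound[OF set_borel_measurable_H[OF L2_measurable[OF g] uv], rotated 2])
    show "set_integrable lborel {u..v} w" using w_int uv by (simp only: loc_integrable_def)
    fix x assume "x \<in> {u..v}"
    then have "x \<in> J" using uv by blast
    then show "0 \<le> w x" using w_pos less_imp_le by blast
  qed
qed

lemma continuous_reps_eq:
  assumes c: "continuous_on J c" "continuous_on J c'" and ae: "eq_ae H v c" "eq_ae H v c'" and y: "y \<in> J"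
  shows "c y = c' y"
proof (rule continuous_AE_eq[OF J_open c _ y])
  from ae show "AE x in lborel. x \<in> J \<longrightarrow> c x = c' x"
    unfolding eq_ae_def AE_H_iff by eventually_elim auto
qed

text \<open>\<open>ac_rep\<close> is a choice. Its values on \<open>J\<close> are determined because
  two continuous functions equal almost everywhere agree there.\<close>

lemma ac_rep_eq:
  assumes c: "ac_loc J c" "eq_ae H v c"
  shows "ac_loc J (ac_rep H J v)" "eq_ae H v (ac_rep H J v)" "\<And>y. y \<in> J \<Longrightarrow> ac_rep H J v y = c y"
proof -
  have "ac_loc J (ac_rep H J v) \<and> eq_ae H v (ac_rep H J v)"
    unfolding ac_rep_def by (rule someI[of _ c]) (use c in simp)
  then show 1: "ac_loc J (ac_rep H J v)" "eq_ae H v (ac_rep H J v)" by auto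
  show "ac_rep H J v y = c y" if "y \<in> J" for y
    using continuous_reps_eq[OF ac_loc_continuous_on[OF J_open 1(1)] ac_loc_continuous_on[OF J_open c(1)] 1(2) c(2) that] .
qed

lemma test_function_DERIV:
  assumes "\<phi> \<in> test_functions J" shows "DERIV \<phi> x :> deriv \<phi> x" "isCont (deriv \<phi>) x"
proof -
  have sm: "\<And>k x. (deriv ^^ k) \<phi> field_differentiable at x" using assms by (auto simp: test_functions_def)
  show "DERIV \<phi> x :> deriv \<phi> x" using sm[of 0 x] by (simp add: DERIV_deriv_iff_field_differentiable)
  show "isCont (deriv \<phi>) x" using sm[of 1 x] by (simp add: field_differentiable_imp_continuous_at)
qed

lemma form_deriv_test:
  assumes "\<phi> \<in> test_functions J" "y \<in> J" shows "form_deriv H J \<phi> y = deriv \<phi> y"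
proof -
  have "ac_loc J \<phi>" unfolding ac_loc_def
    using test_function_DERIV[OF assms(1)] by (auto intro!: ac_on_C1 continuous_at_imp_continuous_on)
  moreover have "eq_ae H \<phi> \<phi>" by (simp add: eq_ae_def)
  ultimately show ?thesis unfolding form_deriv_def using ac_rep_eq(3)[of \<phi> \<phi>] assms
    by (intro deriv_cong_open[OF J_open]) auto
qed

text \<open>The classical content of \<open>g = A v\<close> with boundary conditions left aside:
  \<open>c\<close> is the representative of \<open>v\<close>, \<open>D\<close> its derivative, and
  \<open>c'' = w g\<close> in integrated form. Dropping the domain makes the estimates below
  independent of the chosen \<open>V\<close>.\<close>

definition regular_pair :: "(real \<Rightarrow> real) \<Rightarrow> (real \<Rightarrow> real) \<Rightarrow> (real \<Rightarrow> real) \<Rightarrow> (real \<Rightarrow> real) \<Rightarrow> bool" where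
  "regular_pair v g c D \<longleftrightarrow> v \<in> L2 H \<and> g \<in> L2 H \<and> eq_ae H v c \<and> (\<forall>y\<in>J. DERIV c y :> D y) \<and>
     primitive_on J (\<lambda>y. w y * g y) D"

text \<open>The form identity, read on test functions, says that \<open>deriv c\<close> has weak
  derivative \<open>w g\<close>. It therefore agrees almost everywhere with a continuous primitive
  \<open>D\<close>, and a primitive of a continuous function is continuously differentiable.\<close>

theorem form_regular:
  assumes v: "v \<in> V_max H J" and g: "g \<in> L2 H"
    and weak: "\<And>\<phi>. \<phi> \<in> test_functions J \<Longrightarrow> \<phi> \<in> L2 H \<and> form_energy H J v \<phi> = - inner_L2 H g \<phi>"
  shows "\<exists>c D. regular_pair v g c D"
proof -
  define c where "c = ac_rep H J v"
  obtain c0 where c0: "ac_loc J c0" "eq_ae H v c0" "deriv c0 \<in> L2 (restrict_space lborel J)"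
    using v by (auto simp: V_max_def)
  have c: "ac_loc J c" "eq_ae H v c" "\<And>y. y \<in> J \<Longrightarrow> c y = c0 y"
    using ac_rep_eq[OF c0(1,2)] by (auto simp: c_def)
  have dc: "deriv c y = deriv c0 y" if "y \<in> J" for y using deriv_cong_open[OF J_open c(3) that] .
  have "deriv c0 \<in> borel_measurable (restrict_space borel J)"
    using L2_measurable[OF c0(3)] by (simp add: measurable_restrict_lborel)
  then have dm: "deriv c \<in> borel_measurable (restrict_space borel J)"
    by (subst measurable_cong[of _ _ "deriv c0"]) (auto simp: space_restrict_space dc)
  have prim: "primitive_on J (deriv c) c" by (rule ac_loc_primitive_deriv[OF J_open c(1) dm])
  have "\<exists>D. primitive_on J (\<lambda>y. w y * g y) D \<and> (AE x in lborel. x \<in> J \<longrightarrow> deriv c x = D x)"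
  proof (rule weak_derivative_primitive[OF J_open J_int J_ne _ w_times_L2_integrable[OF g]])
    show "loc_integrable J (deriv c)" using prim by (simp add: primitive_on_def)
    fix \<phi> assume \<phi>: "\<phi> \<in> test_functions J"
    have "form_energy H J v \<phi> = (LBINT x:J. deriv c x * deriv \<phi> x)"
    proof -
      have "form_energy H J v \<phi> = (LINT x|restrict_space lborel J. deriv c x * form_deriv H J \<phi> x)"
        by (simp add: form_energy_def inner_L2_def form_deriv_def c_def)
      also have "\<dots> = (LBINT x:J. deriv c x * form_deriv H J \<phi> x)"
        using J by (subst integral_restrict_space) (auto simp: set_lebesgue_integral_def)
      also have "\<dots> = (LBINT x:J. deriv c x * deriv \<phi> x)"
        by (rule set_lebesgue_integral_cong) (use J form_deriv_test[OF \<phi>] in auto)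
      finally show ?thesis .
    qed
    moreover have "inner_L2 H g \<phi> = (LBINT x:J. w x * g x * \<phi> x)"
      unfolding inner_L2_def using L2_measurable[OF g] L2_measurable[OF conjunct1[OF weak[OF \<phi>]]]
      by (subst integral_H(2)) (auto simp: set_lebesgue_integral_def mult.assoc)
    ultimately show "(LBINT x:J. deriv c x * deriv \<phi> x) = - (LBINT x:J. w x * g x * \<phi> x)"
      using weak[OF \<phi>] by simp
  qed
  then obtain D where D: "primitive_on J (\<lambda>y. w y * g y) D" "AE x in lborel. x \<in> J \<longrightarrow> deriv c x = D x" by blast
  have Dc: "continuous_on J D" by (rule ac_loc_continuous_on[OF J_open primitive_on_ac_loc[OF D(1)]])
  have "primitive_on J D c"
    by (rule primitive_on_cong_AE[OF J_open prim borel_measurable_continuous_on_restrict[OF Dc] D(2)])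
  then have "DERIV c y :> D y" if "y \<in> J" for y
    using primitive_on_DERIV_cont[OF J_open _ that] Dc that by (auto simp: continuous_on_eq_continuous_at[OF J_open])
  moreover have "v \<in> L2 H" using v by (auto simp: V_max_def)
  ultimately show ?thesis using c(2) D(1) g unfolding regular_pair_def by blast
qed

lemma regular_pair_lincomb:
  assumes 1: "regular_pair v g c D" and 2: "regular_pair v' g' c' D'"
  shows "regular_pair (\<lambda>y. k * v y + v' y) (\<lambda>y. k * g y + g' y) (\<lambda>y. k * c y + c' y) (\<lambda>y. k * D y + D' y)"
  unfolding regular_pair_def
proof (intro conjI ballI)
  show "(\<lambda>y. k * v y + v' y) \<in> L2 H" "(\<lambda>y. k * g y + g' y) \<in> L2 H"
    using 1 2 by (auto simp: regular_pair_def intro: L2_lincomb)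
  have "eq_ae H v c" "eq_ae H v' c'" using 1 2 by (auto simp: regular_pair_def)
  then show "eq_ae H (\<lambda>y. k * v y + v' y) (\<lambda>y. k * c y + c' y)"
    unfolding eq_ae_def by eventually_elim simp
  show "DERIV (\<lambda>y. k * c y + c' y) y :> k * D y + D' y" if "y \<in> J" for y
    using 1 2 that by (auto simp: regular_pair_def intro!: DERIV_add DERIV_cmult)
  have p: "primitive_on J (\<lambda>y. w y * g y) D" "primitive_on J (\<lambda>y. w y * g' y) D'"
    using 1 2 by (auto simp: regular_pair_def)
  show "primitive_on J (\<lambda>y. w y * (k * g y + g' y)) (\<lambda>y. k * D y + D' y)"
    unfolding primitive_on_def loc_integrable_def
  proof (intro conjI allI impI)
    have eq: "(\<lambda>y. w y * (k * g y + g' y)) = (\<lambda>y. k * (w y * g y) + w y * g' y)" by (auto simp: algebra_simps)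
    fix u v' assume sub: "{u..v'} \<subseteq> J"
    note i = primitive_on_integrable[OF p(1) sub] primitive_on_integrable[OF p(2) sub]
    show "set_integrable lborel {u..v'} (\<lambda>y. w y * (k * g y + g' y))"
      unfolding eq using i by (intro set_integral_add set_integrable_mult_right)
    assume "u \<le> v'"
    from primitive_onD[OF p(1) this sub] primitive_onD[OF p(2) this sub]
    have "(k * D v' + D' v') - (k * D u + D' u) = k * (LBINT y:{u..v'}. w y * g y) + (LBINT y:{u..v'}. w y * g' y)"
      by (simp add: algebra_simps)
    also have "\<dots> = (LBINT y:{u..v'}. w y * (k * g y + g' y))"
      unfolding eq using i by (subst set_integral_add) auto
    finally show "(k * D v' + D' v') - (k * D u + D' u) = (LBINT y:{u..v'}. w y * (k * g y + g' y))" .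
  qed
qed

lemma w_integral_pos: assumes "u < v" "{u..v} \<subseteq> J" shows "(LBINT y:{u..v}. w y) > 0"
proof -
  have i: "integrable lborel (\<lambda>y. indicator {u..v} y * w y)"
    using w_int assms by (simp add: loc_integrable_def set_integrable_def)
  have nn: "0 \<le> indicator {u..v} y * w y" for y
    using w_pos assms by (auto simp: less_imp_le subset_eq split: split_indicator)
  have "(LBINT y:{u..v}. w y) \<noteq> 0"
  proof
    assume "(LBINT y:{u..v}. w y) = 0"
    then have "AE y in lborel. indicator {u..v} y * w y = 0"
      using integral_nonneg_eq_0_iff_AE[OF i] nn by (simp add: set_lebesgue_integral_def)
    then have "AE y in lborel. y \<notin> {u..v}"
    proof eventually_elim
      case (elim y)
      then show ?case using w_pos[of y] assms by (auto split: split_indicator_asm)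
    qed
    then have "{u..v} \<in> null_sets lborel" by (simp add: AE_iff_null_sets)
    then show False using assms by (simp add: null_sets_def)
  qed
  moreover have "(LBINT y:{u..v}. w y) \<ge> 0" unfolding set_lebesgue_integral_def using nn by simp
  ultimately show ?thesis by simp
qed

lemma integral_Icc_le_norm:
  assumes "v \<in> L2 H" "{a..b} \<subseteq> J"
  shows "(LBINT y:{a..b}. w y * (v y)\<^sup>2) \<le> (norm_L2 H v)\<^sup>2" "set_integrable lborel {a..b} (\<lambda>y. w y * (v y)\<^sup>2)"
proof -
  have m: "(\<lambda>y. (v y)\<^sup>2) \<in> borel_measurable H" and i0: "integrable H (\<lambda>y. (v y)\<^sup>2)" using assms by (auto simp: L2_def)
  have i: "integrable lborel (\<lambda>y. indicator J y * (w y * (v y)\<^sup>2))" using i0 integral_H(1)[OF m] by simp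
  from integrable_mult_indicator[OF _ i, of "{a..b}"]
  have "integrable lborel (\<lambda>y. indicator {a..b} y *\<^sub>R (indicator J y * (w y * (v y)\<^sup>2)))" by simp
  moreover have "indicator {a..b} y *\<^sub>R (indicator J y * (w y * (v y)\<^sup>2)) = indicator {a..b} y *\<^sub>R (w y * (v y)\<^sup>2)" for y
    using assms(2) by (auto split: split_indicator)
  ultimately show s: "set_integrable lborel {a..b} (\<lambda>y. w y * (v y)\<^sup>2)" by (simp only: set_integrable_def)
  have "(LBINT y:{a..b}. w y * (v y)\<^sup>2) \<le> (LINT y|lborel. indicator J y * (w y * (v y)\<^sup>2))"
    unfolding set_lebesgue_integral_def
    using s i assms(2) w_pos by (intro integral_mono) (auto simp: set_integrable_def less_imp_le split: split_indicator)
  also have "\<dots> = (norm_L2 H v)\<^sup>2"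
    using integral_H(2)[OF m, symmetric] by (simp add: norm_L2_def inner_L2_def power2_eq_square[of "v _", symmetric])
  finally show "(LBINT y:{a..b}. w y * (v y)\<^sup>2) \<le> (norm_L2 H v)\<^sup>2" .
qed

text \<open>If \<open>\<bar>c\<bar>\<close> exceeded the stated value throughout, its minimum over
  the compact interval would make the weighted integral of the square larger than the squared norm
  of \<open>v\<close>.\<close>

lemma L2_small_value:
  assumes v: "v \<in> L2 H" "eq_ae H v c" and c: "continuous_on J c" and ab: "a < b" "{a..b} \<subseteq> J"
  shows "\<exists>y\<in>{a..b}. \<bar>c y\<bar> \<le> norm_L2 H v / sqrt (LBINT y:{a..b}. w y)"
proof (rule ccontr)
  define m where "m = (LBINT y:{a..b}. w y)"
  have m: "m > 0" unfolding m_def by (rule w_integral_pos[OF ab])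
  assume "\<not> ?thesis"
  then have big: "\<And>y. y \<in> {a..b} \<Longrightarrow> norm_L2 H v / sqrt m < \<bar>c y\<bar>" by (auto simp: m_def not_le)
  have "continuous_on {a..b} (\<lambda>y. \<bar>c y\<bar>)" using c ab by (intro continuous_intros) (auto intro: continuous_on_subset)
  then obtain z where z: "z \<in> {a..b}" "\<And>y. y \<in> {a..b} \<Longrightarrow> \<bar>c z\<bar> \<le> \<bar>c y\<bar>"
    using continuous_attains_inf[of "{a..b}" "\<lambda>y. \<bar>c y\<bar>"] ab by auto
  have N0: "norm_L2 H v \<ge> 0" using norm_emb[OF v(1)] by (metis norm_ge_zero)
  have "(norm_L2 H v / sqrt m)\<^sup>2 < \<bar>c z\<bar>\<^sup>2" using big[OF z(1)] N0 m by (intro power_strict_mono) auto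
  then have lt: "(norm_L2 H v)\<^sup>2 < m * (c z)\<^sup>2" using m by (simp add: power_divide field_simps)
  have "m * (c z)\<^sup>2 = (LBINT y:{a..b}. w y * (c z)\<^sup>2)" by (simp add: m_def)
  also have "\<dots> \<le> (LBINT y:{a..b}. w y * (v y)\<^sup>2)"
  proof (rule set_integral_mono_AE)
    show "set_integrable lborel {a..b} (\<lambda>y. w y * (c z)\<^sup>2)"
      using w_int ab by (intro set_integrable_mult_left) (auto simp: loc_integrable_def)
    show "set_integrable lborel {a..b} (\<lambda>y. w y * (v y)\<^sup>2)" by (rule integral_Icc_le_norm(2)[OF v(1) ab(2)])
    have "AE y in lborel. y \<in> J \<longrightarrow> v y = c y" using v(2) by (simp add: eq_ae_def AE_H_iff)
    then show "AE y \<in> {a..b} in lborel. w y * (c z)\<^sup>2 \<le> w y * (v y)\<^sup>2"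
    proof eventually_elim
      case (elim y)
      show ?case
      proof
        assume y: "y \<in> {a..b}"
        then have "y \<in> J" using ab by auto
        have "\<bar>c z\<bar>\<^sup>2 \<le> \<bar>c y\<bar>\<^sup>2" using z(2)[OF y] by (intro power_mono) auto
        then show "w y * (c z)\<^sup>2 \<le> w y * (v y)\<^sup>2"
          using elim \<open>y \<in> J\<close> w_pos[of y] by (simp add: mult_left_mono less_imp_le)
      qed
    qed
  qed
  also have "\<dots> \<le> (norm_L2 H v)\<^sup>2" by (rule integral_Icc_le_norm(1)[OF v(1) ab(2)])
  finally show False using lt by simp
qed

text \<open>Cauchy-Schwarz in \<open>L2 H\<close> against the indicator of the interval, which is
  square integrable because \<open>w\<close> is locally integrable.\<close>

lemma integral_w_bound:
  assumes g: "g \<in> L2 H" and ab: "{a..b} \<subseteq> J"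
  shows "\<bar>LBINT y:{a..b}. w y * g y\<bar> \<le> sqrt (LBINT y:{a..b}. w y) * norm_L2 H g"
proof -
  define f where "f = (indicator {a..b} :: real \<Rightarrow> real)"
  have e: "indicator J y * (w y * f y) = indicator {a..b} y * w y" for y
    using ab by (auto simp: f_def split: split_indicator)
  have fm: "f \<in> borel_measurable H"
    unfolding measurable_H f_def by (rule measurable_restrict_space1) simp
  have f2: "(f y)\<^sup>2 = f y" for y by (simp add: f_def power2_eq_square split: split_indicator)
  have "integrable lborel (\<lambda>y. indicator J y * (w y * f y))"
    unfolding e using w_int ab by (simp add: loc_integrable_def set_integrable_def)
  then have fL: "f \<in> L2 H" using fm by (simp add: L2_def f2 integral_H(1))
  have "norm_L2 H f = sqrt (LBINT y:{a..b}. w y)"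
    using integral_H(2)[OF fm] by (simp add: norm_L2_def inner_L2_def power2_eq_square[symmetric] f2 e set_lebesgue_integral_def)
  moreover have "inner_L2 H f g = (LBINT y:{a..b}. w y * g y)"
  proof -
    have eq: "(\<lambda>y. indicator J y * (w y * (f y * g y))) = (\<lambda>y. indicator {a..b} y *\<^sub>R (w y * g y))"
    proof
      fix y
      show "indicator J y * (w y * (f y * g y)) = indicator {a..b} y *\<^sub>R (w y * g y)"
        using ab by (cases "y \<in> {a..b}") (auto simp: f_def)
    qed
    have "(\<lambda>y. f y * g y) \<in> borel_measurable H" using L2_measurable[OF g] fm by simp
    from integral_H(2)[OF this] show ?thesis unfolding inner_L2_def set_lebesgue_integral_def eq .
  qed
  ultimately show ?thesis
    using Cauchy_Schwarz_ineq2[of "emb f" "emb g"] by (simp add: inner_emb norm_emb fL g)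
qed

text \<open>Two separated points where \<open>c\<close> is small give, by the mean value theorem, a
  point where \<open>D\<close> is small. Cauchy-Schwarz bounds the oscillation of \<open>D\<close>,
  hence \<open>D\<close> everywhere, and the mean value theorem then bounds
  \<open>c\<close>.\<close>

theorem local_estimate:
  assumes ab: "a < b" "{a..b} \<subseteq> J"
  obtains C where "C \<ge> 0" "\<And>v g c D y. regular_pair v g c D \<Longrightarrow> y \<in> {a..b} \<Longrightarrow>
     \<bar>c y\<bar> \<le> C * (norm_L2 H v + norm_L2 H g) \<and> \<bar>D y\<bar> \<le> C * (norm_L2 H v + norm_L2 H g)"
proof -
  \<comment> \<open>The small values of \<open>c\<close> are sought in the outer thirds, so that the
    two points are at least \<open>d\<close> apart.\<close>
  define d where "d = (b - a) / 3"
  have d: "d > 0" "a + d < b - d" "a + d < b" "a < b - d" using ab by (simp_all add: d_def field_simps)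
  define k1 where "k1 = 1 / sqrt (LBINT y:{a..a + d}. w y)"
  define k2 where "k2 = 1 / sqrt (LBINT y:{b - d..b}. w y)"
  define W where "W = sqrt (LBINT y:{a..b}. w y)"
  have sub: "{a..a + d} \<subseteq> J" "{b - d..b} \<subseteq> J" using ab d by auto
  have k: "k1 \<ge> 0" "k2 \<ge> 0" "W \<ge> 0"
    using w_integral_pos[OF _ sub(1)] w_integral_pos[OF _ sub(2)] w_integral_pos[OF ab] d
    by (auto simp: k1_def k2_def W_def)
  \<comment> \<open>\<open>C1\<close> bounds \<open>D\<close>: the slope between the two small
    values plus the oscillation \<open>W\<close>. \<open>C\<close> adds the small value
    \<open>k1\<close> of \<open>c\<close> and the growth \<open>(b - a) * C1\<close> away from
    it.\<close>
  define C1 where "C1 = (k1 + k2) / d + W"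
  define C where "C = C1 + k1 + (b - a) * C1"
  have C1: "C1 \<ge> 0" using k d by (simp add: C1_def)
  have C: "C \<ge> 0" "C1 \<le> C" "k1 + (b - a) * C1 \<le> C" using k C1 ab by (auto simp: C_def)
  show ?thesis
  proof (rule that[OF C(1)])
    fix v g c D y assume reg: "regular_pair v g c D" and y: "y \<in> {a..b}"
    define N where "N = norm_L2 H v + norm_L2 H g"
    have L: "v \<in> L2 H" "g \<in> L2 H" "eq_ae H v c" "\<And>y. y \<in> J \<Longrightarrow> DERIV c y :> D y" "primitive_on J (\<lambda>y. w y * g y) D"
      using reg by (auto simp: regular_pair_def)
    have n0: "norm_L2 H v \<ge> 0" "norm_L2 H g \<ge> 0" using norm_emb[OF L(1)] norm_emb[OF L(2)] by (metis norm_ge_zero)+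
    have N: "norm_L2 H v \<le> N" "norm_L2 H g \<le> N" "0 \<le> N" using n0 by (auto simp: N_def)
    have cc: "continuous_on J c" using L(4) by (auto intro!: continuous_at_imp_continuous_on DERIV_isCont)
    obtain y1 where y1: "y1 \<in> {a..a + d}" "\<bar>c y1\<bar> \<le> k1 * norm_L2 H v"
      using L2_small_value[OF L(1,3) cc _ sub(1)] d by (auto simp: k1_def)
    obtain y2 where y2: "y2 \<in> {b - d..b}" "\<bar>c y2\<bar> \<le> k2 * norm_L2 H v"
      using L2_small_value[OF L(1,3) cc _ sub(2)] d by (auto simp: k2_def)
    have c1: "\<bar>c y1\<bar> \<le> k1 * N" using y1(2) mult_left_mono[OF N(1) k(1)] by linarith
    have c2: "\<bar>c y2\<bar> \<le> k2 * N" using y2(2) mult_left_mono[OF N(1) k(2)] by linarith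
    have "b - a = 3 * d" by (simp add: d_def)
    then have y12: "y1 < y2" "d \<le> y2 - y1" using y1 y2 d(1) by auto
    have inJ: "z \<in> J" if "a \<le> z" "z \<le> b" for z using ab that by auto
    have "y1 \<ge> a" "y2 \<le> b" using y1 y2 by auto
    then obtain z where z: "y1 < z" "z < y2" "c y2 - c y1 = (y2 - y1) * D z"
      using MVT2[of y1 y2 c D] y12 L(4)[OF inJ] by auto
    have zab: "a \<le> z" "z \<le> b" using z y1 y2 by auto
    have "d * \<bar>D z\<bar> \<le> (y2 - y1) * \<bar>D z\<bar>" using y12 by (intro mult_right_mono) auto
    also have "\<dots> = \<bar>c y2 - c y1\<bar>" using z y12 by (simp add: abs_mult)
    also have "\<dots> \<le> (k1 + k2) * N" using c1 c2 by (simp add: distrib_right)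
    finally have Dz: "\<bar>D z\<bar> \<le> (k1 + k2) / d * N" using d by (simp add: field_simps)
    have Dinc: "\<bar>D v' - D u'\<bar> \<le> W * N" if uv: "a \<le> u'" "u' \<le> v'" "v' \<le> b" for u' v'
    proof -
      have s: "{u'..v'} \<subseteq> J" using uv ab by auto
      have "\<bar>D v' - D u'\<bar> \<le> sqrt (LBINT y:{u'..v'}. w y) * norm_L2 H g"
        using primitive_onD[OF L(5) uv(2) s] integral_w_bound[OF L(2) s] by simp
      also have "\<dots> \<le> W * N"
      proof (intro mult_mono N n0)
        have "(LBINT y:{u'..v'}. w y) \<le> (LBINT y:{a..b}. w y)"
          unfolding set_lebesgue_integral_def
          using w_int s ab uv w_pos inJ
          by (intro integral_mono) (auto simp: loc_integrable_def set_integrable_def less_imp_le split: split_indicator)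
        then show "sqrt (LBINT y:{u'..v'}. w y) \<le> W" by (simp add: W_def)
      qed (rule k)
      finally show ?thesis .
    qed
    have Dall: "\<bar>D x\<bar> \<le> C1 * N" if x: "a \<le> x" "x \<le> b" for x
    proof -
      have "\<bar>D x - D z\<bar> \<le> W * N"
        using Dinc[of x z] Dinc[of z x] x zab by (cases "x \<le> z") (auto simp: abs_minus_commute)
      then show ?thesis using Dz by (simp add: C1_def distrib_right)
    qed
    have "\<bar>c y - c y1\<bar> \<le> (b - a) * (C1 * N)"
    proof -
      have "\<bar>c v' - c u'\<bar> \<le> (b - a) * (C1 * N)" if uv: "a \<le> u'" "u' < v'" "v' \<le> b" for u' v'
      proof -
        obtain x where x: "u' < x" "x < v'" "c v' - c u' = (v' - u') * D x"
          using MVT2[of u' v' c D] uv(2) L(4)[OF inJ] uv(1,3) by auto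
        have "\<bar>c v' - c u'\<bar> = (v' - u') * \<bar>D x\<bar>" using x uv by (simp add: abs_mult)
        also have "\<dots> \<le> (b - a) * (C1 * N)" using Dall[of x] x uv by (intro mult_mono) auto
        finally show ?thesis .
      qed
      from this[of y y1] this[of y1 y] show ?thesis
        using y y1 d ab C1 N by (cases y y1 rule: linorder_cases) (auto simp: abs_minus_commute)
    qed
    then have "\<bar>c y\<bar> \<le> (k1 + (b - a) * C1) * N" using c1 by (simp add: algebra_simps)
    also have "\<dots> \<le> C * N" using C N by (intro mult_right_mono) auto
    finally have "\<bar>c y\<bar> \<le> C * N" .
    moreover have "\<bar>D y\<bar> \<le> C * N"
      using Dall[of y] y mult_right_mono[OF C(2) N(3)] by auto
    ultimately show "\<bar>c y\<bar> \<le> C * (norm_L2 H v + norm_L2 H g) \<and> \<bar>D y\<bar> \<le> C * (norm_L2 H v + norm_L2 H g)"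
      by (simp add: N_def)
  qed
qed

end

section \<open>Joint regularity of orbits\<close>

text \<open>Difference quotients in \<open>t\<close>, uniform on compact sets of \<open>y\<close> at
  each fixed \<open>t\<close>, give the time derivative and a Lipschitz bound in \<open>t\<close> at
  that time, uniform in nearby \<open>y\<close>. Together with continuity in \<open>y\<close> this
  is joint continuity.\<close>

lemma joint_regularity:
  fixes F F' :: "real \<Rightarrow> real \<Rightarrow> real"
  assumes J: "open J" and F: "\<And>t. t > 0 \<Longrightarrow> continuous_on J (F t)" and F': "\<And>t. t > 0 \<Longrightarrow> continuous_on J (F' t)"
    and uni: "\<And>t a b \<epsilon>. \<lbrakk>t > 0; a < b; {a..b} \<subseteq> J; \<epsilon> > 0\<rbrakk> \<Longrightarrow>
       \<forall>\<^sub>F h in at 0. \<forall>y\<in>{a..b}. \<bar>(F (t + h) y - F t y) / h - F' t y\<bar> \<le> \<epsilon>"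
  shows "\<And>t y. \<lbrakk>t > 0; y \<in> J\<rbrakk> \<Longrightarrow> DERIV (\<lambda>\<tau>. F \<tau> y) t :> F' t y"
    and "continuous_on ({0<..} \<times> J) (\<lambda>(t, y). F t y)"
proof -
  fix t y :: real assume t: "t > 0" and y: "y \<in> J"
  obtain a b where ab: "a < y" "y < b" "{a..b} \<subseteq> J" using open_Icc_nbhd[OF J y] by blast
  show "DERIV (\<lambda>\<tau>. F \<tau> y) t :> F' t y"
    unfolding DERIV_def
  proof (rule tendstoI)
    fix e :: real assume "e > 0"
    then have "\<forall>\<^sub>F h in at 0. \<forall>y\<in>{a..b}. \<bar>(F (t + h) y - F t y) / h - F' t y\<bar> \<le> e / 2"
      using ab by (intro uni t) auto
    then show "\<forall>\<^sub>F h in at 0. dist ((F (t + h) y - F t y) / h) (F' t y) < e"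
    proof eventually_elim
      case (elim h)
      then have "\<bar>(F (t + h) y - F t y) / h - F' t y\<bar> \<le> e / 2" using ab by auto
      then show ?case using \<open>e > 0\<close> by (simp add: dist_real_def)
    qed
  qed
next
  have op: "open ({0::real<..} \<times> J)" using J by (intro open_Times) auto
  show "continuous_on ({0<..} \<times> J) (\<lambda>(t, y). F t y)"
    unfolding continuous_on_eq_continuous_at[OF op]
  proof
    fix z assume "z \<in> {0::real<..} \<times> J"
    then obtain t y where z: "z = (t, y)" "t > 0" "y \<in> J" by auto
    obtain a b where ab: "a < y" "y < b" "{a..b} \<subseteq> J" using open_Icc_nbhd[OF J z(3)] by blast
    obtain B where B: "B \<ge> 0" "\<And>x. x \<in> {a..b} \<Longrightarrow> \<bar>F' t x\<bar> \<le> B"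
      using continuous_on_Icc_bounded[OF continuous_on_subset[OF F'[OF z(2)] ab(3)]] by blast
    have "\<forall>\<^sub>F h in at 0. \<forall>y\<in>{a..b}. \<bar>(F (t + h) y - F t y) / h - F' t y\<bar> \<le> 1"
      using ab by (intro uni z) auto
    then obtain d where d: "d > 0" "\<And>h. h \<noteq> 0 \<Longrightarrow> \<bar>h\<bar> < d \<Longrightarrow> \<forall>y\<in>{a..b}. \<bar>(F (t + h) y - F t y) / h - F' t y\<bar> \<le> 1"
      unfolding eventually_at by (auto simp: dist_real_def)
    \<comment> \<open>The quotient is within 1 of its limit, and the limit is bounded by
      \<open>B\<close> on the compact interval.\<close>
    have incr: "\<bar>F t' x - F t x\<bar> \<le> \<bar>t' - t\<bar> * (1 + B)" if "\<bar>t' - t\<bar> < d" "x \<in> {a..b}" for t' x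
    proof (cases "t' = t")
      case False
      then have "\<bar>(F t' x - F t x) / (t' - t) - F' t x\<bar> \<le> 1" using d(2)[of "t' - t"] that by simp
      then have "\<bar>(F t' x - F t x) / (t' - t)\<bar> \<le> 1 + B" using B(2)[OF that(2)] by linarith
      then show ?thesis using False by (simp add: abs_divide field_simps)
    qed simp
    have ev: "\<forall>\<^sub>F p in at z. \<bar>fst p - t\<bar> < d \<and> snd p \<in> {a..b}"
    proof -
      have "open ({t - d<..<t + d} \<times> {a<..<b})" "z \<in> {t - d<..<t + d} \<times> {a<..<b}"
        using z d ab by (auto intro: open_Times)
      then have "\<forall>\<^sub>F p in at z. p \<in> {t - d<..<t + d} \<times> {a<..<b}" by (rule eventually_at_in_open')
      then show ?thesis by eventually_elim auto
    qed
    have "isCont (F t) y" using F[OF z(2)] z(3) continuous_on_eq_continuous_at[OF J] by blast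
    moreover have "((\<lambda>p. snd p) \<longlongrightarrow> y) (at z)" using tendsto_snd[OF tendsto_ident_at, of z UNIV] z(1) by simp
    ultimately have "((\<lambda>p. F t (snd p)) \<longlongrightarrow> F t y) (at z)" by (rule isCont_tendsto_compose)
    moreover have "((\<lambda>p. fst p) \<longlongrightarrow> t) (at z)" using tendsto_fst[OF tendsto_ident_at, of z UNIV] z(1) by simp
    ultimately have lim: "((\<lambda>p. \<bar>fst p - t\<bar> * (1 + B) + \<bar>F t (snd p) - F t y\<bar>) \<longlongrightarrow> \<bar>t - t\<bar> * (1 + B) + \<bar>F t y - F t y\<bar>) (at z)"
      by (intro tendsto_intros)
    have "((\<lambda>p. F (fst p) (snd p) - F t y) \<longlongrightarrow> 0) (at z)"
    proof (rule Lim_null_comparison)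
      show "((\<lambda>p. \<bar>fst p - t\<bar> * (1 + B) + \<bar>F t (snd p) - F t y\<bar>) \<longlongrightarrow> 0) (at z)" using lim by simp
      show "\<forall>\<^sub>F p in at z. norm (F (fst p) (snd p) - F t y) \<le> \<bar>fst p - t\<bar> * (1 + B) + \<bar>F t (snd p) - F t y\<bar>"
        using ev
      proof eventually_elim
        case (elim p)
        then have "\<bar>F (fst p) (snd p) - F t (snd p)\<bar> \<le> \<bar>fst p - t\<bar> * (1 + B)" using incr by blast
        then show ?case by simp
      qed
    qed
    then show "isCont (\<lambda>(t, y). F t y) z"
      unfolding isCont_def case_prod_beta' using z(1) by (simp add: LIM_zero_iff)
  qed
qed

lemma norm_L2_nonneg: "0 \<le> norm_L2 M f"
  by (simp add: norm_L2_def inner_L2_def)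

context weighted_interval
begin

lemma L2_bounded_mult:
  assumes p: "p \<in> borel_measurable H" "\<And>y. y \<in> J \<Longrightarrow> \<bar>p y\<bar> \<le> P" and f: "f \<in> L2 H"
  shows "(\<lambda>y. p y * f y) \<in> L2 H" "norm_L2 H (\<lambda>y. p y * f y) \<le> \<bar>P\<bar> * norm_L2 H f"
proof -
  have fm: "f \<in> borel_measurable H" and fi: "integrable H (\<lambda>y. (f y)\<^sup>2)" using f by (auto simp: L2_def)
  have sp: "space H = J" unfolding H weighted_measure_def by (simp add: space_restrict_space)
  have le: "(p y * f y)\<^sup>2 \<le> P\<^sup>2 * (f y)\<^sup>2" if "y \<in> J" for y
    using power_mono[OF p(2)[OF that], of 2] by (simp add: power_mult_distrib mult_right_mono)
  have pi: "integrable H (\<lambda>y. P\<^sup>2 * (f y)\<^sup>2)" using fi by simp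
  have i: "integrable H (\<lambda>y. (p y * f y)\<^sup>2)"
    by (rule Bochner_Integration.integrable_bound[OF pi]) (use p fm le sp in \<open>auto intro!: AE_I2\<close>)
  then show L: "(\<lambda>y. p y * f y) \<in> L2 H" using p fm by (simp add: L2_def)
  have "(LINT y|H. (p y * f y)\<^sup>2) \<le> (LINT y|H. P\<^sup>2 * (f y)\<^sup>2)"
    by (rule integral_mono[OF i pi]) (use le sp in auto)
  then have "sqrt (LINT y|H. (p y * f y)\<^sup>2) \<le> sqrt (P\<^sup>2 * (LINT y|H. (f y)\<^sup>2))" by simp
  then show "norm_L2 H (\<lambda>y. p y * f y) \<le> \<bar>P\<bar> * norm_L2 H f"
    by (simp add: norm_L2_def inner_L2_def power2_eq_square[symmetric] real_sqrt_mult)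
qed

lemma norm_L2_add: "f \<in> L2 H \<Longrightarrow> g \<in> L2 H \<Longrightarrow> norm_L2 H (\<lambda>y. f y + g y) \<le> norm_L2 H f + norm_L2 H g"
  using norm_triangle_ineq[of "emb f" "emb g"] emb_lincomb[of f g 1] by (simp add: norm_emb L2_add flip: norm_emb)

lemma regular_pair_zero: "regular_pair (\<lambda>_. 0) (\<lambda>_. 0) (\<lambda>_. 0) (\<lambda>_. 0)"
  by (auto simp: regular_pair_def eq_ae_def primitive_on_def loc_integrable_def set_integrable_def set_lebesgue_integral_def)

text \<open>The error of a difference quotient is a linear combination of regular pairs, hence a
  regular pair; the zero pair supplies the missing summand in the combination for the third
  term.\<close>

lemma regular_pair_quotient:
  assumes 1: "regular_pair v g c D" and 2: "regular_pair v' g' c' D'" and 3: "regular_pair v'' g'' c'' D''"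
  shows "regular_pair (\<lambda>y. (v' y - v y) / h - v'' y) (\<lambda>y. (g' y - g y) / h - g'' y)
     (\<lambda>y. (c' y - c y) / h - c'' y) (\<lambda>y. (D' y - D y) / h - D'' y)"
proof -
  have eq: "1 / h * (-1 * a + b) + (-1 * e + 0) = (b - a) / h - e" for a b e :: real
    by (simp add: diff_divide_distrib)
  from regular_pair_lincomb[OF regular_pair_lincomb[OF 1 2, of "-1"] regular_pair_lincomb[OF 3 regular_pair_zero, of "-1"], of "1 / h"]
  show ?thesis unfolding eq .
qed

text \<open>The errors of the quotients of \<open>c k\<close> and \<open>D k\<close> are controlled
  by \<open>local_estimate\<close> through the errors of \<open>X k\<close> and of
  \<open>X (Suc k) + p X k\<close>. Both tend to 0, the second because \<open>p\<close> is bounded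
  and the orbit is differentiable one order further.\<close>

theorem orbit_regularity:
  assumes p: "p \<in> borel_measurable H" "\<And>y. y \<in> J \<Longrightarrow> \<bar>p y\<bar> \<le> P"
    and reg: "\<And>k t. t > 0 \<Longrightarrow> \<exists>c D. regular_pair (X k t) (\<lambda>y. X (Suc k) t y + p y * X k t y) c D"
    and dq: "\<And>k t. t > 0 \<Longrightarrow> ((\<lambda>h. norm_L2 H (\<lambda>y. (X k (t + h) y - X k t y) / h - X (Suc k) t y)) \<longlongrightarrow> 0) (at 0)"
  obtains c D where
    "\<And>k t. t > 0 \<Longrightarrow> regular_pair (X k t) (\<lambda>y. X (Suc k) t y + p y * X k t y) (c k t) (D k t)"
    "\<And>k t y. t > 0 \<Longrightarrow> y \<in> J \<Longrightarrow> DERIV (\<lambda>\<tau>. c k \<tau> y) t :> c (Suc k) t y"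
    "\<And>k. continuous_on ({0<..} \<times> J) (\<lambda>(t, y). c k t y)"
    "\<And>k. continuous_on ({0<..} \<times> J) (\<lambda>(t, y). D k t y)"
proof -
  define G where "G = (\<lambda>k t y. X (Suc k) t y + p y * X k t y)"
  have "\<forall>k t. \<exists>c D. t > 0 \<longrightarrow> regular_pair (X k t) (G k t) c D" using reg unfolding G_def by blast
  then obtain c D where cD: "\<And>k t. t > 0 \<Longrightarrow> regular_pair (X k t) (G k t) (c k t) (D k t)" by metis
  have XL: "X k t \<in> L2 H" if "t > 0" for k t using cD[OF that] by (simp add: regular_pair_def)
  have uni: "\<forall>\<^sub>F h in at 0. \<forall>y\<in>{a..b}. \<bar>(c k (t + h) y - c k t y) / h - c (Suc k) t y\<bar> \<le> \<epsilon> \<and>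
      \<bar>(D k (t + h) y - D k t y) / h - D (Suc k) t y\<bar> \<le> \<epsilon>"
    if t: "t > 0" and ab: "a < b" "{a..b} \<subseteq> J" and \<epsilon>: "\<epsilon> > 0" for k t a b \<epsilon>
  proof -
    obtain C where C: "C \<ge> 0" "\<And>v g c D y. regular_pair v g c D \<Longrightarrow> y \<in> {a..b} \<Longrightarrow>
     \<bar>c y\<bar> \<le> C * (norm_L2 H v + norm_L2 H g) \<and> \<bar>D y\<bar> \<le> C * (norm_L2 H v + norm_L2 H g)"
      using local_estimate[OF ab] by blast
    define Q where "Q = (\<lambda>k h y. (X k (t + h) y - X k t y) / h - X (Suc k) t y)"
    have "((\<lambda>h. C * (norm_L2 H (Q k h) + (norm_L2 H (Q (Suc k) h) + \<bar>P\<bar> * norm_L2 H (Q k h)))) \<longlongrightarrow> C * (0 + (0 + \<bar>P\<bar> * 0))) (at 0)"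
      unfolding Q_def by (intro tendsto_intros dq t)
    then have "\<forall>\<^sub>F h in at 0. C * (norm_L2 H (Q k h) + (norm_L2 H (Q (Suc k) h) + \<bar>P\<bar> * norm_L2 H (Q k h))) < \<epsilon>"
      using \<epsilon> by (intro order_tendstoD(2)) auto
    moreover have "\<forall>\<^sub>F h in at (0::real). dist h 0 < t" using t by (auto simp: eventually_at intro: exI[of _ t])
    ultimately show ?thesis
    proof eventually_elim
      case (elim h)
      then have th: "t + h > 0" by (auto simp: dist_real_def)
      have QL: "Q k h \<in> L2 H" for k
      proof -
        have "(\<lambda>y. inverse h * (X k (t + h) y - X k t y) - X (Suc k) t y) \<in> L2 H"
          by (intro L2_diff L2_scale XL t th)
        then show ?thesis by (simp add: Q_def divide_inverse mult.commute)
      qed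
      note r = regular_pair_quotient[OF cD[OF t, of k] cD[OF th, of k] cD[OF t, of "Suc k"], of h]
      \<comment> \<open>The potential does not depend on time, so it passes through the
        quotient.\<close>
      have Geq: "(\<lambda>y. (G k (t + h) y - G k t y) / h - G (Suc k) t y) = (\<lambda>y. Q (Suc k) h y + p y * Q k h y)"
        by (simp add: G_def Q_def fun_eq_iff add_divide_distrib diff_divide_distrib right_diff_distrib)
      have "norm_L2 H (\<lambda>y. (G k (t + h) y - G k t y) / h - G (Suc k) t y) \<le> norm_L2 H (Q (Suc k) h) + \<bar>P\<bar> * norm_L2 H (Q k h)"
        unfolding Geq using norm_L2_add[OF QL L2_bounded_mult(1)[OF p QL]] L2_bounded_mult(2)[OF p QL]
        by (meson add_left_mono order_trans)
      then have "C * (norm_L2 H (Q k h) + norm_L2 H (\<lambda>y. (G k (t + h) y - G k t y) / h - G (Suc k) t y)) \<le>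
          C * (norm_L2 H (Q k h) + (norm_L2 H (Q (Suc k) h) + \<bar>P\<bar> * norm_L2 H (Q k h)))"
        using C(1) by (intro mult_left_mono add_left_mono)
      then have "C * (norm_L2 H (Q k h) + norm_L2 H (\<lambda>y. (G k (t + h) y - G k t y) / h - G (Suc k) t y)) \<le> \<epsilon>"
        using elim(1) by linarith
      then show ?case using C(2)[OF r] unfolding Q_def by (meson order_trans)
    qed
  qed
  have cc: "continuous_on J (c k t)" and Dc: "continuous_on J (D k t)" if "t > 0" for k t
  proof -
    note r = cD[OF that, of k, unfolded regular_pair_def]
    show "continuous_on J (c k t)" using r by (auto intro!: continuous_at_imp_continuous_on DERIV_isCont)
    show "continuous_on J (D k t)" using r by (intro ac_loc_continuous_on[OF J_open] primitive_on_ac_loc) blast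
  qed
  have unic: "\<forall>\<^sub>F h in at 0. \<forall>y\<in>{a..b}. \<bar>(c k (t + h) y - c k t y) / h - c (Suc k) t y\<bar> \<le> \<epsilon>"
    and uniD: "\<forall>\<^sub>F h in at 0. \<forall>y\<in>{a..b}. \<bar>(D k (t + h) y - D k t y) / h - D (Suc k) t y\<bar> \<le> \<epsilon>"
    if "t > 0" "a < b" "{a..b} \<subseteq> J" "\<epsilon> > 0" for k t a b \<epsilon>
    using uni[OF that, of k] by (auto elim!: eventually_mono)
  show ?thesis
  proof (rule that[OF cD[unfolded G_def]])
    show "DERIV (\<lambda>\<tau>. c k \<tau> y) t :> c (Suc k) t y" if "t > 0" "y \<in> J" for k t y
      by (rule joint_regularity(1)[OF J_open cc cc unic that])
    show "continuous_on ({0<..} \<times> J) (\<lambda>(t, y). c k t y)" for k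
      by (rule joint_regularity(2)[OF J_open cc cc unic])
    show "continuous_on ({0<..} \<times> J) (\<lambda>(t, y). D k t y)" for k
      by (rule joint_regularity(2)[OF J_open Dc Dc uniD])
  qed
qed

end

section \<open>Scale and speed\<close>

lemma ac_on_minus: assumes "ac_on {c..d} f" shows "ac_on {c..d} (\<lambda>x. - f x)"
proof (rule ac_on_bound[OF assms assms, of 1])
  show "\<bar>- f v - - f u\<bar> \<le> 1 * (\<bar>f v - f u\<bar> + \<bar>f v - f u\<bar>)" for u v
  proof -
    have "\<bar>- f v - - f u\<bar> = \<bar>f v - f u\<bar>" by (simp add: abs_minus_commute)
    then show ?thesis by simp
  qed
qed simp

locale diffusion =
  fixes l r :: ereal and I :: "real set" and a b :: "real \<Rightarrow> real" and x\<^sub>0 :: real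
  assumes I: "I = einterval l r" and x0: "x\<^sub>0 \<in> I"
    and a_meas: "a \<in> borel_measurable (restrict_space borel I)"
    and b_meas: "b \<in> borel_measurable (restrict_space borel I)"
    and a_pos: "x \<in> I \<Longrightarrow> a x > 0"
    and inv_a: "loc_integrable I (\<lambda>x. 1 / a x)"
    and b_a: "loc_integrable I (\<lambda>x. b x / a x)"
begin

abbreviation R where "R \<equiv> rho a b x\<^sub>0"
abbreviation s where "s \<equiv> scale_fun a b x\<^sub>0"
abbreviation J where "J \<equiv> s ` I"
abbreviation w where "w \<equiv> weight I a b x\<^sub>0"
abbreviation H where "H \<equiv> weighted_measure J w"
abbreviation \<mu> where "\<mu> \<equiv> speed_measure I a b x\<^sub>0"
abbreviation m where "m x \<equiv> 1 / (a x * R x)"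
abbreviation sinv where "sinv \<equiv> the_inv_into I s"

lemma I_open: "open I" by (simp add: I)

lemma I_borel [measurable]: "I \<in> sets borel" by (simp add: I)

lemma I_interval: "is_interval I"
  unfolding is_interval_1 I
proof (intro ballI allI impI)
  fix u v x assume "u \<in> einterval l r" "v \<in> einterval l r" "u \<le> x \<and> x \<le> v"
  then show "x \<in> einterval l r"
    using less_le_trans[of l "ereal u" "ereal x"] le_less_trans[of "ereal x" "ereal v" r]
    by (simp add: einterval_iff)
qed

lemma I_Icc: "u \<in> I \<Longrightarrow> v \<in> I \<Longrightarrow> {u..v} \<subseteq> I"
  using I_interval unfolding is_interval_1 by (meson atLeastAtMost_iff subsetI)

lemma log_rho_primitive: "primitive_on I (\<lambda>x. b x / a x) (\<lambda>x. LBINT z=ereal x\<^sub>0..ereal x. b z / a z)"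
  by (rule primitive_on_interval_integral[OF b_a x0 I_interval])

lemma R_pos: "R x > 0" by (simp add: rho_def)

lemma R_ac_loc: "ac_loc I R"
proof -
  have "ac_loc I (\<lambda>x. LBINT z=ereal x\<^sub>0..ereal x. b z / a z)"
    by (rule primitive_on_ac_loc[OF log_rho_primitive])
  then have ac: "ac_on {c..d} (\<lambda>x. LBINT z=ereal x\<^sub>0..ereal x. b z / a z)" if "{c..d} \<subseteq> I" for c d
    using that by (simp add: ac_loc_def)
  have "ac_on {c..d} (\<lambda>x. - (LBINT z=ereal x\<^sub>0..ereal x. b z / a z))" if "{c..d} \<subseteq> I" for c d
    by (rule ac_on_minus[OF ac[OF that]])
  then show ?thesis unfolding ac_loc_def rho_def[abs_def] by (intro allI impI ac_on_exp)
qed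

lemma R_DERIV:
  assumes "DERIV (\<lambda>x. LBINT z=ereal x\<^sub>0..ereal x. b z / a z) x :> b x / a x"
  shows "DERIV R x :> - (b x / a x) * R x"
  unfolding rho_def[abs_def] using DERIV_chain2[OF DERIV_exp DERIV_minus[OF assms]] by (simp add: mult.commute)

lemma R_DERIV_AE: "AE x in lborel. x \<in> I \<longrightarrow> DERIV R x :> - (b x / a x) * R x"
  using primitive_on_DERIV_AE[OF I_open log_rho_primitive] by eventually_elim (blast intro: R_DERIV)

lemma R_DERIV_cont:
  assumes "continuous_on I a" "continuous_on I b" "x \<in> I"
  shows "DERIV R x :> - (b x / a x) * R x"
proof (rule R_DERIV[OF primitive_on_DERIV_cont[OF I_open log_rho_primitive assms(3)]])
  have "isCont a x" "isCont b x" using assms continuous_on_eq_continuous_at[OF I_open] by auto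
  then show "isCont (\<lambda>x. b x / a x) x" using a_pos[OF assms(3)] by (intro continuous_intros) auto
qed

lemma R_cont: "continuous_on I R"
  by (rule ac_loc_continuous_on[OF I_open R_ac_loc])

text \<open>Although \<open>b / a\<close> is only integrable, \<open>R\<close> is the exponential of
  its integral and hence continuous; so the scale function is differentiable everywhere, with
  positive derivative.\<close>

lemma s_DERIV: "x \<in> I \<Longrightarrow> DERIV s x :> R x"
proof -
  assume x: "x \<in> I"
  have "loc_integrable I R"
    unfolding loc_integrable_def using R_cont
    by (auto intro: borel_integrable_atLeastAtMost' continuous_on_subset)
  then have "primitive_on I R s"
    unfolding scale_fun_def[abs_def] by (rule primitive_on_interval_integral[OF _ x0 I_interval])
  then show ?thesis
    using primitive_on_DERIV_cont[OF I_open _ x] R_cont x continuous_on_eq_continuous_at[OF I_open] by blast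
qed

lemma s_less: "x \<in> I \<Longrightarrow> y \<in> I \<Longrightarrow> x < y \<Longrightarrow> s x < s y"
proof -
  assume xy: "x \<in> I" "y \<in> I" "x < y"
  obtain z where "x < z" "z < y" "s y - s x = (y - x) * R z"
    using MVT2[OF xy(3), of s R] I_Icc[OF xy(1,2)] s_DERIV by (auto simp: subset_eq)
  then have "s y - s x > 0" using xy R_pos[of z] by simp
  then show ?thesis by simp
qed

lemma s_less_iff: "x \<in> I \<Longrightarrow> y \<in> I \<Longrightarrow> s x < s y \<longleftrightarrow> x < y"
  using s_less by (metis less_asym linorder_neqE_linordered_idom)

lemma s_le_iff: "x \<in> I \<Longrightarrow> y \<in> I \<Longrightarrow> s x \<le> s y \<longleftrightarrow> x \<le> y"
  using s_less_iff by (metis not_less)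

lemma s_inj: "inj_on s I"
  using s_less by (intro linorder_inj_onI) fastforce+

lemma s_cont: "continuous_on I s"
  using s_DERIV by (auto intro!: continuous_at_imp_continuous_on DERIV_isCont)

lemma J_interval: "is_interval J"
  using connected_continuous_image[OF s_cont] I_interval by (simp add: is_interval_connected_1)

lemma J_Icc: "u \<in> J \<Longrightarrow> v \<in> J \<Longrightarrow> {u..v} \<subseteq> J"
  using J_interval unfolding is_interval_1 by (meson atLeastAtMost_iff subsetI)

lemma s_Icc: "u \<in> I \<Longrightarrow> v \<in> I \<Longrightarrow> {s u..s v} \<subseteq> J"
  by (rule J_Icc) auto

lemma J_open: "open J"
  unfolding open_subopen[of J]
proof
  fix y assume "y \<in> J"
  then obtain x where x: "x \<in> I" "y = s x" by auto
  obtain u v where uv: "u < x" "x < v" "{u..v} \<subseteq> I" using open_Icc_nbhd[OF I_open x(1)] by blast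
  then have uvI: "u \<in> I" "v \<in> I" by auto
  have "{s u<..<s v} \<subseteq> J" using s_Icc[OF uvI] greaterThanLessThan_subseteq_atLeastAtMost_iff[of "s u" "s v"] by fastforce
  moreover have "y \<in> {s u<..<s v}" using s_less uvI uv x by auto
  ultimately show "\<exists>T. open T \<and> y \<in> T \<and> T \<subseteq> J" by (intro exI[of _ "{s u<..<s v}"]) auto
qed

lemma J_borel [measurable]: "J \<in> sets borel" using J_open by simp

lemma sinv_s [simp]: "x \<in> I \<Longrightarrow> sinv (s x) = x" by (rule the_inv_into_f_f[OF s_inj])

lemma sinv_in: "y \<in> J \<Longrightarrow> sinv y \<in> I" and s_sinv: "y \<in> J \<Longrightarrow> s (sinv y) = y" by auto

lemma sinv_cont: "continuous_on J sinv"
proof -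
  obtain g where g: "homeomorphism I J s g"
    using invariance_of_domain_homeomorphism[OF I_open s_cont _ s_inj] by auto
  have "continuous_on J g" using g by (simp add: homeomorphism_def)
  moreover have "sinv y = g y" if "y \<in> J" for y using g that by (auto simp: homeomorphism_def)
  ultimately show ?thesis by (simp cong: continuous_on_cong)
qed

lemma w_s: "x \<in> I \<Longrightarrow> w (s x) = 1 / (a x * (R x)\<^sup>2)"
  by (simp add: weight_def)

lemma sinv_meas: "sinv \<in> measurable (restrict_space borel J) (restrict_space borel I)"
  using borel_measurable_continuous_on_restrict[OF sinv_cont] sinv_in
  by (intro measurable_restrict_space2) (auto simp: space_restrict_space)

lemma s_meas: "s \<in> measurable (restrict_space borel I) (restrict_space borel J)"
  using borel_measurable_continuous_on_restrict[OF s_cont]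
  by (intro measurable_restrict_space2) (auto simp: space_restrict_space)

lemma R_meas: "R \<in> borel_measurable (restrict_space borel I)"
  by (rule borel_measurable_continuous_on_restrict[OF R_cont])

lemma w_meas: "w \<in> borel_measurable (restrict_space borel J)"
proof -
  have "(\<lambda>x. 1 / (a x * (R x)\<^sup>2)) \<in> borel_measurable (restrict_space borel I)"
    using a_meas R_meas by measurable
  from measurable_compose[OF sinv_meas this] show ?thesis by (simp add: weight_def[abs_def] Let_def)
qed

lemma w_pos: assumes "y \<in> J" shows "w y > 0"
proof -
  obtain x where x: "x \<in> I" "y = s x" using assms by auto
  show ?thesis using a_pos[OF x(1)] R_pos[of x] by (simp add: x(2) w_s[OF x(1)])
qed

sublocale ws: weighted_space J w H
  by unfold_locales (auto simp: w_meas w_pos)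

lemma m_pos: "x \<in> I \<Longrightarrow> m x > 0" using a_pos R_pos by simp

lemma m_meas: "(\<lambda>x. m x) \<in> borel_measurable (restrict_space borel I)"
  using a_meas R_meas by measurable

text \<open>The speed measure is itself a weighted measure, so null sets and integrals on
  \<open>I\<close> are handled by the same lemmas as those on \<open>J\<close>.\<close>

interpretation wI: weighted_space I "\<lambda>x. m x" \<mu>
  by unfold_locales (use m_meas m_pos in \<open>auto simp: speed_measure_def weighted_measure_def\<close>)

lemma m_loc: "loc_integrable I (\<lambda>x. m x)"
  unfolding loc_integrable_def
proof (intro allI impI)
  fix u v assume uv: "{u..v} \<subseteq> I"
  have "continuous_on {u..v} (\<lambda>x. 1 / R x)"
    using R_cont uv R_pos by (intro continuous_intros) (auto intro: continuous_on_subset simp: less_imp_neq[symmetric])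
  from set_integrable_mult_continuous[OF inv_a[unfolded loc_integrable_def, rule_format, OF uv] this]
  show "set_integrable lborel {u..v} (\<lambda>x. m x)" by simp
qed

lemma sets_\<mu>: "sets \<mu> = sets (restrict_space borel I)"
  by (simp add: speed_measure_def sets_restrict_space)

lemma sets_H: "sets H = sets (restrict_space borel J)"
  by (simp add: weighted_measure_def sets_restrict_space)

lemma s_meas_\<mu>: "s \<in> measurable \<mu> H"
  using s_meas measurable_cong_sets[OF sets_\<mu> sets_H] by simp

section \<open>The weighted measure as push-forward of the speed measure\<close>

text \<open>Substitution \<open>y = s x\<close> on a compact interval:
  \<open>w (s x) * R x = m x\<close>, one of the two factors \<open>R\<close> in the weight being
  cancelled by the derivative of \<open>s\<close>.\<close>

lemma emeasure_H_Icc: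
  assumes cd: "c \<le> d" "{c..d} \<subseteq> I" and A: "A \<in> sets borel" "A \<subseteq> J"
  shows "emeasure H (A \<inter> {s c..s d}) = emeasure \<mu> (s -` A \<inter> {c..d})"
proof -
  have cdI: "c \<in> I" "d \<in> I" using cd by auto
  have subJ: "{s c..s d} \<subseteq> J" by (rule s_Icc[OF cdI])
  have wm: "(\<lambda>y. ennreal (w y)) \<in> borel_measurable (restrict_space lborel J)"
    using w_meas by (simp add: measurable_restrict_lborel[symmetric])
  have mm: "(\<lambda>x. ennreal (m x)) \<in> borel_measurable (restrict_space lborel I)"
    using m_meas by (simp add: measurable_restrict_lborel[symmetric])
  have sA: "s -` A \<inter> I \<in> sets borel"
  proof -
    have "s -` A \<inter> space (restrict_space borel I) \<in> sets (restrict_space borel I)"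
      using A by (intro measurable_sets[OF borel_measurable_continuous_on_restrict[OF s_cont]]) auto
    then show ?thesis by (auto simp: space_restrict_space sets_restrict_space_iff)
  qed
  then have sA': "s -` A \<inter> {c..d} \<in> sets borel"
  proof -
    have "s -` A \<inter> {c..d} = (s -` A \<inter> I) \<inter> {c..d}" using cd by auto
    then show ?thesis using sA by simp
  qed
  define f where "f = (\<lambda>y. indicator A y * w y)"
  have "emeasure H (A \<inter> {s c..s d}) = (\<integral>\<^sup>+y. ennreal (w y) * indicator (A \<inter> {s c..s d}) y \<partial>restrict_space lborel J)"
    unfolding weighted_measure_def using A by (intro emeasure_density wm) (auto simp: sets_restrict_space_iff)
  also have "\<dots> = (\<integral>\<^sup>+y. ennreal (f y * indicator {s c..s d} y) \<partial>lborel)"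
    using A subJ by (subst nn_integral_restrict_space) (auto simp: f_def intro!: nn_integral_cong split: split_indicator)
  also have "\<dots> = (\<integral>\<^sup>+x. ennreal (f (s x) * R x * indicator {c..d} x) \<partial>lborel)"
  proof (rule nn_integral_substitution)
    have "(\<lambda>y. indicator J y * w y) \<in> borel_measurable borel" using w_meas ws.measurable_J_iff by blast
    then have "(\<lambda>y. indicator (A \<inter> {s c..s d}) y * (indicator J y * w y)) \<in> borel_measurable borel"
      using A(1) by measurable
    moreover have "indicator (A \<inter> {s c..s d}) y * (indicator J y * w y) = indicator {s c..s d} y *\<^sub>R f y" for y
      using subJ by (auto simp: f_def split: split_indicator)
    ultimately show "set_borel_measurable borel {s c..s d} f" by (simp add: set_borel_measurable_def)
    show "continuous_on {c..d} R" using R_cont cd(2) continuous_on_subset by blast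
  qed (use cd s_DERIV R_pos in \<open>auto simp: less_imp_le\<close>)
  also have "\<dots> = (\<integral>\<^sup>+x. ennreal (m x) * indicator (s -` A \<inter> {c..d}) x * indicator I x \<partial>lborel)"
  proof (intro nn_integral_cong)
    fix x
    show "ennreal (f (s x) * R x * indicator {c..d} x) = ennreal (m x) * indicator (s -` A \<inter> {c..d}) x * indicator I x"
    proof (cases "x \<in> {c..d} \<and> s x \<in> A")
      case True
      then have "x \<in> I" using cd by auto
      then have "f (s x) * R x = m x" using True R_pos[of x] by (simp add: f_def w_s power2_eq_square)
      then show ?thesis using True \<open>x \<in> I\<close> by simp
    qed (auto simp: f_def split: split_indicator)
  qed
  also have "\<dots> = (\<integral>\<^sup>+x. ennreal (m x) * indicator (s -` A \<inter> {c..d}) x \<partial>restrict_space lborel I)"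
    by (subst nn_integral_restrict_space) auto
  also have "\<dots> = emeasure \<mu> (s -` A \<inter> {c..d})"
    unfolding speed_measure_def using sA' cd by (intro emeasure_density[symmetric] mm) (auto simp: sets_restrict_space_iff)
  finally show ?thesis .
qed

text \<open>The substitution rule works on compact intervals; exhausting \<open>I\<close> by an
  increasing sequence of them gives equality of the measures.\<close>

theorem H_distr: "distr \<mu> H s = H"
proof (rule measure_eqI)
  show "sets (distr \<mu> H s) = sets H" by simp
  fix A assume "A \<in> sets (distr \<mu> H s)"
  then have AH: "A \<in> sets H" by simp
  then have A: "A \<in> sets borel" "A \<subseteq> J" unfolding sets_H by (auto simp: sets_restrict_space_iff)
  have lr: "l < r" using x0 by (auto simp: I einterval_iff)
  obtain u v :: "nat \<Rightarrow> real" where uv: "einterval l r = (\<Union>i. {v i .. u i})" "incseq u" "decseq v" "\<And>i. v i < u i"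
    by (rule einterval_Icc_approximation[OF lr]) blast
  have sub: "{v i..u i} \<subseteq> I" for i using uv(1) I by blast
  have end1: "v i \<in> I" "u i \<in> I" for i using uv(4)[of i] by (auto intro: subsetD[OF sub[of i]])
  have space: "space \<mu> = I" by (simp add: speed_measure_def space_restrict_space)
  have sAm: "s -` A \<inter> I \<in> sets \<mu>" using measurable_sets[OF s_meas_\<mu> AH] space by simp
  have icc: "{v i..u i} \<in> sets \<mu>" "{s (v i)..s (u i)} \<inter> J \<in> sets H" for i
    using sub by (auto simp: sets_\<mu> sets_H sets_restrict_space_iff)
  have "emeasure \<mu> (s -` A \<inter> I) = (SUP i. emeasure \<mu> (s -` A \<inter> {v i..u i}))"
  proof -
    have "(SUP i. emeasure \<mu> (s -` A \<inter> {v i..u i})) = emeasure \<mu> (\<Union>i. s -` A \<inter> {v i..u i})"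
    proof (rule SUP_emeasure_incseq)
      have "s -` A \<inter> {v i..u i} = (s -` A \<inter> I) \<inter> {v i..u i}" for i using sub by auto
      then show "range (\<lambda>i. s -` A \<inter> {v i..u i}) \<subseteq> sets \<mu>" using sAm icc(1) by auto
      show "incseq (\<lambda>i. s -` A \<inter> {v i..u i})"
        using uv(2,3) by (fastforce simp: incseq_def decseq_def intro: order_trans)
    qed
    also have "(\<Union>i. s -` A \<inter> {v i..u i}) = s -` A \<inter> I" using uv(1) I by auto
    finally show ?thesis by simp
  qed
  also have "\<dots> = (SUP i. emeasure H (A \<inter> {s (v i)..s (u i)}))"
    using uv(4) by (intro SUP_cong refl emeasure_H_Icc[symmetric] sub A less_imp_le)
  also have "\<dots> = emeasure H (\<Union>i. A \<inter> {s (v i)..s (u i)})"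
  proof (rule SUP_emeasure_incseq)
    have "A \<inter> {s (v i)..s (u i)} = A \<inter> ({s (v i)..s (u i)} \<inter> J)" for i using A by auto
    then show "range (\<lambda>i. A \<inter> {s (v i)..s (u i)}) \<subseteq> sets H" using AH icc(2) by auto
    show "incseq (\<lambda>i. A \<inter> {s (v i)..s (u i)})"
      unfolding incseq_def
    proof (intro allI impI)
      fix i j :: nat assume "i \<le> j"
      then have "s (v j) \<le> s (v i)" "s (u i) \<le> s (u j)"
        using uv(2,3) end1 by (auto simp: s_le_iff incseq_def decseq_def)
      then show "A \<inter> {s (v i)..s (u i)} \<subseteq> A \<inter> {s (v j)..s (u j)}" by auto
    qed
  qed
  also have "(\<Union>i. A \<inter> {s (v i)..s (u i)}) = A"
  proof -
    have "\<exists>i. s x \<in> {s (v i)..s (u i)}" if "x \<in> I" for x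
    proof -
      have "x \<in> (\<Union>i. {v i..u i})" using that uv(1) I by simp
      then obtain i where "x \<in> {v i..u i}" by blast
      then show ?thesis using that end1[of i] by (intro exI[of _ i]) (simp add: s_le_iff)
    qed
    then have "J \<subseteq> (\<Union>i. {s (v i)..s (u i)})" by blast
    then have "A \<inter> (\<Union>i. {s (v i)..s (u i)}) = A" using A(2) by (intro Int_absorb2 order_trans[OF A(2)])
    then show ?thesis by (simp only: Int_UN_distrib)
  qed
  finally show "emeasure (distr \<mu> H s) A = emeasure H A"
    using emeasure_distr[OF s_meas_\<mu> AH] space by simp
qed

lemma AE_H_s: "(AE y in H. P y) \<Longrightarrow> AE x in lborel. x \<in> I \<longrightarrow> P (s x)"
proof -
  assume "AE y in H. P y"
  then have "AE y in distr \<mu> H s. P y" unfolding H_distr .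
  then have "AE x in \<mu>. P (s x)" by (rule AE_distrD[OF s_meas_\<mu>])
  then show ?thesis by (simp add: wI.AE_H_iff)
qed

lemma AE_\<mu>_iff: "(AE x in \<mu>. P x) \<longleftrightarrow> (AE x in lborel. x \<in> I \<longrightarrow> P x)"
  by (rule wI.AE_H_iff)

lemma integral_H_s:
  assumes "F \<in> borel_measurable H"
  shows "integrable H F \<longleftrightarrow> integrable \<mu> (\<lambda>x. F (s x))" "(LINT y|H. F y) = (LINT x|\<mu>. F (s x) :: real)"
  using integrable_distr_eq[OF s_meas_\<mu>, of F] integral_distr[OF s_meas_\<mu>, of F] assms unfolding H_distr by simp_all

lemma norm_L2_s: "F \<in> borel_measurable H \<Longrightarrow> norm_L2 \<mu> (\<lambda>x. F (s x)) = norm_L2 H F"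
  using integral_H_s(2)[of "\<lambda>y. F y * F y"] by (simp add: norm_L2_def inner_L2_def)

lemma set_integral_w_s:
  assumes cd: "c \<le> d" "{c..d} \<subseteq> I" and g: "g \<in> borel_measurable H"
  shows "set_integrable lborel {s c..s d} (\<lambda>y. w y * g y) \<longleftrightarrow> set_integrable lborel {c..d} (\<lambda>x. m x * g (s x))"
    and "(LBINT y:{s c..s d}. w y * g y) = (LBINT x:{c..d}. m x * g (s x))"
proof -
  have cdI: "c \<in> I" "d \<in> I" using cd by auto
  have subJ: "{s c..s d} \<subseteq> J" by (rule s_Icc[OF cdI])
  define F where "F = (\<lambda>y. indicator {s c..s d} y * g y)"
  have F: "F \<in> borel_measurable H"
    unfolding F_def using g ws.measurable_H by (auto intro!: borel_measurable_times measurable_restrict_space1)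
  have F': "(\<lambda>x. F (s x)) \<in> borel_measurable \<mu>" using measurable_compose[OF s_meas_\<mu> F] .
  have e1: "indicator J y * (w y * F y) = indicator {s c..s d} y *\<^sub>R (w y * g y)" for y
    using subJ by (auto simp: F_def split: split_indicator)
  have e2: "indicator I x * (m x * F (s x)) = indicator {c..d} x *\<^sub>R (m x * g (s x))" for x
    using cd cdI by (cases "x \<in> I") (auto simp: F_def s_le_iff split: split_indicator)
  show "set_integrable lborel {s c..s d} (\<lambda>y. w y * g y) \<longleftrightarrow> set_integrable lborel {c..d} (\<lambda>x. m x * g (s x))"
    using integral_H_s(1)[OF F] ws.integral_H(1)[OF F] wI.integral_H(1)[OF F'] unfolding e1 e2 set_integrable_def by simp
  show "(LBINT y:{s c..s d}. w y * g y) = (LBINT x:{c..d}. m x * g (s x))"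
    using integral_H_s(2)[OF F] ws.integral_H(2)[OF F] wI.integral_H(2)[OF F'] unfolding e1 e2 set_lebesgue_integral_def by simp
qed

sublocale wi: weighted_interval J w H
proof unfold_locales
  show "open J" "is_interval J" "J \<noteq> {}" using J_open J_interval x0 by auto
  show "loc_integrable J w"
    unfolding loc_integrable_def
  proof (intro allI impI)
    fix u v assume uv: "{u..v} \<subseteq> J"
    show "set_integrable lborel {u..v} w"
    proof (cases "u \<le> v")
      case True
      then have "u \<in> J" "v \<in> J" using uv by auto
      then obtain c d where cd: "c \<in> I" "d \<in> I" "u = s c" "v = s d" by auto
      then have "c \<le> d" using True s_le_iff by simp
      then show ?thesis using set_integral_w_s(1)[OF _ I_Icc[OF cd(1,2)], of "\<lambda>_. 1"] m_loc I_Icc[OF cd(1,2)] cd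
        by (simp add: loc_integrable_def)
    qed simp
  qed
qed

text \<open>Carries the integrated equation for \<open>D\<close> to \<open>I\<close> by push-forward
  alone. No chain rule for functions that are merely absolutely continuous is involved.\<close>

lemma primitive_on_s:
  assumes D: "primitive_on J (\<lambda>y. w y * g y) D" and g: "g \<in> borel_measurable H"
  shows "primitive_on I (\<lambda>x. m x * g (s x)) (\<lambda>x. D (s x))"
  unfolding primitive_on_def loc_integrable_def
proof (intro conjI allI impI)
  note sub = s_Icc
  fix u v assume uv: "{u..v} \<subseteq> I"
  show "set_integrable lborel {u..v} (\<lambda>x. m x * g (s x))"
  proof (cases "u \<le> v")
    case True
    then have "u \<in> I" "v \<in> I" using uv by auto
    from primitive_on_integrable[OF D sub[OF this]] show ?thesis
      by (rule iffD1[OF set_integral_w_s(1)[OF True uv g]])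
  qed simp
  assume le: "u \<le> v"
  then have "u \<in> I" "v \<in> I" using uv by auto
  then have "D (s v) - D (s u) = (LBINT y:{s u..s v}. w y * g y)"
    using le s_le_iff by (intro primitive_onD[OF D _ sub]) auto
  then show "D (s v) - D (s u) = (LBINT x:{u..v}. m x * g (s x))"
    unfolding set_integral_w_s(2)[OF le uv g] .
qed

end

section \<open>The evolution in the original coordinate\<close>

lemma ac_loc_cong: assumes "ac_loc I f" "\<And>x. x \<in> I \<Longrightarrow> f x = g x" shows "ac_loc I g"
  unfolding ac_loc_def
proof (intro allI impI)
  fix c d assume cd: "{c..d} \<subseteq> I"
  then have "ac_on {c..d} f" using assms(1) by (simp add: ac_loc_def)
  then show "ac_on {c..d} g"
  proof (rule ac_on_bound[of c d f f 1])
    fix u v assume "c \<le> u" "u \<le> v" "v \<le> d"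
    then have "u \<in> I" "v \<in> I" using cd by auto
    then show "\<bar>g v - g u\<bar> \<le> 1 * (\<bar>f v - f u\<bar> + \<bar>f v - f u\<bar>)" using assms(2)[of u] assms(2)[of v] by simp
  qed (use \<open>ac_on {c..d} f\<close> in auto)
qed

lemma DERIV_cong_open:
  assumes "DERIV f x :> D" "open S" "x \<in> S" "\<And>y. y \<in> S \<Longrightarrow> f y = g y"
  shows "DERIV g x :> D" "deriv g x = D" "g field_differentiable at x"
proof -
  show 1: "DERIV g x :> D" by (rule has_field_derivative_transform_within_open[OF assms])
  then show "deriv g x = D" by (rule DERIV_imp_deriv)
  from 1 show "g field_differentiable at x" unfolding field_differentiable_def by blast
qed

text \<open>Separates the formal derivatives from their construction. \<open>pt\<close> and
  \<open>px\<close> differentiate total functions, yet \<open>u\<close> is known only for positive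
  \<open>t\<close> and \<open>x\<close> in \<open>I\<close>; as these sets are open, agreement there
  determines the derivatives.\<close>

locale smooth_family =
  fixes I :: "real set" and U W :: "nat \<Rightarrow> real \<Rightarrow> real \<Rightarrow> real" and u :: "real \<Rightarrow> real \<Rightarrow> real"
  assumes I_open: "open I"
    and U_t: "\<lbrakk>t > 0; x \<in> I\<rbrakk> \<Longrightarrow> DERIV (\<lambda>\<tau>. U k \<tau> x) t :> U (Suc k) t x"
    and U_x: "\<lbrakk>t > 0; x \<in> I\<rbrakk> \<Longrightarrow> DERIV (U k t) x :> W k t x"
    and U_cont: "continuous_on ({0<..} \<times> I) (\<lambda>(t, x). U k t x)"
    and W_cont: "continuous_on ({0<..} \<times> I) (\<lambda>(t, x). W k t x)"
    and u: "\<lbrakk>t > 0; x \<in> I\<rbrakk> \<Longrightarrow> u t x = U 0 t x"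
begin

lemma pt_power: "t > 0 \<Longrightarrow> x \<in> I \<Longrightarrow> (pt ^^ k) u t x = U k t x"
proof (induction k arbitrary: t x)
  case (Suc k)
  have "deriv (\<lambda>\<tau>. (pt ^^ k) u \<tau> x) t = U (Suc k) t x"
    by (rule DERIV_cong_open(2)[OF U_t[OF Suc.prems], of "{0<..}"]) (use Suc in auto)
  then show ?case by (simp add: pt_def[of "(pt ^^ k) u"])
qed (simp add: u)

lemma has_pt_power: "has_pt ({0<..} \<times> I) ((pt ^^ k) u)"
  unfolding has_pt_def
proof clarsimp
  fix t x assume tx: "0 < (t::real)" "x \<in> I"
  show "(\<lambda>\<tau>. (pt ^^ k) u \<tau> x) field_differentiable at t"
    by (rule DERIV_cong_open(3)[OF U_t[OF tx, of k], of "{0<..}"]) (use tx pt_power in auto)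
qed

lemma px_power: assumes tx: "t > 0" "x \<in> I"
  shows "(pt ^^ k) u t field_differentiable at x" "px ((pt ^^ k) u) t x = W k t x"
  using DERIV_cong_open(2,3)[OF U_x[OF tx, of k] I_open tx(2), of "(pt ^^ k) u t"] tx pt_power
  by (auto simp: px_def)

lemma px_px_power:
  assumes tx: "t > 0" "x \<in> I" and D: "DERIV (W k t) x :> D"
  shows "px ((pt ^^ k) u) t field_differentiable at x" "px (px ((pt ^^ k) u)) t x = D"
  using DERIV_cong_open(2,3)[OF D I_open tx(2), of "px ((pt ^^ k) u) t"] tx(1) px_power(2)
  by (auto simp: px_def[of "px _"])

lemma jointly_continuous_power:
  "jointly_continuous ({0<..} \<times> I) ((pt ^^ k) u)" "jointly_continuous ({0<..} \<times> I) (px ((pt ^^ k) u))"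
proof -
  show "jointly_continuous ({0<..} \<times> I) ((pt ^^ k) u)"
    unfolding jointly_continuous_def
    by (rule continuous_on_cong[THEN iffD1, OF refl _ U_cont[of k]]) (use pt_power in auto)
  show "jointly_continuous ({0<..} \<times> I) (px ((pt ^^ k) u))"
    unfolding jointly_continuous_def
    by (rule continuous_on_cong[THEN iffD1, OF refl _ W_cont[of k]]) (use px_power(2) in auto)
qed

lemma has_px_power: "has_px ({0<..} \<times> I) ((pt ^^ k) u)"
  unfolding has_px_def using px_power(1) by auto

lemma C12_power:
  assumes Z: "\<And>t x. t > 0 \<Longrightarrow> x \<in> I \<Longrightarrow> DERIV (W k t) x :> Z t x"
    and Zc: "continuous_on ({0<..} \<times> I) (\<lambda>(t, x). Z t x)"
  shows "C12_on ({0<..} \<times> I) ((pt ^^ k) u)"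
proof -
  have "jointly_continuous ({0<..} \<times> I) (pt ((pt ^^ k) u))"
    using jointly_continuous_power(1)[of "Suc k"] by simp
  moreover have "has_px ({0<..} \<times> I) (px ((pt ^^ k) u))"
    unfolding has_px_def using px_px_power(1)[OF _ _ Z] by auto
  moreover have "jointly_continuous ({0<..} \<times> I) (px (px ((pt ^^ k) u)))"
    unfolding jointly_continuous_def
    by (rule continuous_on_cong[THEN iffD1, OF refl _ Zc]) (use px_px_power(2)[OF _ _ Z] in auto)
  ultimately show ?thesis
    unfolding C12_on_def using jointly_continuous_power has_pt_power has_px_power by blast
qed

end

context diffusion
begin

lemma inner_L2_diff:
  "f \<in> L2 M \<Longrightarrow> g \<in> L2 M \<Longrightarrow> h \<in> L2 M \<Longrightarrow> inner_L2 M (\<lambda>x. f x - g x) h = inner_L2 M f h - inner_L2 M g h"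
  using inner_L2_lincomb[of g M f h "-1"] by simp

text \<open>Produces all time derivatives \<open>U k\<close> together with their space derivatives
  \<open>W k\<close>, so that the assertions for \<open>u\<close> and for its time derivatives need
  no separate treatment.\<close>

theorem evolution:
  assumes adm: "admissible H J V" and op: "associated_operator H J V A"
    and q: "q \<in> borel_measurable (restrict_space borel I)" "bounded (q ` I)"
    and S: "exp_semigroup H (minus_mult A (q \<circ> sinv)) S" and f: "f \<in> L2 \<mu>"
  obtains U W where
    "\<And>t. t > 0 \<Longrightarrow> eq_ae \<mu> (U 0 t) (conj_scale I s S t f)"
    "\<And>k t x. t > 0 \<Longrightarrow> x \<in> I \<Longrightarrow> DERIV (\<lambda>\<tau>. U k \<tau> x) t :> U (Suc k) t x"
    "\<And>k t x. t > 0 \<Longrightarrow> x \<in> I \<Longrightarrow> DERIV (U k t) x :> W k t x"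
    "\<And>k. continuous_on ({0<..} \<times> I) (\<lambda>(t, x). U k t x)"
    "\<And>k. continuous_on ({0<..} \<times> I) (\<lambda>(t, x). W k t x)"
    "\<And>k t. t > 0 \<Longrightarrow> ac_loc I (W k t)"
    "\<And>k t. t > 0 \<Longrightarrow> AE x in lborel. x \<in> I \<longrightarrow>
       DERIV (W k t) x :> (U (Suc k) t x + q x * U k t x) / a x - b x / a x * W k t x"
    "\<And>k t x. continuous_on I a \<Longrightarrow> continuous_on I b \<Longrightarrow> continuous_on I q \<Longrightarrow> t > 0 \<Longrightarrow> x \<in> I \<Longrightarrow>
       DERIV (W k t) x :> (U (Suc k) t x + q x * U k t x) / a x - b x / a x * W k t x"
    "((\<lambda>t. norm_L2 \<mu> (\<lambda>x. U 0 t x - f x)) \<longlongrightarrow> 0) (at_right 0)"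
proof -
  define p where "p = q \<circ> sinv"
  define B where "B = minus_mult A p"
  define g0 where "g0 = f \<circ> sinv"
  have pm: "p \<in> borel_measurable H"
    unfolding ws.measurable_H p_def using measurable_compose[OF sinv_meas q(1)] by (simp add: o_def)
  obtain P where P: "\<And>x. x \<in> I \<Longrightarrow> \<bar>q x\<bar> \<le> P" using q(2) unfolding bounded_iff by auto
  have pb: "\<bar>p y\<bar> \<le> P" if "y \<in> J" for y using P[OF sinv_in[OF that]] by (simp add: p_def)
  have P0: "P \<ge> 0" using P[OF x0] by linarith
  note pL = wi.L2_bounded_mult(1)[OF pm pb]
  have fm: "f \<in> borel_measurable (restrict_space borel I)"
    using L2_measurable[OF f] measurable_cong_sets[OF sets_\<mu> refl] by blast
  have g0m: "g0 \<in> borel_measurable H"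
    unfolding ws.measurable_H g0_def using measurable_compose[OF sinv_meas fm] by (simp add: o_def)
  have space\<mu>: "space \<mu> = I" by (simp add: speed_measure_def space_restrict_space)
  have g0: "g0 \<in> L2 H"
  proof -
    have "integrable \<mu> (\<lambda>x. (g0 (s x))\<^sup>2) \<longleftrightarrow> integrable \<mu> (\<lambda>x. (f x)\<^sup>2)"
      by (rule Bochner_Integration.integrable_cong) (auto simp: space\<mu> g0_def)
    then have "integrable H (\<lambda>y. (g0 y)\<^sup>2)"
      using integral_H_s(1)[of "\<lambda>y. (g0 y)\<^sup>2"] g0m L2_square[OF f] by simp
    then show ?thesis using g0m by (simp add: L2_def)
  qed
  have c0: "c0_semigroup H S" and gen: "generator H S = B"
    using S by (auto simp: exp_semigroup_def B_def p_def)
  have sa: "operator_L2 H A" "densely_defined H A" "adjoint_L2 H A = A" and np: "nonpositive H A"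
    and AV: "Domain A \<subseteq> V" and form: "\<And>v g z. (v, g) \<in> A \<Longrightarrow> z \<in> V \<Longrightarrow> form_energy H J v z = - inner_L2 H g z"
    using op by (auto simp: associated_operator_def self_adjoint_def)
  have AL: "v \<in> L2 H" "g \<in> L2 H" if "(v, g) \<in> A" for v g
    using sa(1) that by (auto simp: operator_L2_def)
  have Asym: "inner_L2 H g v' = inner_L2 H v g'" if "(v, g) \<in> A" "(v', g') \<in> A" for v g v' g'
    using that sa(3) unfolding adjoint_L2_def by blast
  have BA: "(v, \<lambda>y. h y + p y * v y) \<in> A" if "(v, h) \<in> B" for v h
    using that by (auto simp: B_def minus_mult_def)
  have AB: "(v, h) \<in> B" if "(v, \<lambda>y. h y + p y * v y) \<in> A" for v h
    unfolding B_def minus_mult_def mem_Collect_eq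
    by (rule exI[of _ v], rule exI[of _ "\<lambda>y. h y + p y * v y"]) (use that in auto)
  have BL: "v \<in> L2 H" "h \<in> L2 H" if "(v, h) \<in> B" for v h
    using gen that by (auto simp: generator_def)
  have pin: "inner_L2 H (\<lambda>y. p y * v y) z = inner_L2 H v (\<lambda>y. p y * z y)" for v z
    unfolding inner_L2_def by (simp add: mult.left_commute mult.assoc)
  have Bin: "inner_L2 H h z = inner_L2 H (\<lambda>y. h y + p y * v y) z - inner_L2 H (\<lambda>y. p y * v y) z"
    if "h \<in> L2 H" "v \<in> L2 H" "z \<in> L2 H" for h v z
    using inner_L2_diff[of "\<lambda>y. h y + p y * v y" H "\<lambda>y. p y * v y" z] that by (simp add: L2_add pL)
  have Bsym: "inner_L2 H h v' = inner_L2 H v h'" if 1: "(v, h) \<in> B" and 2: "(v', h') \<in> B" for v h v' h'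
  proof -
    have "inner_L2 H h v' = inner_L2 H v (\<lambda>y. h' y + p y * v' y) - inner_L2 H v (\<lambda>y. p y * v' y)"
      using Bin[OF BL(2)[OF 1] BL(1)[OF 1] BL(1)[OF 2]] Asym[OF BA[OF 1] BA[OF 2]] pin by simp
    also have "\<dots> = inner_L2 H v h'"
      using Bin[OF BL(2)[OF 2] BL(1)[OF 2] BL(1)[OF 1]] by (simp add: inner_L2_commute)
    finally show ?thesis .
  qed
  \<comment> \<open>Pairing with an arbitrary element of the graph of \<open>A\<close> and passing
    to the limit puts the limit, with \<open>p v\<close> added back, into the adjoint of
    \<open>A\<close>, which is \<open>A\<close> itself.\<close>
  have Bclo: "(v, h) \<in> B"
    if vs: "\<And>n::nat. (vs n, hs n) \<in> B" and L: "v \<in> L2 H" "h \<in> L2 H"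
      and lim: "(\<lambda>n. norm_L2 H (\<lambda>y. vs n y - v y)) \<longlonglongrightarrow> 0" "(\<lambda>n. norm_L2 H (\<lambda>y. hs n y - h y)) \<longlonglongrightarrow> 0" for vs hs v h
  proof -
    have e: "(\<lambda>n. ws.emb (vs n)) \<longlonglongrightarrow> ws.emb v" "(\<lambda>n. ws.emb (hs n)) \<longlonglongrightarrow> ws.emb h"
      using lim BL[OF vs] L by (auto simp: ws.lim_emb_iff)
    have il: "(\<lambda>n. inner_L2 H (vs n) z) \<longlonglongrightarrow> inner_L2 H v z" "(\<lambda>n. inner_L2 H (hs n) z) \<longlonglongrightarrow> inner_L2 H h z"
      if "z \<in> L2 H" for z
      using tendsto_inner[OF e(1) tendsto_const[of "ws.emb z"]] tendsto_inner[OF e(2) tendsto_const[of "ws.emb z"]]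
        that BL[OF vs] L by (simp_all add: ws.inner_emb)
    have "(v, \<lambda>y. h y + p y * v y) \<in> adjoint_L2 H A"
      unfolding adjoint_L2_def mem_Collect_eq case_prod_conv
    proof (intro conjI L L2_add pL ballI)
      fix zk assume "zk \<in> A"
      then obtain z k where zk: "zk = (z, k)" "(z, k) \<in> A" by (cases zk) auto
      have zL: "z \<in> L2 H" "k \<in> L2 H" using AL[OF zk(2)] by auto
      have eqn: "inner_L2 H (vs n) k = inner_L2 H (hs n) z + inner_L2 H (vs n) (\<lambda>y. p y * z y)" for n
        using Asym[OF BA[OF vs] zk(2), of n] Bin[OF BL(2)[OF vs] BL(1)[OF vs] zL(1), of n n] pin[of "vs n" z] by simp
      have "(\<lambda>n. inner_L2 H (vs n) k) \<longlonglongrightarrow> inner_L2 H h z + inner_L2 H v (\<lambda>y. p y * z y)"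
        unfolding eqn by (intro tendsto_add il zL pL)
      then have "inner_L2 H v k = inner_L2 H h z + inner_L2 H v (\<lambda>y. p y * z y)"
        using il(1)[OF zL(2)] LIMSEQ_unique by blast
      also have "\<dots> = inner_L2 H (\<lambda>y. h y + p y * v y) z"
        using Bin[OF L(2,1) zL(1)] pin[of v z] by simp
      finally show "case zk of (va, g) \<Rightarrow> inner_L2 H g v = inner_L2 H va (\<lambda>y. h y + p y * v y)"
        by (simp add: zk(1) inner_L2_commute)
    qed
    then show ?thesis using sa(3) AB by simp
  qed
  have "Domain B = Domain A"
  proof -
    have "v \<in> Domain B" if "(v, g) \<in> A" for v g
      using AB[of v "\<lambda>y. g y - p y * v y"] that by auto
    then show ?thesis using BA by blast
  qed
  then have Bdense: "densely_defined H B" using sa(2) by (simp add: densely_defined_def)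
  \<comment> \<open>\<open>A\<close> is nonpositive and multiplication by \<open>- p\<close> is
    bounded by \<open>P\<close>; this is the constant \<omega> of the dissipative semigroup.\<close>
  have Bdiss: "inner_L2 H h v \<le> P * inner_L2 H v v" if B: "(v, h) \<in> B" for v h
  proof -
    have "inner_L2 H (\<lambda>y. h y + p y * v y) v \<le> 0" using np BA[OF B] by (auto simp: nonpositive_def)
    moreover have "- inner_L2 H (\<lambda>y. p y * v y) v \<le> P * inner_L2 H v v"
    proof -
      note vL = BL(1)[OF B]
      have "\<bar>inner_L2 H (\<lambda>y. p y * v y) v\<bar> \<le> norm_L2 H (\<lambda>y. p y * v y) * norm_L2 H v"
        using Cauchy_Schwarz_ineq2[of "ws.emb (\<lambda>y. p y * v y)" "ws.emb v"]
        by (simp add: ws.inner_emb ws.norm_emb vL pL)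
      also have "\<dots> \<le> (P * norm_L2 H v) * norm_L2 H v"
        using wi.L2_bounded_mult(2)[OF pm pb vL] P0 by (intro mult_right_mono) (auto simp: norm_L2_nonneg)
      also have "\<dots> = P * inner_L2 H v v"
        using ws.norm_emb[OF vL] ws.inner_emb[OF vL vL] by (simp add: power2_norm_eq_inner[symmetric] power2_eq_square)
      finally show ?thesis by linarith
    qed
    ultimately show ?thesis using Bin[OF BL(2,1)[OF B] BL(1)[OF B]] by linarith
  qed
  obtain X where X0: "\<And>t. t > 0 \<Longrightarrow> eq_ae H (X 0 t) (S t g0)"
    and XB: "\<And>k t. t > 0 \<Longrightarrow> (X k t, X (Suc k) t) \<in> B"
    and Xd: "\<And>k t. t > 0 \<Longrightarrow> ((\<lambda>h. norm_L2 H (\<lambda>y. (X k (t + h) y - X k t y) / h - X (Suc k) t y)) \<longlongrightarrow> 0) (at 0)"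
  proof (rule ws.smooth_orbit_H[where \<omega>=P, OF c0 gen _ _ Bdense _ g0])
    show "\<And>v g v' g'. \<lbrakk>(v, g) \<in> B; (v', g') \<in> B\<rbrakk> \<Longrightarrow> inner_L2 H g v' = inner_L2 H v g'" by (rule Bsym)
    show "\<And>v g. (v, g) \<in> B \<Longrightarrow> inner_L2 H g v \<le> P * inner_L2 H v v" by (rule Bdiss)
    show "\<And>vs gs v g. \<lbrakk>\<And>n::nat. (vs n, gs n) \<in> B; v \<in> L2 H; g \<in> L2 H;
        (\<lambda>n. norm_L2 H (\<lambda>y. vs n y - v y)) \<longlonglongrightarrow> 0; (\<lambda>n. norm_L2 H (\<lambda>y. gs n y - g y)) \<longlonglongrightarrow> 0\<rbrakk> \<Longrightarrow> (v, g) \<in> B"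
      by (rule Bclo)
  qed (rule that)
  have reg: "\<exists>c D. wi.regular_pair (X k t) (\<lambda>y. X (Suc k) t y + p y * X k t y) c D" if t: "t > 0" for k t
  proof (rule wi.form_regular)
    note vg = BA[OF XB[OF t, of k]]
    have V: "X k t \<in> V" using vg AV by blast
    then show "X k t \<in> V_max H J" using adm by (auto simp: admissible_def)
    show "(\<lambda>y. X (Suc k) t y + p y * X k t y) \<in> L2 H" using AL[OF vg] by simp
    fix \<phi> assume "\<phi> \<in> test_functions J"
    then have "\<phi> \<in> V" using adm by (auto simp: admissible_def)
    moreover have "V \<subseteq> L2 H" using adm by (auto simp: admissible_def subspace_L2_def)
    ultimately show "\<phi> \<in> L2 H \<and> form_energy H J (X k t) \<phi> = - inner_L2 H (\<lambda>y. X (Suc k) t y + p y * X k t y) \<phi>"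
      using form[OF vg] by blast
  qed
  obtain c D where cD: "\<And>k t. t > 0 \<Longrightarrow> wi.regular_pair (X k t) (\<lambda>y. X (Suc k) t y + p y * X k t y) (c k t) (D k t)"
    and ct: "\<And>k t y. t > 0 \<Longrightarrow> y \<in> J \<Longrightarrow> DERIV (\<lambda>\<tau>. c k \<tau> y) t :> c (Suc k) t y"
    and cc: "\<And>k. continuous_on ({0<..} \<times> J) (\<lambda>(t, y). c k t y)"
    and Dc: "\<And>k. continuous_on ({0<..} \<times> J) (\<lambda>(t, y). D k t y)"
  proof (rule wi.orbit_regularity[of p P X])
    show "p \<in> borel_measurable H" by (rule pm)
    show "\<And>y. y \<in> J \<Longrightarrow> \<bar>p y\<bar> \<le> P" by (rule pb)
    show "\<And>k t. t > 0 \<Longrightarrow> \<exists>c D. wi.regular_pair (X k t) (\<lambda>y. X (Suc k) t y + p y * X k t y) c D" by (rule reg)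
    show "\<And>k t. t > 0 \<Longrightarrow> ((\<lambda>h. norm_L2 H (\<lambda>y. (X k (t + h) y - X k t y) / h - X (Suc k) t y)) \<longlongrightarrow> 0) (at 0)" by (rule Xd)
  qed (rule that)
  define U where "U = (\<lambda>k t x. c k t (s x))"
  \<comment> \<open>\<open>M\<close> is the derivative with respect to scale, that is, the space
    derivative divided by \<open>R\<close>. It satisfies a first-order equation without drift term;
    the drift returns through the derivative of \<open>R\<close> in \<open>W\<close>.\<close>
  define M where "M = (\<lambda>k t x. D k t (s x))"
  define W where "W = (\<lambda>k t x. M k t x * R x)"
  have XL: "X k t \<in> L2 H" if "t > 0" for k t using BL(1)[OF XB[OF that]] .
  have Ux: "DERIV (U k t) x :> W k t x" if "t > 0" "x \<in> I" for k t x
  proof -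
    have "DERIV (c k t) (s x) :> D k t (s x)" using cD[OF that(1)] that(2) by (auto simp: wi.regular_pair_def)
    from DERIV_chain2[OF this s_DERIV[OF that(2)]] show ?thesis by (simp add: U_def W_def M_def)
  qed
  have pull: "continuous_on ({0<..} \<times> I) (\<lambda>(t, x). F t (s x))"
    if "continuous_on ({0<..} \<times> J) (\<lambda>(t, y). F t y)" for F :: "real \<Rightarrow> real \<Rightarrow> real"
  proof -
    have "continuous_on ({0<..} \<times> I) (\<lambda>z. (fst z, s (snd z)))"
      by (intro continuous_intros continuous_on_compose2[OF s_cont]) auto
    moreover have "(\<lambda>z. (fst z, s (snd z))) ` ({0<..} \<times> I) \<subseteq> {0<..} \<times> J" by auto
    ultimately show ?thesis
      using continuous_on_compose2[OF that, of "{0<..} \<times> I" "\<lambda>z. (fst z, s (snd z))"] by (simp add: case_prod_beta')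
  qed
  have Uc: "continuous_on ({0<..} \<times> I) (\<lambda>(t, x). U k t x)" for k unfolding U_def by (rule pull[OF cc])
  have Wc: "continuous_on ({0<..} \<times> I) (\<lambda>(t, x). W k t x)" for k
  proof -
    have "continuous_on ({0<..} \<times> I) (\<lambda>z. R (snd z))"
      by (intro continuous_on_compose2[OF R_cont] continuous_intros) auto
    with pull[OF Dc[of k]] have "continuous_on ({0<..} \<times> I) (\<lambda>z. (case z of (t, x) \<Rightarrow> D k t (s x)) * R (snd z))"
      by (rule continuous_on_mult)
    then show ?thesis by (simp add: W_def M_def case_prod_beta')
  qed
  have Utc: "continuous_on I (U k t)" if "t > 0" for k t
    using Ux[OF that] by (intro continuous_at_imp_continuous_on) (blast intro: DERIV_isCont)
  have AEX: "AE x in lborel. x \<in> I \<longrightarrow> X k t (s x) = U k t x" if "t > 0" for k t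
  proof -
    have "AE y in H. X k t y = c k t y" using cD[OF that, of k] by (simp add: wi.regular_pair_def eq_ae_def)
    from AE_H_s[OF this] show ?thesis by (simp add: U_def)
  qed
  \<comment> \<open>The classes \<open>X\<close> under the integral are replaced by their continuous
    representatives \<open>U\<close>. With \<open>U\<close> the integrand is continuous wherever the
    coefficients are, as the pointwise equation demands.\<close>
  have Mprim: "primitive_on I (\<lambda>x. m x * (U (Suc k) t x + q x * U k t x)) (M k t)" if t: "t > 0" for k t
  proof -
    have "primitive_on J (\<lambda>y. w y * (X (Suc k) t y + p y * X k t y)) (D k t)"
      using cD[OF t, of k] by (simp add: wi.regular_pair_def)
    moreover have "(\<lambda>y. X (Suc k) t y + p y * X k t y) \<in> borel_measurable H"
      by (intro L2_measurable L2_add pL XL t)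
    ultimately have prim: "primitive_on I (\<lambda>x. m x * (X (Suc k) t (s x) + p (s x) * X k t (s x))) (\<lambda>x. D k t (s x))"
      by (rule primitive_on_s)
    show ?thesis unfolding M_def
    proof (rule primitive_on_cong_AE[OF I_open prim])
      show "(\<lambda>x. m x * (U (Suc k) t x + q x * U k t x)) \<in> borel_measurable (restrict_space borel I)"
        by (intro borel_measurable_times borel_measurable_add q m_meas borel_measurable_continuous_on_restrict Utc t)
      show "AE x in lborel. x \<in> I \<longrightarrow> m x * (X (Suc k) t (s x) + p (s x) * X k t (s x)) = m x * (U (Suc k) t x + q x * U k t x)"
        using AEX[OF t, of k] AEX[OF t, of "Suc k"] by eventually_elim (simp add: p_def)
    qed
  qed
  \<comment> \<open>Product rule for \<open>W = M R\<close>: \<open>m\<close> times \<open>R\<close>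
    is \<open>1 / a\<close>, and the derivative of \<open>R\<close> contributes
    \<open>- (b / a) * W\<close>. This is the equation solved for the second space
    derivative.\<close>
  have DW: "DERIV (W k t) x :> (U (Suc k) t x + q x * U k t x) / a x - b x / a x * W k t x"
    if "DERIV (M k t) x :> m x * (U (Suc k) t x + q x * U k t x)" "DERIV R x :> - (b x / a x) * R x" for k t x
  proof -
    have "m x * (U (Suc k) t x + q x * U k t x) * R x + - (b x / a x) * R x * M k t x
        = (U (Suc k) t x + q x * U k t x) / a x - b x / a x * W k t x"
    proof -
      have "m x * N * R x = N / a x" for N using R_pos[of x] by simp
      then show ?thesis by (simp add: W_def mult.assoc mult.left_commute mult.commute)
    qed
    then show ?thesis using DERIV_mult[OF that] unfolding W_def by simp
  qed
  have E0: "eq_ae \<mu> (U 0 t) (conj_scale I s S t f)" if t: "t > 0" for t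
  proof -
    have "AE y in H. X 0 t y = S t g0 y" using X0[OF t] by (simp add: eq_ae_def)
    from AE_H_s[OF this] AEX[OF t, of 0] have "AE x in lborel. x \<in> I \<longrightarrow> U 0 t x = S t g0 (s x)"
      by eventually_elim auto
    then show ?thesis by (simp add: eq_ae_def AE_\<mu>_iff conj_scale_def g0_def)
  qed
  show ?thesis
  proof (rule that[of U W])
    show "eq_ae \<mu> (U 0 t) (conj_scale I s S t f)" if "t > 0" for t by (rule E0[OF that])
    show "DERIV (U k t) x :> W k t x" if "t > 0" "x \<in> I" for k t x by (rule Ux[OF that])
    show "continuous_on ({0<..} \<times> I) (\<lambda>(t, x). U k t x)" for k by (rule Uc)
    show "continuous_on ({0<..} \<times> I) (\<lambda>(t, x). W k t x)" for k by (rule Wc)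
    show "DERIV (\<lambda>\<tau>. U k \<tau> x) t :> U (Suc k) t x" if "t > 0" "x \<in> I" for k t x
      unfolding U_def using that by (intro ct) auto
    show "ac_loc I (W k t)" if "t > 0" for k t
      unfolding W_def by (intro ac_loc_mult primitive_on_ac_loc[OF Mprim[OF that]] R_ac_loc)
    show "AE x in lborel. x \<in> I \<longrightarrow> DERIV (W k t) x :> (U (Suc k) t x + q x * U k t x) / a x - b x / a x * W k t x"
      if "t > 0" for k t
      using primitive_on_DERIV_AE[OF I_open Mprim[OF that, of k]] R_DERIV_AE
      by eventually_elim (blast intro: DW)
    show "DERIV (W k t) x :> (U (Suc k) t x + q x * U k t x) / a x - b x / a x * W k t x"
      if c: "continuous_on I a" "continuous_on I b" "continuous_on I q" and tx: "t > 0" "x \<in> I" for k t x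
    proof (rule DW[OF primitive_on_DERIV_cont[OF I_open Mprim[OF tx(1)] tx(2)] R_DERIV_cont[OF c(1,2) tx(2)]])
      have "isCont a x" "isCont q x" "isCont R x" "isCont (U (Suc k) t) x" "isCont (U k t) x"
        using c R_cont Utc[OF tx(1)] tx(2) continuous_on_eq_continuous_at[OF I_open] by blast+
      then show "isCont (\<lambda>x. m x * (U (Suc k) t x + q x * U k t x)) x"
        using a_pos[OF tx(2)] R_pos[of x] by (intro continuous_intros) auto
    qed
    have SL: "S t g0 \<in> L2 H" if "t \<ge> 0" for t using c0 that g0 by (auto simp: c0_semigroup_def)
    have lim: "((\<lambda>t. norm_L2 H (\<lambda>y. S t g0 y - g0 y)) \<longlongrightarrow> 0) (at_right 0)"
      using c0 g0 by (simp add: c0_semigroup_def)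
    \<comment> \<open>For positive \<open>t\<close> the norm in \<mu> equals the norm in
      \<open>H\<close> by push-forward, so this is strong continuity of \<open>S\<close> at
      0.\<close>
    show "((\<lambda>t. norm_L2 \<mu> (\<lambda>x. U 0 t x - f x)) \<longlongrightarrow> 0) (at_right 0)"
    proof (rule Lim_transform_eventually[OF lim])
      show "\<forall>\<^sub>F t in at_right 0. norm_L2 H (\<lambda>y. S t g0 y - g0 y) = norm_L2 \<mu> (\<lambda>x. U 0 t x - f x)"
        unfolding eventually_at_right_field
      proof (intro exI[of _ 1] conjI allI impI)
        fix t :: real assume t: "0 < t" "t < 1"
        have m1: "(\<lambda>y. S t g0 y - g0 y) \<in> borel_measurable H"
          using L2_measurable[OF SL[of t]] g0m t by simp
        have m2: "(\<lambda>x. U 0 t x - f x) \<in> borel_measurable \<mu>"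
        proof -
          have "U 0 t \<in> borel_measurable (restrict_space borel I)"
            by (intro borel_measurable_continuous_on_restrict Utc t)
          then have "(\<lambda>x. U 0 t x - f x) \<in> borel_measurable (restrict_space borel I)"
            using fm by (rule borel_measurable_diff)
          then show ?thesis using measurable_cong_sets[OF sets_\<mu> refl] by blast
        qed
        have m3: "(\<lambda>x. S t g0 (s x) - g0 (s x)) \<in> borel_measurable \<mu>"
          using measurable_compose[OF s_meas_\<mu> m1] .
        have ae: "AE x in \<mu>. S t g0 (s x) - g0 (s x) = U 0 t x - f x"
        proof -
          have "AE x in lborel. x \<in> I \<longrightarrow> U 0 t x = S t g0 (s x)"
            using E0[OF t(1)] by (simp add: eq_ae_def AE_\<mu>_iff conj_scale_def g0_def)
          then have "AE x in lborel. x \<in> I \<longrightarrow> S t g0 (s x) - g0 (s x) = U 0 t x - f x"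
            by eventually_elim (simp add: g0_def)
          then show ?thesis by (simp add: AE_\<mu>_iff)
        qed
        have "norm_L2 H (\<lambda>y. S t g0 y - g0 y) = norm_L2 \<mu> (\<lambda>x. S t g0 (s x) - g0 (s x))"
          using norm_L2_s[OF m1] by simp
        also have "\<dots> = norm_L2 \<mu> (\<lambda>x. U 0 t x - f x)"
        proof -
          have "AE x in \<mu>. (S t g0 (s x) - g0 (s x)) * (S t g0 (s x) - g0 (s x)) = (U 0 t x - f x) * (U 0 t x - f x)"
            using ae by eventually_elim simp
          then show ?thesis unfolding norm_L2_def inner_L2_def
            using m2 m3 by (intro arg_cong[of _ _ sqrt] integral_cong_AE) simp_all
        qed
        finally show "norm_L2 H (\<lambda>y. S t g0 y - g0 y) = norm_L2 \<mu> (\<lambda>x. U 0 t x - f x)" .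
      qed simp
    qed
  qed
qed

end

theorem theorem3p2:
  fixes l r :: ereal and I J :: "real set" and x\<^sub>0 :: real
    and b \<sigma> a q s w f :: "real \<Rightarrow> real"
    and \<mu> H :: "real measure"
    and V :: "(real \<Rightarrow> real) set"
    and A B :: "((real \<Rightarrow> real) \<times> (real \<Rightarrow> real)) set"
    and S T :: "real \<Rightarrow> (real \<Rightarrow> real) \<Rightarrow> (real \<Rightarrow> real)"
  assumes "l < r" and I: "I = einterval l r" and x0: "x\<^sub>0 \<in> I"
    and "b \<in> borel_measurable (restrict_space borel I)"
    and "\<sigma> \<in> borel_measurable (restrict_space borel I)"
    and "\<And>x. x \<in> I \<Longrightarrow> \<sigma> x \<noteq> 0"
    and "loc_integrable I (\<lambda>x. 1 / (\<sigma> x)\<^sup>2)"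
    and "loc_integrable I (\<lambda>x. b x / (\<sigma> x)\<^sup>2)"
    and a: "a = (\<lambda>x. (\<sigma> x)\<^sup>2 / 2)"
    and s: "s = scale_fun a b x\<^sub>0" and J: "J = s ` I"
    and mu: "\<mu> = speed_measure I a b x\<^sub>0"
    and w: "w = weight I a b x\<^sub>0" and H: "H = weighted_measure J w"
    and "admissible H J V"
    and "associated_operator H J V A"
    and "q \<in> borel_measurable (restrict_space borel I)" and "bounded (q ` I)"
    and B: "B = minus_mult A (q \<circ> the_inv_into I s)"
    and "exp_semigroup H B S"
    and T: "T = conj_scale I s S"
    and "f \<in> L2 \<mu>"
  shows "(\<forall>t>0. \<exists>g. continuous_on I g \<and> eq_ae \<mu> g (T t f) \<and>
           (\<forall>g'. continuous_on I g' \<and> eq_ae \<mu> g' (T t f) \<longrightarrow> (\<forall>x\<in>I. g' x = g x))) \<and>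
         (\<forall>u. (\<forall>t>0. continuous_on I (u t) \<and> eq_ae \<mu> (u t) (T t f)) \<longrightarrow>
           (let \<Omega> = {0<..} \<times> I in
             (\<forall>k. (\<forall>j<k. has_pt \<Omega> ((pt ^^ j) u)) \<and>
                 jointly_continuous \<Omega> ((pt ^^ k) u) \<and>
                 has_px \<Omega> ((pt ^^ k) u) \<and>
                 jointly_continuous \<Omega> (px ((pt ^^ k) u))) \<and>
             (\<forall>k. let v = (pt ^^ k) u in
                 \<forall>t>0. ac_loc I (px v t) \<and>
                   (AE x in lborel. x \<in> I \<longrightarrow>
                      px v t field_differentiable at x \<and>
                      pt v t x = a x * px (px v) t x + b x * px v t x - q x * v t x)) \<and>
             (continuous_on I a \<and> continuous_on I b \<and> continuous_on I q \<longrightarrow>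
                 C12_on \<Omega> u \<and>
                 (\<forall>t>0. \<forall>x\<in>I.
                    pt u t x = a x * px (px u) t x + b x * px u t x - q x * u t x) \<and>
                 (\<forall>k. C12_on \<Omega> ((pt ^^ k) u))) \<and>
             ((\<lambda>t. norm_L2 \<mu> (\<lambda>x. u t x - f x)) \<longlongrightarrow> 0) (at_right 0)))"
proof -
  \<comment> \<open>The factor 2 passes from quotients by the square of \<sigma> to quotients by
    \<open>a\<close>.\<close>
  have double: "loc_integrable I (\<lambda>x. 2 * g x)" if "loc_integrable I g" for g
    using that unfolding loc_integrable_def by (intro allI impI set_integrable_mult_right) blast
  have inv: "loc_integrable I (\<lambda>x. 1 / a x)" and quo: "loc_integrable I (\<lambda>x. b x / a x)"
    using double[OF assms(7)] double[OF assms(8)] by (simp_all add: a mult.commute)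
  interpret diffusion l r I a b "x\<^sub>0"
  proof
    show "a \<in> borel_measurable (restrict_space borel I)" using assms(5) unfolding a by simp
    show "a x > 0" if "x \<in> I" for x using assms(6)[OF that] by (simp add: a)
  qed (fact I x0 assms(4) inv quo)+
  have S: "exp_semigroup (weighted_measure ((\<lambda>x. scale_fun a b x\<^sub>0 x) ` I) (weight I a b x\<^sub>0))
      (minus_mult A (q \<circ> the_inv_into I (scale_fun a b x\<^sub>0))) S"
    using assms(20) unfolding B H J w s .
  obtain U W where E: "\<And>t. t > 0 \<Longrightarrow> eq_ae \<mu> (U 0 t) (T t f)"
    and Ut: "\<And>k t x. t > 0 \<Longrightarrow> x \<in> I \<Longrightarrow> DERIV (\<lambda>\<tau>. U k \<tau> x) t :> U (Suc k) t x"
    and Ux: "\<And>k t x. t > 0 \<Longrightarrow> x \<in> I \<Longrightarrow> DERIV (U k t) x :> W k t x"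
    and Uc: "\<And>k. continuous_on ({0<..} \<times> I) (\<lambda>(t, x). U k t x)"
    and Wc: "\<And>k. continuous_on ({0<..} \<times> I) (\<lambda>(t, x). W k t x)"
    and Wac: "\<And>k t. t > 0 \<Longrightarrow> ac_loc I (W k t)"
    and Wx: "\<And>k t. t > 0 \<Longrightarrow> AE x in lborel. x \<in> I \<longrightarrow>
       DERIV (W k t) x :> (U (Suc k) t x + q x * U k t x) / a x - b x / a x * W k t x"
    and Wx': "\<And>k t x. continuous_on I a \<Longrightarrow> continuous_on I b \<Longrightarrow> continuous_on I q \<Longrightarrow> t > 0 \<Longrightarrow> x \<in> I \<Longrightarrow>
       DERIV (W k t) x :> (U (Suc k) t x + q x * U k t x) / a x - b x / a x * W k t x"
    and lim: "((\<lambda>t. norm_L2 \<mu> (\<lambda>x. U 0 t x - f x)) \<longlongrightarrow> 0) (at_right 0)"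
    using evolution[OF assms(15,16)[unfolded H J w s] assms(17,18) S assms(22)[unfolded mu]]
    unfolding mu T s by blast
  have cont: "continuous_on I (U 0 t)" if "t > 0" for t
    using Ux[OF that] by (intro continuous_at_imp_continuous_on) (blast intro: DERIV_isCont)
  \<comment> \<open>The density of \<mu> is positive, so equality \<mu>-almost everywhere is
    Lebesgue-almost everywhere on \<open>I\<close>, and continuity extends it to all points.\<close>
  have unique: "g x = U 0 t x" if t: "t > 0" and g: "continuous_on I g" "eq_ae \<mu> g (T t f)" and x: "x \<in> I" for t g x
  proof (rule continuous_AE_eq[OF I_open g(1) cont[OF t] _ x])
    have "AE x in \<mu>. g x = U 0 t x" using g(2) E[OF t] unfolding eq_ae_def by eventually_elim simp
    then show "AE x in lborel. x \<in> I \<longrightarrow> g x = U 0 t x" unfolding mu AE_\<mu>_iff .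
  qed
  show ?thesis
  proof (intro conjI allI impI)
    show "\<exists>g. continuous_on I g \<and> eq_ae \<mu> g (T t f) \<and>
        (\<forall>g'. continuous_on I g' \<and> eq_ae \<mu> g' (T t f) \<longrightarrow> (\<forall>x\<in>I. g' x = g x))" if "t > 0" for t
      using cont[OF that] E[OF that] unique[OF that] by blast
  next
    fix u assume u: "\<forall>t>0. continuous_on I (u t) \<and> eq_ae \<mu> (u t) (T t f)"
    then have uU: "u t x = U 0 t x" if "t > 0" "x \<in> I" for t x using unique[of t "u t"] that by blast
    interpret smooth_family I U W u by unfold_locales (fact I_open Ut Ux Uc Wc uU)+
    have eq: "px ((pt ^^ k) u) t field_differentiable at x"
        "pt ((pt ^^ k) u) t x = a x * px (px ((pt ^^ k) u)) t x + b x * px ((pt ^^ k) u) t x - q x * (pt ^^ k) u t x"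
      if tx: "t > 0" "x \<in> I" and D: "DERIV (W k t) x :> (U (Suc k) t x + q x * U k t x) / a x - b x / a x * W k t x" for k t x
    proof -
      show "px ((pt ^^ k) u) t field_differentiable at x" by (rule px_px_power(1)[OF tx D])
      have "pt ((pt ^^ k) u) t x = U (Suc k) t x" using pt_power[OF tx, of "Suc k"] by simp
      then show "pt ((pt ^^ k) u) t x = a x * px (px ((pt ^^ k) u)) t x + b x * px ((pt ^^ k) u) t x - q x * (pt ^^ k) u t x"
        using a_pos[OF tx(2)] by (simp add: px_px_power(2)[OF tx D] px_power(2)[OF tx] pt_power[OF tx] field_simps)
    qed
    have ae: "ac_loc I (px ((pt ^^ k) u) t) \<and> (AE x in lborel. x \<in> I \<longrightarrow> px ((pt ^^ k) u) t field_differentiable at x \<and>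
        pt ((pt ^^ k) u) t x = a x * px (px ((pt ^^ k) u)) t x + b x * px ((pt ^^ k) u) t x - q x * (pt ^^ k) u t x)"
      if t: "t > 0" for k t
    proof
      show "ac_loc I (px ((pt ^^ k) u) t)"
        by (rule ac_loc_cong[OF Wac[OF t, of k]]) (simp add: px_power(2)[OF t])
      show "AE x in lborel. x \<in> I \<longrightarrow> px ((pt ^^ k) u) t field_differentiable at x \<and>
        pt ((pt ^^ k) u) t x = a x * px (px ((pt ^^ k) u)) t x + b x * px ((pt ^^ k) u) t x - q x * (pt ^^ k) u t x"
        using Wx[OF t, of k] by eventually_elim (use eq[OF t] in blast)
    qed
    have C12: "C12_on ({0<..} \<times> I) ((pt ^^ k) u)"
      and pointwise: "\<forall>t>0. \<forall>x\<in>I. pt u t x = a x * px (px u) t x + b x * px u t x - q x * u t x"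
      if c: "continuous_on I a" "continuous_on I b" "continuous_on I q" for k
    proof -
      have snd: "continuous_on ({0<..} \<times> I) (\<lambda>z. g (snd z))" if "continuous_on I g" for g :: "real \<Rightarrow> real"
        by (rule continuous_on_compose2[OF that]) (auto intro: continuous_intros)
      \<comment> \<open>The candidate for the second space derivative, read off from the equation,
        is jointly continuous because \<open>a\<close> is positive; this closes the argument for all
        \<open>k\<close> at once.\<close>
      have "continuous_on ({0<..} \<times> I)
          (\<lambda>(t, x). (U (Suc k) t x + q x * U k t x) / a x - b x / a x * W k t x)"
        unfolding case_prod_beta'
        by (intro continuous_intros snd c Uc[unfolded case_prod_beta'] Wc[unfolded case_prod_beta']) (auto dest: a_pos)
      then show "C12_on ({0<..} \<times> I) ((pt ^^ k) u)" by (rule C12_power[rotated]) (rule Wx'[OF c])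
      show "\<forall>t>0. \<forall>x\<in>I. pt u t x = a x * px (px u) t x + b x * px u t x - q x * u t x"
        using eq(2)[where k=0] Wx'[OF c, where k=0] by simp
    qed
    have "((\<lambda>t. norm_L2 \<mu> (\<lambda>x. u t x - f x)) \<longlongrightarrow> 0) (at_right 0)"
    proof (rule Lim_transform_eventually[OF lim])
      have "norm_L2 \<mu> (\<lambda>x. U 0 t x - f x) = norm_L2 \<mu> (\<lambda>x. u t x - f x)" if "t > 0" for t
        unfolding norm_L2_def inner_L2_def
        by (intro arg_cong[of _ _ sqrt] Bochner_Integration.integral_cong)
          (auto simp: mu speed_measure_def space_restrict_space uU[OF that])
      then show "\<forall>\<^sub>F t in at_right 0. norm_L2 \<mu> (\<lambda>x. U 0 t x - f x) = norm_L2 \<mu> (\<lambda>x. u t x - f x)"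
        by (auto simp: eventually_at_right_field intro: exI[of _ 1])
    qed
    then show "let \<Omega> = {0<..} \<times> I in
             (\<forall>k. (\<forall>j<k. has_pt \<Omega> ((pt ^^ j) u)) \<and>
                 jointly_continuous \<Omega> ((pt ^^ k) u) \<and>
                 has_px \<Omega> ((pt ^^ k) u) \<and>
                 jointly_continuous \<Omega> (px ((pt ^^ k) u))) \<and>
             (\<forall>k. let v = (pt ^^ k) u in
                 \<forall>t>0. ac_loc I (px v t) \<and>
                   (AE x in lborel. x \<in> I \<longrightarrow>
                      px v t field_differentiable at x \<and>
                      pt v t x = a x * px (px v) t x + b x * px v t x - q x * v t x)) \<and>
             (continuous_on I a \<and> continuous_on I b \<and> continuous_on I q \<longrightarrow>
                 C12_on \<Omega> u \<and>
                 (\<forall>t>0. \<forall>x\<in>I.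
                    pt u t x = a x * px (px u) t x + b x * px u t x - q x * u t x) \<and>
                 (\<forall>k. C12_on \<Omega> ((pt ^^ k) u))) \<and>
             ((\<lambda>t. norm_L2 \<mu> (\<lambda>x. u t x - f x)) \<longlongrightarrow> 0) (at_right 0)"
      unfolding Let_def
      using has_pt_power jointly_continuous_power has_px_power ae C12 C12[where k=0] pointwise by simp
  qed
qed

end
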